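(* Let $\mathcal C$ be a category with its tensor structure $(\mathcal C,\times,1)$ given by products and a final object $1$. There exists a universal Künneth cohomology $(U_\kappa,\kappa,\upsilon)$ on $\mathcal C$ with values in an abelian tensor $\mathbb Q$-linear category $(\mathcal A_\kappa(\mathcal C),\otimes_\kappa,\mathbb 1_\kappa)$ such that $\otimes_\kappa$ is exact. Moreover, for the category of pairs with its induced tensor structure $(\mathcal C^\square,\times,(1,\emptyset))$ there exists a universal relative Künneth cohomology $(U_{\partial\kappa},\kappa,\upsilon)$ with values in an abelian tensor $\mathbb Q$-linear category $(\mathcal A_{\partial\kappa}(\mathcal C),\otimes_{\partial\kappa},\mathbb 1_{\partial\kappa})$ with exact tensor product.
   Context: Size issues are handled as usual by universes. "Tensor structure" means unital symmetric monoidal structure. $\mathrm{Ex}^\otimes$ is the 2-category whose objects are abelian tensor $\mathbb Q$-linear categories $(\mathcal A,\otimes,\mathbb 1)$ with $\otimes$ exact in each variable (the ring $\mathrm{End}(\mathbb 1)$ is not assumed to be a field), and whose 1-morphisms are exact strong tensor $\mathbb Q$-linear functors. Künneth cohomology. A Künneth cohomology on $\mathcal C$ with values in $\mathcal A\in\mathrm{Ex}^\otimes$ is a triple $(H,\kappa,\upsilon)$ where $H=\{H^i\}_{i\in\mathbb N}$ is a family of contravariant functors $H^i:\mathcal C\to\mathcal A$; $\kappa^{i,j}_{X,Y}:H^i(X)\otimes H^j(Y)\to H^{i+j}(X\times Y)$ are morphisms natural in $X,Y$, associative, unital and graded commutative (compatible with the symmetries up to the Koszul sign $(-1)^{ij}$);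 $H^i(1)=0$ for $i\neq0$ and $\upsilon$ is an isomorphism $H^0(1)\cong\mathbb 1$; and for all $k$ the Künneth map $\sum\kappa^{i,j}_{X,Y}:\bigoplus_{i+j=k}H^i(X)\otimes H^j(Y)\to H^k(X\times Y)$ is an isomorphism. Equivalently, $H^*:\mathcal C\to\mathcal A^{\mathbb N}$ is a contravariant strong tensor functor, where $\mathcal A^{\mathbb N}$ is the category of $\mathbb N$-graded objects with the Koszul symmetry. Relative Künneth cohomology. $\mathcal C^\square$ is a category of pairs $(X,Y)$, with $X\in\mathcal C$ and $Y$ a (closed, distinguished) subobject of $X$, and morphisms of pairs, such that the unions, intersections and products of these subobjects used below are available (e.g. $\mathcal C$ a category of varieties or spaces and $Y\subseteq X$ closed), with tensor structure $(X,Y)\times(X',Y'):=(X\times X',\,X\times Y'\cup Y\times X')$ and unit $(1,\emptyset)$. A relative Künneth cohomology on $\mathcal C^\square$ with values in $\mathcal A$ consists of contravariant functors $H^i:\mathcal C^\square\to\mathcal A$ ($i\in\mathbb N$); boundary morphisms $\partial^i:H^i(Y,Z)\to H^{i+1}(X,Y)$ for $(X,Y),(Y,Z)\in\mathcal C^\square$, natural in the triple $(X,Y,Z)$; external products $\kappa^{i,j}:H^i(X,Y)\otimes H^j(X',Y')\to H^{i+j}(X\times X',X\times Y'\cup Y\times X')$, natural, associative, unital and graded commutative; and $\upsilon:H^0(1,\emptyset)\cong\mathbb 1$ with $H^i(1,\emptyset)=0$ for $i\neq0$; such that: (a) each triple yields a long exact sequence $\cdots\to H^i(X,Y)\to H^i(X,Z)\to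 H^i(Y,Z)\xrightarrow{\partial^i}H^{i+1}(X,Y)\to\cdots$; (b) excision: $H^i(X,Z)\to H^i(Y,Y\cap Z)$ is an isomorphism for $(X,Y),(X,Z)\in\mathcal C^\square$ with $X=Y\cup Z$; (c) the relative Künneth maps $\sum\kappa^{i,j}:\bigoplus_{i+j=k}H^i(X,Y)\otimes H^j(X',Y')\to H^k(X\times X',X\times Y'\cup Y\times X')$ are isomorphisms; (d) compatibility of $\kappa$ and $\partial$: $\kappa^{i+1,j}\circ(\partial^i\otimes\mathrm{id})$ on $H^i(Y,\emptyset)\otimes H^j(X',Y')$ equals the composite of $\kappa^{i,j}$ into $H^{i+j}(Y\times X',Y\times Y')$, the inverse of the excision isomorphism $H^{i+j}(X\times Y'\cup Y\times X',X\times Y')\cong H^{i+j}(Y\times X',Y\times Y')$, and the boundary to $H^{i+j+1}(X\times X',X\times Y'\cup Y\times X')$. Universality. (Relative) Künneth cohomologies can be pushed forward along 1-morphisms of $\mathrm{Ex}^\otimes$; this defines a 2-functor on $\mathrm{Ex}^\otimes$. A (relative) Künneth cohomology $U$ with values in $\mathcal A_0\in\mathrm{Ex}^\otimes$ is universal if it 2-represents this 2-functor: for every $\mathcal A\in\mathrm{Ex}^\otimes$, $F\mapsto F_*U$ is an equivalence from the groupoid of exact strong tensor $\mathbb Q$-linear functors $\mathcal A_0\to\mathcal A$ (and tensor isomorphisms) to the groupoid of (relative) Künneth cohomologies with values in $\mathcal A$ (and isomorphisms compatible with all structure); in particular each such cohomology is the push-forward of $U$ along a functor unique up to isomorphism.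 *)

theory Defs
  imports Complex_Main "HOL-Library.FuncSet"
begin

section \<open>Categories, functors, equivalences\<close>

record ('o, 'a) cat =
  Ob :: "'o set"
  Ar :: "'a set"
  Dom :: "'a \<Rightarrow> 'o"
  Cod :: "'a \<Rightarrow> 'o"
  Id :: "'o \<Rightarrow> 'a"
  Comp :: "'a \<Rightarrow> 'a \<Rightarrow> 'a"  (infixl "\<cdot>\<index>" 70)

definition hom :: "('o, 'a, 'z) cat_scheme \<Rightarrow> 'o \<Rightarrow> 'o \<Rightarrow> 'a set" where
  "hom C x y = {f \<in> Ar C. Dom C f = x \<and> Cod C f = y}"

locale category =
  fixes C :: "('o, 'a, 'z) cat_scheme" (structure)
  assumes dom_ob: "f \<in> Ar C \<Longrightarrow> Dom C f \<in> Ob C"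
    and cod_ob: "f \<in> Ar C \<Longrightarrow> Cod C f \<in> Ob C"
    and id_hom: "x \<in> Ob C \<Longrightarrow> Id C x \<in> hom C x x"
    and comp_hom: "f \<in> hom C x y \<Longrightarrow> g \<in> hom C y z \<Longrightarrow> g \<cdot> f \<in> hom C x z"
    and comp_assoc:
      "f \<in> hom C w x \<Longrightarrow> g \<in> hom C x y \<Longrightarrow> h \<in> hom C y z \<Longrightarrow> (h \<cdot> g) \<cdot> f = h \<cdot> (g \<cdot> f)"
    and id_left: "f \<in> hom C x y \<Longrightarrow> Id C y \<cdot> f = f"
    and id_right: "f \<in> hom C x y \<Longrightarrow> f \<cdot> Id C x = f"

definition opposite :: "('o, 'a, 'z) cat_scheme \<Rightarrow> ('o, 'a) cat" where
  "opposite C =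
    \<lparr>Ob = Ob C, Ar = Ar C, Dom = Cod C, Cod = Dom C, Id = Id C, Comp = (\<lambda>g f. f \<cdot>\<^bsub>C\<^esub> g)\<rparr>"

definition inverse_arrows :: "('o, 'a, 'z) cat_scheme \<Rightarrow> 'a \<Rightarrow> 'a \<Rightarrow> bool" where
  "inverse_arrows C f g \<longleftrightarrow>
    f \<in> Ar C \<and> g \<in> hom C (Cod C f) (Dom C f) \<and>
    g \<cdot>\<^bsub>C\<^esub> f = Id C (Dom C f) \<and> f \<cdot>\<^bsub>C\<^esub> g = Id C (Cod C f)"

definition iso_arrow :: "('o, 'a, 'z) cat_scheme \<Rightarrow> 'a \<Rightarrow> bool" where
  "iso_arrow C f \<longleftrightarrow> (\<exists>g. inverse_arrows C f g)"

definition inv_arrow :: "('o, 'a, 'z) cat_scheme \<Rightarrow> 'a \<Rightarrow> 'a" where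
  "inv_arrow C f = (THE g. inverse_arrows C f g)"

definition monic :: "('o, 'a, 'z) cat_scheme \<Rightarrow> 'a \<Rightarrow> bool" where
  "monic C f \<longleftrightarrow> f \<in> Ar C \<and>
    (\<forall>g\<in>Ar C. \<forall>h\<in>Ar C. Cod C g = Dom C f \<and> Cod C h = Dom C f \<and> Dom C g = Dom C h \<and>
      f \<cdot>\<^bsub>C\<^esub> g = f \<cdot>\<^bsub>C\<^esub> h \<longrightarrow> g = h)"

definition epic :: "('o, 'a, 'z) cat_scheme \<Rightarrow> 'a \<Rightarrow> bool" where
  "epic C f \<longleftrightarrow> f \<in> Ar C \<and>
    (\<forall>g\<in>Ar C. \<forall>h\<in>Ar C. Dom C g = Cod C f \<and> Dom C h = Cod C f \<and> Cod C g = Cod C h \<and>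
      g \<cdot>\<^bsub>C\<^esub> f = h \<cdot>\<^bsub>C\<^esub> f \<longrightarrow> g = h)"

definition terminal_object :: "('o, 'a, 'z) cat_scheme \<Rightarrow> 'o \<Rightarrow> bool" where
  "terminal_object C t \<longleftrightarrow> t \<in> Ob C \<and> (\<forall>x\<in>Ob C. \<exists>!f. f \<in> hom C x t)"

definition initial_object :: "('o, 'a, 'z) cat_scheme \<Rightarrow> 'o \<Rightarrow> bool" where
  "initial_object C t \<longleftrightarrow> t \<in> Ob C \<and> (\<forall>x\<in>Ob C. \<exists>!f. f \<in> hom C t x)"

definition is_product :: "('o, 'a, 'z) cat_scheme \<Rightarrow> 'o \<Rightarrow> 'o \<Rightarrow> 'o \<Rightarrow> 'a \<Rightarrow> 'a \<Rightarrow> bool" where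
  "is_product C x y p p1 p2 \<longleftrightarrow> p \<in> Ob C \<and> p1 \<in> hom C p x \<and> p2 \<in> hom C p y \<and>
    (\<forall>z\<in>Ob C. \<forall>f\<in>hom C z x. \<forall>g\<in>hom C z y.
      \<exists>!h. h \<in> hom C z p \<and> p1 \<cdot>\<^bsub>C\<^esub> h = f \<and> p2 \<cdot>\<^bsub>C\<^esub> h = g)"

definition is_coproduct ::
  "('o, 'a, 'z) cat_scheme \<Rightarrow> 'i set \<Rightarrow> ('i \<Rightarrow> 'o) \<Rightarrow> 'o \<Rightarrow> ('i \<Rightarrow> 'a) \<Rightarrow> bool" where
  "is_coproduct C I X s \<iota> \<longleftrightarrow> s \<in> Ob C \<and> (\<forall>i\<in>I. \<iota> i \<in> hom C (X i) s) \<and>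
    (\<forall>z\<in>Ob C. \<forall>g. (\<forall>i\<in>I. g i \<in> hom C (X i) z) \<longrightarrow>
      (\<exists>!u. u \<in> hom C s z \<and> (\<forall>i\<in>I. u \<cdot>\<^bsub>C\<^esub> \<iota> i = g i)))"

definition is_pullback :: "('o, 'a, 'z) cat_scheme \<Rightarrow> 'a \<Rightarrow> 'a \<Rightarrow> 'a \<Rightarrow> 'a \<Rightarrow> bool" where
  "is_pullback C m n p q \<longleftrightarrow>
    m \<in> Ar C \<and> n \<in> Ar C \<and> p \<in> Ar C \<and> q \<in> Ar C \<and>
    Cod C m = Cod C n \<and> Dom C p = Dom C q \<and> Cod C p = Dom C m \<and> Cod C q = Dom C n \<and>
    m \<cdot>\<^bsub>C\<^esub> p = n \<cdot>\<^bsub>C\<^esub> q \<and>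
    (\<forall>z\<in>Ob C. \<forall>f\<in>hom C z (Dom C m). \<forall>g\<in>hom C z (Dom C n). m \<cdot>\<^bsub>C\<^esub> f = n \<cdot>\<^bsub>C\<^esub> g \<longrightarrow>
      (\<exists>!h. h \<in> hom C z (Dom C p) \<and> p \<cdot>\<^bsub>C\<^esub> h = f \<and> q \<cdot>\<^bsub>C\<^esub> h = g))"

record ('o, 'a, 'p, 'b) func =
  FO :: "'o \<Rightarrow> 'p"
  FA :: "'a \<Rightarrow> 'b"

text \<open>
  Functors and natural transformations are extensional (\<open>undefined\<close> off the source category),
  so that they can serve as the objects and arrows of functor groupoids.
\<close>

locale cat_functor = source: category C + target: category D
  for C :: "('o, 'a, 'z) cat_scheme" and D :: "('p, 'b, 'w) cat_scheme"
    and F :: "('o, 'a, 'p, 'b, 'v) func_scheme" +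
  assumes FO_ob: "x \<in> Ob C \<Longrightarrow> FO F x \<in> Ob D"
    and FA_hom: "f \<in> hom C x y \<Longrightarrow> FA F f \<in> hom D (FO F x) (FO F y)"
    and FA_id: "x \<in> Ob C \<Longrightarrow> FA F (Id C x) = Id D (FO F x)"
    and FA_comp: "f \<in> hom C x y \<Longrightarrow> g \<in> hom C y z \<Longrightarrow> FA F (g \<cdot>\<^bsub>C\<^esub> f) = FA F g \<cdot>\<^bsub>D\<^esub> FA F f"
    and FO_ext: "FO F \<in> extensional (Ob C)"
    and FA_ext: "FA F \<in> extensional (Ar C)"

definition func_id :: "('o, 'a, 'z) cat_scheme \<Rightarrow> ('o, 'a, 'o, 'a) func" where
  "func_id C = \<lparr>FO = (\<lambda>x\<in>Ob C. x), FA = (\<lambda>f\<in>Ar C. f)\<rparr>"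

definition func_comp :: "('o, 'a, 'z) cat_scheme \<Rightarrow> ('p, 'b, 'q, 'c, 'v) func_scheme \<Rightarrow>
    ('o, 'a, 'p, 'b, 'w) func_scheme \<Rightarrow> ('o, 'a, 'q, 'c) func" where
  "func_comp C G F = \<lparr>FO = (\<lambda>x\<in>Ob C. FO G (FO F x)), FA = (\<lambda>f\<in>Ar C. FA G (FA F f))\<rparr>"

definition nat_iso :: "('o, 'a, 'z) cat_scheme \<Rightarrow> ('p, 'b, 'w) cat_scheme \<Rightarrow>
    ('o, 'a, 'p, 'b, 'v) func_scheme \<Rightarrow> ('o, 'a, 'p, 'b, 'v') func_scheme \<Rightarrow> ('o \<Rightarrow> 'b) \<Rightarrow> bool"
  where
  "nat_iso C D F G \<eta> \<longleftrightarrow>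
    (\<forall>x\<in>Ob C. \<eta> x \<in> hom D (FO F x) (FO G x) \<and> iso_arrow D (\<eta> x)) \<and>
    (\<forall>x\<in>Ob C. \<forall>y\<in>Ob C. \<forall>f\<in>hom C x y. \<eta> y \<cdot>\<^bsub>D\<^esub> FA F f = FA G f \<cdot>\<^bsub>D\<^esub> \<eta> x) \<and>
    \<eta> \<in> extensional (Ob C)"

definition equivalence_of_categories :: "('o, 'a, 'z) cat_scheme \<Rightarrow> ('p, 'b, 'w) cat_scheme \<Rightarrow>
    ('o, 'a, 'p, 'b) func \<Rightarrow> bool" where
  "equivalence_of_categories C D F \<longleftrightarrow> cat_functor C D F \<and>
    (\<exists>G :: ('p, 'b, 'o, 'a) func. cat_functor D C G \<and>
      (\<exists>\<eta>. nat_iso C C (func_id C) (func_comp C G F) \<eta>) \<and>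
      (\<exists>\<epsilon>. nat_iso D D (func_comp D F G) (func_id D) \<epsilon>))"


section \<open>Tensor structures\<close>

record ('o, 'a) tcat = "('o, 'a) cat" +
  TO :: "'o \<Rightarrow> 'o \<Rightarrow> 'o"  (infixl "\<otimes>\<index>" 75)
  TA :: "'a \<Rightarrow> 'a \<Rightarrow> 'a"  (infixl "\<odot>\<index>" 75)
  One :: 'o  ("\<one>\<index>")
  Assoc :: "'o \<Rightarrow> 'o \<Rightarrow> 'o \<Rightarrow> 'a"
  Lun :: "'o \<Rightarrow> 'a"
  Run :: "'o \<Rightarrow> 'a"
  Sym :: "'o \<Rightarrow> 'o \<Rightarrow> 'a"

locale tensor_category = category C for C :: "('o, 'a, 'z) tcat_scheme" (structure) +
  assumes TO_ob: "x \<in> Ob C \<Longrightarrow> y \<in> Ob C \<Longrightarrow> x \<otimes> y \<in> Ob C"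
    and TA_hom: "f \<in> hom C x x' \<Longrightarrow> g \<in> hom C y y' \<Longrightarrow> f \<odot> g \<in> hom C (x \<otimes> y) (x' \<otimes> y')"
    and TA_id: "x \<in> Ob C \<Longrightarrow> y \<in> Ob C \<Longrightarrow> Id C x \<odot> Id C y = Id C (x \<otimes> y)"
    and TA_comp:
      "f \<in> hom C x x' \<Longrightarrow> f' \<in> hom C x' x'' \<Longrightarrow> g \<in> hom C y y' \<Longrightarrow> g' \<in> hom C y' y'' \<Longrightarrow>
        (f' \<cdot> f) \<odot> (g' \<cdot> g) = (f' \<odot> g') \<cdot> (f \<odot> g)"
    and One_ob: "\<one> \<in> Ob C"
    and Assoc_hom: "x \<in> Ob C \<Longrightarrow> y \<in> Ob C \<Longrightarrow> z \<in> Ob C \<Longrightarrow>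
        Assoc C x y z \<in> hom C ((x \<otimes> y) \<otimes> z) (x \<otimes> (y \<otimes> z))"
    and Assoc_iso: "x \<in> Ob C \<Longrightarrow> y \<in> Ob C \<Longrightarrow> z \<in> Ob C \<Longrightarrow> iso_arrow C (Assoc C x y z)"
    and Assoc_nat: "f \<in> hom C x x' \<Longrightarrow> g \<in> hom C y y' \<Longrightarrow> h \<in> hom C z z' \<Longrightarrow>
        Assoc C x' y' z' \<cdot> ((f \<odot> g) \<odot> h) = (f \<odot> (g \<odot> h)) \<cdot> Assoc C x y z"
    and Lun_hom: "x \<in> Ob C \<Longrightarrow> Lun C x \<in> hom C (\<one> \<otimes> x) x"
    and Lun_iso: "x \<in> Ob C \<Longrightarrow> iso_arrow C (Lun C x)"
    and Lun_nat: "f \<in> hom C x x' \<Longrightarrow> Lun C x' \<cdot> (Id C \<one> \<odot> f) = f \<cdot> Lun C x"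
    and Run_hom: "x \<in> Ob C \<Longrightarrow> Run C x \<in> hom C (x \<otimes> \<one>) x"
    and Run_iso: "x \<in> Ob C \<Longrightarrow> iso_arrow C (Run C x)"
    and Run_nat: "f \<in> hom C x x' \<Longrightarrow> Run C x' \<cdot> (f \<odot> Id C \<one>) = f \<cdot> Run C x"
    and Sym_hom: "x \<in> Ob C \<Longrightarrow> y \<in> Ob C \<Longrightarrow> Sym C x y \<in> hom C (x \<otimes> y) (y \<otimes> x)"
    and Sym_inv: "x \<in> Ob C \<Longrightarrow> y \<in> Ob C \<Longrightarrow> Sym C y x \<cdot> Sym C x y = Id C (x \<otimes> y)"
    and Sym_nat: "f \<in> hom C x x' \<Longrightarrow> g \<in> hom C y y' \<Longrightarrow>
        Sym C x' y' \<cdot> (f \<odot> g) = (g \<odot> f) \<cdot> Sym C x y"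
    and pentagon: "w \<in> Ob C \<Longrightarrow> x \<in> Ob C \<Longrightarrow> y \<in> Ob C \<Longrightarrow> z \<in> Ob C \<Longrightarrow>
        (Id C w \<odot> Assoc C x y z) \<cdot> (Assoc C w (x \<otimes> y) z \<cdot> (Assoc C w x y \<odot> Id C z)) =
        Assoc C w x (y \<otimes> z) \<cdot> Assoc C (w \<otimes> x) y z"
    and triangle: "x \<in> Ob C \<Longrightarrow> y \<in> Ob C \<Longrightarrow>
        (Id C x \<odot> Lun C y) \<cdot> Assoc C x \<one> y = Run C x \<odot> Id C y"
    and hexagon: "x \<in> Ob C \<Longrightarrow> y \<in> Ob C \<Longrightarrow> z \<in> Ob C \<Longrightarrow>
        Assoc C y z x \<cdot> (Sym C x (y \<otimes> z) \<cdot> Assoc C x y z) =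
        (Id C y \<odot> Sym C x z) \<cdot> (Assoc C y x z \<cdot> (Sym C x y \<odot> Id C z))"


section \<open>The 2-category of abelian rational tensor categories with exact tensor product\<close>

record ('o, 'a) ltcat = "('o, 'a) tcat" +
  Null :: "'o \<Rightarrow> 'o \<Rightarrow> 'a"
  Plus :: "'a \<Rightarrow> 'a \<Rightarrow> 'a"  (infixl "\<oplus>\<index>" 65)
  Scale :: "rat \<Rightarrow> 'a \<Rightarrow> 'a"

text \<open>
  \<open>Null C x y\<close> is the zero arrow from \<open>x\<close> to \<open>y\<close>; the opposite of \<open>f\<close> is \<open>Scale C (-1) f\<close>.
\<close>

locale linear_category = category C for C :: "('o, 'a, 'z) ltcat_scheme" (structure) +
  assumes Null_hom: "x \<in> Ob C \<Longrightarrow> y \<in> Ob C \<Longrightarrow> Null C x y \<in> hom C x y"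
    and Plus_hom: "f \<in> hom C x y \<Longrightarrow> g \<in> hom C x y \<Longrightarrow> f \<oplus> g \<in> hom C x y"
    and Scale_hom: "f \<in> hom C x y \<Longrightarrow> Scale C r f \<in> hom C x y"
    and Plus_assoc: "f \<in> hom C x y \<Longrightarrow> g \<in> hom C x y \<Longrightarrow> h \<in> hom C x y \<Longrightarrow>
        (f \<oplus> g) \<oplus> h = f \<oplus> (g \<oplus> h)"
    and Plus_commute: "f \<in> hom C x y \<Longrightarrow> g \<in> hom C x y \<Longrightarrow> f \<oplus> g = g \<oplus> f"
    and Plus_Null: "f \<in> hom C x y \<Longrightarrow> f \<oplus> Null C x y = f"
    and Plus_neg: "f \<in> hom C x y \<Longrightarrow> f \<oplus> Scale C (-1) f = Null C x y"
    and Scale_one: "f \<in> hom C x y \<Longrightarrow> Scale C 1 f = f"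
    and Scale_mult: "f \<in> hom C x y \<Longrightarrow> Scale C (r * s) f = Scale C r (Scale C s f)"
    and Scale_add: "f \<in> hom C x y \<Longrightarrow> Scale C (r + s) f = Scale C r f \<oplus> Scale C s f"
    and Scale_Plus: "f \<in> hom C x y \<Longrightarrow> g \<in> hom C x y \<Longrightarrow>
        Scale C r (f \<oplus> g) = Scale C r f \<oplus> Scale C r g"
    and comp_Plus_right: "f \<in> hom C x y \<Longrightarrow> f' \<in> hom C x y \<Longrightarrow> g \<in> hom C y z \<Longrightarrow>
        g \<cdot> (f \<oplus> f') = (g \<cdot> f) \<oplus> (g \<cdot> f')"
    and comp_Plus_left: "f \<in> hom C x y \<Longrightarrow> g \<in> hom C y z \<Longrightarrow> g' \<in> hom C y z \<Longrightarrow>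
        (g \<oplus> g') \<cdot> f = (g \<cdot> f) \<oplus> (g' \<cdot> f)"
    and comp_Scale_right: "f \<in> hom C x y \<Longrightarrow> g \<in> hom C y z \<Longrightarrow> g \<cdot> Scale C r f = Scale C r (g \<cdot> f)"
    and comp_Scale_left: "f \<in> hom C x y \<Longrightarrow> g \<in> hom C y z \<Longrightarrow> Scale C r g \<cdot> f = Scale C r (g \<cdot> f)"

definition zero_object :: "('o, 'a, 'z) cat_scheme \<Rightarrow> 'o \<Rightarrow> bool" where
  "zero_object C z \<longleftrightarrow> initial_object C z \<and> terminal_object C z"

definition is_biproduct :: "('o, 'a, 'z) ltcat_scheme \<Rightarrow> 'o \<Rightarrow> 'o \<Rightarrow> 'o \<Rightarrow>
    'a \<Rightarrow> 'a \<Rightarrow> 'a \<Rightarrow> 'a \<Rightarrow> bool" where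
  "is_biproduct C x y s i1 i2 p1 p2 \<longleftrightarrow> s \<in> Ob C \<and>
    i1 \<in> hom C x s \<and> i2 \<in> hom C y s \<and> p1 \<in> hom C s x \<and> p2 \<in> hom C s y \<and>
    p1 \<cdot>\<^bsub>C\<^esub> i1 = Id C x \<and> p2 \<cdot>\<^bsub>C\<^esub> i2 = Id C y \<and>
    p2 \<cdot>\<^bsub>C\<^esub> i1 = Null C x y \<and> p1 \<cdot>\<^bsub>C\<^esub> i2 = Null C y x \<and>
    (i1 \<cdot>\<^bsub>C\<^esub> p1) \<oplus>\<^bsub>C\<^esub> (i2 \<cdot>\<^bsub>C\<^esub> p2) = Id C s"

definition is_kernel :: "('o, 'a, 'z) ltcat_scheme \<Rightarrow> 'a \<Rightarrow> 'a \<Rightarrow> bool" where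
  "is_kernel C k f \<longleftrightarrow> f \<in> Ar C \<and> k \<in> Ar C \<and> Cod C k = Dom C f \<and>
    f \<cdot>\<^bsub>C\<^esub> k = Null C (Dom C k) (Cod C f) \<and>
    (\<forall>h\<in>Ar C. Cod C h = Dom C f \<and> f \<cdot>\<^bsub>C\<^esub> h = Null C (Dom C h) (Cod C f) \<longrightarrow>
      (\<exists>!u. u \<in> hom C (Dom C h) (Dom C k) \<and> k \<cdot>\<^bsub>C\<^esub> u = h))"

definition is_cokernel :: "('o, 'a, 'z) ltcat_scheme \<Rightarrow> 'a \<Rightarrow> 'a \<Rightarrow> bool" where
  "is_cokernel C q f \<longleftrightarrow> f \<in> Ar C \<and> q \<in> Ar C \<and> Dom C q = Cod C f \<and>
    q \<cdot>\<^bsub>C\<^esub> f = Null C (Dom C f) (Cod C q) \<and>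
    (\<forall>h\<in>Ar C. Dom C h = Cod C f \<and> h \<cdot>\<^bsub>C\<^esub> f = Null C (Dom C f) (Cod C h) \<longrightarrow>
      (\<exists>!u. u \<in> hom C (Cod C q) (Cod C h) \<and> u \<cdot>\<^bsub>C\<^esub> q = h))"

locale abelian_category = linear_category C for C :: "('o, 'a, 'z) ltcat_scheme" (structure) +
  assumes ex_zero: "\<exists>z. zero_object C z"
    and ex_biproduct: "x \<in> Ob C \<Longrightarrow> y \<in> Ob C \<Longrightarrow> \<exists>s i1 i2 p1 p2. is_biproduct C x y s i1 i2 p1 p2"
    and ex_kernel: "f \<in> Ar C \<Longrightarrow> \<exists>k. is_kernel C k f"
    and ex_cokernel: "f \<in> Ar C \<Longrightarrow> \<exists>q. is_cokernel C q f"
    and monic_normal: "monic C f \<Longrightarrow> \<exists>g. is_kernel C f g"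
    and epic_normal: "epic C f \<Longrightarrow> \<exists>g. is_cokernel C f g"

text \<open>\<open>0 \<rightarrow> x \<rightarrow> y \<rightarrow> z \<rightarrow> 0\<close> is exact.\<close>

definition short_exact :: "('o, 'a, 'z) ltcat_scheme \<Rightarrow> 'a \<Rightarrow> 'a \<Rightarrow> bool" where
  "short_exact C f g \<longleftrightarrow> is_kernel C f g \<and> is_cokernel C g f"

text \<open>\<open>x \<rightarrow> y \<rightarrow> z\<close> is exact at \<open>y\<close>: the image of \<open>f\<close>, i.e. the monic part of the
  epi-mono factorisation of \<open>f\<close>, is the kernel of \<open>g\<close>.\<close>

definition exact_at :: "('o, 'a, 'z) ltcat_scheme \<Rightarrow> 'a \<Rightarrow> 'a \<Rightarrow> bool" where
  "exact_at C f g \<longleftrightarrow>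
    (\<exists>k e. is_kernel C k g \<and> epic C e \<and> Cod C e = Dom C k \<and> f = k \<cdot>\<^bsub>C\<^esub> e)"

text \<open>The objects of \<open>Ex\<^sup>\<otimes>\<close>.\<close>

locale ex_tensor_category = tensor_category A + abelian_category A
  for A :: "('o, 'a, 'z) ltcat_scheme" (structure) +
  assumes TA_Plus_left: "f \<in> hom A x x' \<Longrightarrow> f' \<in> hom A x x' \<Longrightarrow> g \<in> hom A y y' \<Longrightarrow>
        (f \<oplus> f') \<odot> g = (f \<odot> g) \<oplus> (f' \<odot> g)"
    and TA_Plus_right: "f \<in> hom A x x' \<Longrightarrow> g \<in> hom A y y' \<Longrightarrow> g' \<in> hom A y y' \<Longrightarrow>
        f \<odot> (g \<oplus> g') = (f \<odot> g) \<oplus> (f \<odot> g')"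
    and TA_Scale_left: "f \<in> hom A x x' \<Longrightarrow> g \<in> hom A y y' \<Longrightarrow>
        Scale A r f \<odot> g = Scale A r (f \<odot> g)"
    and TA_Scale_right: "f \<in> hom A x x' \<Longrightarrow> g \<in> hom A y y' \<Longrightarrow>
        f \<odot> Scale A r g = Scale A r (f \<odot> g)"
    and tensor_exact_right: "x \<in> Ob A \<Longrightarrow> short_exact A f g \<Longrightarrow>
        short_exact A (Id A x \<odot> f) (Id A x \<odot> g)"
    and tensor_exact_left: "x \<in> Ob A \<Longrightarrow> short_exact A f g \<Longrightarrow>
        short_exact A (f \<odot> Id A x) (g \<odot> Id A x)"

record ('o, 'a, 'p, 'b) tfunc = "('o, 'a, 'p, 'b) func" +
  Mult :: "'o \<times> 'o \<Rightarrow> 'b"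
  Unit :: 'b

text \<open>
  The 1-morphisms of \<open>Ex\<^sup>\<otimes>\<close>, with structure isomorphisms
  \<open>Mult F (x, y) : F x \<otimes> F y \<rightarrow> F (x \<otimes> y)\<close> and \<open>Unit F : \<one> \<rightarrow> F \<one>\<close>.
\<close>

locale exact_tensor_functor = cat_functor A B F + source: ex_tensor_category A +
    target: ex_tensor_category B
  for A :: "('o, 'a, 'z) ltcat_scheme" and B :: "('p, 'b, 'w) ltcat_scheme"
    and F :: "('o, 'a, 'p, 'b, 'v) tfunc_scheme" +
  assumes FA_Plus: "f \<in> hom A x y \<Longrightarrow> g \<in> hom A x y \<Longrightarrow> FA F (f \<oplus>\<^bsub>A\<^esub> g) = FA F f \<oplus>\<^bsub>B\<^esub> FA F g"
    and FA_Scale: "f \<in> hom A x y \<Longrightarrow> FA F (Scale A r f) = Scale B r (FA F f)"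
    and FA_exact: "short_exact A f g \<Longrightarrow> short_exact B (FA F f) (FA F g)"
    and Mult_hom: "x \<in> Ob A \<Longrightarrow> y \<in> Ob A \<Longrightarrow>
        Mult F (x, y) \<in> hom B (FO F x \<otimes>\<^bsub>B\<^esub> FO F y) (FO F (x \<otimes>\<^bsub>A\<^esub> y))"
    and Mult_iso: "x \<in> Ob A \<Longrightarrow> y \<in> Ob A \<Longrightarrow> iso_arrow B (Mult F (x, y))"
    and Mult_nat: "f \<in> hom A x x' \<Longrightarrow> g \<in> hom A y y' \<Longrightarrow>
        Mult F (x', y') \<cdot>\<^bsub>B\<^esub> (FA F f \<odot>\<^bsub>B\<^esub> FA F g) = FA F (f \<odot>\<^bsub>A\<^esub> g) \<cdot>\<^bsub>B\<^esub> Mult F (x, y)"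
    and Mult_ext: "Mult F \<in> extensional (Ob A \<times> Ob A)"
    and Unit_hom: "Unit F \<in> hom B \<one>\<^bsub>B\<^esub> (FO F \<one>\<^bsub>A\<^esub>)"
    and Unit_iso: "iso_arrow B (Unit F)"
    and Mult_Assoc: "x \<in> Ob A \<Longrightarrow> y \<in> Ob A \<Longrightarrow> z \<in> Ob A \<Longrightarrow>
        FA F (Assoc A x y z) \<cdot>\<^bsub>B\<^esub> (Mult F (x \<otimes>\<^bsub>A\<^esub> y, z) \<cdot>\<^bsub>B\<^esub> (Mult F (x, y) \<odot>\<^bsub>B\<^esub> Id B (FO F z))) =
        Mult F (x, y \<otimes>\<^bsub>A\<^esub> z) \<cdot>\<^bsub>B\<^esub>
          ((Id B (FO F x) \<odot>\<^bsub>B\<^esub> Mult F (y, z)) \<cdot>\<^bsub>B\<^esub> Assoc B (FO F x) (FO F y) (FO F z))"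
    and Mult_Lun: "x \<in> Ob A \<Longrightarrow>
        FA F (Lun A x) \<cdot>\<^bsub>B\<^esub> (Mult F (\<one>\<^bsub>A\<^esub>, x) \<cdot>\<^bsub>B\<^esub> (Unit F \<odot>\<^bsub>B\<^esub> Id B (FO F x))) = Lun B (FO F x)"
    and Mult_Run: "x \<in> Ob A \<Longrightarrow>
        FA F (Run A x) \<cdot>\<^bsub>B\<^esub> (Mult F (x, \<one>\<^bsub>A\<^esub>) \<cdot>\<^bsub>B\<^esub> (Id B (FO F x) \<odot>\<^bsub>B\<^esub> Unit F)) = Run B (FO F x)"
    and Mult_Sym: "x \<in> Ob A \<Longrightarrow> y \<in> Ob A \<Longrightarrow>
        FA F (Sym A x y) \<cdot>\<^bsub>B\<^esub> Mult F (x, y) = Mult F (y, x) \<cdot>\<^bsub>B\<^esub> Sym B (FO F x) (FO F y)"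

definition tensor_iso :: "('o, 'a, 'z) ltcat_scheme \<Rightarrow> ('p, 'b, 'w) ltcat_scheme \<Rightarrow>
    ('o, 'a, 'p, 'b) tfunc \<Rightarrow> ('o, 'a, 'p, 'b) tfunc \<Rightarrow> ('o \<Rightarrow> 'b) \<Rightarrow> bool" where
  "tensor_iso A B F G \<eta> \<longleftrightarrow> nat_iso A B F G \<eta> \<and>
    (\<forall>x\<in>Ob A. \<forall>y\<in>Ob A.
      \<eta> (x \<otimes>\<^bsub>A\<^esub> y) \<cdot>\<^bsub>B\<^esub> Mult F (x, y) = Mult G (x, y) \<cdot>\<^bsub>B\<^esub> (\<eta> x \<odot>\<^bsub>B\<^esub> \<eta> y)) \<and>
    \<eta> \<one>\<^bsub>A\<^esub> \<cdot>\<^bsub>B\<^esub> Unit F = Unit G"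

text \<open>The groupoid of 1-morphisms from \<open>A\<close> to \<open>B\<close>; an arrow carries its source and target.\<close>

definition tensor_functor_groupoid :: "('o, 'a, 'z) ltcat_scheme \<Rightarrow> ('p, 'b, 'w) ltcat_scheme \<Rightarrow>
    (('o, 'a, 'p, 'b) tfunc,
     ('o, 'a, 'p, 'b) tfunc \<times> ('o \<Rightarrow> 'b) \<times> ('o, 'a, 'p, 'b) tfunc) cat" where
  "tensor_functor_groupoid A B =
    \<lparr>Ob = {F. exact_tensor_functor A B F},
     Ar = {(F, \<eta>, G). exact_tensor_functor A B F \<and> exact_tensor_functor A B G \<and>
            tensor_iso A B F G \<eta>},
     Dom = (\<lambda>(F, \<eta>, G). F),
     Cod = (\<lambda>(F, \<eta>, G). G),
     Id = (\<lambda>F. (F, (\<lambda>x\<in>Ob A. Id B (FO F x)), F)),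
     Comp = (\<lambda>(G', \<theta>, K) (F, \<eta>, G). (F, (\<lambda>x\<in>Ob A. \<theta> x \<cdot>\<^bsub>B\<^esub> \<eta> x), K))\<rparr>"


section \<open>Kuenneth cohomologies\<close>

record ('o, 'a, 'p, 'b) kunneth =
  Coh :: "nat \<Rightarrow> ('o, 'a, 'p, 'b) func"
  Kap :: "nat \<Rightarrow> nat \<Rightarrow> 'o \<times> 'o \<Rightarrow> 'b"
  Ups :: 'b

text \<open>
  The source \<open>T\<close> is an arbitrary tensor category, so that the definition applies both to
  \<open>(C, \<times>, 1)\<close> and to the category of pairs. The last axiom says that the Kuenneth map out of the
  direct sum, given by its components, is an isomorphism.
\<close>

locale kunneth_cohomology = source: tensor_category T + target: ex_tensor_category A
  for T :: "('o, 'a, 'z) tcat_scheme" and A :: "('p, 'b, 'w) ltcat_scheme"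
    and H :: "('o, 'a, 'p, 'b, 'v) kunneth_scheme" +
  assumes Coh_functor: "cat_functor (opposite T) A (Coh H i)"
    and Kap_hom: "X \<in> Ob T \<Longrightarrow> Y \<in> Ob T \<Longrightarrow> Kap H i j (X, Y) \<in>
        hom A (FO (Coh H i) X \<otimes>\<^bsub>A\<^esub> FO (Coh H j) Y) (FO (Coh H (i + j)) (X \<otimes>\<^bsub>T\<^esub> Y))"
    and Kap_ext: "Kap H i j \<in> extensional (Ob T \<times> Ob T)"
    and Kap_nat: "f \<in> hom T X X' \<Longrightarrow> g \<in> hom T Y Y' \<Longrightarrow>
        Kap H i j (X, Y) \<cdot>\<^bsub>A\<^esub> (FA (Coh H i) f \<odot>\<^bsub>A\<^esub> FA (Coh H j) g) =
        FA (Coh H (i + j)) (f \<odot>\<^bsub>T\<^esub> g) \<cdot>\<^bsub>A\<^esub> Kap H i j (X', Y')"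
    and Kap_Assoc: "X \<in> Ob T \<Longrightarrow> Y \<in> Ob T \<Longrightarrow> Z \<in> Ob T \<Longrightarrow>
        Kap H (i + j) k (X \<otimes>\<^bsub>T\<^esub> Y, Z) \<cdot>\<^bsub>A\<^esub> (Kap H i j (X, Y) \<odot>\<^bsub>A\<^esub> Id A (FO (Coh H k) Z)) =
        FA (Coh H (i + j + k)) (Assoc T X Y Z) \<cdot>\<^bsub>A\<^esub> (Kap H i (j + k) (X, Y \<otimes>\<^bsub>T\<^esub> Z) \<cdot>\<^bsub>A\<^esub>
          ((Id A (FO (Coh H i) X) \<odot>\<^bsub>A\<^esub> Kap H j k (Y, Z)) \<cdot>\<^bsub>A\<^esub>
            Assoc A (FO (Coh H i) X) (FO (Coh H j) Y) (FO (Coh H k) Z)))"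
    and Ups_hom: "Ups H \<in> hom A (FO (Coh H 0) \<one>\<^bsub>T\<^esub>) \<one>\<^bsub>A\<^esub>"
    and Ups_iso: "iso_arrow A (Ups H)"
    and Coh_One: "i \<noteq> 0 \<Longrightarrow> zero_object A (FO (Coh H i) \<one>\<^bsub>T\<^esub>)"
    and Kap_Lun: "X \<in> Ob T \<Longrightarrow> Kap H 0 i (\<one>\<^bsub>T\<^esub>, X) =
        FA (Coh H i) (Lun T X) \<cdot>\<^bsub>A\<^esub>
          (Lun A (FO (Coh H i) X) \<cdot>\<^bsub>A\<^esub> (Ups H \<odot>\<^bsub>A\<^esub> Id A (FO (Coh H i) X)))"
    and Kap_Run: "X \<in> Ob T \<Longrightarrow> Kap H i 0 (X, \<one>\<^bsub>T\<^esub>) =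
        FA (Coh H i) (Run T X) \<cdot>\<^bsub>A\<^esub>
          (Run A (FO (Coh H i) X) \<cdot>\<^bsub>A\<^esub> (Id A (FO (Coh H i) X) \<odot>\<^bsub>A\<^esub> Ups H))"
    and Kap_Sym: "X \<in> Ob T \<Longrightarrow> Y \<in> Ob T \<Longrightarrow>
        FA (Coh H (i + j)) (Sym T X Y) \<cdot>\<^bsub>A\<^esub>
          (Kap H j i (Y, X) \<cdot>\<^bsub>A\<^esub> Sym A (FO (Coh H i) X) (FO (Coh H j) Y)) =
        Scale A ((-1) ^ (i * j)) (Kap H i j (X, Y))"
    and Kunneth_iso: "X \<in> Ob T \<Longrightarrow> Y \<in> Ob T \<Longrightarrow>
        is_coproduct A {(i, j). i + j = k} (\<lambda>(i, j). FO (Coh H i) X \<otimes>\<^bsub>A\<^esub> FO (Coh H j) Y) S \<iota> \<Longrightarrow>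
        s \<in> hom A S (FO (Coh H k) (X \<otimes>\<^bsub>T\<^esub> Y)) \<Longrightarrow>
        (\<And>i j. i + j = k \<Longrightarrow> s \<cdot>\<^bsub>A\<^esub> \<iota> (i, j) = Kap H i j (X, Y)) \<Longrightarrow>
        iso_arrow A s"

definition kunneth_iso :: "('o, 'a, 'z) tcat_scheme \<Rightarrow> ('p, 'b, 'w) ltcat_scheme \<Rightarrow>
    ('o, 'a, 'p, 'b, 'v) kunneth_scheme \<Rightarrow> ('o, 'a, 'p, 'b, 'v) kunneth_scheme \<Rightarrow>
    (nat \<Rightarrow> 'o \<Rightarrow> 'b) \<Rightarrow> bool" where
  "kunneth_iso T A H K \<phi> \<longleftrightarrow> (\<forall>i. nat_iso (opposite T) A (Coh H i) (Coh K i) (\<phi> i)) \<and>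
    (\<forall>i j. \<forall>X\<in>Ob T. \<forall>Y\<in>Ob T.
      \<phi> (i + j) (X \<otimes>\<^bsub>T\<^esub> Y) \<cdot>\<^bsub>A\<^esub> Kap H i j (X, Y) =
      Kap K i j (X, Y) \<cdot>\<^bsub>A\<^esub> (\<phi> i X \<odot>\<^bsub>A\<^esub> \<phi> j Y)) \<and>
    Ups K \<cdot>\<^bsub>A\<^esub> \<phi> 0 \<one>\<^bsub>T\<^esub> = Ups H"

definition kunneth_groupoid :: "('o, 'a, 'z) tcat_scheme \<Rightarrow> ('p, 'b, 'w) ltcat_scheme \<Rightarrow>
    (('o, 'a, 'p, 'b) kunneth,
     ('o, 'a, 'p, 'b) kunneth \<times> (nat \<Rightarrow> 'o \<Rightarrow> 'b) \<times> ('o, 'a, 'p, 'b) kunneth) cat" where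
  "kunneth_groupoid T A =
    \<lparr>Ob = {H. kunneth_cohomology T A H},
     Ar = {(H, \<phi>, K). kunneth_cohomology T A H \<and> kunneth_cohomology T A K \<and>
            kunneth_iso T A H K \<phi>},
     Dom = (\<lambda>(H, \<phi>, K). H),
     Cod = (\<lambda>(H, \<phi>, K). K),
     Id = (\<lambda>H. (H, (\<lambda>i. \<lambda>X\<in>Ob T. Id A (FO (Coh H i) X)), H)),
     Comp = (\<lambda>(K', \<psi>, L) (H, \<phi>, K). (H, (\<lambda>i. \<lambda>X\<in>Ob T. \<psi> i X \<cdot>\<^bsub>A\<^esub> \<phi> i X), L))\<rparr>"

definition push_kunneth :: "('o, 'a, 'z) tcat_scheme \<Rightarrow> ('q, 'c, 'y) ltcat_scheme \<Rightarrow>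
    ('o, 'a, 'p, 'b, 'v) kunneth_scheme \<Rightarrow> ('p, 'b, 'q, 'c) tfunc \<Rightarrow> ('o, 'a, 'q, 'c) kunneth" where
  "push_kunneth T B H F =
    \<lparr>Coh = (\<lambda>i. func_comp (opposite T) F (Coh H i)),
     Kap = (\<lambda>i j. \<lambda>(X, Y)\<in>Ob T \<times> Ob T.
       FA F (Kap H i j (X, Y)) \<cdot>\<^bsub>B\<^esub> Mult F (FO (Coh H i) X, FO (Coh H j) Y)),
     Ups = inv_arrow B (Unit F) \<cdot>\<^bsub>B\<^esub> FA F (Ups H)\<rparr>"

text \<open>The functor \<open>F \<mapsto> F\<^sub>* U\<close> on 1-morphisms \<open>A \<rightarrow> B\<close> and on tensor isomorphisms.\<close>

definition push_kunneth_functor :: "('o, 'a, 'z) tcat_scheme \<Rightarrow> ('p, 'b, 'w) ltcat_scheme \<Rightarrow>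
    ('q, 'c, 'y) ltcat_scheme \<Rightarrow> ('o, 'a, 'p, 'b) kunneth \<Rightarrow>
    (('p, 'b, 'q, 'c) tfunc, ('p, 'b, 'q, 'c) tfunc \<times> ('p \<Rightarrow> 'c) \<times> ('p, 'b, 'q, 'c) tfunc,
     ('o, 'a, 'q, 'c) kunneth,
     ('o, 'a, 'q, 'c) kunneth \<times> (nat \<Rightarrow> 'o \<Rightarrow> 'c) \<times> ('o, 'a, 'q, 'c) kunneth) func" where
  "push_kunneth_functor T A B U =
    \<lparr>FO = (\<lambda>F\<in>Ob (tensor_functor_groupoid A B). push_kunneth T B U F),
     FA = (\<lambda>(F, \<eta>, G)\<in>Ar (tensor_functor_groupoid A B).
       (push_kunneth T B U F, (\<lambda>i. \<lambda>X\<in>Ob T. \<eta> (FO (Coh U i) X)), push_kunneth T B U G))\<rparr>"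

text \<open>
  Universes: \<open>'u\<close> plays the role of the universe; the objects of \<open>Ex\<^sup>\<otimes>\<close> are the categories
  whose objects and arrows are elements of \<open>'u\<close>; in particular \<open>A0\<close> itself is one of them.
\<close>

definition universal_kunneth_cohomology ::
  "('o, 'a, 'z) tcat_scheme \<Rightarrow> ('u, 'u) ltcat \<Rightarrow> ('o, 'a, 'u, 'u) kunneth \<Rightarrow> bool" where
  "universal_kunneth_cohomology T A0 U \<longleftrightarrow>
    ex_tensor_category A0 \<and> kunneth_cohomology T A0 U \<and>
    (\<forall>A :: ('u, 'u) ltcat. ex_tensor_category A \<longrightarrow>
      equivalence_of_categories (tensor_functor_groupoid A0 A) (kunneth_groupoid T A)
        (push_kunneth_functor T A0 A U))"


section \<open>Cartesian categories\<close>

record ('o, 'a) ccat = "('o, 'a) cat" +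
  Prod :: "'o \<Rightarrow> 'o \<Rightarrow> 'o"
  Fst :: "'o \<Rightarrow> 'o \<Rightarrow> 'a"
  Snd :: "'o \<Rightarrow> 'o \<Rightarrow> 'a"
  Final :: 'o

locale cartesian_category = category C for C :: "('o, 'a, 'z) ccat_scheme" +
  assumes product: "x \<in> Ob C \<Longrightarrow> y \<in> Ob C \<Longrightarrow> is_product C x y (Prod C x y) (Fst C x y) (Snd C x y)"
    and final: "terminal_object C (Final C)"

definition pairing :: "('o, 'a, 'z) ccat_scheme \<Rightarrow> 'a \<Rightarrow> 'a \<Rightarrow> 'a" where
  "pairing C f g = (THE h. h \<in> hom C (Dom C f) (Prod C (Cod C f) (Cod C g)) \<and>
    Fst C (Cod C f) (Cod C g) \<cdot>\<^bsub>C\<^esub> h = f \<and> Snd C (Cod C f) (Cod C g) \<cdot>\<^bsub>C\<^esub> h = g)"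

definition prod_arrow :: "('o, 'a, 'z) ccat_scheme \<Rightarrow> 'a \<Rightarrow> 'a \<Rightarrow> 'a" where
  "prod_arrow C f g =
    pairing C (f \<cdot>\<^bsub>C\<^esub> Fst C (Dom C f) (Dom C g)) (g \<cdot>\<^bsub>C\<^esub> Snd C (Dom C f) (Dom C g))"

definition cartesian_tensor :: "('o, 'a, 'z) ccat_scheme \<Rightarrow> ('o, 'a) tcat" where
  "cartesian_tensor C =
    \<lparr>Ob = Ob C, Ar = Ar C, Dom = Dom C, Cod = Cod C, Id = Id C, Comp = Comp C,
     TO = Prod C,
     TA = prod_arrow C,
     One = Final C,
     Assoc = (\<lambda>x y z. pairing C
       (Fst C x y \<cdot>\<^bsub>C\<^esub> Fst C (Prod C x y) z)
       (pairing C (Snd C x y \<cdot>\<^bsub>C\<^esub> Fst C (Prod C x y) z) (Snd C (Prod C x y) z))),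
     Lun = (\<lambda>x. Snd C (Final C) x),
     Run = (\<lambda>x. Fst C x (Final C)),
     Sym = (\<lambda>x y. pairing C (Snd C x y) (Fst C x y))\<rparr>"


section \<open>Categories of pairs\<close>

text \<open>
  A pair \<open>(X, Y)\<close> is represented by a distinguished monomorphism \<open>m : Y \<rightarrow> X\<close>.
  \<open>Union P m n\<close> is a chosen representative of the union of two distinguished subobjects of the
  same object, and \<open>Empty P\<close> is the object \<open>\<emptyset>\<close>.
\<close>

record ('o, 'a) pairs =
  Dist :: "'a set"
  Union :: "'a \<Rightarrow> 'a \<Rightarrow> 'a"
  Empty :: 'o

definition factors :: "('o, 'a, 'z) cat_scheme \<Rightarrow> 'a \<Rightarrow> 'a \<Rightarrow> bool" where
  "factors C f m \<longleftrightarrow> (\<exists>u. u \<in> hom C (Dom C f) (Dom C m) \<and> m \<cdot>\<^bsub>C\<^esub> u = f)"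

definition factor :: "('o, 'a, 'z) cat_scheme \<Rightarrow> 'a \<Rightarrow> 'a \<Rightarrow> 'a" where
  "factor C f m = (THE u. u \<in> hom C (Dom C f) (Dom C m) \<and> m \<cdot>\<^bsub>C\<^esub> u = f)"

definition from_empty :: "('o, 'a, 'z) cat_scheme \<Rightarrow> ('o, 'a, 'v) pairs_scheme \<Rightarrow> 'o \<Rightarrow> 'a" where
  "from_empty C P X = (THE f. f \<in> hom C (Empty P) X)"

text \<open>
  The availability assumptions on unions, intersections and products of distinguished subobjects.
  \<open>Union_least\<close> with \<open>f\<close> the identity says that \<open>Union P m n\<close> is the join among the distinguished
  subobjects of \<open>X\<close>; for general \<open>f\<close> it says that a morphism mapping \<open>m\<close> and \<open>n\<close> into \<open>t\<close> maps
  their union into \<open>t\<close>, which follows from the former whenever preimages of distinguished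
  subobjects exist. Together with the compatibility of unions and \<open>\<emptyset>\<close> with products, this is what
  makes \<open>(X, Y) \<times> (X', Y') = (X \<times> X', X \<times> Y' \<union> Y \<times> X')\<close> a tensor structure with unit \<open>(1, \<emptyset>)\<close>.
\<close>

locale pair_structure = cartesian_category C
  for C :: "('o, 'a, 'z) ccat_scheme" and P :: "('o, 'a, 'v) pairs_scheme" +
  assumes Dist_monic: "m \<in> Dist P \<Longrightarrow> monic C m"
    and Dist_iso: "iso_arrow C f \<Longrightarrow> f \<in> Dist P"
    and Dist_comp: "m \<in> Dist P \<Longrightarrow> n \<in> Dist P \<Longrightarrow> Cod C n = Dom C m \<Longrightarrow> m \<cdot>\<^bsub>C\<^esub> n \<in> Dist P"
    and Dist_cancel: "m \<in> Dist P \<Longrightarrow> n \<in> Ar C \<Longrightarrow> Cod C n = Dom C m \<Longrightarrow> m \<cdot>\<^bsub>C\<^esub> n \<in> Dist P \<Longrightarrow>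
        n \<in> Dist P"
    and Dist_inter: "m \<in> Dist P \<Longrightarrow> n \<in> Dist P \<Longrightarrow> Cod C m = Cod C n \<Longrightarrow>
        \<exists>p q. is_pullback C m n p q \<and> p \<in> Dist P \<and> q \<in> Dist P"
    and Dist_prod: "X \<in> Ob C \<Longrightarrow> m \<in> Dist P \<Longrightarrow> prod_arrow C (Id C X) m \<in> Dist P"
    and Union_Dist: "m \<in> Dist P \<Longrightarrow> n \<in> Dist P \<Longrightarrow> Cod C m = Cod C n \<Longrightarrow> Union P m n \<in> Dist P"
    and Union_Cod: "m \<in> Dist P \<Longrightarrow> n \<in> Dist P \<Longrightarrow> Cod C m = Cod C n \<Longrightarrow>
        Cod C (Union P m n) = Cod C m"
    and Union_upper: "m \<in> Dist P \<Longrightarrow> n \<in> Dist P \<Longrightarrow> Cod C m = Cod C n \<Longrightarrow>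
        factors C m (Union P m n) \<and> factors C n (Union P m n)"
    and Union_least: "m \<in> Dist P \<Longrightarrow> n \<in> Dist P \<Longrightarrow> Cod C m = X \<Longrightarrow> Cod C n = X \<Longrightarrow>
        t \<in> Dist P \<Longrightarrow> f \<in> hom C X (Cod C t) \<Longrightarrow> factors C (f \<cdot>\<^bsub>C\<^esub> m) t \<Longrightarrow> factors C (f \<cdot>\<^bsub>C\<^esub> n) t \<Longrightarrow>
        factors C (f \<cdot>\<^bsub>C\<^esub> Union P m n) t"
    and Union_prod: "X \<in> Ob C \<Longrightarrow> m \<in> Dist P \<Longrightarrow> n \<in> Dist P \<Longrightarrow> Cod C m = Cod C n \<Longrightarrow>
        factors C (prod_arrow C (Id C X) (Union P m n))
          (Union P (prod_arrow C (Id C X) m) (prod_arrow C (Id C X) n))"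
    and Empty_initial: "initial_object C (Empty P)"
    and Empty_Dist: "X \<in> Ob C \<Longrightarrow> from_empty C P X \<in> Dist P"
    and Empty_prod: "X \<in> Ob C \<Longrightarrow> initial_object C (Prod C X (Empty P))"

definition prod_pair :: "('o, 'a, 'z) ccat_scheme \<Rightarrow> ('o, 'a, 'v) pairs_scheme \<Rightarrow> 'a \<Rightarrow> 'a \<Rightarrow> 'a" where
  "prod_pair C P m m' =
    Union P (prod_arrow C (Id C (Cod C m)) m') (prod_arrow C m (Id C (Cod C m')))"

text \<open>
  An arrow \<open>(m, f, n)\<close> is a morphism \<open>f\<close> from the ambient object of \<open>m\<close> to that of \<open>n\<close> mapping
  \<open>m\<close> into \<open>n\<close>. The tensor structure is induced by that of \<open>C\<close>.
\<close>

definition pair_category :: "('o, 'a, 'z) ccat_scheme \<Rightarrow> ('o, 'a, 'v) pairs_scheme \<Rightarrow>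
    ('a, 'a \<times> 'a \<times> 'a) tcat" where
  "pair_category C P = (let T = cartesian_tensor C; pr = prod_pair C P;
      u = from_empty C P (Final C) in
    \<lparr>Ob = Dist P,
     Ar = {(m, f, n). m \<in> Dist P \<and> n \<in> Dist P \<and> f \<in> hom C (Cod C m) (Cod C n) \<and>
            factors C (f \<cdot>\<^bsub>C\<^esub> m) n},
     Dom = (\<lambda>(m, f, n). m),
     Cod = (\<lambda>(m, f, n). n),
     Id = (\<lambda>m. (m, Id C (Cod C m), m)),
     Comp = (\<lambda>(n', g, k) (m, f, n). (m, g \<cdot>\<^bsub>C\<^esub> f, k)),
     TO = pr,
     TA = (\<lambda>(m, f, n) (m', f', n'). (pr m m', prod_arrow C f f', pr n n')),
     One = u,
     Assoc = (\<lambda>m n k. (pr (pr m n) k, Assoc T (Cod C m) (Cod C n) (Cod C k), pr m (pr n k))),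
     Lun = (\<lambda>m. (pr u m, Lun T (Cod C m), m)),
     Run = (\<lambda>m. (pr m u, Run T (Cod C m), m)),
     Sym = (\<lambda>m n. (pr m n, Sym T (Cod C m) (Cod C n), pr n m))\<rparr>)"


section \<open>Relative Kuenneth cohomologies\<close>

text \<open>A triple \<open>(X, Y, Z)\<close> is given by \<open>m : Y \<rightarrow> X\<close> and \<open>n : Z \<rightarrow> Y\<close>; the pair \<open>(X, Z)\<close> is then
  \<open>m \<cdot> n\<close>.\<close>

definition triples :: "('o, 'a, 'z) cat_scheme \<Rightarrow> ('o, 'a, 'v) pairs_scheme \<Rightarrow> ('a \<times> 'a) set" where
  "triples C P = {(m, n). m \<in> Dist P \<and> n \<in> Dist P \<and> Cod C n = Dom C m}"

record ('o, 'a, 'p, 'b) rel_kunneth = "('o, 'a, 'p, 'b) kunneth" +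
  Bd :: "nat \<Rightarrow> 'o \<times> 'o \<Rightarrow> 'b"

text \<open>
  \<open>Bd H i (m, n) : H\<^sup>i(Y, Z) \<rightarrow> H\<^sup>i\<^sup>+\<^sup>1(X, Y)\<close> for \<open>m : Y \<rightarrow> X\<close> and \<open>n : Z \<rightarrow> Y\<close>.
  External products, unit and relative Kuenneth isomorphisms are those of a Kuenneth cohomology
  on the tensor category of pairs. The long exact sequences start with \<open>0 \<rightarrow> H\<^sup>0(X, Y)\<close>.
  In \<open>Bd_Kap\<close>, \<open>w\<close> is \<open>W = X \<times> Y' \<union> Y \<times> X' \<rightarrow> X \<times> X'\<close>, \<open>a\<close> and \<open>b\<close> are the inclusions of
  \<open>X \<times> Y'\<close> and \<open>Y \<times> X'\<close> into \<open>W\<close>, and \<open>c\<close> is \<open>Y \<times> Y' \<rightarrow> Y \<times> X'\<close>. The product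
  \<open>(Y, \<emptyset>) \<times> (X', Y')\<close> is \<open>(Y \<times> X', Y \<times> Y' \<union> \<emptyset> \<times> X')\<close>; the arrow \<open>(c, id, _)\<close> identifies it with
  \<open>(Y \<times> X', Y \<times> Y')\<close>.
\<close>

locale relative_kunneth_cohomology = pair_structure C P + kunneth_cohomology "pair_category C P" A H
  for C :: "('o, 'a, 'z) ccat_scheme" and P :: "('o, 'a, 'v) pairs_scheme"
    and A :: "('p, 'b, 'w) ltcat_scheme"
    and H :: "('a, 'a \<times> 'a \<times> 'a, 'p, 'b, 'y) rel_kunneth_scheme" +
  assumes Bd_hom: "(m, n) \<in> triples C P \<Longrightarrow>
        Bd H i (m, n) \<in> hom A (FO (Coh H i) n) (FO (Coh H (Suc i)) m)"
    and Bd_ext: "Bd H i \<in> extensional (triples C P)"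
    and Bd_nat: "(m, n) \<in> triples C P \<Longrightarrow> (m', n') \<in> triples C P \<Longrightarrow>
        f \<in> hom C (Cod C m) (Cod C m') \<Longrightarrow> g \<in> hom C (Dom C m) (Dom C m') \<Longrightarrow>
        f \<cdot>\<^bsub>C\<^esub> m = m' \<cdot>\<^bsub>C\<^esub> g \<Longrightarrow> factors C (g \<cdot>\<^bsub>C\<^esub> n) n' \<Longrightarrow>
        Bd H i (m, n) \<cdot>\<^bsub>A\<^esub> FA (Coh H i) (n, g, n') =
        FA (Coh H (Suc i)) (m, f, m') \<cdot>\<^bsub>A\<^esub> Bd H i (m', n')"
    and exact_start: "(m, n) \<in> triples C P \<Longrightarrow>
        monic A (FA (Coh H 0) (m \<cdot>\<^bsub>C\<^esub> n, Id C (Cod C m), m))"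
    and exact_XZ: "(m, n) \<in> triples C P \<Longrightarrow>
        exact_at A (FA (Coh H i) (m \<cdot>\<^bsub>C\<^esub> n, Id C (Cod C m), m)) (FA (Coh H i) (n, m, m \<cdot>\<^bsub>C\<^esub> n))"
    and exact_YZ: "(m, n) \<in> triples C P \<Longrightarrow>
        exact_at A (FA (Coh H i) (n, m, m \<cdot>\<^bsub>C\<^esub> n)) (Bd H i (m, n))"
    and exact_XY: "(m, n) \<in> triples C P \<Longrightarrow>
        exact_at A (Bd H i (m, n)) (FA (Coh H (Suc i)) (m \<cdot>\<^bsub>C\<^esub> n, Id C (Cod C m), m))"
    and excision: "m \<in> Dist P \<Longrightarrow> n \<in> Dist P \<Longrightarrow> Cod C m = Cod C n \<Longrightarrow> iso_arrow C (Union P m n) \<Longrightarrow>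
        is_pullback C m n p q \<Longrightarrow> p \<in> Dist P \<Longrightarrow> iso_arrow A (FA (Coh H i) (p, m, n))"
    and Bd_Kap: "m \<in> Dist P \<Longrightarrow> m' \<in> Dist P \<Longrightarrow>
        Kap H (Suc i) j (m, m') \<cdot>\<^bsub>A\<^esub>
          (Bd H i (m, from_empty C P (Dom C m)) \<odot>\<^bsub>A\<^esub> Id A (FO (Coh H j) m')) =
        (let w = prod_pair C P m m';
             a = factor C (prod_arrow C (Id C (Cod C m)) m') w;
             b = factor C (prod_arrow C m (Id C (Cod C m'))) w;
             c = prod_arrow C (Id C (Dom C m)) m';
             y = from_empty C P (Dom C m)
         in Bd H (i + j) (w, a) \<cdot>\<^bsub>A\<^esub>
              (inv_arrow A (FA (Coh H (i + j)) (c, b, a)) \<cdot>\<^bsub>A\<^esub>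
                (FA (Coh H (i + j)) (c, Id C (Cod C c), prod_pair C P y m') \<cdot>\<^bsub>A\<^esub>
                  Kap H i j (y, m'))))"

definition rel_kunneth_iso :: "('o, 'a, 'z) ccat_scheme \<Rightarrow> ('o, 'a, 'v) pairs_scheme \<Rightarrow>
    ('p, 'b, 'w) ltcat_scheme \<Rightarrow> ('a, 'a \<times> 'a \<times> 'a, 'p, 'b) rel_kunneth \<Rightarrow>
    ('a, 'a \<times> 'a \<times> 'a, 'p, 'b) rel_kunneth \<Rightarrow> (nat \<Rightarrow> 'a \<Rightarrow> 'b) \<Rightarrow> bool" where
  "rel_kunneth_iso C P A H K \<phi> \<longleftrightarrow> kunneth_iso (pair_category C P) A H K \<phi> \<and>
    (\<forall>i. \<forall>(m, n)\<in>triples C P.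
      Bd K i (m, n) \<cdot>\<^bsub>A\<^esub> \<phi> i n = \<phi> (Suc i) m \<cdot>\<^bsub>A\<^esub> Bd H i (m, n))"

definition rel_kunneth_groupoid :: "('o, 'a, 'z) ccat_scheme \<Rightarrow> ('o, 'a, 'v) pairs_scheme \<Rightarrow>
    ('p, 'b, 'w) ltcat_scheme \<Rightarrow>
    (('a, 'a \<times> 'a \<times> 'a, 'p, 'b) rel_kunneth,
     ('a, 'a \<times> 'a \<times> 'a, 'p, 'b) rel_kunneth \<times> (nat \<Rightarrow> 'a \<Rightarrow> 'b) \<times>
       ('a, 'a \<times> 'a \<times> 'a, 'p, 'b) rel_kunneth) cat" where
  "rel_kunneth_groupoid C P A =
    \<lparr>Ob = {H. relative_kunneth_cohomology C P A H},
     Ar = {(H, \<phi>, K). relative_kunneth_cohomology C P A H \<and> relative_kunneth_cohomology C P A K \<and>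
            rel_kunneth_iso C P A H K \<phi>},
     Dom = (\<lambda>(H, \<phi>, K). H),
     Cod = (\<lambda>(H, \<phi>, K). K),
     Id = (\<lambda>H. (H, (\<lambda>i. \<lambda>m\<in>Dist P. Id A (FO (Coh H i) m)), H)),
     Comp = (\<lambda>(K', \<psi>, L) (H, \<phi>, K). (H, (\<lambda>i. \<lambda>m\<in>Dist P. \<psi> i m \<cdot>\<^bsub>A\<^esub> \<phi> i m), L))\<rparr>"

definition push_rel_kunneth :: "('o, 'a, 'z) ccat_scheme \<Rightarrow> ('o, 'a, 'v) pairs_scheme \<Rightarrow>
    ('q, 'c, 'y) ltcat_scheme \<Rightarrow> ('a, 'a \<times> 'a \<times> 'a, 'p, 'b) rel_kunneth \<Rightarrow>
    ('p, 'b, 'q, 'c) tfunc \<Rightarrow> ('a, 'a \<times> 'a \<times> 'a, 'q, 'c) rel_kunneth" where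
  "push_rel_kunneth C P B H F =
    kunneth.extend (push_kunneth (pair_category C P) B H F)
      (rel_kunneth.fields (\<lambda>i. \<lambda>t\<in>triples C P. FA F (Bd H i t)))"

definition push_rel_kunneth_functor :: "('o, 'a, 'z) ccat_scheme \<Rightarrow> ('o, 'a, 'v) pairs_scheme \<Rightarrow>
    ('p, 'b, 'w) ltcat_scheme \<Rightarrow> ('q, 'c, 'y) ltcat_scheme \<Rightarrow>
    ('a, 'a \<times> 'a \<times> 'a, 'p, 'b) rel_kunneth \<Rightarrow>
    (('p, 'b, 'q, 'c) tfunc, ('p, 'b, 'q, 'c) tfunc \<times> ('p \<Rightarrow> 'c) \<times> ('p, 'b, 'q, 'c) tfunc,
     ('a, 'a \<times> 'a \<times> 'a, 'q, 'c) rel_kunneth,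
     ('a, 'a \<times> 'a \<times> 'a, 'q, 'c) rel_kunneth \<times> (nat \<Rightarrow> 'a \<Rightarrow> 'c) \<times>
       ('a, 'a \<times> 'a \<times> 'a, 'q, 'c) rel_kunneth) func" where
  "push_rel_kunneth_functor C P A B U =
    \<lparr>FO = (\<lambda>F\<in>Ob (tensor_functor_groupoid A B). push_rel_kunneth C P B U F),
     FA = (\<lambda>(F, \<eta>, G)\<in>Ar (tensor_functor_groupoid A B).
       (push_rel_kunneth C P B U F, (\<lambda>i. \<lambda>m\<in>Dist P. \<eta> (FO (Coh U i) m)),
        push_rel_kunneth C P B U G))\<rparr>"

definition universal_relative_kunneth_cohomology ::
  "('o, 'a, 'z) ccat_scheme \<Rightarrow> ('o, 'a, 'v) pairs_scheme \<Rightarrow> ('u, 'u) ltcat \<Rightarrow>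
    ('a, 'a \<times> 'a \<times> 'a, 'u, 'u) rel_kunneth \<Rightarrow> bool" where
  "universal_relative_kunneth_cohomology C P A0 U \<longleftrightarrow>
    ex_tensor_category A0 \<and> relative_kunneth_cohomology C P A0 U \<and>
    (\<forall>A :: ('u, 'u) ltcat. ex_tensor_category A \<longrightarrow>
      equivalence_of_categories (tensor_functor_groupoid A0 A) (rel_kunneth_groupoid C P A)
        (push_rel_kunneth_functor C P A0 A U))"

end

theory Submission
  imports Defs "HOL-Library.Countable"
begin

text \<open>
  A model is a cohomology \<open>H\<close> with values in a category \<open>A\<close> on the type \<open>'u\<close>, together with a choice of
  kernels, cokernels and biproducts in \<open>A\<close>. The universal category \<open>A0\<close> is the subcategory of the product
  of all models that the cohomologies generate under the operations of a model and under factorisation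
  through monomorphisms and epimorphisms. Its arrows are values of terms, of which there are no more than
  elements of the infinite type \<open>'u\<close>, so \<open>A0\<close> can be coded on \<open>'u\<close>; it is abelian with exact tensor product
  because the projections are jointly faithful and the required universal arrows are generated.

  The projection of \<open>A0\<close> to a model \<open>(A, H)\<close> sends the tautological cohomology \<open>U\<close> to \<open>H\<close>, so push-forward is
  surjective on objects. It is full: given \<open>F\<close>, \<open>G\<close> and \<open>\<phi> : F\<^sub>*U \<cong> G\<^sub>*U\<close>, the objects \<open>x\<close> of \<open>A0\<close> with an
  isomorphism \<open>F x \<cong> G x\<close> form a category \<open>E\<close> in which \<open>(U, \<phi>)\<close> is a cohomology; so \<open>E\<close> carries a model, the
  projection \<open>A0 \<rightarrow> E\<close> is a section of the forgetful functor, and its second component extends \<open>\<phi>\<close>.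
  It is faithful by induction on the generation of \<open>A0\<close>. The relative case runs in parallel with the
  absolute one, because boundary maps and their axioms are just further generators and relations.
\<close>


text \<open>All models live on the one type \<open>'u\<close>, so they form a set and their product
  exists; testing equations in this product replaces a presentation by generators and relations. The
  construction is impredicative: once coded on \<open>'u\<close>, the universal category is the
  category of a model too, and so is the auxiliary category \<open>E\<close> built from it. Hence
  size has to be controlled before any universal property is proved.

  Two kinds of strictness shape the rest. Projections preserve tensor products, the unit and the
  chosen kernels, cokernels and biproducts on the nose, so push-forward along a projection returns a
  cohomology equal to the given one, not merely isomorphic to it. And the choices made in
  \<open>E\<close> lie strictly over those of \<open>A0\<close>, so that induction on generation
  applies to the composite of projection and forgetful functor.

  Closure under the chosen operations alone need not give an abelian category, since the arrows
  provided by universal properties need not be values of these operations. The rules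
  \<open>lift\<close> and \<open>ext\<close> add them, guarded by the existence of the factorisation
  in every model.\<close>

lemma hom_iff: "f \<in> hom C x y \<longleftrightarrow> f \<in> Ar C \<and> Dom C f = x \<and> Cod C f = y"
  by (simp add: hom_def)

section \<open>Elementary calculus of arrows, isomorphisms and factorisations\<close>

context category
begin

lemma Dom_Ob [simp]: "f \<in> Ar C \<Longrightarrow> Dom C f \<in> Ob C"
  and Cod_Ob [simp]: "f \<in> Ar C \<Longrightarrow> Cod C f \<in> Ob C"
  by (simp_all add: dom_ob cod_ob)

lemma Id_simps [simp]:
  assumes "x \<in> Ob C"
  shows "Id C x \<in> Ar C" "Dom C (Id C x) = x" "Cod C (Id C x) = x"
  using id_hom[OF assms] by (simp_all add: hom_iff)

lemma comp_simps [simp]: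
  assumes "f \<in> Ar C" "g \<in> Ar C" "Dom C g = Cod C f"
  shows "g \<cdot> f \<in> Ar C" "Dom C (g \<cdot> f) = Dom C f" "Cod C (g \<cdot> f) = Cod C g"
  using comp_hom[of f "Dom C f" "Cod C f" g "Cod C g"] assms by (simp_all add: hom_iff)

lemma assoc [simp]:
  "f \<in> Ar C \<Longrightarrow> g \<in> Ar C \<Longrightarrow> h \<in> Ar C \<Longrightarrow> Dom C g = Cod C f \<Longrightarrow> Dom C h = Cod C g \<Longrightarrow>
    (h \<cdot> g) \<cdot> f = h \<cdot> (g \<cdot> f)"
  using comp_assoc[of f "Dom C f" "Cod C f" g "Cod C g" h "Cod C h"] by (simp add: hom_iff)

lemma Id_comp [simp]: "f \<in> Ar C \<Longrightarrow> Cod C f = y \<Longrightarrow> Id C y \<cdot> f = f"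
  using id_left[of f "Dom C f" y] by (simp add: hom_iff)

lemma comp_Id [simp]: "f \<in> Ar C \<Longrightarrow> Dom C f = x \<Longrightarrow> f \<cdot> Id C x = f"
  using id_right[of f x "Cod C f"] by (simp add: hom_iff)

lemma comp_extend:
  assumes "g \<cdot> f = g' \<cdot> f'" "f \<in> Ar C" "g \<in> Ar C" "f' \<in> Ar C" "g' \<in> Ar C" "t \<in> Ar C"
    "Dom C g = Cod C f" "Dom C g' = Cod C f'" "Cod C t = Dom C f" "Dom C f' = Dom C f"
  shows "g \<cdot> (f \<cdot> t) = g' \<cdot> (f' \<cdot> t)"
  using assms assoc[of t f g] assoc[of t f' g'] by simp

lemma comp_extend1:
  assumes "g \<cdot> f = h" "f \<in> Ar C" "g \<in> Ar C" "t \<in> Ar C" "Dom C g = Cod C f" "Cod C t = Dom C f"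
  shows "g \<cdot> (f \<cdot> t) = h \<cdot> t"
  using assms assoc[of t f g] by simp

lemma inverse_arrows_unique: "inverse_arrows C f g \<Longrightarrow> inverse_arrows C f g' \<Longrightarrow> g = g'"
  unfolding inverse_arrows_def hom_iff
  by (metis assoc comp_Id Id_comp)

lemma inverse_arrows_inv: "iso_arrow C f \<Longrightarrow> inverse_arrows C f (inv_arrow C f)"
  unfolding iso_arrow_def inv_arrow_def using inverse_arrows_unique by (metis theI)

lemma inv_arrow_eq: "inverse_arrows C f g \<Longrightarrow> inv_arrow C f = g"
  using inverse_arrows_unique inverse_arrows_inv iso_arrow_def by metis

lemma iso_simps [simp]:
  assumes "iso_arrow C f"
  shows "inv_arrow C f \<in> Ar C" "Dom C (inv_arrow C f) = Cod C f"
    "Cod C (inv_arrow C f) = Dom C f"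
    "inv_arrow C f \<cdot> f = Id C (Dom C f)" "f \<cdot> inv_arrow C f = Id C (Cod C f)"
  using inverse_arrows_inv[OF assms] by (auto simp: inverse_arrows_def hom_iff)

lemma iso_Ar: "iso_arrow C f \<Longrightarrow> f \<in> Ar C"
  by (auto simp: iso_arrow_def inverse_arrows_def)

lemma iso_cancel [simp]:
  assumes "iso_arrow C f" "t \<in> Ar C"
  shows "Cod C t = Dom C f \<Longrightarrow> inv_arrow C f \<cdot> (f \<cdot> t) = t"
    "Cod C t = Cod C f \<Longrightarrow> f \<cdot> (inv_arrow C f \<cdot> t) = t"
  using comp_extend1[of "inv_arrow C f" f "Id C (Dom C f)" t]
    comp_extend1[of f "inv_arrow C f" "Id C (Cod C f)" t] assms iso_Ar[OF assms(1)] by auto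

lemma iso_arrowI:
  assumes "f \<in> Ar C" "g \<in> Ar C" "Dom C g = Cod C f" "Cod C g = Dom C f"
    "g \<cdot> f = Id C (Dom C f)" "f \<cdot> g = Id C (Cod C f)"
  shows "iso_arrow C f" "inv_arrow C f = g"
proof -
  have "inverse_arrows C f g" using assms by (simp add: inverse_arrows_def hom_iff)
  then show "iso_arrow C f" "inv_arrow C f = g"
    by (auto simp: iso_arrow_def inv_arrow_eq)
qed

lemma iso_inv [simp]: "iso_arrow C f \<Longrightarrow> iso_arrow C (inv_arrow C f)"
  by (rule iso_arrowI(1)[where g = f]) (simp_all add: iso_Ar)

lemma iso_Id [simp]: "x \<in> Ob C \<Longrightarrow> iso_arrow C (Id C x)"
  and inv_Id [simp]: "x \<in> Ob C \<Longrightarrow> inv_arrow C (Id C x) = Id C x"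
  using iso_arrowI[of "Id C x" "Id C x"] by simp_all

lemma iso_comp:
  assumes "iso_arrow C f" "iso_arrow C g" "Dom C g = Cod C f"
  shows "iso_arrow C (g \<cdot> f)" "inv_arrow C (g \<cdot> f) = inv_arrow C f \<cdot> inv_arrow C g"
  using iso_arrowI[of "g \<cdot> f" "inv_arrow C f \<cdot> inv_arrow C g"] assms by (simp_all add: iso_Ar)

lemma iso_epi_cancel:
  assumes "g \<cdot> f = h \<cdot> f" "iso_arrow C f" "g \<in> Ar C" "h \<in> Ar C"
    "Dom C g = Cod C f" "Dom C h = Cod C f"
  shows "g = h"
proof -
  have "(g \<cdot> f) \<cdot> inv_arrow C f = (h \<cdot> f) \<cdot> inv_arrow C f" using assms(1) by simp
  then show ?thesis using assms(2-) by (simp add: iso_Ar)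
qed

lemma iso_mono_cancel:
  assumes "f \<cdot> g = f \<cdot> h" "iso_arrow C f" "g \<in> Ar C" "h \<in> Ar C"
    "Cod C g = Dom C f" "Cod C h = Dom C f"
  shows "g = h"
proof -
  have "inv_arrow C f \<cdot> (f \<cdot> g) = inv_arrow C f \<cdot> (f \<cdot> h)" using assms(1) by simp
  then show ?thesis using assms(2-) by (simp add: iso_Ar)
qed

lemma inv_square:
  assumes "g \<cdot> a = b \<cdot> f" "iso_arrow C a" "iso_arrow C b"
    "f \<in> Ar C" "g \<in> Ar C" "Dom C g = Cod C a" "Dom C b = Cod C f" "Dom C a = Dom C f"
  shows "f \<cdot> inv_arrow C a = inv_arrow C b \<cdot> g"
proof -
  have "inv_arrow C b \<cdot> ((g \<cdot> a) \<cdot> inv_arrow C a) = inv_arrow C b \<cdot> ((b \<cdot> f) \<cdot> inv_arrow C a)"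
    using assms(1) by simp
  moreover have "Cod C g = Cod C b"
    using assms comp_simps(3)[of a g] comp_simps(3)[of f b] by (simp add: iso_Ar)
  ultimately show ?thesis using assms(2-) by (simp add: iso_Ar)
qed

lemma monic_cancel:
  "monic C m \<Longrightarrow> m \<cdot> g = m \<cdot> h \<Longrightarrow> g \<in> Ar C \<Longrightarrow> h \<in> Ar C \<Longrightarrow> Cod C g = Dom C m \<Longrightarrow>
    Cod C h = Dom C m \<Longrightarrow> Dom C g = Dom C h \<Longrightarrow> g = h"
  by (auto simp: monic_def)

lemma epic_cancel:
  "epic C e \<Longrightarrow> g \<cdot> e = h \<cdot> e \<Longrightarrow> g \<in> Ar C \<Longrightarrow> h \<in> Ar C \<Longrightarrow> Dom C g = Cod C e \<Longrightarrow>
    Dom C h = Cod C e \<Longrightarrow> Cod C g = Cod C h \<Longrightarrow> g = h"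
  by (auto simp: epic_def)

lemma monic_Ar: "monic C m \<Longrightarrow> m \<in> Ar C"
  and epic_Ar: "epic C m \<Longrightarrow> m \<in> Ar C"
  by (auto simp: epic_def monic_def)

lemma iso_monic: "iso_arrow C f \<Longrightarrow> monic C f"
  unfolding monic_def by (meson iso_Ar iso_mono_cancel)

lemma iso_epic: "iso_arrow C f \<Longrightarrow> epic C f"
  unfolding epic_def by (meson iso_Ar iso_epi_cancel)

text \<open>Cancelling \<open>m\<close> gives uniqueness, so the definite description in
  \<open>factor\<close> denotes. Arrows generated by factorisation are then functions of the model,
  with no choice involved.\<close>

lemma monic_factor:
  assumes "monic C m" "factors C f m"
  shows "factor C f m \<in> hom C (Dom C f) (Dom C m)" "m \<cdot> factor C f m = f"
proof -
  obtain u where u: "u \<in> hom C (Dom C f) (Dom C m) \<and> m \<cdot> u = f"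
    using assms(2) by (auto simp: factors_def)
  have "factor C f m \<in> hom C (Dom C f) (Dom C m) \<and> m \<cdot> factor C f m = f"
    unfolding factor_def
    by (rule theI[where a = u], rule u, rule monic_cancel[OF assms(1)]) (use u in \<open>auto simp: hom_iff\<close>)
  then show "factor C f m \<in> hom C (Dom C f) (Dom C m)" "m \<cdot> factor C f m = f" by simp_all
qed

lemma factor_eq:
  assumes "monic C m" "u \<in> Ar C" "Cod C u = Dom C m" "m \<cdot> u = f"
  shows "factors C f m" "factor C f m = u"
proof -
  have *: "Dom C f = Dom C u" using assms by (auto simp: monic_Ar)
  show f: "factors C f m" unfolding factors_def using assms * by (intro exI[of _ u]) (simp add: hom_iff)
  note w = monic_factor[OF assms(1) f, unfolded hom_iff]
  show "factor C f m = u"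
    by (rule monic_cancel[OF assms(1)]) (use w assms * in simp_all)
qed

lemma monic_comp:
  assumes "monic C f" "monic C g" "Dom C g = Cod C f"
  shows "monic C (g \<cdot> f)"
  unfolding monic_def
proof (intro conjI ballI impI, goal_cases)
  case 1 then show ?case using assms by (simp add: monic_Ar)
next
  case (2 u v)
  then have "g \<cdot> (f \<cdot> u) = g \<cdot> (f \<cdot> v)"
    using assms assoc[of u f g] assoc[of v f g] by (simp add: monic_Ar)
  then have "f \<cdot> u = f \<cdot> v"
    by (rule monic_cancel[OF assms(2)]) (use 2 assms in \<open>simp_all add: monic_Ar\<close>)
  then show ?case
    by (rule monic_cancel[OF assms(1)]) (use 2 assms in \<open>simp_all add: monic_Ar\<close>)
qed

end


section \<open>Duality for linear categories\<close>

text \<open>In contrast to \<open>opposite\<close>, this keeps the record with its linear structure,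
  so that kernel and cokernel, monic and epic are exchanged by rewriting. Most statements about
  cokernels, epimorphisms and extensions below are those about kernels, monomorphisms and lifts,
  read in \<open>dual C\<close>. The tensor fields are copied without being dualised.\<close>

definition dual :: "('o, 'a, 'z) ltcat_scheme \<Rightarrow> ('o, 'a, 'z) ltcat_scheme" where
  "dual C = C\<lparr>Dom := Cod C, Cod := Dom C, Comp := (\<lambda>g f. f \<cdot>\<^bsub>C\<^esub> g), Null := (\<lambda>x y. Null C y x)\<rparr>"

lemma dual_simps [simp]:
  "Ob (dual C) = Ob C" "Ar (dual C) = Ar C" "Dom (dual C) = Cod C" "Cod (dual C) = Dom C"
  "Id (dual C) = Id C" "g \<cdot>\<^bsub>dual C\<^esub> f = f \<cdot>\<^bsub>C\<^esub> g" "Null (dual C) x y = Null C y x"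
  "Plus (dual C) = Plus C" "Scale (dual C) = Scale C"
  by (simp_all add: dual_def)

lemma dual_dual [simp]: "dual (dual C) = C"
  by (simp add: dual_def)

lemma hom_dual [simp]: "hom (dual C) x y = hom C y x"
  by (auto simp: hom_def)

lemma dual_notions [simp]:
  "is_kernel (dual C) q f = is_cokernel C q f" "is_cokernel (dual C) q f = is_kernel C q f"
  "monic (dual C) f = epic C f" "epic (dual C) f = monic C f"
  "initial_object (dual C) x = terminal_object C x" "terminal_object (dual C) x = initial_object C x"
  "zero_object (dual C) x = zero_object C x"
  "iso_arrow (dual C) f = iso_arrow C f"
  "is_biproduct (dual C) x y s i1 i2 p1 p2 = is_biproduct C x y s p1 p2 i1 i2"
  "short_exact (dual C) f g = short_exact C g f"
  by (auto simp: is_kernel_def is_cokernel_def monic_def epic_def initial_object_def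
      terminal_object_def zero_object_def iso_arrow_def inverse_arrows_def is_biproduct_def
      short_exact_def)

lemma category_dual [intro]:
  assumes "category C"
  shows "category (dual C)"
proof -
  interpret category C by fact
  show ?thesis by unfold_locales (simp_all add: hom_iff)
qed

context linear_category
begin

lemma Null_simps [simp]:
  assumes "x \<in> Ob C" "y \<in> Ob C"
  shows "Null C x y \<in> Ar C" "Dom C (Null C x y) = x" "Cod C (Null C x y) = y"
  using Null_hom[OF assms] by (simp_all add: hom_iff)

lemma Plus_simps [simp]:
  assumes "f \<in> Ar C" "g \<in> Ar C" "Dom C g = Dom C f" "Cod C g = Cod C f"
  shows "f \<oplus> g \<in> Ar C" "Dom C (f \<oplus> g) = Dom C f" "Cod C (f \<oplus> g) = Cod C f"
  using Plus_hom[of f "Dom C f" "Cod C f" g] assms by (simp_all add: hom_iff)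

lemma Scale_simps [simp]:
  assumes "f \<in> Ar C"
  shows "Scale C r f \<in> Ar C" "Dom C (Scale C r f) = Dom C f" "Cod C (Scale C r f) = Cod C f"
  using Scale_hom[of f "Dom C f" "Cod C f" r] assms by (simp_all add: hom_iff)

lemma comp_Plus:
  "f \<in> Ar C \<Longrightarrow> f' \<in> Ar C \<Longrightarrow> Dom C f' = Dom C f \<Longrightarrow> Cod C f' = Cod C f \<Longrightarrow>
    g \<in> Ar C \<Longrightarrow> Dom C g = Cod C f \<Longrightarrow> g \<cdot> (f \<oplus> f') = (g \<cdot> f) \<oplus> (g \<cdot> f')"
  using comp_Plus_right[of f "Dom C f" "Cod C f" f' g "Cod C g"] by (simp add: hom_iff)

lemma Plus_comp:
  "f \<in> Ar C \<Longrightarrow> g \<in> Ar C \<Longrightarrow> g' \<in> Ar C \<Longrightarrow> Dom C g' = Dom C g \<Longrightarrow> Cod C g' = Cod C g \<Longrightarrow>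
    Dom C g = Cod C f \<Longrightarrow> (g \<oplus> g') \<cdot> f = (g \<cdot> f) \<oplus> (g' \<cdot> f)"
  using comp_Plus_left[of f "Dom C f" "Cod C f" g "Cod C g" g'] by (simp add: hom_iff)

lemma comp_Scale [simp]:
  "f \<in> Ar C \<Longrightarrow> g \<in> Ar C \<Longrightarrow> Dom C g = Cod C f \<Longrightarrow> g \<cdot> Scale C r f = Scale C r (g \<cdot> f)"
  using comp_Scale_right[of f "Dom C f" "Cod C f" g "Cod C g"] by (simp add: hom_iff)

lemma Scale_comp [simp]:
  "f \<in> Ar C \<Longrightarrow> g \<in> Ar C \<Longrightarrow> Dom C g = Cod C f \<Longrightarrow> Scale C r g \<cdot> f = Scale C r (g \<cdot> f)"
  using comp_Scale_left[of f "Dom C f" "Cod C f" g "Cod C g"] by (simp add: hom_iff)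

lemma Plus_Scale_neg: "f \<in> Ar C \<Longrightarrow> f \<oplus> Scale C (-1) f = Null C (Dom C f) (Cod C f)"
  using Plus_neg by (simp add: hom_iff)

lemma Plus_Null_right [simp]:
  "f \<in> Ar C \<Longrightarrow> Dom C f = x \<Longrightarrow> Cod C f = y \<Longrightarrow> f \<oplus> Null C x y = f"
  using Plus_Null[of f x y] by (simp add: hom_iff)

lemma Plus_comm:
  "f \<in> Ar C \<Longrightarrow> g \<in> Ar C \<Longrightarrow> Dom C g = Dom C f \<Longrightarrow> Cod C g = Cod C f \<Longrightarrow> f \<oplus> g = g \<oplus> f"
  using Plus_commute by (simp add: hom_iff)

lemma Plus_ass:
  "f \<in> Ar C \<Longrightarrow> g \<in> Ar C \<Longrightarrow> h \<in> Ar C \<Longrightarrow> Dom C g = Dom C f \<Longrightarrow> Cod C g = Cod C f \<Longrightarrow>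
    Dom C h = Dom C f \<Longrightarrow> Cod C h = Cod C f \<Longrightarrow> (f \<oplus> g) \<oplus> h = f \<oplus> (g \<oplus> h)"
  using Plus_assoc by (simp add: hom_iff)

lemma Plus_Null_left [simp]:
  "f \<in> Ar C \<Longrightarrow> Dom C f = x \<Longrightarrow> Cod C f = y \<Longrightarrow> Null C x y \<oplus> f = f"
  using Plus_comm[of "Null C x y" f] by auto

text \<open>Zero arrows are not assumed to absorb composition. It follows from bilinearity:
  \<open>Null\<close> equals \<open>Null\<close> plus its own negative, and composing turns this
  into the sum of an arrow and its negative.\<close>

lemma comp_Null [simp]:
  assumes "g \<in> Ar C" "Dom C g = y" "x \<in> Ob C"
  shows "g \<cdot> Null C x y = Null C x (Cod C g)"
proof -
  have [simp]: "y \<in> Ob C" using assms by auto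
  let ?n = "Null C x y"
  have n: "?n \<oplus> Scale C (-1) ?n = ?n" using Plus_Scale_neg[of ?n] assms by simp
  have "g \<cdot> ?n = g \<cdot> (?n \<oplus> Scale C (-1) ?n)" by (simp only: n)
  also have "\<dots> = (g \<cdot> ?n) \<oplus> Scale C (-1) (g \<cdot> ?n)"
    using assms by (simp add: comp_Plus del: Plus_Null_left)
  finally show ?thesis using Plus_Scale_neg[of "g \<cdot> ?n"] assms by simp
qed

lemma Null_comp [simp]:
  assumes "f \<in> Ar C" "Cod C f = y" "z \<in> Ob C"
  shows "Null C y z \<cdot> f = Null C (Dom C f) z"
proof -
  have [simp]: "y \<in> Ob C" using assms by auto
  let ?n = "Null C y z"
  have n: "?n \<oplus> Scale C (-1) ?n = ?n" using Plus_Scale_neg[of ?n] assms by simp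
  have "?n \<cdot> f = (?n \<oplus> Scale C (-1) ?n) \<cdot> f" by (simp only: n)
  also have "\<dots> = (?n \<cdot> f) \<oplus> Scale C (-1) (?n \<cdot> f)"
    using assms by (simp add: Plus_comp del: Plus_Null_left)
  finally show ?thesis using Plus_Scale_neg[of "?n \<cdot> f"] assms by simp
qed

lemma eq_iff_diff_Null:
  assumes "f \<in> Ar C" "g \<in> Ar C" "Dom C g = Dom C f" "Cod C g = Cod C f"
    "f \<oplus> Scale C (-1) g = Null C (Dom C f) (Cod C f)"
  shows "f = g"
proof -
  have "Scale C (-1) g \<oplus> g = Null C (Dom C f) (Cod C f)"
    using Plus_Scale_neg[of g] Plus_comm[of "Scale C (-1) g" g] assms by simp
  then have "f = f \<oplus> (Scale C (-1) g \<oplus> g)" using assms by simp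
  also have "\<dots> = (f \<oplus> Scale C (-1) g) \<oplus> g" using assms(1-4) by (simp add: Plus_ass)
  also have "\<dots> = g" using assms by simp
  finally show ?thesis .
qed

text \<open>The right-hand side is an equation between arrows; in this form a zero object is
  preserved by linear functors and reflected by jointly faithful ones.\<close>

lemma zero_object_iff: "zero_object C z \<longleftrightarrow> z \<in> Ob C \<and> Id C z = Null C z z"
proof
  assume "zero_object C z"
  then have "z \<in> Ob C" "\<exists>!f. f \<in> hom C z z"
    unfolding zero_object_def initial_object_def by auto
  then show "z \<in> Ob C \<and> Id C z = Null C z z" by (metis Null_hom id_hom)
next
  assume z: "z \<in> Ob C \<and> Id C z = Null C z z"
  { fix x f assume "f \<in> hom C x z"
    then have "f = Null C x z" using Id_comp[of f z] z by (auto simp: hom_iff simp del: Id_comp) }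
  moreover
  { fix x f assume "f \<in> hom C z x"
    then have "f = Null C z x" using comp_Id[of f z] z by (auto simp: hom_iff simp del: comp_Id) }
  ultimately show "zero_object C z"
    using z Null_hom unfolding zero_object_def initial_object_def terminal_object_def by blast
qed

text \<open>By linearity, two arrows with the same composite differ by an arrow that
  \<open>f\<close> kills.\<close>

lemma monicI:
  assumes "f \<in> Ar C"
    "\<And>h. h \<in> Ar C \<Longrightarrow> Cod C h = Dom C f \<Longrightarrow> f \<cdot> h = Null C (Dom C h) (Cod C f) \<Longrightarrow>
      h = Null C (Dom C h) (Dom C f)"
  shows "monic C f"
  unfolding monic_def
proof (intro conjI ballI impI, goal_cases)
  case 1 then show ?case by fact
next
  case (2 g h)
  show ?case
  proof (rule eq_iff_diff_Null)
    have "f \<cdot> (g \<oplus> Scale C (-1) h) = Null C (Dom C g) (Cod C f)"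
      using 2 assms(1) Plus_Scale_neg[of "f \<cdot> h"] by (simp add: comp_Plus)
    then show "g \<oplus> Scale C (-1) h = Null C (Dom C g) (Cod C g)"
      using assms(2)[of "g \<oplus> Scale C (-1) h"] 2 by simp
  qed (use 2 in auto)
qed

lemma monic_Null:
  "monic C f \<Longrightarrow> h \<in> Ar C \<Longrightarrow> Cod C h = Dom C f \<Longrightarrow> f \<cdot> h = Null C (Dom C h) (Cod C f) \<Longrightarrow>
      h = Null C (Dom C h) (Dom C f)"
  by (rule monic_cancel) (auto simp: monic_Ar)

lemma linear_category_dual: "linear_category (dual C)"
proof -
  interpret D: category "dual C" using category_axioms by blast
  show ?thesis
    by unfold_locales
      (auto intro: Plus_comm simp: hom_iff Plus_ass Plus_Scale_neg Scale_one Scale_mult Scale_add Scale_Plus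
        comp_Plus Plus_comp)
qed

lemma kernel_simps:
  assumes "is_kernel C k f"
  shows "k \<in> Ar C" "f \<in> Ar C" "Cod C k = Dom C f" "f \<cdot> k = Null C (Dom C k) (Cod C f)"
  using assms by (auto simp: is_kernel_def)

lemma kernel_lift:
  assumes "is_kernel C k f" "h \<in> Ar C" "Cod C h = Dom C f" "f \<cdot> h = Null C (Dom C h) (Cod C f)"
  obtains u where "u \<in> Ar C" "Dom C u = Dom C h" "Cod C u = Dom C k" "k \<cdot> u = h"
proof -
  have "\<exists>u. u \<in> hom C (Dom C h) (Dom C k) \<and> k \<cdot> u = h"
    using assms unfolding is_kernel_def by blast
  then show thesis using that by (auto simp: hom_iff)
qed

lemma kernel_monic:
  assumes "is_kernel C k f" shows "monic C k"
proof (rule monicI)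
  note k = kernel_simps[OF assms]
  show "k \<in> Ar C" by (rule k)
  fix h assume h: "h \<in> Ar C" "Cod C h = Dom C k" "k \<cdot> h = Null C (Dom C h) (Cod C k)"
  have "f \<cdot> (k \<cdot> h) = Null C (Dom C h) (Cod C f)" using h k by simp
  then have "\<exists>!u. u \<in> hom C (Dom C h) (Dom C k) \<and> k \<cdot> u = k \<cdot> h"
    using assms h k unfolding is_kernel_def by (metis comp_simps)
  moreover have "h \<in> hom C (Dom C h) (Dom C k)" using h by (simp add: hom_iff)
  moreover have "Null C (Dom C h) (Dom C k) \<in> hom C (Dom C h) (Dom C k) \<and>
      k \<cdot> Null C (Dom C h) (Dom C k) = k \<cdot> h"
    using h k by (simp add: hom_iff)
  ultimately show "h = Null C (Dom C h) (Dom C k)" by blast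
qed

lemma is_kernelI:
  assumes "monic C k" "f \<in> Ar C" "Cod C k = Dom C f" "f \<cdot> k = Null C (Dom C k) (Cod C f)"
    "\<And>h. h \<in> Ar C \<Longrightarrow> Cod C h = Dom C f \<Longrightarrow> f \<cdot> h = Null C (Dom C h) (Cod C f) \<Longrightarrow>
      \<exists>u. u \<in> Ar C \<and> Dom C u = Dom C h \<and> Cod C u = Dom C k \<and> k \<cdot> u = h"
  shows "is_kernel C k f"
  unfolding is_kernel_def
proof (intro conjI ballI impI, goal_cases)
  case (5 h)
  then obtain u where "u \<in> Ar C \<and> Dom C u = Dom C h \<and> Cod C u = Dom C k \<and> k \<cdot> u = h"
    using assms(5) by blast
  then show ?case using monic_cancel[OF assms(1)] by (intro ex1I[of _ u]) (auto simp: hom_iff)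
qed (use assms monic_Ar in auto)

text \<open>Monicity quantifies over all test arrows, which a functor need not hit. Once a kernel is
  given it becomes a single equation, and equations pass to projections.\<close>

lemma monic_iff_kernel_Null:
  assumes "is_kernel C k f"
  shows "monic C f \<longleftrightarrow> k = Null C (Dom C k) (Dom C f)"
proof
  note k = kernel_simps[OF assms]
  show "monic C f \<Longrightarrow> k = Null C (Dom C k) (Dom C f)" using monic_Null k by metis
  assume n: "k = Null C (Dom C k) (Dom C f)"
  show "monic C f"
  proof (rule monicI[OF k(2)])
    fix h assume h: "h \<in> Ar C" "Cod C h = Dom C f" "f \<cdot> h = Null C (Dom C h) (Cod C f)"
    from kernel_lift[OF assms this] obtain u
      where "u \<in> Ar C" "Dom C u = Dom C h" "Cod C u = Dom C k" "k \<cdot> u = h" .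
    then show "h = Null C (Dom C h) (Dom C f)" using n k by (metis Null_comp Dom_Ob)
  qed
qed

lemma kernel_comp_iso:
  assumes "is_kernel C k f" "iso_arrow C \<theta>" "Cod C \<theta> = Dom C k"
  shows "is_kernel C (k \<cdot> \<theta>) f"
proof (rule is_kernelI)
  note k = kernel_simps[OF assms(1)]
  note t = iso_Ar[OF assms(2)]
  show "monic C (k \<cdot> \<theta>)" using assms by (intro monic_comp iso_monic kernel_monic[OF assms(1)]) auto
  show "f \<in> Ar C" by (rule k)
  show "Cod C (k \<cdot> \<theta>) = Dom C f" using k t assms by simp
  show "f \<cdot> (k \<cdot> \<theta>) = Null C (Dom C (k \<cdot> \<theta>)) (Cod C f)"
    using k t assms(3) comp_extend1[of f k "Null C (Dom C k) (Cod C f)" \<theta>] by simp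
  fix h assume h: "h \<in> Ar C" "Cod C h = Dom C f" "f \<cdot> h = Null C (Dom C h) (Cod C f)"
  from kernel_lift[OF assms(1) this] obtain u
    where "u \<in> Ar C" "Dom C u = Dom C h" "Cod C u = Dom C k" "k \<cdot> u = h" .
  then show "\<exists>u. u \<in> Ar C \<and> Dom C u = Dom C h \<and> Cod C u = Dom C (k \<cdot> \<theta>) \<and> k \<cdot> \<theta> \<cdot> u = h"
    using k t assms by (intro exI[of _ "inv_arrow C \<theta> \<cdot> u"]) simp
qed

lemma kernel_unique:
  assumes "is_kernel C k f" "is_kernel C k' f"
  obtains \<theta> where "iso_arrow C \<theta>" "Dom C \<theta> = Dom C k'" "Cod C \<theta> = Dom C k" "k' = k \<cdot> \<theta>"
proof -
  note k = kernel_simps[OF assms(1)] and k' = kernel_simps[OF assms(2)]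
  obtain u where u: "u \<in> Ar C" "Dom C u = Dom C k'" "Cod C u = Dom C k" "k \<cdot> u = k'"
    using kernel_lift[OF assms(1) k'(1)] k' by auto
  obtain v where v: "v \<in> Ar C" "Dom C v = Dom C k" "Cod C v = Dom C k'" "k' \<cdot> v = k"
    using kernel_lift[OF assms(2) k(1)] k by auto
  have "v \<cdot> u = Id C (Dom C u)"
    by (rule monic_cancel[OF kernel_monic[OF assms(2)]])
      (use u v k' comp_extend1[OF v(4), of u] in simp_all)
  moreover have "u \<cdot> v = Id C (Cod C u)"
    by (rule monic_cancel[OF kernel_monic[OF assms(1)]])
      (use u v k comp_extend1[OF u(4), of v] in simp_all)
  ultimately have "iso_arrow C u" using u v iso_arrowI(1)[of u v] by simp
  then show thesis using that u by metis
qed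

lemma kernel_monic_comp:
  assumes "is_kernel C k f" "monic C m" "Dom C m = Cod C f"
  shows "is_kernel C k (m \<cdot> f)"
proof (rule is_kernelI)
  note k = kernel_simps[OF assms(1)] and m = monic_Ar[OF assms(2)]
  show "monic C k" by (rule kernel_monic[OF assms(1)])
  show "m \<cdot> f \<in> Ar C" "Cod C k = Dom C (m \<cdot> f)" "m \<cdot> f \<cdot> k = Null C (Dom C k) (Cod C (m \<cdot> f))"
    using k m assms(3) by simp_all
  fix h assume h: "h \<in> Ar C" "Cod C h = Dom C (m \<cdot> f)"
    "m \<cdot> f \<cdot> h = Null C (Dom C h) (Cod C (m \<cdot> f))"
  then have "f \<cdot> h = Null C (Dom C h) (Cod C f)"
    using monic_Null[OF assms(2), of "f \<cdot> h"] k m assms(3) by simp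
  then show "\<exists>u. u \<in> Ar C \<and> Dom C u = Dom C h \<and> Cod C u = Dom C k \<and> k \<cdot> u = h"
    using kernel_lift[OF assms(1) h(1)] h k m assms(3) by (metis comp_simps(2))
qed

lemma kernel_of_monic_comp:
  assumes "is_kernel C k (m \<cdot> f)" "m \<in> Ar C" "f \<in> Ar C" "Dom C m = Cod C f" "monic C m"
  shows "is_kernel C k f"
proof (rule is_kernelI)
  note k = kernel_simps[OF assms(1)]
  show "monic C k" by (rule kernel_monic[OF assms(1)])
  show "f \<in> Ar C" "Cod C k = Dom C f" using k assms by simp_all
  show "f \<cdot> k = Null C (Dom C k) (Cod C f)"
    using monic_Null[OF assms(5), of "f \<cdot> k"] k assms by simp
  fix h assume h: "h \<in> Ar C" "Cod C h = Dom C f" "f \<cdot> h = Null C (Dom C h) (Cod C f)"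
  then have "m \<cdot> f \<cdot> h = Null C (Dom C h) (Cod C (m \<cdot> f))" using assms by simp
  then show "\<exists>u. u \<in> Ar C \<and> Dom C u = Dom C h \<and> Cod C u = Dom C k \<and> k \<cdot> u = h"
    using kernel_lift[OF assms(1) h(1)] h k assms by (metis comp_simps(2))
qed

end


section \<open>Abelian categories\<close>

context abelian_category
begin

lemma abelian_category_dual: "abelian_category (dual C)"
proof -
  interpret D: linear_category "dual C" by (rule linear_category_dual)
  show ?thesis
  proof unfold_locales
    fix x y assume "x \<in> Ob (dual C)" "y \<in> Ob (dual C)"
    then obtain s i1 i2 p1 p2 where "is_biproduct C x y s i1 i2 p1 p2"
      using ex_biproduct by (metis dual_simps(1))
    then have "is_biproduct (dual C) x y s p1 p2 i1 i2" by simp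
    then show "\<exists>s i1 i2 p1 p2. is_biproduct (dual C) x y s i1 i2 p1 p2" by blast
  qed (simp_all add: ex_zero ex_kernel ex_cokernel monic_normal epic_normal)
qed

text \<open>The normality axiom only makes \<open>f\<close> the kernel of some \<open>g\<close>. But
  \<open>g\<close> kills \<open>f\<close>, hence factors through the cokernel \<open>q\<close>, so
  whatever \<open>q\<close> kills is killed by \<open>g\<close> as well and lifts through
  \<open>f\<close>.\<close>

lemma monic_kernel_of_cokernel:
  assumes "monic C f" "is_cokernel C q f"
  shows "is_kernel C f q"
proof -
  interpret D: linear_category "dual C" by (rule linear_category_dual)
  from monic_normal[OF assms(1)] obtain g where g: "is_kernel C f g" ..
  note f = kernel_simps[OF g]
  have q: "is_kernel (dual C) q f" using assms by simp
  note q' = D.kernel_simps[OF q, simplified]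
  obtain u where u: "u \<in> Ar C" "Cod C u = Cod C g" "Dom C u = Cod C q" "u \<cdot> q = g"
    using D.kernel_lift[OF q, of g] f by auto
  show ?thesis
  proof (rule is_kernelI[OF assms(1)])
    show "q \<in> Ar C" "Cod C f = Dom C q" "q \<cdot> f = Null C (Dom C f) (Cod C q)" using q' by auto
    fix h assume h: "h \<in> Ar C" "Cod C h = Dom C q" "q \<cdot> h = Null C (Dom C h) (Cod C q)"
    have "u \<cdot> (q \<cdot> h) = g \<cdot> h"
      by (rule comp_extend1[OF u(4)]) (use u h q' in auto)
    then have "g \<cdot> h = Null C (Dom C h) (Cod C g)"
      using u h by simp
    then show "\<exists>u. u \<in> Ar C \<and> Dom C u = Dom C h \<and> Cod C u = Dom C f \<and> f \<cdot> u = h"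
      using kernel_lift[OF g h(1)] h f q' by metis
  qed
qed

text \<open>The image \<open>m\<close> is the kernel of the cokernel \<open>q\<close>; the point is
  that the remaining factor \<open>e\<close> is epic. If \<open>g\<close> kills \<open>e\<close>,
  then \<open>f\<close> already passes through the subobject \<open>m \<cdot> n\<close>, where
  \<open>n\<close> is the kernel of \<open>g\<close>. That subobject is normal, and minimality of
  \<open>m\<close> gives \<open>n\<close> a right inverse, which forces \<open>g\<close> to
  vanish.\<close>

lemma image_factorization:
  assumes "f \<in> Ar C"
  obtains q m e where "is_cokernel C q f" "is_kernel C m q" "epic C e" "Cod C e = Dom C m"
    "Dom C e = Dom C f" "f = m \<cdot> e"
proof -
  interpret D: linear_category "dual C" by (rule linear_category_dual)
  obtain q where q: "is_cokernel C q f" using ex_cokernel[OF assms] ..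
  then have qd: "is_kernel (dual C) q f" by simp
  note q' = D.kernel_simps[OF qd, simplified]
  obtain m where m: "is_kernel C m q" using ex_kernel q' by blast
  note m' = kernel_simps[OF m]
  obtain e where e: "e \<in> Ar C" "Dom C e = Dom C f" "Cod C e = Dom C m" "m \<cdot> e = f"
    using kernel_lift[OF m assms] q' by auto
  have "monic (dual C) e"
  proof (rule D.monicI)
    show "e \<in> Ar (dual C)" using e by simp
    fix g assume "g \<in> Ar (dual C)" "Cod (dual C) g = Dom (dual C) e"
      "e \<cdot>\<^bsub>dual C\<^esub> g = Null (dual C) (Dom (dual C) g) (Cod (dual C) e)"
    then have g: "g \<in> Ar C" "Dom C g = Cod C e" "g \<cdot> e = Null C (Dom C e) (Cod C g)" by auto
    obtain n where n: "is_kernel C n g" using ex_kernel g by blast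
    note n' = kernel_simps[OF n]
    obtain e' where e': "e' \<in> Ar C" "Dom C e' = Dom C e" "Cod C e' = Dom C n" "n \<cdot> e' = e"
      using kernel_lift[OF n e(1)] g by auto
    have mn: "monic C (m \<cdot> n)"
      using m' n' g e by (intro monic_comp kernel_monic[OF n] kernel_monic[OF m]) simp
    from monic_normal[OF this] obtain h where h: "is_kernel C (m \<cdot> n) h" ..
    note h' = kernel_simps[OF h]
    have hm: "h \<in> Ar C" "Dom C h = Cod C m" "h \<cdot> (m \<cdot> n) = Null C (Dom C n) (Cod C h)"
      using h' m' n' g e by auto
    \<comment> \<open>\<open>h\<close> has \<open>m \<cdot> n\<close> as its kernel. Since it kills
      \<open>f\<close>, it factors through \<open>q\<close> and hence kills \<open>m\<close> too; so
      \<open>m\<close> lifts through \<open>m \<cdot> n\<close>.\<close>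
    have "h \<cdot> f = h \<cdot> (m \<cdot> (n \<cdot> e'))" using e e' by simp
    also have "\<dots> = (h \<cdot> (m \<cdot> n)) \<cdot> e'" using hm(1,2) m' n' g e e' by simp
    also have "\<dots> = Null C (Dom C f) (Cod C h)" using hm e' e n' by simp
    finally have "h \<cdot> f = Null C (Dom C f) (Cod C h)" .
    moreover have "Dom C h = Cod C f" using hm(2) m' q' by simp
    ultimately obtain h2 where h2: "h2 \<in> Ar C" "Dom C h2 = Cod C q" "h2 \<cdot> q = h"
      using D.kernel_lift[OF qd, of h] hm by auto
    have "h2 \<cdot> (q \<cdot> m) = h \<cdot> m"
      by (rule comp_extend1[OF h2(3)]) (use h2 q' m' in auto)
    then have "h \<cdot> m = Null C (Dom C m) (Cod C h)" using h2 q' m' hm by auto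
    then obtain t where t: "t \<in> Ar C" "Dom C t = Dom C m" "Cod C t = Dom C n" "(m \<cdot> n) \<cdot> t = m"
      using kernel_lift[OF h m'(1)] hm m' n' g e by auto
    have "n \<cdot> t = Id C (Dom C m)"
      by (rule monic_cancel[OF kernel_monic[OF m]]) (use t m' n' g e in auto)
    moreover have "g \<cdot> (n \<cdot> t) = Null C (Dom C n) (Cod C g) \<cdot> t"
      by (rule comp_extend1[OF n'(4)]) (use n' t in auto)
    ultimately have "g = Null C (Dom C g) (Cod C g)" using n' t g e by simp
    then show "g = Null (dual C) (Dom (dual C) g) (Dom (dual C) e)" using g by simp
  qed
  then show thesis using that q m e by auto
qed

lemma epic_cokernel_of_kernel:
  assumes "epic C f" "is_kernel C k f"
  shows "is_cokernel C f k"
  using abelian_category.monic_kernel_of_cokernel[OF abelian_category_dual, of f k] assms by simp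

end

section \<open>Functors\<close>

context cat_functor
begin

lemma FO_Ob [simp]: "x \<in> Ob C \<Longrightarrow> FO F x \<in> Ob D"
  by (rule FO_ob)

lemma FA_simps [simp]:
  assumes "f \<in> Ar C"
  shows "FA F f \<in> Ar D" "Dom D (FA F f) = FO F (Dom C f)" "Cod D (FA F f) = FO F (Cod C f)"
  using FA_hom[of f "Dom C f" "Cod C f"] assms by (simp_all add: hom_iff)

lemma FA_Id [simp]: "x \<in> Ob C \<Longrightarrow> FA F (Id C x) = Id D (FO F x)"
  by (rule FA_id)

lemma FA_Comp:
  "f \<in> Ar C \<Longrightarrow> g \<in> Ar C \<Longrightarrow> Dom C g = Cod C f \<Longrightarrow> FA F (g \<cdot>\<^bsub>C\<^esub> f) = FA F g \<cdot>\<^bsub>D\<^esub> FA F f"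
  using FA_comp[of f "Dom C f" "Cod C f" g "Cod C g"] by (simp add: hom_iff)

lemma FA_iso:
  assumes "iso_arrow C f"
  shows "iso_arrow D (FA F f)" "inv_arrow D (FA F f) = FA F (inv_arrow C f)"
proof -
  note f = source.iso_Ar[OF assms]
  have "FA F (inv_arrow C f) \<cdot>\<^bsub>D\<^esub> FA F f = Id D (FO F (Dom C f))"
    "FA F f \<cdot>\<^bsub>D\<^esub> FA F (inv_arrow C f) = Id D (FO F (Cod C f))"
    using f assms by (simp_all flip: FA_Comp)
  then show "iso_arrow D (FA F f)" "inv_arrow D (FA F f) = FA F (inv_arrow C f)"
    using target.iso_arrowI[of "FA F f" "FA F (inv_arrow C f)"] f assms by simp_all
qed

end

text \<open>Surjectivity on objects is on the nose, so a choice of preimages gives a functor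
  \<open>G\<close> for which \<open>F\<close> after \<open>G\<close> is the identity. The counit
  thus consists of identities, and the unit at \<open>x\<close> lifts the identity of the common
  image of \<open>x\<close> and of the chosen preimage of \<open>FO F x\<close>.\<close>

lemma equivalence_of_surjective:
  fixes F :: "('o, 'a, 'p, 'b) func"
  assumes F: "cat_functor C D F"
    and surj: "\<And>y. y \<in> Ob D \<Longrightarrow> \<exists>x\<in>Ob C. FO F x = y"
    and ff: "\<And>x y g. x \<in> Ob C \<Longrightarrow> y \<in> Ob C \<Longrightarrow> g \<in> hom D (FO F x) (FO F y) \<Longrightarrow>
      \<exists>!f. f \<in> hom C x y \<and> FA F f = g"
  shows "equivalence_of_categories C D F"
proof -
  interpret F: cat_functor C D F by fact
  define s where "s y = (SOME x. x \<in> Ob C \<and> FO F x = y)" for y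
  have s [simp]: "s y \<in> Ob C" "FO F (s y) = y" if "y \<in> Ob D" for y
  proof -
    have "s y \<in> Ob C \<and> FO F (s y) = y"
      unfolding s_def by (rule someI_ex) (use surj[OF that] in blast)
    then show "s y \<in> Ob C" "FO F (s y) = y" by auto
  qed
  define l where "l x y g = (THE f. f \<in> hom C x y \<and> FA F f = g)" for x y g
  have l': "l x y g \<in> hom C x y \<and> FA F (l x y g) = g"
    if "x \<in> Ob C" "y \<in> Ob C" "g \<in> Ar D" "Dom D g = FO F x" "Cod D g = FO F y" for x y g
    unfolding l_def by (rule theI') (use ff[of x y g] that in \<open>auto simp: hom_iff\<close>)
  then have l [simp]: "l x y g \<in> Ar C" "Dom C (l x y g) = x" "Cod C (l x y g) = y"
      "FA F (l x y g) = g"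
    if "x \<in> Ob C" "y \<in> Ob C" "g \<in> Ar D" "Dom D g = FO F x" "Cod D g = FO F y" for x y g
    using that by (auto simp: hom_iff)
  have inj: "f = f'" if "FA F f = FA F f'" "f \<in> Ar C" "f' \<in> Ar C" "Dom C f = Dom C f'"
    "Cod C f = Cod C f'" for f f'
    using ff[of "Dom C f" "Cod C f" "FA F f"] that by (fastforce simp: hom_iff)
  define G :: "('p, 'b, 'o, 'a) func" where
    "G = \<lparr>FO = (\<lambda>y\<in>Ob D. s y), FA = (\<lambda>g\<in>Ar D. l (s (Dom D g)) (s (Cod D g)) g)\<rparr>"
  have "cat_functor D C G"
  proof unfold_locales
    fix f g x y z assume "f \<in> hom D x y" "g \<in> hom D y z"
    then have "f \<in> Ar D" "g \<in> Ar D" "Dom D g = Cod D f" by (auto simp: hom_iff)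
    then show "FA G (g \<cdot>\<^bsub>D\<^esub> f) = FA G g \<cdot>\<^bsub>C\<^esub> FA G f"
      by (intro inj) (simp_all add: G_def F.FA_Comp)
  qed (auto simp: G_def hom_iff intro!: inj)
  moreover
  define \<eta> where "\<eta> = (\<lambda>x\<in>Ob C. l x (s (FO F x)) (Id D (FO F x)))"
  have "nat_iso C C (func_id C) (func_comp C G F) \<eta>"
    unfolding nat_iso_def
  proof (intro conjI ballI)
    fix x assume x: "x \<in> Ob C"
    show "\<eta> x \<in> hom C (FO (func_id C) x) (FO (func_comp C G F) x)"
      using x by (simp add: \<eta>_def func_id_def func_comp_def G_def hom_iff)
    show "iso_arrow C (\<eta> x)"
    proof (rule F.source.iso_arrowI(1)[where g = "l (s (FO F x)) x (Id D (FO F x))"])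
    qed (use x in \<open>auto simp: \<eta>_def F.FA_Comp intro!: inj\<close>)
  next
    fix x y f assume "x \<in> Ob C" "y \<in> Ob C" "f \<in> hom C x y"
    then show "\<eta> y \<cdot>\<^bsub>C\<^esub> FA (func_id C) f = FA (func_comp C G F) f \<cdot>\<^bsub>C\<^esub> \<eta> x"
      by (intro inj) (auto simp: \<eta>_def func_id_def func_comp_def G_def hom_iff F.FA_Comp)
  qed (simp add: \<eta>_def)
  moreover
  have "nat_iso D D (func_comp D F G) (func_id D) (\<lambda>y\<in>Ob D. Id D y)"
    by (auto simp: nat_iso_def func_id_def func_comp_def G_def hom_iff)
  ultimately show ?thesis unfolding equivalence_of_categories_def using F by blast
qed


section \<open>Tensor categories\<close>

context tensor_category
begin

lemma TO_Ob [simp]: "x \<in> Ob C \<Longrightarrow> y \<in> Ob C \<Longrightarrow> x \<otimes> y \<in> Ob C"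
  by (rule TO_ob)

lemma One_Ob [simp]: "\<one> \<in> Ob C"
  by (rule One_ob)

lemma TA_simps [simp]:
  assumes "f \<in> Ar C" "g \<in> Ar C"
  shows "f \<odot> g \<in> Ar C" "Dom C (f \<odot> g) = Dom C f \<otimes> Dom C g" "Cod C (f \<odot> g) = Cod C f \<otimes> Cod C g"
  using TA_hom[of f "Dom C f" "Cod C f" g "Dom C g" "Cod C g"] assms by (simp_all add: hom_iff)

lemma TA_Id [simp]: "x \<in> Ob C \<Longrightarrow> y \<in> Ob C \<Longrightarrow> Id C x \<odot> Id C y = Id C (x \<otimes> y)"
  by (rule TA_id)

lemma TA_merge:
  "f \<in> Ar C \<Longrightarrow> f' \<in> Ar C \<Longrightarrow> g \<in> Ar C \<Longrightarrow> g' \<in> Ar C \<Longrightarrow> Dom C f' = Cod C f \<Longrightarrow>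
    Dom C g' = Cod C g \<Longrightarrow> (f' \<odot> g') \<cdot> (f \<odot> g) = (f' \<cdot> f) \<odot> (g' \<cdot> g)"
  using TA_comp[of f "Dom C f" "Cod C f" f' "Cod C f'" g "Dom C g" "Cod C g" g' "Cod C g'"]
  by (simp add: hom_iff)

lemma TA_merge2:
  assumes "f \<in> Ar C" "f' \<in> Ar C" "g \<in> Ar C" "g' \<in> Ar C" "Dom C f' = Cod C f"
    "Dom C g' = Cod C g" "t \<in> Ar C" "Cod C t = Dom C f \<otimes> Dom C g"
  shows "(f' \<odot> g') \<cdot> ((f \<odot> g) \<cdot> t) = ((f' \<cdot> f) \<odot> (g' \<cdot> g)) \<cdot> t"
  using assms by (intro comp_extend1 TA_merge) auto

lemma TA_iso:
  assumes "iso_arrow C f" "iso_arrow C g"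
  shows "iso_arrow C (f \<odot> g)" "inv_arrow C (f \<odot> g) = inv_arrow C f \<odot> inv_arrow C g"
  using iso_arrowI[of "f \<odot> g" "inv_arrow C f \<odot> inv_arrow C g"] assms
  by (simp_all add: iso_Ar TA_merge)

lemma Assoc_simps [simp]:
  assumes "x \<in> Ob C" "y \<in> Ob C" "z \<in> Ob C"
  shows "Assoc C x y z \<in> Ar C" "Dom C (Assoc C x y z) = (x \<otimes> y) \<otimes> z"
    "Cod C (Assoc C x y z) = x \<otimes> (y \<otimes> z)" "iso_arrow C (Assoc C x y z)"
  using Assoc_hom[OF assms] Assoc_iso[OF assms] by (simp_all add: hom_iff)

lemma Lun_simps [simp]:
  assumes "x \<in> Ob C"
  shows "Lun C x \<in> Ar C" "Dom C (Lun C x) = \<one> \<otimes> x" "Cod C (Lun C x) = x" "iso_arrow C (Lun C x)"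
  using Lun_hom[OF assms] Lun_iso[OF assms] by (simp_all add: hom_iff)

lemma Run_simps [simp]:
  assumes "x \<in> Ob C"
  shows "Run C x \<in> Ar C" "Dom C (Run C x) = x \<otimes> \<one>" "Cod C (Run C x) = x" "iso_arrow C (Run C x)"
  using Run_hom[OF assms] Run_iso[OF assms] by (simp_all add: hom_iff)

lemma Sym_simps [simp]:
  assumes "x \<in> Ob C" "y \<in> Ob C"
  shows "Sym C x y \<in> Ar C" "Dom C (Sym C x y) = x \<otimes> y" "Cod C (Sym C x y) = y \<otimes> x"
    "Sym C y x \<cdot> Sym C x y = Id C (x \<otimes> y)"
  using Sym_hom[OF assms] Sym_inv[OF assms] by (simp_all add: hom_iff)

lemma Assoc_natural:
  "f \<in> Ar C \<Longrightarrow> g \<in> Ar C \<Longrightarrow> h \<in> Ar C \<Longrightarrow>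
    Assoc C (Cod C f) (Cod C g) (Cod C h) \<cdot> ((f \<odot> g) \<odot> h) =
    (f \<odot> (g \<odot> h)) \<cdot> Assoc C (Dom C f) (Dom C g) (Dom C h)"
  by (rule Assoc_nat) (auto simp: hom_iff)

lemma Lun_natural: "f \<in> Ar C \<Longrightarrow> Lun C (Cod C f) \<cdot> (Id C \<one> \<odot> f) = f \<cdot> Lun C (Dom C f)"
  by (rule Lun_nat) (auto simp: hom_iff)

lemma Run_natural: "f \<in> Ar C \<Longrightarrow> Run C (Cod C f) \<cdot> (f \<odot> Id C \<one>) = f \<cdot> Run C (Dom C f)"
  by (rule Run_nat) (auto simp: hom_iff)

lemma Sym_natural:
  "f \<in> Ar C \<Longrightarrow> g \<in> Ar C \<Longrightarrow>
    Sym C (Cod C f) (Cod C g) \<cdot> (f \<odot> g) = (g \<odot> f) \<cdot> Sym C (Dom C f) (Dom C g)"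
  by (rule Sym_nat) (auto simp: hom_iff)

end

context linear_category
begin

lemma Scale_0: "f \<in> Ar C \<Longrightarrow> Scale C 0 f = Null C (Dom C f) (Cod C f)"
  using Scale_add[of f "Dom C f" "Cod C f" 1 "-1"] Plus_Scale_neg[of f]
    Scale_one[of f "Dom C f" "Cod C f"] by (simp add: hom_iff)

lemma Scale_Scale: "f \<in> Ar C \<Longrightarrow> Scale C r (Scale C s f) = Scale C (r * s) f"
  using Scale_mult[of f "Dom C f" "Cod C f" r s] by (simp add: hom_iff)

lemma Scale_1 [simp]: "f \<in> Ar C \<Longrightarrow> Scale C 1 f = f"
  using Scale_one[of f "Dom C f" "Cod C f"] by (simp add: hom_iff)

end

context ex_tensor_category
begin

end


section \<open>Finite biproducts\<close>

text \<open>The sum runs over the degrees 0 to \<open>k\<close> inclusive, matching i + j = k. It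
  starts with \<open>f 0\<close> because an empty sum would need a prescribed source and
  target.\<close>

primrec hsum :: "('o, 'a, 'z) ltcat_scheme \<Rightarrow> (nat \<Rightarrow> 'a) \<Rightarrow> nat \<Rightarrow> 'a" where
  "hsum C f 0 = f 0"
| "hsum C f (Suc k) = hsum C f k \<oplus>\<^bsub>C\<^esub> f (Suc k)"

text \<open>An equational form of being a finite biproduct. The Kuenneth axiom speaks of arbitrary
  coproducts, a property quantified over all objects; injections and projections subject to
  equations are preserved by linear functors and reflected by jointly faithful ones.\<close>

definition bsys :: "('o, 'a, 'z) ltcat_scheme \<Rightarrow> nat \<Rightarrow> (nat \<Rightarrow> 'o) \<Rightarrow> 'o \<Rightarrow> (nat \<Rightarrow> 'a) \<Rightarrow>
    (nat \<Rightarrow> 'a) \<Rightarrow> bool" where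
  "bsys C k X s \<kappa> \<pi> \<longleftrightarrow> s \<in> Ob C \<and>
    (\<forall>i\<le>k. X i \<in> Ob C \<and> \<kappa> i \<in> hom C (X i) s \<and> \<pi> i \<in> hom C s (X i) \<and>
      \<pi> i \<cdot>\<^bsub>C\<^esub> \<kappa> i = Id C (X i)) \<and>
    (\<forall>i\<le>k. \<forall>j\<le>k. i \<noteq> j \<longrightarrow> \<pi> j \<cdot>\<^bsub>C\<^esub> \<kappa> i = Null C (X i) (X j)) \<and>
    hsum C (\<lambda>i. \<kappa> i \<cdot>\<^bsub>C\<^esub> \<pi> i) k = Id C s"

lemma hsum_cong: "(\<And>i. i \<le> k \<Longrightarrow> f i = g i) \<Longrightarrow> hsum C f k = hsum C g k"
  by (induction k) auto

context linear_category
begin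

lemma hsum_simps:
  assumes "\<And>i. i \<le> k \<Longrightarrow> f i \<in> hom C x y"
  shows "hsum C f k \<in> Ar C" "Dom C (hsum C f k) = x" "Cod C (hsum C f k) = y"
proof -
  have "hsum C f k \<in> hom C x y" using assms by (induction k) (simp_all add: Plus_hom)
  then show "hsum C f k \<in> Ar C" "Dom C (hsum C f k) = x" "Cod C (hsum C f k) = y"
    by (simp_all add: hom_iff)
qed

lemma comp_hsum:
  assumes "\<And>i. i \<le> k \<Longrightarrow> f i \<in> hom C x y" "g \<in> Ar C" "Dom C g = y"
  shows "g \<cdot> hsum C f k = hsum C (\<lambda>i. g \<cdot> f i) k"
  using assms(1)
proof (induction k)
  case (Suc k)
  then show ?case
    using hsum_simps[of k f x y] assms(2,3) Suc.prems[of "Suc k"]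
    by (simp add: comp_Plus hom_iff)
qed simp

lemma hsum_comp:
  assumes "\<And>i. i \<le> k \<Longrightarrow> f i \<in> hom C x y" "g \<in> Ar C" "Cod C g = x"
  shows "hsum C f k \<cdot> g = hsum C (\<lambda>i. f i \<cdot> g) k"
  using assms(1)
proof (induction k)
  case (Suc k)
  then show ?case
    using hsum_simps[of k f x y] assms(2,3) Suc.prems[of "Suc k"]
    by (simp add: Plus_comp hom_iff)
qed simp

lemma hsum_Null:
  "(\<And>i. i \<le> k \<Longrightarrow> f i = Null C x y) \<Longrightarrow> x \<in> Ob C \<Longrightarrow> y \<in> Ob C \<Longrightarrow> hsum C f k = Null C x y"
  by (induction k) auto

lemma hsum_delta:
  assumes "j \<le> k" "\<And>i. i \<le> k \<Longrightarrow> i \<noteq> j \<Longrightarrow> f i = Null C x y" "f j \<in> hom C x y"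
  shows "hsum C f k = f j"
proof -
  have xy: "x \<in> Ob C" "y \<in> Ob C" using assms(3) by (auto simp: hom_iff)
  show ?thesis
    using assms(1,2)
  proof (induction k)
    case (Suc k)
    show ?case
    proof (cases "j = Suc k")
      case True
      have "hsum C f k = Null C x y"
        by (rule hsum_Null) (use Suc.prems True xy in auto)
      then show ?thesis using True assms(3) by (simp add: hom_iff)
    next
      case False
      then have "hsum C f k = f j" using Suc by simp
      then show ?thesis using Suc.prems(2)[of "Suc k"] False assms(3) by (simp add: hom_iff)
    qed
  qed simp
qed

lemma bsysD:
  assumes "bsys C k X s \<kappa> \<pi>"
  shows "s \<in> Ob C" "\<And>i. i \<le> k \<Longrightarrow> X i \<in> Ob C"
    "\<And>i. i \<le> k \<Longrightarrow> \<kappa> i \<in> Ar C" "\<And>i. i \<le> k \<Longrightarrow> Dom C (\<kappa> i) = X i" "\<And>i. i \<le> k \<Longrightarrow> Cod C (\<kappa> i) = s"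
    "\<And>i. i \<le> k \<Longrightarrow> \<pi> i \<in> Ar C" "\<And>i. i \<le> k \<Longrightarrow> Dom C (\<pi> i) = s" "\<And>i. i \<le> k \<Longrightarrow> Cod C (\<pi> i) = X i"
    "\<And>i. i \<le> k \<Longrightarrow> \<pi> i \<cdot> \<kappa> i = Id C (X i)"
    "\<And>i j. i \<le> k \<Longrightarrow> j \<le> k \<Longrightarrow> i \<noteq> j \<Longrightarrow> \<pi> j \<cdot> \<kappa> i = Null C (X i) (X j)"
    "hsum C (\<lambda>i. \<kappa> i \<cdot> \<pi> i) k = Id C s"
  using assms by (auto simp: bsys_def hom_iff)

lemma bsys_expand_left:
  assumes "bsys C k X s \<kappa> \<pi>" "g \<in> Ar C" "Dom C g = s"
  shows "g = hsum C (\<lambda>i. (g \<cdot> \<kappa> i) \<cdot> \<pi> i) k"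
proof -
  note b = bsysD[OF assms(1)]
  have "g = g \<cdot> hsum C (\<lambda>i. \<kappa> i \<cdot> \<pi> i) k" using b(11) assms(2,3) by simp
  also have "\<dots> = hsum C (\<lambda>i. g \<cdot> (\<kappa> i \<cdot> \<pi> i)) k"
    by (rule comp_hsum[where x = s and y = s]) (use b assms in \<open>auto simp: hom_iff\<close>)
  also have "\<dots> = hsum C (\<lambda>i. (g \<cdot> \<kappa> i) \<cdot> \<pi> i) k"
    by (rule hsum_cong) (use b assms in auto)
  finally show ?thesis .
qed

lemma bsys_delta:
  assumes "bsys C k X s \<kappa> \<pi>" "j \<le> k" "g j \<in> Ar C" "Dom C (g j) = X j" "Cod C (g j) = z"
    "\<And>i. i \<le> k \<Longrightarrow> g i \<in> Ar C \<and> Dom C (g i) = X i \<and> Cod C (g i) = z"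
  shows "hsum C (\<lambda>i. g i \<cdot> \<pi> i) k \<cdot> \<kappa> j = g j"
proof -
  note b = bsysD[OF assms(1)]
  have "hsum C (\<lambda>i. g i \<cdot> \<pi> i) k \<cdot> \<kappa> j = hsum C (\<lambda>i. (g i \<cdot> \<pi> i) \<cdot> \<kappa> j) k"
    by (rule hsum_comp[where x = s and y = z]) (use b assms in \<open>auto simp: hom_iff\<close>)
  also have "\<dots> = (g j \<cdot> \<pi> j) \<cdot> \<kappa> j"
  proof (rule hsum_delta[where x = "X j" and y = z])
    fix i assume "i \<le> k" "i \<noteq> j"
    then show "(g i \<cdot> \<pi> i) \<cdot> \<kappa> j = Null C (X j) z" using b assms by simp
  qed (use b assms in \<open>auto simp: hom_iff\<close>)
  finally show ?thesis using b assms by simp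
qed

text \<open>Expanding \<open>\<pi>' i\<close> along the identity of \<open>s\<close> leaves a single
  term. So the injections determine the projections, and projections selected by \<open>SOME\<close>
  are nevertheless canonical.\<close>

lemma bsys_unique:
  assumes "bsys C k X s \<kappa> \<pi>" "bsys C k X s \<kappa> \<pi>'" "i \<le> k"
  shows "\<pi>' i = \<pi> i"
proof -
  note b = bsysD[OF assms(1)] and b' = bsysD[OF assms(2)]
  have "\<pi>' i = hsum C (\<lambda>j. (\<pi>' i \<cdot> \<kappa> j) \<cdot> \<pi> j) k"
    by (rule bsys_expand_left[OF assms(1)]) (use b' assms in auto)
  also have "\<dots> = (\<pi>' i \<cdot> \<kappa> i) \<cdot> \<pi> i"
  proof (rule hsum_delta[where x = s and y = "X i"])
    fix j assume "j \<le> k" "j \<noteq> i"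
    then show "(\<pi>' i \<cdot> \<kappa> j) \<cdot> \<pi> j = Null C s (X i)" using b b' assms by simp
  qed (use b b' assms in \<open>auto simp: hom_iff\<close>)
  finally show ?thesis using b b' assms by simp
qed

lemma bsys_coproduct:
  assumes b: "bsys C k X s \<kappa> \<pi>" and Y: "\<And>i j. i + j = k \<Longrightarrow> Y (i, j) = X i"
  shows "is_coproduct C {(i, j). i + j = k} Y s (\<lambda>(i, j). \<kappa> i)"
  unfolding is_coproduct_def
proof (intro conjI ballI allI impI)
  note b' = bsysD[OF b]
  show "s \<in> Ob C" by (rule b')
  fix p assume "p \<in> {(i, j). i + j = k}"
  then show "(case p of (i, j) \<Rightarrow> \<kappa> i) \<in> hom C (Y p) s" using b' Y by (auto simp: hom_iff)
next
  note b' = bsysD[OF b]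
  fix z g assume z: "z \<in> Ob C" and g: "\<forall>p\<in>{(i, j). i + j = k}. g p \<in> hom C (Y p) z"
  have g': "g (i, k - i) \<in> Ar C" "Dom C (g (i, k - i)) = X i" "Cod C (g (i, k - i)) = z"
    if "i \<le> k" for i
    using bspec[OF g, of "(i, k - i)"] that Y[of i "k - i"] by (auto simp: hom_iff)
  let ?u = "hsum C (\<lambda>i. g (i, k - i) \<cdot> \<pi> i) k"
  have "?u \<in> Ar C" "Dom C ?u = s" "Cod C ?u = z"
    by (rule hsum_simps[where x = s and y = z]; use b' g' in \<open>auto simp: hom_iff\<close>)+
  then have u: "?u \<in> hom C s z" by (simp add: hom_iff)
  show "\<exists>!u. u \<in> hom C s z \<and> (\<forall>p\<in>{(i, j). i + j = k}. u \<cdot> (case p of (i, j) \<Rightarrow> \<kappa> i) = g p)"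
  proof (rule ex1I[of _ ?u])
    have "?u \<cdot> \<kappa> i = g (i, j)" if "i + j = k" for i j
      using bsys_delta[OF b, of i "\<lambda>i. g (i, k - i)" z] that g' by auto
    then show "?u \<in> hom C s z \<and> (\<forall>p\<in>{(i, j). i + j = k}. ?u \<cdot> (case p of (i, j) \<Rightarrow> \<kappa> i) = g p)"
      using u by auto
  next
    fix u assume *: "u \<in> hom C s z \<and> (\<forall>p\<in>{(i, j). i + j = k}. u \<cdot> (case p of (i, j) \<Rightarrow> \<kappa> i) = g p)"
    then have "u = hsum C (\<lambda>i. (u \<cdot> \<kappa> i) \<cdot> \<pi> i) k"
      by (intro bsys_expand_left[OF b]) (auto simp: hom_iff)
    also have "\<dots> = ?u"
    proof (rule hsum_cong)
      fix i assume "i \<le> k"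
      then have "u \<cdot> \<kappa> i = g (i, k - i)" using * by force
      then show "(u \<cdot> \<kappa> i) \<cdot> \<pi> i = g (i, k - i) \<cdot> \<pi> i" by simp
    qed
    finally show "u = ?u" .
  qed
qed

lemma bsys_iso_target:
  assumes b: "bsys C k X S \<iota> p" and u: "iso_arrow C u" "Dom C u = S" "Cod C u = s"
    and \<kappa>: "\<And>i. i \<le> k \<Longrightarrow> \<kappa> i = u \<cdot> \<iota> i"
  shows "bsys C k X s \<kappa> (\<lambda>i. p i \<cdot> inv_arrow C u)"
proof -
  note b' = bsysD[OF b] and ua = iso_Ar[OF u(1)]
  have "hsum C (\<lambda>i. \<kappa> i \<cdot> (p i \<cdot> inv_arrow C u)) k = hsum C (\<lambda>i. (u \<cdot> (\<iota> i \<cdot> p i)) \<cdot> inv_arrow C u) k"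
    by (rule hsum_cong) (use b' ua u \<kappa> in auto)
  also have "\<dots> = hsum C (\<lambda>i. u \<cdot> (\<iota> i \<cdot> p i)) k \<cdot> inv_arrow C u"
    by (rule hsum_comp[symmetric, where x = S and y = s]) (use b' ua u in \<open>auto simp: hom_iff\<close>)
  also have "hsum C (\<lambda>i. u \<cdot> (\<iota> i \<cdot> p i)) k = u \<cdot> hsum C (\<lambda>i. \<iota> i \<cdot> p i) k"
    by (rule comp_hsum[symmetric, where x = S and y = S]) (use b' ua u in \<open>auto simp: hom_iff\<close>)
  also have "u \<cdot> hsum C (\<lambda>i. \<iota> i \<cdot> p i) k = u" using b'(11) ua u by simp
  finally have "hsum C (\<lambda>i. \<kappa> i \<cdot> (p i \<cdot> inv_arrow C u)) k = Id C s" using u by simp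
  moreover have "s \<in> Ob C" using ua u by auto
  ultimately show ?thesis using b' ua u \<kappa> unfolding bsys_def by (auto simp: hom_iff)
qed

lemma bsys_iso_source:
  assumes b: "bsys C k X s \<kappa> p"
    and \<theta>: "\<And>i. i \<le> k \<Longrightarrow> iso_arrow C (\<theta> i) \<and> Dom C (\<theta> i) = Y i \<and> Cod C (\<theta> i) = X i"
    and \<kappa>: "\<And>i. i \<le> k \<Longrightarrow> \<kappa>' i = \<kappa> i \<cdot> \<theta> i"
  shows "bsys C k Y s \<kappa>' (\<lambda>i. inv_arrow C (\<theta> i) \<cdot> p i)"
proof -
  note b' = bsysD[OF b]
  have \<theta>': "iso_arrow C (\<theta> i)" "\<theta> i \<in> Ar C" "Dom C (\<theta> i) = Y i" "Cod C (\<theta> i) = X i" "Y i \<in> Ob C"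
    if "i \<le> k" for i
    using \<theta>[OF that] iso_Ar[of "\<theta> i"] Dom_Ob[of "\<theta> i"] by auto
  have "hsum C (\<lambda>i. \<kappa>' i \<cdot> (inv_arrow C (\<theta> i) \<cdot> p i)) k = hsum C (\<lambda>i. \<kappa> i \<cdot> p i) k"
    by (rule hsum_cong) (use b' \<theta>' \<kappa> in auto)
  then have 1: "hsum C (\<lambda>i. \<kappa>' i \<cdot> (inv_arrow C (\<theta> i) \<cdot> p i)) k = Id C s" using b'(11) by simp
  have 2: "(inv_arrow C (\<theta> j) \<cdot> p j) \<cdot> (\<kappa> i \<cdot> \<theta> i) =
      inv_arrow C (\<theta> j) \<cdot> ((p j \<cdot> \<kappa> i) \<cdot> \<theta> i)" if "i \<le> k" "j \<le> k" for i j
    using that b' \<theta>' by simp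
  have 3: "inv_arrow C (\<theta> i) \<cdot> ((p i \<cdot> \<kappa> i) \<cdot> \<theta> i) = Id C (Y i)" if "i \<le> k" for i
    using that b'(9)[OF that] \<theta>'[OF that] by (simp del: assoc)
  have 4: "inv_arrow C (\<theta> j) \<cdot> ((p j \<cdot> \<kappa> i) \<cdot> \<theta> i) = Null C (Y i) (Y j)"
    if "i \<le> k" "j \<le> k" "i \<noteq> j" for i j
    using that b'(10)[OF that] \<theta>'[OF that(1)] \<theta>'[OF that(2)] b'(2) by (simp del: assoc)
  show ?thesis
    unfolding bsys_def
    using b'(1,3-8) \<theta>' 1 2 3 4 \<kappa> by (auto simp: hom_iff simp del: assoc)
qed

text \<open>The Kuenneth axiom asks for an isomorphism out of every coproduct, not out of a chosen
  one. The inverse is assembled from the projections, each followed by the corresponding injection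
  into \<open>S\<close>.\<close>

lemma coproduct_bsys_iso:
  assumes b: "bsys C k X s \<kappa> \<pi>" and Y: "\<And>i j. i + j = k \<Longrightarrow> Y (i, j) = X i"
    and c: "is_coproduct C {(i, j). i + j = k} Y S \<iota>" and u: "u \<in> hom C S s"
    and \<kappa>: "\<And>i j. i + j = k \<Longrightarrow> u \<cdot> \<iota> (i, j) = \<kappa> i"
  shows "iso_arrow C u"
proof -
  note b' = bsysD[OF b]
  have \<iota>': "\<iota> (i, j) \<in> hom C (X i) S" if "i + j = k" for i j
    using c that Y unfolding is_coproduct_def by auto
  then have \<iota>: "\<iota> (i, k - i) \<in> Ar C" "Dom C (\<iota> (i, k - i)) = X i" "Cod C (\<iota> (i, k - i)) = S"
    if "i \<le> k" for i
    using that by (auto simp: hom_iff)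
  have u': "u \<in> Ar C" "Dom C u = S" "Cod C u = s" using u by (auto simp: hom_iff)
  let ?v = "hsum C (\<lambda>i. \<iota> (i, k - i) \<cdot> \<pi> i) k"
  have v: "?v \<in> Ar C" "Dom C ?v = s" "Cod C ?v = S"
    by (rule hsum_simps[where x = s and y = S]; use b' \<iota> in \<open>auto simp: hom_iff\<close>)+
  have v\<kappa>: "?v \<cdot> \<kappa> i = \<iota> (i, k - i)" if "i \<le> k" for i
    by (rule bsys_delta[OF b that, where z = S]) (use \<iota> that in auto)
  have "u \<cdot> ?v = hsum C (\<lambda>i. u \<cdot> (\<iota> (i, k - i) \<cdot> \<pi> i)) k"
    by (rule comp_hsum[where x = s and y = S]) (use b' \<iota> u' in \<open>auto simp: hom_iff\<close>)
  also have "\<dots> = hsum C (\<lambda>i. \<kappa> i \<cdot> \<pi> i) k"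
  proof (rule hsum_cong)
    fix i assume i: "i \<le> k"
    show "u \<cdot> (\<iota> (i, k - i) \<cdot> \<pi> i) = \<kappa> i \<cdot> \<pi> i"
      by (rule comp_extend1) (use i \<kappa>[of i "k - i"] \<iota> b' u' in auto)
  qed
  finally have uv: "u \<cdot> ?v = Id C s" using b' by simp
  \<comment> \<open>Both the identity of \<open>S\<close> and the composite to be shown trivial fix
    the universal cocone, so they coincide.\<close>
  have "\<exists>!w. w \<in> hom C S S \<and> (\<forall>p\<in>{(i, j). i + j = k}. w \<cdot> \<iota> p = \<iota> p)"
  proof -
    have "S \<in> Ob C" "\<forall>p\<in>{(i, j). i + j = k}. \<iota> p \<in> hom C (Y p) S"
      using c unfolding is_coproduct_def by auto
    then show ?thesis using c unfolding is_coproduct_def by blast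
  qed
  moreover have "?v \<cdot> u \<in> hom C S S" using u' v by (simp add: hom_iff)
  moreover have "(?v \<cdot> u) \<cdot> \<iota> (i, j) = \<iota> (i, j)" if "i + j = k" for i j
  proof -
    have j: "j = k - i" "i \<le> k" using that by auto
    have "(?v \<cdot> u) \<cdot> \<iota> (i, j) = ?v \<cdot> (u \<cdot> \<iota> (i, j))" using \<iota>[of i] j v u' by simp
    then show ?thesis using v\<kappa>[of i] \<kappa>[OF that] j by simp
  qed
  moreover have "Id C S \<in> hom C S S" using u' by (auto simp: hom_iff)
  moreover have "Id C S \<cdot> \<iota> (i, j) = \<iota> (i, j)" if "i + j = k" for i j
    using \<iota>'[OF that] by (simp add: hom_iff)
  ultimately have "?v \<cdot> u = Id C S" by blast
  then show ?thesis using uv u' v iso_arrowI(1)[of u ?v] by simp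
qed

end

lemma (in abelian_category) bsys_exists:
  assumes "\<And>i. i \<le> k \<Longrightarrow> X i \<in> Ob C"
  shows "\<exists>s \<kappa> \<pi>. bsys C k X s \<kappa> \<pi>"
  using assms
proof (induction k)
  case 0
  then have "bsys C 0 X (X 0) (\<lambda>i. Id C (X i)) (\<lambda>i. Id C (X i))"
    by (simp add: bsys_def hom_iff)
  then show ?case by blast
next
  case (Suc k)
  then obtain s \<kappa> \<pi> where b: "bsys C k X s \<kappa> \<pi>" by fastforce
  note b' = bsysD[OF b]
  obtain t i1 i2 p1 p2 where t: "is_biproduct C s (X (Suc k)) t i1 i2 p1 p2"
    using ex_biproduct b'(1) Suc.prems by blast
  then have t': "t \<in> Ob C" "i1 \<in> Ar C" "Dom C i1 = s" "Cod C i1 = t" "i2 \<in> Ar C"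
    "Dom C i2 = X (Suc k)" "Cod C i2 = t" "p1 \<in> Ar C" "Dom C p1 = t" "Cod C p1 = s" "p2 \<in> Ar C"
    "Dom C p2 = t" "Cod C p2 = X (Suc k)"
    "p1 \<cdot> i1 = Id C s" "p2 \<cdot> i2 = Id C (X (Suc k))" "p2 \<cdot> i1 = Null C s (X (Suc k))"
    "p1 \<cdot> i2 = Null C (X (Suc k)) s" "(i1 \<cdot> p1) \<oplus> (i2 \<cdot> p2) = Id C t"
    by (auto simp: is_biproduct_def hom_iff)
  define \<kappa>' where "\<kappa>' i = (if i = Suc k then i2 else i1 \<cdot> \<kappa> i)" for i
  define \<pi>' where "\<pi>' i = (if i = Suc k then p2 else \<pi> i \<cdot> p1)" for i
  have XS: "X (Suc k) \<in> Ob C" using Suc.prems by simp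
  have ty: "\<kappa>' i \<in> hom C (X i) t" "\<pi>' i \<in> hom C t (X i)" if "i \<le> Suc k" for i
    using that b' t' unfolding \<kappa>'_def \<pi>'_def by (auto simp: hom_iff le_Suc_eq)
  have e1: "p1 \<cdot> (i1 \<cdot> \<kappa> i) = \<kappa> i" "p2 \<cdot> (i1 \<cdot> \<kappa> i) = Null C (X i) (X (Suc k))" if "i \<le> k" for i
    using that b' t' XS comp_extend1[OF t'(14), of "\<kappa> i"] comp_extend1[OF t'(16), of "\<kappa> i"]
    by simp_all
  have e2: "(\<pi> j \<cdot> p1) \<cdot> (i1 \<cdot> \<kappa> i) = \<pi> j \<cdot> \<kappa> i" "(\<pi> j \<cdot> p1) \<cdot> i2 = Null C (X (Suc k)) (X j)"
    if "i \<le> k" "j \<le> k" for i j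
    using that b' t' e1 XS by simp_all
  have "hsum C (\<lambda>i. \<kappa>' i \<cdot> \<pi>' i) k = hsum C (\<lambda>i. (i1 \<cdot> (\<kappa> i \<cdot> \<pi> i)) \<cdot> p1) k"
    by (rule hsum_cong) (use b' t' in \<open>auto simp: \<kappa>'_def \<pi>'_def\<close>)
  also have "\<dots> = hsum C (\<lambda>i. i1 \<cdot> (\<kappa> i \<cdot> \<pi> i)) k \<cdot> p1"
    by (rule hsum_comp[symmetric, where x = s and y = t]) (use b' t' in \<open>auto simp: hom_iff\<close>)
  also have "hsum C (\<lambda>i. i1 \<cdot> (\<kappa> i \<cdot> \<pi> i)) k = i1 \<cdot> hsum C (\<lambda>i. \<kappa> i \<cdot> \<pi> i) k"
    by (rule comp_hsum[symmetric, where x = s and y = s]) (use b' t' in \<open>auto simp: hom_iff\<close>)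
  finally have "hsum C (\<lambda>i. \<kappa>' i \<cdot> \<pi>' i) k = i1 \<cdot> p1" using b' t' by simp
  then have "hsum C (\<lambda>i. \<kappa>' i \<cdot> \<pi>' i) (Suc k) = Id C t" using t' by (simp add: \<kappa>'_def \<pi>'_def)
  moreover have "\<pi>' i \<cdot> \<kappa>' i = Id C (X i)" if "i \<le> Suc k" for i
    using that e2[of i i] b' t' by (auto simp: \<kappa>'_def \<pi>'_def le_Suc_eq)
  moreover have "\<pi>' j \<cdot> \<kappa>' i = Null C (X i) (X j)" if "i \<le> Suc k" "j \<le> Suc k" "i \<noteq> j" for i j
    using that e2[of i j] e2[of j j] e1[of i] b' t' by (auto simp: \<kappa>'_def \<pi>'_def le_Suc_eq)
  ultimately have "bsys C (Suc k) X t \<kappa>' \<pi>'"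
    unfolding bsys_def using ty t' Suc.prems by auto
  then show ?case by blast
qed

text \<open>Among the coproducts there is a biproduct. The comparison with it is invertible by
  hypothesis, and its projections can be carried over to \<open>s\<close>.\<close>

lemma (in abelian_category) bsys_of_coproduct_iso:
  assumes "\<And>i. i \<le> k \<Longrightarrow> \<kappa> i \<in> hom C (X i) s"
    and "\<And>S \<iota> u. is_coproduct C {(i, j). i + j = k} (\<lambda>(i, j). X i) S \<iota> \<Longrightarrow> u \<in> hom C S s \<Longrightarrow>
      (\<And>i j. i + j = k \<Longrightarrow> u \<cdot> \<iota> (i, j) = \<kappa> i) \<Longrightarrow> iso_arrow C u"
  shows "\<exists>\<pi>. bsys C k X s \<kappa> \<pi>"
proof -
  have s: "s \<in> Ob C" using assms(1)[of 0] by (auto simp: hom_iff)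
  obtain S \<iota> p where b: "bsys C k X S \<iota> p"
    using bsys_exists[of k X] assms(1) Dom_Ob unfolding hom_iff by metis
  have c: "is_coproduct C {(i, j). i + j = k} (\<lambda>(i, j). X i) S (\<lambda>(i, j). \<iota> i)"
    by (rule bsys_coproduct[OF b]) auto
  have "\<exists>!u. u \<in> hom C S s \<and> (\<forall>p\<in>{(i, j). i + j = k}. u \<cdot> (case p of (i, j) \<Rightarrow> \<iota> i) =
      (case p of (i, j) \<Rightarrow> \<kappa> i))"
  proof -
    have \<kappa>: "\<forall>p\<in>{(i, j). i + j = k}. (case p of (i, j) \<Rightarrow> \<kappa> i) \<in> hom C (case p of (i, j) \<Rightarrow> X i) s"
      using assms(1) by auto
    have *: "\<forall>z\<in>Ob C. \<forall>g. (\<forall>p\<in>{(i, j). i + j = k}. g p \<in> hom C (case p of (i, j) \<Rightarrow> X i) z) \<longrightarrow>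
      (\<exists>!u. u \<in> hom C S z \<and> (\<forall>p\<in>{(i, j). i + j = k}. u \<cdot> (case p of (i, j) \<Rightarrow> \<iota> i) = g p))"
      using c unfolding is_coproduct_def by (elim conjE)
    note bspec[OF * s]
    from spec[where x = "\<lambda>p. case p of (i, j) \<Rightarrow> \<kappa> i", OF this] \<kappa> show ?thesis by (rule mp)
  qed
  from ex1_implies_ex[OF this] obtain u where u: "u \<in> hom C S s" "\<And>i j. i + j = k \<Longrightarrow> u \<cdot> \<iota> i = \<kappa> i"
    by (elim exE conjE) auto
  have "iso_arrow C u" by (rule assms(2)[OF c u(1)]) (use u(2) in auto)
  then have "bsys C k X s \<kappa> (\<lambda>i. p i \<cdot> inv_arrow C u)"
    by (rule bsys_iso_target[OF b]) (use u(1) u(2)[OF le_add_diff_inverse] in \<open>auto simp: hom_iff\<close>)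
  then show ?thesis by blast
qed

section \<open>Exact functors\<close>

text \<open>Separated from tensor functors because this part is self-dual: preservation of cokernels
  and epimorphisms then comes from \<open>exact_functor_dual\<close>.\<close>

locale exact_functor = cat_functor A B F + source: abelian_category A + target: abelian_category B
  for A :: "('o, 'a, 'z) ltcat_scheme" and B :: "('p, 'b, 'w) ltcat_scheme"
    and F :: "('o, 'a, 'p, 'b, 'v) func_scheme" +
  assumes preserves_Plus:
      "f \<in> hom A x y \<Longrightarrow> g \<in> hom A x y \<Longrightarrow> FA F (f \<oplus>\<^bsub>A\<^esub> g) = FA F f \<oplus>\<^bsub>B\<^esub> FA F g"
    and preserves_Scale: "f \<in> hom A x y \<Longrightarrow> FA F (Scale A r f) = Scale B r (FA F f)"
    and preserves_exact: "short_exact A f g \<Longrightarrow> short_exact B (FA F f) (FA F g)"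
begin

lemma F_Plus:
  "f \<in> Ar A \<Longrightarrow> g \<in> Ar A \<Longrightarrow> Dom A g = Dom A f \<Longrightarrow> Cod A g = Cod A f \<Longrightarrow>
    FA F (f \<oplus>\<^bsub>A\<^esub> g) = FA F f \<oplus>\<^bsub>B\<^esub> FA F g"
  by (rule preserves_Plus) (auto simp: hom_iff)

lemma F_Scale: "f \<in> Ar A \<Longrightarrow> FA F (Scale A r f) = Scale B r (FA F f)"
  by (rule preserves_Scale) (auto simp: hom_iff)

text \<open>A zero arrow is its own multiple by 0, and multiples are preserved.\<close>

lemma F_Null [simp]:
  assumes "x \<in> Ob A" "y \<in> Ob A"
  shows "FA F (Null A x y) = Null B (FO F x) (FO F y)"
  using F_Scale[of "Null A x y" 0] assms by (simp add: source.Scale_0 target.Scale_0)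

text \<open>A monic is the first half of the short exact sequence that it forms with its
  cokernel.\<close>

lemma F_monic:
  assumes "monic A m" shows "monic B (FA F m)"
proof -
  obtain q where "is_cokernel A q m"
    using source.ex_cokernel source.monic_Ar[OF assms] by blast
  then have "short_exact A m q"
    using source.monic_kernel_of_cokernel assms unfolding short_exact_def by blast
  then have "is_kernel B (FA F m) (FA F q)"
    using preserves_exact unfolding short_exact_def by blast
  then show ?thesis by (rule target.kernel_monic)
qed

text \<open>Only short exact sequences are assumed to be preserved. The kernel of \<open>f\<close>
  is also the kernel of its epic part, with which it forms a short exact sequence; the monic part
  can be restored afterwards because its image under \<open>F\<close> is monic again.\<close>

lemma F_kernel:
  assumes "is_kernel A k f" shows "is_kernel B (FA F k) (FA F f)"
proof -
  obtain q m e where e: "is_cokernel A q f" "is_kernel A m q" "epic A e" "Cod A e = Dom A m"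
    "Dom A e = Dom A f" "f = m \<cdot>\<^bsub>A\<^esub> e"
    using source.image_factorization source.kernel_simps(2)[OF assms] by metis
  note m = source.kernel_monic[OF e(2)]
  have "is_kernel A k e"
    by (rule source.kernel_of_monic_comp[of k m e])
      (use e m assms source.monic_Ar source.epic_Ar in auto)
  then have "short_exact A k e"
    using source.epic_cokernel_of_kernel e(3) unfolding short_exact_def by blast
  then have "is_kernel B (FA F k) (FA F e)"
    using preserves_exact unfolding short_exact_def by blast
  then have "is_kernel B (FA F k) (FA F m \<cdot>\<^bsub>B\<^esub> FA F e)"
    by (rule target.kernel_monic_comp)
      (use m e source.monic_Ar[OF m] source.epic_Ar in \<open>auto intro: F_monic\<close>)
  then show ?thesis
    using e source.monic_Ar[OF m] source.epic_Ar[OF e(3)] by (simp add: FA_Comp)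
qed

lemma exact_functor_dual: "exact_functor (dual A) (dual B) F"
proof -
  interpret sd: abelian_category "dual A" by (rule source.abelian_category_dual)
  interpret td: abelian_category "dual B" by (rule target.abelian_category_dual)
  show ?thesis
    by unfold_locales
      (use preserves_exact FO_ext FA_ext in \<open>auto simp: hom_iff FA_Comp F_Plus F_Scale\<close>)
qed

lemma F_cokernel: "is_cokernel A q f \<Longrightarrow> is_cokernel B (FA F q) (FA F f)"
  using exact_functor.F_kernel[OF exact_functor_dual] by simp

lemma F_epic: "epic A e \<Longrightarrow> epic B (FA F e)"
  using exact_functor.F_monic[OF exact_functor_dual] by simp

lemma F_exact_at:
  assumes "exact_at A f g" shows "exact_at B (FA F f) (FA F g)"
proof -
  obtain k e where k: "is_kernel A k g" "epic A e" "Cod A e = Dom A k" "f = k \<cdot>\<^bsub>A\<^esub> e"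
    using assms unfolding exact_at_def by blast
  then show ?thesis
    unfolding exact_at_def
    by (intro exI[of _ "FA F k"] exI[of _ "FA F e"])
      (auto simp: F_kernel F_epic FA_Comp source.kernel_simps source.epic_Ar)
qed

lemma F_zero: "zero_object A z \<Longrightarrow> zero_object B (FO F z)"
  unfolding source.zero_object_iff target.zero_object_iff using FA_Id F_Null FO_Ob by metis

lemma F_hsum:
  "(\<And>i. i \<le> k \<Longrightarrow> f i \<in> hom A x y) \<Longrightarrow> FA F (hsum A f k) = hsum B (\<lambda>i. FA F (f i)) k"
proof (induction k)
  case (Suc k)
  then show ?case
    using source.hsum_simps[of k f x y] Suc.prems[of "Suc k"] by (simp add: F_Plus hom_iff)
qed simp

lemma F_bsys:
  assumes "bsys A k X s \<kappa> \<pi>"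
  shows "bsys B k (\<lambda>i. FO F (X i)) (FO F s) (\<lambda>i. FA F (\<kappa> i)) (\<lambda>i. FA F (\<pi> i))"
proof -
  note b = source.bsysD[OF assms]
  have "hsum B (\<lambda>i. FA F (\<kappa> i) \<cdot>\<^bsub>B\<^esub> FA F (\<pi> i)) k = hsum B (\<lambda>i. FA F (\<kappa> i \<cdot>\<^bsub>A\<^esub> \<pi> i)) k"
    by (rule hsum_cong) (use b in \<open>auto simp: FA_Comp\<close>)
  also have "\<dots> = FA F (hsum A (\<lambda>i. \<kappa> i \<cdot>\<^bsub>A\<^esub> \<pi> i) k)"
    by (rule F_hsum[symmetric, where x = s and y = s]) (use b in \<open>auto simp: hom_iff\<close>)
  finally show ?thesis using b unfolding bsys_def by (auto simp: hom_iff simp flip: FA_Comp)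
qed

lemma F_biproduct:
  assumes "is_biproduct A x y s i1 i2 p1 p2"
  shows "is_biproduct B (FO F x) (FO F y) (FO F s) (FA F i1) (FA F i2) (FA F p1) (FA F p2)"
proof -
  have "FA F (i1 \<cdot>\<^bsub>A\<^esub> p1) \<oplus>\<^bsub>B\<^esub> FA F (i2 \<cdot>\<^bsub>A\<^esub> p2) = FA F ((i1 \<cdot>\<^bsub>A\<^esub> p1) \<oplus>\<^bsub>A\<^esub> (i2 \<cdot>\<^bsub>A\<^esub> p2))"
    by (rule F_Plus[symmetric]) (use assms in \<open>auto simp: is_biproduct_def hom_iff\<close>)
  then show ?thesis
    using assms unfolding is_biproduct_def by (auto simp: hom_iff FA_Comp[symmetric])
qed

end


section \<open>Jointly faithful families\<close>

text \<open>
  A linear category \<open>S\<close> with a jointly faithful family of structure-preserving functors into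
  abelian categories is abelian as soon as it is closed under the formation of kernels, cokernels
  and biproducts and under factorisation through monomorphisms and epimorphisms.
\<close>

locale joint_abelian =
  fixes S :: "('o, 'a, 'z) ltcat_scheme" and I :: "'i set"
    and A :: "'i \<Rightarrow> ('p, 'b, 'w) ltcat_scheme" and Q :: "'i \<Rightarrow> 'o \<Rightarrow> 'p" and V :: "'i \<Rightarrow> 'a \<Rightarrow> 'b"
  assumes fam_abelian: "i \<in> I \<Longrightarrow> abelian_category (A i)"
    and S_DC: "f \<in> Ar S \<Longrightarrow> Dom S f \<in> Ob S \<and> Cod S f \<in> Ob S"
    and S_Id: "x \<in> Ob S \<Longrightarrow> Id S x \<in> hom S x x"
    and S_comp: "f \<in> hom S x y \<Longrightarrow> g \<in> hom S y z \<Longrightarrow> g \<cdot>\<^bsub>S\<^esub> f \<in> hom S x z"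
    and S_Null: "x \<in> Ob S \<Longrightarrow> y \<in> Ob S \<Longrightarrow> Null S x y \<in> hom S x y"
    and S_Plus: "f \<in> hom S x y \<Longrightarrow> g \<in> hom S x y \<Longrightarrow> f \<oplus>\<^bsub>S\<^esub> g \<in> hom S x y"
    and S_Scale: "f \<in> hom S x y \<Longrightarrow> Scale S r f \<in> hom S x y"
    and Q_Ob: "i \<in> I \<Longrightarrow> x \<in> Ob S \<Longrightarrow> Q i x \<in> Ob (A i)"
    and V_hom: "i \<in> I \<Longrightarrow> f \<in> hom S x y \<Longrightarrow> V i f \<in> hom (A i) (Q i x) (Q i y)"
    and V_Id: "i \<in> I \<Longrightarrow> x \<in> Ob S \<Longrightarrow> V i (Id S x) = Id (A i) (Q i x)"
    and V_comp: "i \<in> I \<Longrightarrow> f \<in> hom S x y \<Longrightarrow> g \<in> hom S y z \<Longrightarrow>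
        V i (g \<cdot>\<^bsub>S\<^esub> f) = V i g \<cdot>\<^bsub>A i\<^esub> V i f"
    and V_Null: "i \<in> I \<Longrightarrow> x \<in> Ob S \<Longrightarrow> y \<in> Ob S \<Longrightarrow> V i (Null S x y) = Null (A i) (Q i x) (Q i y)"
    and V_Plus: "i \<in> I \<Longrightarrow> f \<in> hom S x y \<Longrightarrow> g \<in> hom S x y \<Longrightarrow>
        V i (f \<oplus>\<^bsub>S\<^esub> g) = V i f \<oplus>\<^bsub>A i\<^esub> V i g"
    and V_Scale: "i \<in> I \<Longrightarrow> f \<in> hom S x y \<Longrightarrow> V i (Scale S r f) = Scale (A i) r (V i f)"
    and faithful: "f \<in> hom S x y \<Longrightarrow> g \<in> hom S x y \<Longrightarrow> (\<And>i. i \<in> I \<Longrightarrow> V i f = V i g) \<Longrightarrow> f = g"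
    and has_zero: "\<exists>z\<in>Ob S. \<forall>i\<in>I. zero_object (A i) (Q i z)"
    and has_biproduct: "x \<in> Ob S \<Longrightarrow> y \<in> Ob S \<Longrightarrow> \<exists>s i1 i2 p1 p2. s \<in> Ob S \<and>
        i1 \<in> hom S x s \<and> i2 \<in> hom S y s \<and> p1 \<in> hom S s x \<and> p2 \<in> hom S s y \<and>
        (\<forall>i\<in>I. is_biproduct (A i) (Q i x) (Q i y) (Q i s) (V i i1) (V i i2) (V i p1) (V i p2))"
    and has_kernel: "f \<in> Ar S \<Longrightarrow>
        \<exists>k\<in>Ar S. Cod S k = Dom S f \<and> (\<forall>i\<in>I. is_kernel (A i) (V i k) (V i f))"
    and has_cokernel: "f \<in> Ar S \<Longrightarrow>
        \<exists>q\<in>Ar S. Dom S q = Cod S f \<and> (\<forall>i\<in>I. is_cokernel (A i) (V i q) (V i f))"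
    and has_lift: "m \<in> Ar S \<Longrightarrow> h \<in> Ar S \<Longrightarrow> Cod S h = Cod S m \<Longrightarrow>
        (\<And>i. i \<in> I \<Longrightarrow> monic (A i) (V i m) \<and> factors (A i) (V i h) (V i m)) \<Longrightarrow>
        \<exists>u\<in>hom S (Dom S h) (Dom S m). m \<cdot>\<^bsub>S\<^esub> u = h"
    and has_extension: "e \<in> Ar S \<Longrightarrow> h \<in> Ar S \<Longrightarrow> Dom S h = Dom S e \<Longrightarrow>
        (\<And>i. i \<in> I \<Longrightarrow> epic (A i) (V i e) \<and> factors (dual (A i)) (V i h) (V i e)) \<Longrightarrow>
        \<exists>u\<in>hom S (Cod S e) (Cod S h). u \<cdot>\<^bsub>S\<^esub> e = h"
begin

lemma ac: "i \<in> I \<Longrightarrow> abelian_category (A i)"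
  "i \<in> I \<Longrightarrow> linear_category (A i)" "i \<in> I \<Longrightarrow> category (A i)"
  using fam_abelian[of i] by (auto simp: abelian_category_def linear_category_def)

lemma V_simps [simp]:
  assumes "i \<in> I" "f \<in> Ar S"
  shows "V i f \<in> Ar (A i)" "Dom (A i) (V i f) = Q i (Dom S f)" "Cod (A i) (V i f) = Q i (Cod S f)"
  using V_hom[of i f "Dom S f" "Cod S f"] assms by (auto simp: hom_iff)

lemma Q_simps [simp]: "i \<in> I \<Longrightarrow> x \<in> Ob S \<Longrightarrow> Q i x \<in> Ob (A i)"
  by (rule Q_Ob)

lemma V_Comp:
  "i \<in> I \<Longrightarrow> f \<in> Ar S \<Longrightarrow> g \<in> Ar S \<Longrightarrow> Dom S g = Cod S f \<Longrightarrow> V i (g \<cdot>\<^bsub>S\<^esub> f) = V i g \<cdot>\<^bsub>A i\<^esub> V i f"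
  using V_comp[of i f "Dom S f" "Cod S f" g "Cod S g"] by (simp add: hom_iff)

text \<open>Not even associativity and the unit laws are assumed of \<open>S\<close>. Like every law
  below, they hold because they hold in all projections.\<close>

lemma category_S: "category S"
proof unfold_locales
  show "Dom S f \<in> Ob S" "Cod S f \<in> Ob S" if "f \<in> Ar S" for f
    using S_DC that by blast+
  show "Id S x \<in> hom S x x" if "x \<in> Ob S" for x by (rule S_Id[OF that])
  show "g \<cdot>\<^bsub>S\<^esub> f \<in> hom S x z" if "f \<in> hom S x y" "g \<in> hom S y z" for f g x y z
    by (rule S_comp[OF that])
  fix f g h w x y z
  assume *: "f \<in> hom S w x" "g \<in> hom S x y" "h \<in> hom S y z"
  show "(h \<cdot>\<^bsub>S\<^esub> g) \<cdot>\<^bsub>S\<^esub> f = h \<cdot>\<^bsub>S\<^esub> (g \<cdot>\<^bsub>S\<^esub> f)"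
  proof (rule faithful)
    fix i assume i: "i \<in> I"
    interpret A: category "A i" by (rule ac[OF i])
    show "V i ((h \<cdot>\<^bsub>S\<^esub> g) \<cdot>\<^bsub>S\<^esub> f) = V i (h \<cdot>\<^bsub>S\<^esub> (g \<cdot>\<^bsub>S\<^esub> f))"
      using V_comp[OF i *(1) S_comp[OF *(2,3)]] V_comp[OF i S_comp[OF *(1,2)] *(3)]
        V_comp[OF i *(1,2)] V_comp[OF i *(2,3)] *
      by (simp add: hom_iff i)
  qed (use * in \<open>blast intro: S_comp\<close>)+
next
  fix f x y assume f: "f \<in> hom S x y"
  then have xy: "x \<in> Ob S" "y \<in> Ob S" using S_DC by (auto simp: hom_iff)
  show "Id S y \<cdot>\<^bsub>S\<^esub> f = f"
  proof (rule faithful)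
    fix i assume i: "i \<in> I"
    interpret A: category "A i" by (rule ac[OF i])
    show "V i (Id S y \<cdot>\<^bsub>S\<^esub> f) = V i f"
      using V_comp[OF i f S_Id[OF xy(2)]] f i xy by (simp add: V_Id hom_iff)
  qed (use f xy in \<open>blast intro: S_comp S_Id\<close>)+
  show "f \<cdot>\<^bsub>S\<^esub> Id S x = f"
  proof (rule faithful)
    fix i assume i: "i \<in> I"
    interpret A: category "A i" by (rule ac[OF i])
    show "V i (f \<cdot>\<^bsub>S\<^esub> Id S x) = V i f"
      using V_comp[OF i S_Id[OF xy(1)] f] f i xy by (simp add: V_Id hom_iff)
  qed (use f xy in \<open>blast intro: S_comp S_Id\<close>)+
qed

sublocale S: category S by (rule category_S)

lemma S_simps [simp]:
  "x \<in> Ob S \<Longrightarrow> y \<in> Ob S \<Longrightarrow>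
    Null S x y \<in> Ar S \<and> Dom S (Null S x y) = x \<and> Cod S (Null S x y) = y"
  "f \<in> Ar S \<Longrightarrow> g \<in> Ar S \<Longrightarrow> Dom S g = Dom S f \<Longrightarrow> Cod S g = Cod S f \<Longrightarrow>
    f \<oplus>\<^bsub>S\<^esub> g \<in> Ar S \<and> Dom S (f \<oplus>\<^bsub>S\<^esub> g) = Dom S f \<and> Cod S (f \<oplus>\<^bsub>S\<^esub> g) = Cod S f"
  "f \<in> Ar S \<Longrightarrow> Scale S r f \<in> Ar S \<and> Dom S (Scale S r f) = Dom S f \<and> Cod S (Scale S r f) = Cod S f"
  using S_Null[of x y] S_Plus[of f "Dom S f" "Cod S f" g] S_Scale[of f "Dom S f" "Cod S f" r]
  by (auto simp: hom_iff)

lemma V_ops [simp]: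
  "i \<in> I \<Longrightarrow> x \<in> Ob S \<Longrightarrow> V i (Id S x) = Id (A i) (Q i x)"
  "i \<in> I \<Longrightarrow> x \<in> Ob S \<Longrightarrow> y \<in> Ob S \<Longrightarrow> V i (Null S x y) = Null (A i) (Q i x) (Q i y)"
  "i \<in> I \<Longrightarrow> f \<in> Ar S \<Longrightarrow> g \<in> Ar S \<Longrightarrow> Dom S g = Dom S f \<Longrightarrow> Cod S g = Cod S f \<Longrightarrow>
    V i (f \<oplus>\<^bsub>S\<^esub> g) = V i f \<oplus>\<^bsub>A i\<^esub> V i g"
  "i \<in> I \<Longrightarrow> f \<in> Ar S \<Longrightarrow> V i (Scale S r f) = Scale (A i) r (V i f)"
  by (auto intro: V_Id V_Null V_Plus V_Scale simp: hom_iff)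

lemma eqI:
  "f \<in> Ar S \<Longrightarrow> g \<in> Ar S \<Longrightarrow> Dom S g = Dom S f \<Longrightarrow> Cod S g = Cod S f \<Longrightarrow>
    (\<And>i. i \<in> I \<Longrightarrow> V i f = V i g) \<Longrightarrow> f = g"
  by (rule faithful) (auto simp: hom_iff)

lemma linear_category_S: "linear_category S"
proof unfold_locales
  fix f g h x y assume "f \<in> hom S x y" "g \<in> hom S x y" "h \<in> hom S x y"
  then show "(f \<oplus>\<^bsub>S\<^esub> g) \<oplus>\<^bsub>S\<^esub> h = f \<oplus>\<^bsub>S\<^esub> (g \<oplus>\<^bsub>S\<^esub> h)"
    by (intro eqI) (auto simp: hom_iff linear_category.Plus_ass[OF ac(2)])
next
  fix f g x y assume "f \<in> hom S x y" "g \<in> hom S x y"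
  then show "f \<oplus>\<^bsub>S\<^esub> g = g \<oplus>\<^bsub>S\<^esub> f"
    by (intro eqI) (auto simp: hom_iff intro!: linear_category.Plus_comm[OF ac(2)])
next
  fix f x y assume "f \<in> hom S x y"
  then show "f \<oplus>\<^bsub>S\<^esub> Null S x y = f"
    by (intro eqI) (auto simp: hom_iff linear_category.Plus_Null_right[OF ac(2)])
next
  fix f x y assume "f \<in> hom S x y"
  then show "f \<oplus>\<^bsub>S\<^esub> Scale S (-1) f = Null S x y"
    by (intro eqI) (auto simp: hom_iff linear_category.Plus_Scale_neg[OF ac(2)])
next
  fix f x y assume "f \<in> hom S x y"
  then show "Scale S 1 f = f"
    by (intro eqI) (auto simp: hom_iff linear_category.Scale_1[OF ac(2)])
next
  fix f x y r s assume "f \<in> hom S x y"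
  then show "Scale S (r * s) f = Scale S r (Scale S s f)"
    by (intro eqI) (auto simp: hom_iff linear_category.Scale_Scale[OF ac(2)])
next
  fix f x y r s assume "f \<in> hom S x y"
  then show "Scale S (r + s) f = Scale S r f \<oplus>\<^bsub>S\<^esub> Scale S s f"
    by (intro eqI) (auto simp: hom_iff intro!: linear_category.Scale_add[OF ac(2)])
next
  fix f g x y r assume "f \<in> hom S x y" "g \<in> hom S x y"
  then show "Scale S r (f \<oplus>\<^bsub>S\<^esub> g) = Scale S r f \<oplus>\<^bsub>S\<^esub> Scale S r g"
    by (intro eqI) (auto simp: hom_iff intro!: linear_category.Scale_Plus[OF ac(2)])
next
  fix f f' g x y z assume "f \<in> hom S x y" "f' \<in> hom S x y" "g \<in> hom S y z"
  then show "g \<cdot>\<^bsub>S\<^esub> (f \<oplus>\<^bsub>S\<^esub> f') = (g \<cdot>\<^bsub>S\<^esub> f) \<oplus>\<^bsub>S\<^esub> (g \<cdot>\<^bsub>S\<^esub> f')"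
    by (intro eqI) (auto simp: hom_iff V_Comp intro!: linear_category.comp_Plus[OF ac(2)])
next
  fix f g g' x y z assume "f \<in> hom S x y" "g \<in> hom S y z" "g' \<in> hom S y z"
  then show "(g \<oplus>\<^bsub>S\<^esub> g') \<cdot>\<^bsub>S\<^esub> f = (g \<cdot>\<^bsub>S\<^esub> f) \<oplus>\<^bsub>S\<^esub> (g' \<cdot>\<^bsub>S\<^esub> f)"
    by (intro eqI) (auto simp: hom_iff V_Comp intro!: linear_category.Plus_comp[OF ac(2)])
next
  fix f g x y z r assume "f \<in> hom S x y" "g \<in> hom S y z"
  then show "g \<cdot>\<^bsub>S\<^esub> Scale S r f = Scale S r (g \<cdot>\<^bsub>S\<^esub> f)" "Scale S r g \<cdot>\<^bsub>S\<^esub> f = Scale S r (g \<cdot>\<^bsub>S\<^esub> f)"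
    by (intro eqI; auto simp: hom_iff V_Comp linear_category.comp_Scale[OF ac(2)]
        linear_category.Scale_comp[OF ac(2)])+
qed (rule S_Null S_Plus S_Scale; assumption)+

sublocale S: linear_category S by (rule linear_category_S)

lemma reflect_monic:
  assumes "m \<in> Ar S" "\<And>i. i \<in> I \<Longrightarrow> monic (A i) (V i m)"
  shows "monic S m"
  unfolding monic_def
proof (intro conjI ballI impI)
  fix g h assume *: "g \<in> Ar S" "h \<in> Ar S" "Cod S g = Dom S m \<and> Cod S h = Dom S m \<and>
    Dom S g = Dom S h \<and> m \<cdot>\<^bsub>S\<^esub> g = m \<cdot>\<^bsub>S\<^esub> h"
  show "g = h"
  proof (rule eqI)
    fix i assume i: "i \<in> I"
    have "V i m \<cdot>\<^bsub>A i\<^esub> V i g = V i m \<cdot>\<^bsub>A i\<^esub> V i h"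
      using V_Comp[OF i, of g m] V_Comp[OF i, of h m] * assms(1) by simp
    then show "V i g = V i h"
      by (rule category.monic_cancel[OF ac(3)[OF i] assms(2)[OF i]]) (use * assms(1) i in auto)
  qed (use * in auto)
qed fact

text \<open>A test arrow factors through the kernel in each component separately;
  \<open>has_lift\<close> combines these factorisations into one arrow of \<open>S\<close>.\<close>

lemma reflect_kernel:
  assumes "k \<in> Ar S" "f \<in> Ar S" "Cod S k = Dom S f" "\<And>i. i \<in> I \<Longrightarrow> is_kernel (A i) (V i k) (V i f)"
  shows "is_kernel S k f"
proof (rule S.is_kernelI)
  have m: "monic (A i) (V i k)" if "i \<in> I" for i
    using linear_category.kernel_monic[OF ac(2)] assms that by blast
  show "monic S k" by (rule reflect_monic) (use assms m in auto)
  show "f \<in> Ar S" "Cod S k = Dom S f" by fact+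
  show "f \<cdot>\<^bsub>S\<^esub> k = Null S (Dom S k) (Cod S f)"
    by (rule eqI) (use assms linear_category.kernel_simps(4)[OF ac(2) assms(4)] in \<open>auto simp: V_Comp\<close>)
  fix h assume h: "h \<in> Ar S" "Cod S h = Dom S f" "f \<cdot>\<^bsub>S\<^esub> h = Null S (Dom S h) (Cod S f)"
  have "factors (A i) (V i h) (V i k)" if i: "i \<in> I" for i
  proof -
    have "V i f \<cdot>\<^bsub>A i\<^esub> V i h = Null (A i) (Dom (A i) (V i h)) (Cod (A i) (V i f))"
      using V_Comp[OF i h(1) assms(2)] i h(1,2) assms(2) unfolding h(3) by simp
    then obtain u where "u \<in> Ar (A i)" "Dom (A i) u = Dom (A i) (V i h)"
      "Cod (A i) u = Dom (A i) (V i k)" "V i k \<cdot>\<^bsub>A i\<^esub> u = V i h"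
      using linear_category.kernel_lift[OF ac(2)[OF i] assms(4)[OF i], of "V i h"] i h assms by auto
    then show ?thesis by (auto simp: factors_def hom_iff)
  qed
  then have "\<exists>u\<in>hom S (Dom S h) (Dom S k). k \<cdot>\<^bsub>S\<^esub> u = h"
    by (intro has_lift) (use assms h m in auto)
  then show "\<exists>u. u \<in> Ar S \<and> Dom S u = Dom S h \<and> Cod S u = Dom S k \<and> k \<cdot>\<^bsub>S\<^esub> u = h"
    by (auto simp: hom_iff)
qed

text \<open>A right inverse is a lift of an identity through \<open>f\<close>, available because
  isomorphisms are monic. It is a left inverse too, since each component of \<open>f\<close> can be
  cancelled. So inverses need no closure condition of their own.\<close>

lemma reflect_iso:
  assumes "f \<in> Ar S" "\<And>i. i \<in> I \<Longrightarrow> iso_arrow (A i) (V i f)"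
  shows "iso_arrow S f"
proof -
  have "\<exists>u\<in>hom S (Dom S (Id S (Cod S f))) (Dom S f). f \<cdot>\<^bsub>S\<^esub> u = Id S (Cod S f)"
  proof (rule has_lift)
    fix i assume i: "i \<in> I"
    interpret A: category "A i" by (rule ac[OF i])
    show "monic (A i) (V i f) \<and> factors (A i) (V i (Id S (Cod S f))) (V i f)"
      using assms i A.iso_monic
      by (auto simp: factors_def hom_iff intro!: exI[of _ "inv_arrow (A i) (V i f)"])
  qed (use assms in auto)
  then obtain u where u: "u \<in> Ar S" "Dom S u = Cod S f" "Cod S u = Dom S f" "f \<cdot>\<^bsub>S\<^esub> u = Id S (Cod S f)"
    using assms by (auto simp: hom_iff)
  have "u \<cdot>\<^bsub>S\<^esub> f = Id S (Dom S f)"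
  proof (rule eqI)
    fix i assume i: "i \<in> I"
    interpret A: category "A i" by (rule ac[OF i])
    have fu: "V i f \<cdot>\<^bsub>A i\<^esub> V i u = Id (A i) (Q i (Cod S f))"
      using V_Comp[OF i, of u f] u assms i by simp
    have "V i f \<cdot>\<^bsub>A i\<^esub> (V i u \<cdot>\<^bsub>A i\<^esub> V i f) = V i f \<cdot>\<^bsub>A i\<^esub> Id (A i) (Q i (Dom S f))"
      using A.comp_extend1[OF fu, of "V i f"] u assms i by simp
    then have "V i u \<cdot>\<^bsub>A i\<^esub> V i f = Id (A i) (Q i (Dom S f))"
      by (rule A.monic_cancel[OF A.iso_monic[OF assms(2)[OF i]]]) (use u assms i in auto)
    then show "V i (u \<cdot>\<^bsub>S\<^esub> f) = V i (Id S (Dom S f))" using u assms i by (simp add: V_Comp)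
  qed (use u assms in auto)
  then show ?thesis using u assms S.iso_arrowI(1)[of f u] by auto
qed

lemma reflect_zero:
  assumes "z \<in> Ob S" "\<And>i. i \<in> I \<Longrightarrow> zero_object (A i) (Q i z)"
  shows "zero_object S z"
proof -
  have "Id S z = Null S z z"
    by (rule eqI) (use assms linear_category.zero_object_iff[OF ac(2)] in auto)
  then show ?thesis using assms by (simp add: S.zero_object_iff)
qed

lemma V_iso:
  assumes "iso_arrow S f" "i \<in> I"
  shows "iso_arrow (A i) (V i f)" "inv_arrow (A i) (V i f) = V i (inv_arrow S f)"
proof -
  interpret A: category "A i" by (rule ac[OF assms(2)])
  note f = S.iso_Ar[OF assms(1)]
  show "iso_arrow (A i) (V i f)" "inv_arrow (A i) (V i f) = V i (inv_arrow S f)"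
    using A.iso_arrowI[of "V i f" "V i (inv_arrow S f)"] f assms by (simp_all flip: V_Comp)
qed

text \<open>\<open>has_kernel\<close> provides one kernel whose projections are kernels. Any other
  kernel differs from it by an isomorphism, and projections preserve isomorphisms.\<close>

lemma V_kernel:
  assumes "is_kernel S k f" "i \<in> I"
  shows "is_kernel (A i) (V i k) (V i f)"
proof -
  note k = S.kernel_simps[OF assms(1)]
  obtain k' where k': "k' \<in> Ar S" "Cod S k' = Dom S f" "\<And>i. i \<in> I \<Longrightarrow> is_kernel (A i) (V i k') (V i f)"
    using has_kernel[OF k(2)] by blast
  have "is_kernel S k' f" by (rule reflect_kernel) (use k k' in auto)
  then obtain \<theta> where \<theta>: "iso_arrow S \<theta>" "Dom S \<theta> = Dom S k" "Cod S \<theta> = Dom S k'" "k = k' \<cdot>\<^bsub>S\<^esub> \<theta>"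
    using S.kernel_unique assms(1) by metis
  have "is_kernel (A i) (V i k' \<cdot>\<^bsub>A i\<^esub> V i \<theta>) (V i f)"
    by (rule linear_category.kernel_comp_iso[OF ac(2)])
      (use \<theta> k' assms V_iso S.iso_Ar[OF \<theta>(1)] in auto)
  then show ?thesis using \<theta> k' assms S.iso_Ar[OF \<theta>(1)] by (simp add: V_Comp)
qed

text \<open>Faithful functors need not preserve monics. Here the kernel of a monic vanishes, it
  projects to kernels of the components, and these vanish with it.\<close>

lemma V_monic:
  assumes "monic S m" "i \<in> I"
  shows "monic (A i) (V i m)"
proof -
  note m = S.monic_Ar[OF assms(1)]
  obtain k where k: "k \<in> Ar S" "Cod S k = Dom S m" "\<And>i. i \<in> I \<Longrightarrow> is_kernel (A i) (V i k) (V i m)"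
    using has_kernel[OF m] by blast
  have "is_kernel S k m" by (rule reflect_kernel) (use k m in auto)
  then have "k = Null S (Dom S k) (Dom S m)" using S.monic_iff_kernel_Null assms(1) by blast
  then have "V i k = V i (Null S (Dom S k) (Dom S m))" by (rule arg_cong)
  then have "V i k = Null (A i) (Q i (Dom S k)) (Q i (Dom S m))"
    using k(1) m V_ops(2)[OF assms(2), of "Dom S k" "Dom S m"] by (metis S.Dom_Ob)
  then show ?thesis
    unfolding linear_category.monic_iff_kernel_Null[OF ac(2)[OF assms(2)] k(3)[OF assms(2)]]
      V_simps(2)[OF assms(2) k(1)] V_simps(2)[OF assms(2) m] .
qed

text \<open>The components of a monic are monic, hence kernels of their cokernels; and these
  cokernels are the components of one arrow of \<open>S\<close>.\<close>

lemma normal_monic: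
  assumes "monic S m"
  shows "\<exists>g. is_kernel S m g"
proof -
  note m = S.monic_Ar[OF assms(1)]
  obtain q where q: "q \<in> Ar S" "Dom S q = Cod S m" "\<And>i. i \<in> I \<Longrightarrow> is_cokernel (A i) (V i q) (V i m)"
    using has_cokernel[OF m] by blast
  have "is_kernel S m q"
    by (rule reflect_kernel)
      (use q m V_monic[OF assms] abelian_category.monic_kernel_of_cokernel[OF ac(1)] in auto)
  then show ?thesis ..
qed

text \<open>The hypotheses are arranged to be self-dual, with lifts against extensions and kernels
  against cokernels, so that each preservation or reflection result yields its dual.\<close>

lemma joint_abelian_dual: "joint_abelian (dual S) I (\<lambda>i. dual (A i)) Q V"
proof (rule joint_abelian.intro)
  show "\<exists>s i1 i2 p1 p2. s \<in> Ob (dual S) \<and>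
        i1 \<in> hom (dual S) x s \<and> i2 \<in> hom (dual S) y s \<and> p1 \<in> hom (dual S) s x \<and> p2 \<in> hom (dual S) s y \<and>
        (\<forall>i\<in>I. is_biproduct (dual (A i)) (Q i x) (Q i y) (Q i s) (V i i1) (V i i2) (V i p1) (V i p2))"
    if xy: "x \<in> Ob (dual S)" "y \<in> Ob (dual S)" for x y
  proof -
    obtain s i1 i2 p1 p2 where "s \<in> Ob S \<and>
        i1 \<in> hom S x s \<and> i2 \<in> hom S y s \<and> p1 \<in> hom S s x \<and> p2 \<in> hom S s y \<and>
        (\<forall>i\<in>I. is_biproduct (A i) (Q i x) (Q i y) (Q i s) (V i i1) (V i i2) (V i p1) (V i p2))"
      using has_biproduct[of x y, OF xy[unfolded dual_simps]] by (elim exE)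
    then show ?thesis by (intro exI[of _ s] exI[of _ p1] exI[of _ p2] exI[of _ i1] exI[of _ i2]) simp
  qed
  show "\<exists>u\<in>hom (dual S) (Dom (dual S) h) (Dom (dual S) m). m \<cdot>\<^bsub>dual S\<^esub> u = h"
    if "m \<in> Ar (dual S)" "h \<in> Ar (dual S)" "Cod (dual S) h = Cod (dual S) m"
      "\<And>i. i \<in> I \<Longrightarrow> monic (dual (A i)) (V i m) \<and> factors (dual (A i)) (V i h) (V i m)" for m h
    using has_extension[of m h] that by simp
  show "\<exists>u\<in>hom (dual S) (Cod (dual S) e) (Cod (dual S) h). u \<cdot>\<^bsub>dual S\<^esub> e = h"
    if "e \<in> Ar (dual S)" "h \<in> Ar (dual S)" "Dom (dual S) h = Dom (dual S) e"
      "\<And>i. i \<in> I \<Longrightarrow> epic (dual (A i)) (V i e) \<and> factors (dual (dual (A i))) (V i h) (V i e)" for e h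
    using has_lift[of e h] that by simp
  show "abelian_category (dual (A i))" if "i \<in> I" for i
    using abelian_category.abelian_category_dual ac(1)[OF that] by blast
  show "f = g" if "f \<in> hom (dual S) x y" "g \<in> hom (dual S) x y" "\<And>i. i \<in> I \<Longrightarrow> V i f = V i g" for f g x y
    by (rule faithful) (use that in auto)
qed (use has_zero has_kernel has_cokernel in \<open>simp_all add: hom_iff V_Comp\<close>)

lemma abelian_category_S: "abelian_category S"
proof -
  interpret D: joint_abelian "dual S" I "\<lambda>i. dual (A i)" Q V by (rule joint_abelian_dual)
  show ?thesis
  proof unfold_locales
    show "\<exists>z. zero_object S z" using has_zero reflect_zero by blast
    show "\<exists>s i1 i2 p1 p2. is_biproduct S x y s i1 i2 p1 p2" if xy: "x \<in> Ob S" "y \<in> Ob S" for x y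
    proof -
      obtain s i1 i2 p1 p2 where s: "s \<in> Ob S" "i1 \<in> hom S x s" "i2 \<in> hom S y s"
          "p1 \<in> hom S s x" "p2 \<in> hom S s y" and b: "\<And>i. i \<in> I \<Longrightarrow>
          is_biproduct (A i) (Q i x) (Q i y) (Q i s) (V i i1) (V i i2) (V i p1) (V i p2)"
        using has_biproduct[OF xy] by blast
      have "p1 \<cdot>\<^bsub>S\<^esub> i1 = Id S x" "p2 \<cdot>\<^bsub>S\<^esub> i2 = Id S y" "p2 \<cdot>\<^bsub>S\<^esub> i1 = Null S x y"
        "p1 \<cdot>\<^bsub>S\<^esub> i2 = Null S y x" "(i1 \<cdot>\<^bsub>S\<^esub> p1) \<oplus>\<^bsub>S\<^esub> (i2 \<cdot>\<^bsub>S\<^esub> p2) = Id S s"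
        by (rule eqI; use s b xy in \<open>auto simp: is_biproduct_def hom_iff V_Comp\<close>)+
      then have "is_biproduct S x y s i1 i2 p1 p2" using s by (simp add: is_biproduct_def)
      then show ?thesis by blast
    qed
    show "\<exists>k. is_kernel S k f" if "f \<in> Ar S" for f
      using has_kernel[OF that] reflect_kernel that by blast
    show "\<exists>k. is_cokernel S k f" if "f \<in> Ar S" for f
      using D.has_kernel[of f] D.reflect_kernel[of _ f] that by auto
    show "\<exists>g. is_kernel S f g" if "monic S f" for f by (rule normal_monic[OF that])
    show "\<exists>g. is_cokernel S f g" if "epic S f" for f using D.normal_monic[of f] that by simp
  qed
qed

sublocale S: abelian_category S by (rule abelian_category_S)

lemma V_cokernel: "is_cokernel S q f \<Longrightarrow> i \<in> I \<Longrightarrow> is_cokernel (A i) (V i q) (V i f)"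
  using joint_abelian.V_kernel[OF joint_abelian_dual, of q f i] by simp

lemma reflect_cokernel:
  "q \<in> Ar S \<Longrightarrow> f \<in> Ar S \<Longrightarrow> Dom S q = Cod S f \<Longrightarrow>
    (\<And>i. i \<in> I \<Longrightarrow> is_cokernel (A i) (V i q) (V i f)) \<Longrightarrow> is_cokernel S q f"
  using joint_abelian.reflect_kernel[OF joint_abelian_dual, of q f] by simp

lemma reflect_epic: "m \<in> Ar S \<Longrightarrow> (\<And>i. i \<in> I \<Longrightarrow> epic (A i) (V i m)) \<Longrightarrow> epic S m"
  using joint_abelian.reflect_monic[OF joint_abelian_dual, of m] by simp

lemma V_short_exact: "short_exact S f g \<Longrightarrow> i \<in> I \<Longrightarrow> short_exact (A i) (V i f) (V i g)"
  by (simp add: short_exact_def V_kernel V_cokernel)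

lemma reflect_short_exact:
  "f \<in> Ar S \<Longrightarrow> g \<in> Ar S \<Longrightarrow> Dom S g = Cod S f \<Longrightarrow>
    (\<And>i. i \<in> I \<Longrightarrow> short_exact (A i) (V i f) (V i g)) \<Longrightarrow> short_exact S f g"
  by (simp add: short_exact_def reflect_kernel reflect_cokernel)

text \<open>The epi-mono factorisations given in the components need not come from \<open>S\<close>.
  They are compared with a kernel \<open>k\<close> of \<open>g\<close> in \<open>S\<close>: the
  monic part of each differs from the projection of \<open>k\<close> by an isomorphism, so the lift
  of \<open>f\<close> through \<open>k\<close> has epic components.\<close>

lemma reflect_exact_at:
  assumes fg: "f \<in> Ar S" "g \<in> Ar S" "Dom S g = Cod S f"
    and e: "\<And>i. i \<in> I \<Longrightarrow> exact_at (A i) (V i f) (V i g)"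
  shows "exact_at S f g"
proof -
  obtain k where k: "is_kernel S k g" using S.ex_kernel fg by blast
  note k' = S.kernel_simps[OF k]
  \<comment> \<open>Vanishing of the composite is an equation, so it can be read off from the
    components; only then does \<open>f\<close> lift through \<open>k\<close>.\<close>
  have "g \<cdot>\<^bsub>S\<^esub> f = Null S (Dom S f) (Cod S g)"
  proof (rule eqI)
    fix i assume i: "i \<in> I"
    interpret A: linear_category "A i" by (rule ac[OF i])
    obtain k e where ke: "is_kernel (A i) k (V i g)" "epic (A i) e" "Cod (A i) e = Dom (A i) k"
      "V i f = k \<cdot>\<^bsub>A i\<^esub> e"
      using e[OF i] unfolding exact_at_def by blast
    note k' = A.kernel_simps[OF ke(1)] and e' = A.epic_Ar[OF ke(2)]
    have "Dom (A i) e = Q i (Dom S f)" using V_simps(2)[OF i fg(1)] ke k' e' by simp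
    then have "V i g \<cdot>\<^bsub>A i\<^esub> V i f = Null (A i) (Q i (Dom S f)) (Q i (Cod S g))"
      using A.comp_extend1[OF k'(4), of e] ke k' e' i fg by simp
    then show "V i (g \<cdot>\<^bsub>S\<^esub> f) = V i (Null S (Dom S f) (Cod S g))" using i fg by (simp add: V_Comp)
  qed (use fg in auto)
  then obtain u where u: "u \<in> Ar S" "Dom S u = Dom S f" "Cod S u = Dom S k" "k \<cdot>\<^bsub>S\<^esub> u = f"
    using S.kernel_lift[OF k fg(1)] fg by auto
  have "epic S u"
  proof (rule reflect_epic[OF u(1)])
    fix i assume i: "i \<in> I"
    interpret A: linear_category "A i" by (rule ac[OF i])
    obtain k1 e where ke: "is_kernel (A i) k1 (V i g)" "epic (A i) e" "Cod (A i) e = Dom (A i) k1"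
      "V i f = k1 \<cdot>\<^bsub>A i\<^esub> e"
      using e[OF i] unfolding exact_at_def by blast
    note k1 = A.kernel_simps[OF ke(1)] and e' = A.epic_Ar[OF ke(2)]
    note Vk = V_kernel[OF k i]
    obtain \<theta> where \<theta>: "iso_arrow (A i) \<theta>" "Dom (A i) \<theta> = Dom (A i) k1"
      "Cod (A i) \<theta> = Dom (A i) (V i k)" "k1 = V i k \<cdot>\<^bsub>A i\<^esub> \<theta>"
      using A.kernel_unique[OF Vk ke(1)] by metis
    note \<theta>' = A.iso_Ar[OF \<theta>(1)]
    have de: "Dom (A i) e = Q i (Dom S f)"
      using V_simps(2)[OF i fg(1)] ke(3) k1(1) e' unfolding ke(4) by simp
    have "V i k \<cdot>\<^bsub>A i\<^esub> V i u = V i f"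
      using V_Comp[OF i u(1) k'(1)] u(3,4) by simp
    also have "\<dots> = V i k \<cdot>\<^bsub>A i\<^esub> (\<theta> \<cdot>\<^bsub>A i\<^esub> e)"
      unfolding ke(4) \<theta>(4) by (rule A.assoc) (use \<theta>(2,3) \<theta>' e' ke(3) i k'(1) in auto)
    finally have "V i k \<cdot>\<^bsub>A i\<^esub> V i u = V i k \<cdot>\<^bsub>A i\<^esub> (\<theta> \<cdot>\<^bsub>A i\<^esub> e)" .
    then have "V i u = \<theta> \<cdot>\<^bsub>A i\<^esub> e"
      by (rule A.monic_cancel[OF A.kernel_monic[OF Vk]]) (use u(1-3) k'(1) \<theta>(2,3) \<theta>' e' ke(3) de i in auto)
    moreover have "epic (A i) (\<theta> \<cdot>\<^bsub>A i\<^esub> e)"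
    proof -
      interpret Ad: category "dual (A i)" using ac(3)[OF i] by blast
      show ?thesis
        using Ad.monic_comp[of \<theta> e] A.iso_epic[OF \<theta>(1)] ke \<theta> by simp
    qed
    ultimately show "epic (A i) (V i u)" by simp
  qed
  then show ?thesis unfolding exact_at_def using k u by metis
qed

end

sublocale exact_tensor_functor \<subseteq> ef: exact_functor A B F
  by unfold_locales (rule FA_Plus FA_Scale FA_exact; assumption)+

section \<open>Jointly faithful families of strict tensor functors\<close>

locale joint_tensor = joint_abelian S I A Q V
  for S :: "('o, 'a, 'z) ltcat_scheme" and I :: "'i set"
    and A :: "'i \<Rightarrow> ('p, 'b, 'w) ltcat_scheme" and Q :: "'i \<Rightarrow> 'o \<Rightarrow> 'p" and V :: "'i \<Rightarrow> 'a \<Rightarrow> 'b" +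
  assumes fam_tensor: "i \<in> I \<Longrightarrow> ex_tensor_category (A i)"
    and S_TO: "x \<in> Ob S \<Longrightarrow> y \<in> Ob S \<Longrightarrow> x \<otimes>\<^bsub>S\<^esub> y \<in> Ob S"
    and S_TA: "f \<in> hom S x x' \<Longrightarrow> g \<in> hom S y y' \<Longrightarrow> f \<odot>\<^bsub>S\<^esub> g \<in> hom S (x \<otimes>\<^bsub>S\<^esub> y) (x' \<otimes>\<^bsub>S\<^esub> y')"
    and S_One: "\<one>\<^bsub>S\<^esub> \<in> Ob S"
    and S_Assoc: "x \<in> Ob S \<Longrightarrow> y \<in> Ob S \<Longrightarrow> z \<in> Ob S \<Longrightarrow>
        Assoc S x y z \<in> hom S ((x \<otimes>\<^bsub>S\<^esub> y) \<otimes>\<^bsub>S\<^esub> z) (x \<otimes>\<^bsub>S\<^esub> (y \<otimes>\<^bsub>S\<^esub> z))"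
    and S_Lun: "x \<in> Ob S \<Longrightarrow> Lun S x \<in> hom S (\<one>\<^bsub>S\<^esub> \<otimes>\<^bsub>S\<^esub> x) x"
    and S_Run: "x \<in> Ob S \<Longrightarrow> Run S x \<in> hom S (x \<otimes>\<^bsub>S\<^esub> \<one>\<^bsub>S\<^esub>) x"
    and S_Sym: "x \<in> Ob S \<Longrightarrow> y \<in> Ob S \<Longrightarrow> Sym S x y \<in> hom S (x \<otimes>\<^bsub>S\<^esub> y) (y \<otimes>\<^bsub>S\<^esub> x)"
    and Q_TO: "i \<in> I \<Longrightarrow> x \<in> Ob S \<Longrightarrow> y \<in> Ob S \<Longrightarrow> Q i (x \<otimes>\<^bsub>S\<^esub> y) = Q i x \<otimes>\<^bsub>A i\<^esub> Q i y"
    and Q_One: "i \<in> I \<Longrightarrow> Q i \<one>\<^bsub>S\<^esub> = \<one>\<^bsub>A i\<^esub>"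
    and V_TA: "i \<in> I \<Longrightarrow> f \<in> Ar S \<Longrightarrow> g \<in> Ar S \<Longrightarrow> V i (f \<odot>\<^bsub>S\<^esub> g) = V i f \<odot>\<^bsub>A i\<^esub> V i g"
    and V_Assoc: "i \<in> I \<Longrightarrow> x \<in> Ob S \<Longrightarrow> y \<in> Ob S \<Longrightarrow> z \<in> Ob S \<Longrightarrow>
        V i (Assoc S x y z) = Assoc (A i) (Q i x) (Q i y) (Q i z)"
    and V_Lun: "i \<in> I \<Longrightarrow> x \<in> Ob S \<Longrightarrow> V i (Lun S x) = Lun (A i) (Q i x)"
    and V_Run: "i \<in> I \<Longrightarrow> x \<in> Ob S \<Longrightarrow> V i (Run S x) = Run (A i) (Q i x)"
    and V_Sym: "i \<in> I \<Longrightarrow> x \<in> Ob S \<Longrightarrow> y \<in> Ob S \<Longrightarrow>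
        V i (Sym S x y) = Sym (A i) (Q i x) (Q i y)"
begin

lemma tc: "i \<in> I \<Longrightarrow> tensor_category (A i)"
  using fam_tensor[of i] by (simp add: ex_tensor_category_def)

lemma ST_simps [simp]:
  "x \<in> Ob S \<Longrightarrow> y \<in> Ob S \<Longrightarrow> x \<otimes>\<^bsub>S\<^esub> y \<in> Ob S" "\<one>\<^bsub>S\<^esub> \<in> Ob S"
  "f \<in> Ar S \<Longrightarrow> g \<in> Ar S \<Longrightarrow> f \<odot>\<^bsub>S\<^esub> g \<in> Ar S \<and> Dom S (f \<odot>\<^bsub>S\<^esub> g) = Dom S f \<otimes>\<^bsub>S\<^esub> Dom S g \<and>
    Cod S (f \<odot>\<^bsub>S\<^esub> g) = Cod S f \<otimes>\<^bsub>S\<^esub> Cod S g"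
  "x \<in> Ob S \<Longrightarrow> y \<in> Ob S \<Longrightarrow> z \<in> Ob S \<Longrightarrow> Assoc S x y z \<in> Ar S \<and>
    Dom S (Assoc S x y z) = (x \<otimes>\<^bsub>S\<^esub> y) \<otimes>\<^bsub>S\<^esub> z \<and> Cod S (Assoc S x y z) = x \<otimes>\<^bsub>S\<^esub> (y \<otimes>\<^bsub>S\<^esub> z)"
  "x \<in> Ob S \<Longrightarrow> Lun S x \<in> Ar S \<and> Dom S (Lun S x) = \<one>\<^bsub>S\<^esub> \<otimes>\<^bsub>S\<^esub> x \<and> Cod S (Lun S x) = x"
  "x \<in> Ob S \<Longrightarrow> Run S x \<in> Ar S \<and> Dom S (Run S x) = x \<otimes>\<^bsub>S\<^esub> \<one>\<^bsub>S\<^esub> \<and> Cod S (Run S x) = x"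
  "x \<in> Ob S \<Longrightarrow> y \<in> Ob S \<Longrightarrow> Sym S x y \<in> Ar S \<and>
    Dom S (Sym S x y) = x \<otimes>\<^bsub>S\<^esub> y \<and> Cod S (Sym S x y) = y \<otimes>\<^bsub>S\<^esub> x"
  using S_TA[of f "Dom S f" "Cod S f" g "Dom S g" "Cod S g"] S_Assoc[of x y z] S_Lun[of x]
    S_Run[of x] S_Sym[of x y]
  by (auto simp: hom_iff S_TO S_One)

lemmas VT_simps [simp] = Q_TO Q_One V_TA V_Assoc V_Lun V_Run V_Sym

lemma tensor_category_S: "tensor_category S"
proof unfold_locales
  fix w x y z assume *: "x \<in> Ob S" "y \<in> Ob S" "z \<in> Ob S"
  show "iso_arrow S (Assoc S x y z)"
    by (rule reflect_iso) (use * in \<open>auto simp: tensor_category.Assoc_simps[OF tc]\<close>)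
  show "Assoc S y z x \<cdot>\<^bsub>S\<^esub> (Sym S x (y \<otimes>\<^bsub>S\<^esub> z) \<cdot>\<^bsub>S\<^esub> Assoc S x y z) =
      (Id S y \<odot>\<^bsub>S\<^esub> Sym S x z) \<cdot>\<^bsub>S\<^esub> (Assoc S y x z \<cdot>\<^bsub>S\<^esub> (Sym S x y \<odot>\<^bsub>S\<^esub> Id S z))"
    by (rule eqI) (use * in \<open>auto simp: V_Comp intro!: tensor_category.hexagon[OF tc]\<close>)
  assume w: "w \<in> Ob S"
  show "(Id S w \<odot>\<^bsub>S\<^esub> Assoc S x y z) \<cdot>\<^bsub>S\<^esub> (Assoc S w (x \<otimes>\<^bsub>S\<^esub> y) z \<cdot>\<^bsub>S\<^esub> (Assoc S w x y \<odot>\<^bsub>S\<^esub> Id S z)) =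
        Assoc S w x (y \<otimes>\<^bsub>S\<^esub> z) \<cdot>\<^bsub>S\<^esub> Assoc S (w \<otimes>\<^bsub>S\<^esub> x) y z"
    by (rule eqI) (use * w in \<open>auto simp: V_Comp intro!: tensor_category.pentagon[OF tc]\<close>)
next
  fix x y assume *: "x \<in> Ob S" "y \<in> Ob S"
  show "Id S x \<odot>\<^bsub>S\<^esub> Id S y = Id S (x \<otimes>\<^bsub>S\<^esub> y)"
    by (rule eqI) (use * in \<open>auto simp: tensor_category.TA_Id[OF tc]\<close>)
  show "Sym S y x \<cdot>\<^bsub>S\<^esub> Sym S x y = Id S (x \<otimes>\<^bsub>S\<^esub> y)"
    by (rule eqI) (use * in \<open>auto simp: V_Comp intro!: tensor_category.Sym_inv[OF tc]\<close>)
  show "(Id S x \<odot>\<^bsub>S\<^esub> Lun S y) \<cdot>\<^bsub>S\<^esub> Assoc S x \<one>\<^bsub>S\<^esub> y = Run S x \<odot>\<^bsub>S\<^esub> Id S y"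
    by (rule eqI) (use * in \<open>auto simp: V_Comp intro!: tensor_category.triangle[OF tc]\<close>)
  show "iso_arrow S (Lun S x)"
    by (rule reflect_iso) (use * in \<open>auto simp: tensor_category.Lun_simps[OF tc]\<close>)
  show "iso_arrow S (Run S x)"
    by (rule reflect_iso) (use * in \<open>auto simp: tensor_category.Run_simps[OF tc]\<close>)
next
  fix f g h f' g' x y z x' y' z' x'' y'' assume *: "f \<in> hom S x x'" "g \<in> hom S y y'"
  show "Sym S x' y' \<cdot>\<^bsub>S\<^esub> (f \<odot>\<^bsub>S\<^esub> g) = (g \<odot>\<^bsub>S\<^esub> f) \<cdot>\<^bsub>S\<^esub> Sym S x y"
    by (rule eqI) (use * in \<open>auto simp: hom_iff V_Comp intro!: tensor_category.Sym_nat[OF tc]\<close>)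
  { assume "h \<in> hom S z z'"
    then show "Assoc S x' y' z' \<cdot>\<^bsub>S\<^esub> ((f \<odot>\<^bsub>S\<^esub> g) \<odot>\<^bsub>S\<^esub> h) = (f \<odot>\<^bsub>S\<^esub> (g \<odot>\<^bsub>S\<^esub> h)) \<cdot>\<^bsub>S\<^esub> Assoc S x y z"
      by (intro eqI) (use * in \<open>auto simp: hom_iff V_Comp intro!: tensor_category.Assoc_nat[OF tc]\<close>) }
  { assume "f' \<in> hom S x' x''" "g' \<in> hom S y' y''"
    then show "(f' \<cdot>\<^bsub>S\<^esub> f) \<odot>\<^bsub>S\<^esub> (g' \<cdot>\<^bsub>S\<^esub> g) = (f' \<odot>\<^bsub>S\<^esub> g') \<cdot>\<^bsub>S\<^esub> (f \<odot>\<^bsub>S\<^esub> g)"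
      by (intro eqI) (use * in \<open>auto simp: hom_iff V_Comp intro!: tensor_category.TA_comp[OF tc]\<close>) }
  show "Lun S x' \<cdot>\<^bsub>S\<^esub> (Id S \<one>\<^bsub>S\<^esub> \<odot>\<^bsub>S\<^esub> f) = f \<cdot>\<^bsub>S\<^esub> Lun S x"
    by (intro eqI) (use * in \<open>auto simp: hom_iff V_Comp intro!: tensor_category.Lun_nat[OF tc]\<close>)
  show "Run S x' \<cdot>\<^bsub>S\<^esub> (f \<odot>\<^bsub>S\<^esub> Id S \<one>\<^bsub>S\<^esub>) = f \<cdot>\<^bsub>S\<^esub> Run S x"
    by (intro eqI) (use * in \<open>auto simp: hom_iff V_Comp intro!: tensor_category.Run_nat[OF tc]\<close>)
qed (rule S_TO S_TA S_One S_Assoc S_Lun S_Run S_Sym; assumption?)+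

sublocale S: tensor_category S by (rule tensor_category_S)

text \<open>For exactness of the tensor product, an arbitrary short exact sequence of
  \<open>S\<close> is projected, tensored in the components, and the result is reflected. So both
  preservation and reflection of short exact sequences are used.\<close>

lemma ex_tensor_category_S: "ex_tensor_category S"
proof unfold_locales
  fix f f' g x x' y y' r assume *: "f \<in> hom S x x'" "g \<in> hom S y y'"
  { assume "f' \<in> hom S x x'"
    then show "(f \<oplus>\<^bsub>S\<^esub> f') \<odot>\<^bsub>S\<^esub> g = (f \<odot>\<^bsub>S\<^esub> g) \<oplus>\<^bsub>S\<^esub> (f' \<odot>\<^bsub>S\<^esub> g)"
      by (intro eqI)
        (use * in \<open>auto simp: hom_iff intro!: ex_tensor_category.TA_Plus_left[OF fam_tensor]\<close>) }
  { assume "f' \<in> hom S y y'"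
    then show "f \<odot>\<^bsub>S\<^esub> (g \<oplus>\<^bsub>S\<^esub> f') = (f \<odot>\<^bsub>S\<^esub> g) \<oplus>\<^bsub>S\<^esub> (f \<odot>\<^bsub>S\<^esub> f')"
      by (intro eqI)
        (use * in \<open>auto simp: hom_iff intro!: ex_tensor_category.TA_Plus_right[OF fam_tensor]\<close>) }
  show "Scale S r f \<odot>\<^bsub>S\<^esub> g = Scale S r (f \<odot>\<^bsub>S\<^esub> g)"
    by (intro eqI)
      (use * in \<open>auto simp: hom_iff intro!: ex_tensor_category.TA_Scale_left[OF fam_tensor]\<close>)
  show "f \<odot>\<^bsub>S\<^esub> Scale S r g = Scale S r (f \<odot>\<^bsub>S\<^esub> g)"
    by (intro eqI)
      (use * in \<open>auto simp: hom_iff intro!: ex_tensor_category.TA_Scale_right[OF fam_tensor]\<close>)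
next
  fix x f g assume x: "x \<in> Ob S" and fg: "short_exact S f g"
  then have fg': "f \<in> Ar S" "g \<in> Ar S" "Cod S f = Dom S g"
    by (auto simp: short_exact_def is_kernel_def)
  show "short_exact S (Id S x \<odot>\<^bsub>S\<^esub> f) (Id S x \<odot>\<^bsub>S\<^esub> g)"
    by (rule reflect_short_exact)
      (use x fg' V_short_exact[OF fg] ex_tensor_category.tensor_exact_right[OF fam_tensor] in auto)
  show "short_exact S (f \<odot>\<^bsub>S\<^esub> Id S x) (g \<odot>\<^bsub>S\<^esub> Id S x)"
    by (rule reflect_short_exact)
      (use x fg' V_short_exact[OF fg] ex_tensor_category.tensor_exact_left[OF fam_tensor] in auto)
qed

sublocale S: ex_tensor_category S by (rule ex_tensor_category_S)

text \<open>The structure isomorphisms are identities because \<open>Q i\<close> is strict for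
  tensor products and the unit. Pushing a cohomology forward along \<open>proj i\<close> therefore
  inserts nothing into its external products and its unit.\<close>

definition proj :: "'i \<Rightarrow> ('o, 'a, 'p, 'b) tfunc" where
  "proj i = \<lparr>FO = (\<lambda>x\<in>Ob S. Q i x), FA = (\<lambda>f\<in>Ar S. V i f),
    Mult = (\<lambda>(x, y)\<in>Ob S \<times> Ob S. Id (A i) (Q i x \<otimes>\<^bsub>A i\<^esub> Q i y)), Unit = Id (A i) \<one>\<^bsub>A i\<^esub>\<rparr>"

lemma proj_exact_tensor_functor:
  assumes i: "i \<in> I"
  shows "exact_tensor_functor S (A i) (proj i)"
proof -
  interpret A: ex_tensor_category "A i" by (rule fam_tensor[OF i])
  show ?thesis
  proof unfold_locales
    show "Mult (proj i) \<in> extensional (Ob S \<times> Ob S)" by (auto simp: proj_def)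
    show "FO (proj i) \<in> extensional (Ob S)" "FA (proj i) \<in> extensional (Ar S)"
      by (simp_all add: proj_def)
    show "short_exact (A i) (FA (proj i) f) (FA (proj i) g)" if "short_exact S f g" for f g
    proof -
      have "f \<in> Ar S" "g \<in> Ar S" using that by (auto simp: short_exact_def is_kernel_def)
      then show ?thesis using V_short_exact[OF that i] by (simp add: proj_def)
    qed
  qed (use i in \<open>auto simp: proj_def hom_iff V_Comp\<close>)
qed

lemma V_hsum:
  assumes "i \<in> I"
  shows "(\<And>n. n \<le> k \<Longrightarrow> f n \<in> hom S x y) \<Longrightarrow> V i (hsum S f k) = hsum (A i) (\<lambda>n. V i (f n)) k"
proof (induction k)
  case (Suc k)
  then show ?case
    using S.hsum_simps[of k f x y] Suc.prems[of "Suc k"] assms by (simp add: hom_iff)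
qed simp

lemma reflect_bsys:
  assumes X: "\<And>n. n \<le> k \<Longrightarrow> \<kappa> n \<in> hom S (X n) s" "\<And>n. n \<le> k \<Longrightarrow> \<pi> n \<in> hom S s (X n)" "s \<in> Ob S"
    and b: "\<And>i. i \<in> I \<Longrightarrow> bsys (A i) k (\<lambda>n. Q i (X n)) (Q i s) (\<lambda>n. V i (\<kappa> n)) (\<lambda>n. V i (\<pi> n))"
  shows "bsys S k X s \<kappa> \<pi>"
proof -
  have X': "\<kappa> n \<in> Ar S" "Dom S (\<kappa> n) = X n" "Cod S (\<kappa> n) = s" "\<pi> n \<in> Ar S" "Dom S (\<pi> n) = s"
    "Cod S (\<pi> n) = X n" "X n \<in> Ob S" if "n \<le> k" for n
    using X(1)[OF that] X(2)[OF that] S.Dom_Ob[of "\<kappa> n"] by (auto simp: hom_iff)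
  have 1: "\<pi> n \<cdot>\<^bsub>S\<^esub> \<kappa> n = Id S (X n)" if n: "n \<le> k" for n
    by (rule eqI)
      (use X'[OF n] linear_category.bsysD(9)[OF ac(2) b n] in \<open>auto simp: V_Comp\<close>)
  have 2: "\<pi> m \<cdot>\<^bsub>S\<^esub> \<kappa> n = Null S (X n) (X m)" if n: "n \<le> k" "m \<le> k" "n \<noteq> m" for n m
    by (rule eqI)
      (use X'[OF n(1)] X'[OF n(2)] linear_category.bsysD(10)[OF ac(2) b n] in \<open>auto simp: V_Comp\<close>)
  have h: "hsum S (\<lambda>n. \<kappa> n \<cdot>\<^bsub>S\<^esub> \<pi> n) k \<in> Ar S"
    "Dom S (hsum S (\<lambda>n. \<kappa> n \<cdot>\<^bsub>S\<^esub> \<pi> n) k) = s" "Cod S (hsum S (\<lambda>n. \<kappa> n \<cdot>\<^bsub>S\<^esub> \<pi> n) k) = s"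
    by (rule S.hsum_simps[where x = s and y = s]; use X' in \<open>auto simp: hom_iff\<close>)+
  have 3: "hsum S (\<lambda>n. \<kappa> n \<cdot>\<^bsub>S\<^esub> \<pi> n) k = Id S s"
  proof (rule eqI)
    fix i assume i: "i \<in> I"
    have "V i (hsum S (\<lambda>n. \<kappa> n \<cdot>\<^bsub>S\<^esub> \<pi> n) k) = hsum (A i) (\<lambda>n. V i (\<kappa> n \<cdot>\<^bsub>S\<^esub> \<pi> n)) k"
      by (rule V_hsum[OF i, where x = s and y = s]) (use X' in \<open>auto simp: hom_iff\<close>)
    also have "\<dots> = hsum (A i) (\<lambda>n. V i (\<kappa> n) \<cdot>\<^bsub>A i\<^esub> V i (\<pi> n)) k"
      by (rule hsum_cong) (use X' i in \<open>auto simp: V_Comp\<close>)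
    also have "\<dots> = V i (Id S s)"
      using linear_category.bsysD(11)[OF ac(2) b] i X(3) by simp
    finally show "V i (hsum S (\<lambda>n. \<kappa> n \<cdot>\<^bsub>S\<^esub> \<pi> n) k) = V i (Id S s)" .
  qed (use h X in auto)
  show ?thesis unfolding bsys_def using X X' 1 2 3 by auto
qed

lemma V_bsys:
  assumes b: "bsys S k X s \<kappa> \<pi>" and i: "i \<in> I"
  shows "bsys (A i) k (\<lambda>n. Q i (X n)) (Q i s) (\<lambda>n. V i (\<kappa> n)) (\<lambda>n. V i (\<pi> n))"
proof -
  interpret P: exact_tensor_functor S "A i" "proj i" by (rule proj_exact_tensor_functor[OF i])
  note b' = S.bsysD[OF b]
  have "bsys (A i) k (\<lambda>n. FO (proj i) (X n)) (FO (proj i) s) (\<lambda>n. FA (proj i) (\<kappa> n))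
      (\<lambda>n. FA (proj i) (\<pi> n))"
    by (rule P.ef.F_bsys[OF b])
  moreover have "hsum (A i) (\<lambda>n. FA (proj i) (\<kappa> n) \<cdot>\<^bsub>A i\<^esub> FA (proj i) (\<pi> n)) k =
      hsum (A i) (\<lambda>n. V i (\<kappa> n) \<cdot>\<^bsub>A i\<^esub> V i (\<pi> n)) k"
    by (rule hsum_cong) (use b' in \<open>auto simp: proj_def\<close>)
  ultimately show ?thesis using b' by (auto simp: bsys_def proj_def)
qed

end


section \<open>Cohomologies with boundary data\<close>

lemma opposite_simps [simp]:
  "Ob (opposite C) = Ob C" "Ar (opposite C) = Ar C" "Dom (opposite C) = Cod C"
  "Cod (opposite C) = Dom C" "Id (opposite C) = Id C" "g \<cdot>\<^bsub>opposite C\<^esub> f = f \<cdot>\<^bsub>C\<^esub> g"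
  by (simp_all add: opposite_def)

lemma hom_opposite [simp]: "hom (opposite C) x y = hom C y x"
  by (auto simp: hom_def)

lemma is_coproduct_cong:
  assumes "\<And>p. p \<in> I \<Longrightarrow> X p = Y p"
  shows "is_coproduct C I X s \<iota> = is_coproduct C I Y s \<iota>"
  using assms unfolding is_coproduct_def by (simp cong: ball_cong)

context kunneth_cohomology
begin

lemma Coh_simps [simp]:
  "X \<in> Ob T \<Longrightarrow> FO (Coh H i) X \<in> Ob A"
  "X \<in> Ob T \<Longrightarrow> FA (Coh H i) (Id T X) = Id A (FO (Coh H i) X)"
  "f \<in> Ar T \<Longrightarrow> FA (Coh H i) f \<in> Ar A"
  "f \<in> Ar T \<Longrightarrow> Dom A (FA (Coh H i) f) = FO (Coh H i) (Cod T f)"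
  "f \<in> Ar T \<Longrightarrow> Cod A (FA (Coh H i) f) = FO (Coh H i) (Dom T f)"
proof -
  interpret F: cat_functor "opposite T" A "Coh H i" by (rule Coh_functor)
  show "X \<in> Ob T \<Longrightarrow> FO (Coh H i) X \<in> Ob A"
    "X \<in> Ob T \<Longrightarrow> FA (Coh H i) (Id T X) = Id A (FO (Coh H i) X)"
    "f \<in> Ar T \<Longrightarrow> FA (Coh H i) f \<in> Ar A"
    "f \<in> Ar T \<Longrightarrow> Dom A (FA (Coh H i) f) = FO (Coh H i) (Cod T f)"
    "f \<in> Ar T \<Longrightarrow> Cod A (FA (Coh H i) f) = FO (Coh H i) (Dom T f)"
    using F.FO_Ob[of X] F.FA_simps[of f] F.FA_Id[of X] by simp_all
qed

lemma Coh_Comp: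
  "f \<in> Ar T \<Longrightarrow> g \<in> Ar T \<Longrightarrow> Dom T g = Cod T f \<Longrightarrow>
    FA (Coh H i) (g \<cdot>\<^bsub>T\<^esub> f) = FA (Coh H i) f \<cdot>\<^bsub>A\<^esub> FA (Coh H i) g"
  using cat_functor.FA_Comp[OF Coh_functor, of g f i] by simp

lemma Kap_simps [simp]:
  assumes "X \<in> Ob T" "Y \<in> Ob T"
  shows "Kap H i j (X, Y) \<in> Ar A"
    "Dom A (Kap H i j (X, Y)) = FO (Coh H i) X \<otimes>\<^bsub>A\<^esub> FO (Coh H j) Y"
    "Cod A (Kap H i j (X, Y)) = FO (Coh H (i + j)) (X \<otimes>\<^bsub>T\<^esub> Y)"
  using Kap_hom[OF assms, of i j] by (auto simp: hom_iff)

lemma Ups_simps [simp]: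
  "Ups H \<in> Ar A" "Dom A (Ups H) = FO (Coh H 0) \<one>\<^bsub>T\<^esub>" "Cod A (Ups H) = \<one>\<^bsub>A\<^esub>" "iso_arrow A (Ups H)"
  using Ups_hom Ups_iso by (auto simp: hom_iff)

text \<open>The pairs with i + j = k are indexed by n alone, the second degree being k - n. This
  turns the axiom about arbitrary coproducts into the existence of projections satisfying
  equations.\<close>

lemma kunneth_bsys:
  assumes "X \<in> Ob T" "Y \<in> Ob T"
  shows "\<exists>\<pi>. bsys A k (\<lambda>n. FO (Coh H n) X \<otimes>\<^bsub>A\<^esub> FO (Coh H (k - n)) Y) (FO (Coh H k) (X \<otimes>\<^bsub>T\<^esub> Y))
      (\<lambda>n. Kap H n (k - n) (X, Y)) \<pi>"
proof (rule target.bsys_of_coproduct_iso)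
  fix S \<iota> u
  assume *: "is_coproduct A {(i, j). i + j = k}
      (\<lambda>(i, j). FO (Coh H i) X \<otimes>\<^bsub>A\<^esub> FO (Coh H (k - i)) Y) S \<iota>"
    "u \<in> hom A S (FO (Coh H k) (X \<otimes>\<^bsub>T\<^esub> Y))"
    "\<And>i j. i + j = k \<Longrightarrow> u \<cdot>\<^bsub>A\<^esub> \<iota> (i, j) = Kap H i (k - i) (X, Y)"
  have "is_coproduct A {(i, j). i + j = k} (\<lambda>(i, j). FO (Coh H i) X \<otimes>\<^bsub>A\<^esub> FO (Coh H j) Y) S \<iota>"
    using *(1) by (rule iffD1[OF is_coproduct_cong, rotated]) auto
  then show "iso_arrow A u"
    by (rule Kunneth_iso[OF assms _ *(2)]) (use *(3) in auto)
qed (use assms in \<open>auto simp: hom_iff\<close>)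

end

text \<open>The way back from projections to arbitrary coproducts; together with
  \<open>kunneth_bsys\<close> it makes the Kuenneth axiom accessible to functors.\<close>

lemma Kunneth_iso_of_bsys:
  assumes "linear_category A"
    and "bsys A k (\<lambda>n. FO (Coh H n) X \<otimes>\<^bsub>A\<^esub> FO (Coh H (k - n)) Y) Z
      (\<lambda>n. Kap H n (k - n) (X, Y)) \<pi>"
    and "is_coproduct A {(i, j). i + j = k} (\<lambda>(i, j). FO (Coh H i) X \<otimes>\<^bsub>A\<^esub> FO (Coh H j) Y) S \<iota>"
    and "s \<in> hom A S Z" "\<And>i j. i + j = k \<Longrightarrow> s \<cdot>\<^bsub>A\<^esub> \<iota> (i, j) = Kap H i j (X, Y)"
  shows "iso_arrow A s"
  by (rule linear_category.coproduct_bsys_iso[OF assms(1,2) _ assms(3,4)]) (use assms(5) in auto)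

text \<open>
  Boundary data prescribe, on top of a Kuenneth cohomology on \<open>T\<close>, boundary maps
  \<open>H\<^sup>i(Y) \<rightarrow> H\<^sup>i\<^sup>+\<^sup>1(X)\<close> for the pairs \<open>(X, Y)\<close> in \<open>Tri\<close>, and the instances of the axioms: naturality (\<open>NatC\<close>),
  long exact sequences (\<open>MonC\<close>, \<open>ExA\<close>, \<open>ExB\<close>, \<open>ExC\<close>), excision (\<open>IsoC\<close>) and compatibility with products
  (\<open>ProdC\<close>). Empty data give Kuenneth cohomologies; on the category of pairs, suitable data give the
  relative ones.
\<close>

record ('o, 'a) bdata =
  Tri :: "('o \<times> 'o) set"
  NatC :: "(('o \<times> 'o) \<times> ('o \<times> 'o) \<times> 'a \<times> 'a) set"
  MonC :: "'a set"
  ExA :: "('a \<times> 'a) set"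
  ExB :: "('a \<times> ('o \<times> 'o)) set"
  ExC :: "(('o \<times> 'o) \<times> 'a) set"
  IsoC :: "'a set"
  ProdC :: "(('o \<times> 'o) \<times> 'o \<times> ('o \<times> 'o) \<times> 'a \<times> 'a) set"

locale boundary_data = tensor_category T for T :: "('o, 'a, 'z) tcat_scheme" and D :: "('o, 'a) bdata" +
  assumes Tri_wf: "t \<in> Tri D \<Longrightarrow> fst t \<in> Ob T \<and> snd t \<in> Ob T"
    and NatC_wf: "(t, t', f, g) \<in> NatC D \<Longrightarrow> t \<in> Tri D \<and> t' \<in> Tri D \<and>
        f \<in> hom T (fst t) (fst t') \<and> g \<in> hom T (snd t) (snd t')"
    and MonC_wf: "f \<in> MonC D \<Longrightarrow> f \<in> Ar T"
    and ExA_wf: "(f, g) \<in> ExA D \<Longrightarrow> f \<in> Ar T \<and> g \<in> Ar T \<and> Cod T g = Dom T f"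
    and ExB_wf: "(f, t) \<in> ExB D \<Longrightarrow> f \<in> Ar T \<and> t \<in> Tri D \<and> Dom T f = snd t"
    and ExC_wf: "(t, f) \<in> ExC D \<Longrightarrow> f \<in> Ar T \<and> t \<in> Tri D \<and> Cod T f = fst t"
    and IsoC_wf: "f \<in> IsoC D \<Longrightarrow> f \<in> Ar T"
    and ProdC_wf: "(t, Y, t', b, c) \<in> ProdC D \<Longrightarrow> t \<in> Tri D \<and> Y \<in> Ob T \<and> t' \<in> Tri D \<and> b \<in> IsoC D \<and>
        c \<in> Ar T \<and> Cod T c = snd t \<otimes>\<^bsub>T\<^esub> Y \<and> Dom T c = Dom T b \<and> Cod T b = snd t' \<and>
        fst t' = fst t \<otimes>\<^bsub>T\<^esub> Y"

locale bkunneth = boundary_data T D + kunneth_cohomology T A H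
  for T :: "('o, 'a, 'z) tcat_scheme" and D :: "('o, 'a) bdata" and A :: "('p, 'b, 'w) ltcat_scheme"
    and H :: "('o, 'a, 'p, 'b, 'y) rel_kunneth_scheme" +
  assumes Bd_arrow: "t \<in> Tri D \<Longrightarrow> Bd H i t \<in> hom A (FO (Coh H i) (snd t)) (FO (Coh H (Suc i)) (fst t))"
    and Bd_extensional: "Bd H i \<in> extensional (Tri D)"
    and Bd_natural: "(t, t', f, g) \<in> NatC D \<Longrightarrow>
        Bd H i t \<cdot>\<^bsub>A\<^esub> FA (Coh H i) g = FA (Coh H (Suc i)) f \<cdot>\<^bsub>A\<^esub> Bd H i t'"
    and MonC_monic: "f \<in> MonC D \<Longrightarrow> monic A (FA (Coh H 0) f)"
    and ExA_exact: "(f, g) \<in> ExA D \<Longrightarrow> exact_at A (FA (Coh H i) f) (FA (Coh H i) g)"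
    and ExB_exact: "(f, t) \<in> ExB D \<Longrightarrow> exact_at A (FA (Coh H i) f) (Bd H i t)"
    and ExC_exact: "(t, f) \<in> ExC D \<Longrightarrow> exact_at A (Bd H i t) (FA (Coh H (Suc i)) f)"
    and IsoC_iso: "f \<in> IsoC D \<Longrightarrow> iso_arrow A (FA (Coh H i) f)"
    and ProdC_eq: "(t, Y, t', b, c) \<in> ProdC D \<Longrightarrow>
        Kap H (Suc i) j (fst t, Y) \<cdot>\<^bsub>A\<^esub> (Bd H i t \<odot>\<^bsub>A\<^esub> Id A (FO (Coh H j) Y)) =
        Bd H (i + j) t' \<cdot>\<^bsub>A\<^esub> (inv_arrow A (FA (Coh H (i + j)) b) \<cdot>\<^bsub>A\<^esub>
          (FA (Coh H (i + j)) c \<cdot>\<^bsub>A\<^esub> Kap H i j (snd t, Y)))"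
begin

lemma Bd_simps [simp]:
  assumes "t \<in> Tri D"
  shows "Bd H i t \<in> Ar A" "Dom A (Bd H i t) = FO (Coh H i) (snd t)"
    "Cod A (Bd H i t) = FO (Coh H (Suc i)) (fst t)"
  using Bd_arrow[OF assms] by (auto simp: hom_iff)

end

lemma (in category) category_opposite: "category (opposite C)"
  by unfold_locales (simp_all add: hom_iff)

context exact_tensor_functor
begin

lemma Mult_simps [simp]:
  assumes "x \<in> Ob A" "y \<in> Ob A"
  shows "Mult F (x, y) \<in> Ar B" "Dom B (Mult F (x, y)) = FO F x \<otimes>\<^bsub>B\<^esub> FO F y"
    "Cod B (Mult F (x, y)) = FO F (x \<otimes>\<^bsub>A\<^esub> y)" "iso_arrow B (Mult F (x, y))"
  using Mult_hom[OF assms] Mult_iso[OF assms] by (simp_all add: hom_iff)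

lemma Unit_simps [simp]:
  "Unit F \<in> Ar B" "Dom B (Unit F) = \<one>\<^bsub>B\<^esub>" "Cod B (Unit F) = FO F \<one>\<^bsub>A\<^esub>" "iso_arrow B (Unit F)"
  using Unit_hom Unit_iso by (simp_all add: hom_iff)

lemma Mult_natural:
  "f \<in> Ar A \<Longrightarrow> g \<in> Ar A \<Longrightarrow> Mult F (Cod A f, Cod A g) \<cdot>\<^bsub>B\<^esub> (FA F f \<odot>\<^bsub>B\<^esub> FA F g) =
    FA F (f \<odot>\<^bsub>A\<^esub> g) \<cdot>\<^bsub>B\<^esub> Mult F (Dom A f, Dom A g)"
  by (rule Mult_nat) (auto simp: hom_iff)

end

section \<open>Push-forward along exact tensor functors\<close>

definition push_bk :: "('o, 'a, 'z) tcat_scheme \<Rightarrow> ('o, 'a) bdata \<Rightarrow> ('q, 'c, 'y) ltcat_scheme \<Rightarrow>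
    ('o, 'a, 'p, 'b) rel_kunneth \<Rightarrow> ('p, 'b, 'q, 'c) tfunc \<Rightarrow> ('o, 'a, 'q, 'c) rel_kunneth" where
  "push_bk T D B H F = kunneth.extend (push_kunneth T B (kunneth.truncate H) F)
      (rel_kunneth.fields (\<lambda>i. \<lambda>t\<in>Tri D. FA F (Bd H i t)))"

text \<open>The truncation in \<open>push_bk\<close> makes its first part literally the absolute
  push-forward of an absolute cohomology. This equation reconciles it with the relative
  push-forward, which is applied without truncating.\<close>

lemma push_kunneth_truncate: "push_kunneth T B (kunneth.truncate H) F = push_kunneth T B H F"
  by (simp add: push_kunneth_def kunneth.truncate_def)

lemma push_bk_simps [simp]:
  "Coh (push_bk T D B H F) = (\<lambda>i. func_comp (opposite T) F (Coh H i))"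
  "Kap (push_bk T D B H F) = (\<lambda>i j. \<lambda>(X, Y)\<in>Ob T \<times> Ob T.
       FA F (Kap H i j (X, Y)) \<cdot>\<^bsub>B\<^esub> Mult F (FO (Coh H i) X, FO (Coh H j) Y))"
  "Ups (push_bk T D B H F) = inv_arrow B (Unit F) \<cdot>\<^bsub>B\<^esub> FA F (Ups H)"
  "Bd (push_bk T D B H F) = (\<lambda>i. \<lambda>t\<in>Tri D. FA F (Bd H i t))"
  by (simp_all add: push_bk_def push_kunneth_truncate)
    (simp_all add: push_kunneth_def kunneth.defs rel_kunneth.defs)

lemma func_comp_simps [simp]:
  "x \<in> Ob C \<Longrightarrow> FO (func_comp C G F) x = FO G (FO F x)"
  "f \<in> Ar C \<Longrightarrow> FA (func_comp C G F) f = FA G (FA F f)"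
  by (simp_all add: func_comp_def)

text \<open>Equations are images of equations of \<open>H\<close>, with \<open>Mult F\<close> moved
  past them by naturality; monics, exact sequences and zero objects are preserved because
  \<open>F\<close> is exact. The Kuenneth axiom is transported in its form by projections.\<close>

theorem bkunneth_push:
  assumes "bkunneth T D A H" "exact_tensor_functor A B F"
  shows "bkunneth T D B (push_bk T D B H F)"
proof -
  interpret H: bkunneth T D A H by fact
  interpret F: exact_tensor_functor A B F by fact
  interpret opp: category "opposite T" by (rule H.category_opposite)
  let ?h = "\<lambda>i X. FO (Coh H i) X" and ?K = "push_bk T D B H F"
  note [simp] = H.Coh_Comp
  show ?thesis
  proof unfold_locales
    fix i j X Y Z
    show "FO (Coh ?K i) X \<in> Ob B" if "X \<in> Ob (opposite T)" using that by simp
    show "FA (Coh ?K i) f \<in> hom B (FO (Coh ?K i) X) (FO (Coh ?K i) Y)"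
      if "f \<in> hom (opposite T) X Y" for f
      using that by (auto simp: hom_iff)
    show "FA (Coh ?K i) (Id (opposite T) X) = Id B (FO (Coh ?K i) X)" if "X \<in> Ob (opposite T)"
      using that by simp
    show "FA (Coh ?K i) (g \<cdot>\<^bsub>opposite T\<^esub> f) = FA (Coh ?K i) g \<cdot>\<^bsub>B\<^esub> FA (Coh ?K i) f"
      if "f \<in> hom (opposite T) X Y" "g \<in> hom (opposite T) Y Z" for f g
      using that by (simp add: hom_iff F.FA_Comp)
    show "FO (Coh ?K i) \<in> extensional (Ob (opposite T))" "FA (Coh ?K i) \<in> extensional (Ar (opposite T))"
      by (simp_all add: func_comp_def)
    show "Kap ?K i j \<in> extensional (Ob T \<times> Ob T)" by auto
    show "Ups ?K \<in> hom B (FO (Coh ?K 0) \<one>\<^bsub>T\<^esub>) \<one>\<^bsub>B\<^esub>" by (simp add: hom_iff)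
    show "iso_arrow B (Ups ?K)" by (simp add: F.target.iso_comp F.FA_iso)
    show "zero_object B (FO (Coh ?K i) \<one>\<^bsub>T\<^esub>)" if "i \<noteq> 0" using H.Coh_One[OF that] F.ef.F_zero by simp
    show "Bd ?K i \<in> extensional (Tri D)" by simp
  next
    fix X Y i j assume [simp]: "X \<in> Ob T" "Y \<in> Ob T"
    show "Kap ?K i j (X, Y) \<in>
        hom B (FO (Coh ?K i) X \<otimes>\<^bsub>B\<^esub> FO (Coh ?K j) Y) (FO (Coh ?K (i + j)) (X \<otimes>\<^bsub>T\<^esub> Y))"
      by (simp add: hom_iff)
    have *: "Mult F (?h j Y, ?h i X) \<cdot>\<^bsub>B\<^esub> Sym B (FO F (?h i X)) (FO F (?h j Y)) =
        FA F (Sym A (?h i X) (?h j Y)) \<cdot>\<^bsub>B\<^esub> Mult F (?h i X, ?h j Y)"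
      by (simp add: F.Mult_Sym)
    have "FA (Coh ?K (i + j)) (Sym T X Y) \<cdot>\<^bsub>B\<^esub>
          (Kap ?K j i (Y, X) \<cdot>\<^bsub>B\<^esub> Sym B (FO (Coh ?K i) X) (FO (Coh ?K j) Y)) =
        FA F (FA (Coh H (i + j)) (Sym T X Y)) \<cdot>\<^bsub>B\<^esub> (FA F (Kap H j i (Y, X)) \<cdot>\<^bsub>B\<^esub>
          (Mult F (?h j Y, ?h i X) \<cdot>\<^bsub>B\<^esub> Sym B (FO F (?h i X)) (FO F (?h j Y))))"
      by (simp add: add.commute)
    also have "\<dots> = FA F (FA (Coh H (i + j)) (Sym T X Y) \<cdot>\<^bsub>A\<^esub> (Kap H j i (Y, X) \<cdot>\<^bsub>A\<^esub>
        Sym A (?h i X) (?h j Y))) \<cdot>\<^bsub>B\<^esub> Mult F (?h i X, ?h j Y)"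
      unfolding * by (simp add: F.FA_Comp add.commute)
    also have "\<dots> = Scale B ((-1) ^ (i * j)) (Kap ?K i j (X, Y))"
      by (simp add: H.Kap_Sym F.ef.F_Scale)
    finally show "FA (Coh ?K (i + j)) (Sym T X Y) \<cdot>\<^bsub>B\<^esub>
          (Kap ?K j i (Y, X) \<cdot>\<^bsub>B\<^esub> Sym B (FO (Coh ?K i) X) (FO (Coh ?K j) Y)) =
        Scale B ((-1) ^ (i * j)) (Kap ?K i j (X, Y))" .
  next
    fix X X' Y Y' f g i j assume *: "f \<in> hom T X X'" "g \<in> hom T Y Y'"
    then have f [simp]: "f \<in> Ar T" "g \<in> Ar T" "Dom T f = X" "Cod T f = X'" "Dom T g = Y" "Cod T g = Y'"
      by (auto simp: hom_iff)
    have [simp]: "X \<in> Ob T" "X' \<in> Ob T" "Y \<in> Ob T" "Y' \<in> Ob T"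
      using * H.Dom_Ob[of f] H.Dom_Ob[of g] H.Cod_Ob[of f] H.Cod_Ob[of g] by (auto simp: hom_iff)
    have "Kap ?K i j (X, Y) \<cdot>\<^bsub>B\<^esub> (FA (Coh ?K i) f \<odot>\<^bsub>B\<^esub> FA (Coh ?K j) g) =
        FA F (Kap H i j (X, Y)) \<cdot>\<^bsub>B\<^esub> (Mult F (?h i X, ?h j Y) \<cdot>\<^bsub>B\<^esub>
          (FA F (FA (Coh H i) f) \<odot>\<^bsub>B\<^esub> FA F (FA (Coh H j) g)))"
      by simp
    also have "\<dots> = FA F (Kap H i j (X, Y) \<cdot>\<^bsub>A\<^esub> (FA (Coh H i) f \<odot>\<^bsub>A\<^esub> FA (Coh H j) g)) \<cdot>\<^bsub>B\<^esub>
        Mult F (?h i X', ?h j Y')"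
      using F.Mult_natural[of "FA (Coh H i) f" "FA (Coh H j) g"] by (simp add: F.FA_Comp)
    also have "\<dots> = FA (Coh ?K (i + j)) (f \<odot>\<^bsub>T\<^esub> g) \<cdot>\<^bsub>B\<^esub> Kap ?K i j (X', Y')"
      by (simp add: H.Kap_nat[OF *] F.FA_Comp)
    finally show "Kap ?K i j (X, Y) \<cdot>\<^bsub>B\<^esub> (FA (Coh ?K i) f \<odot>\<^bsub>B\<^esub> FA (Coh ?K j) g) =
        FA (Coh ?K (i + j)) (f \<odot>\<^bsub>T\<^esub> g) \<cdot>\<^bsub>B\<^esub> Kap ?K i j (X', Y')" .
  next
    fix X Y Z i j k assume [simp]: "X \<in> Ob T" "Y \<in> Ob T" "Z \<in> Ob T"
    let ?x = "?h i X" and ?y = "?h j Y" and ?z = "?h k Z" and ?XY = "X \<otimes>\<^bsub>T\<^esub> Y" and ?YZ = "Y \<otimes>\<^bsub>T\<^esub> Z"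
    let ?M1 = "Mult F (?x \<otimes>\<^bsub>A\<^esub> ?y, ?z)" and ?M2 = "Mult F (?x, ?y \<otimes>\<^bsub>A\<^esub> ?z)"
    let ?k1 = "Kap H (i + j) k (?XY, Z)" and ?k2 = "Kap H i j (X, Y)"
    let ?k3 = "Kap H i (j + k) (X, ?YZ)" and ?k4 = "Kap H j k (Y, Z)"
    let ?a = "FA (Coh H (i + j + k)) (Assoc T X Y Z)"
    \<comment> \<open>The structure map of the inner product is split off so that it meets
      \<open>?M1\<close>; together they form the combination on the left of
      \<open>Mult_Assoc\<close>.\<close>
    have 1: "(FA F ?k2 \<cdot>\<^bsub>B\<^esub> Mult F (?x, ?y)) \<odot>\<^bsub>B\<^esub> Id B (FO F ?z) =
        (FA F ?k2 \<odot>\<^bsub>B\<^esub> FA F (Id A ?z)) \<cdot>\<^bsub>B\<^esub> (Mult F (?x, ?y) \<odot>\<^bsub>B\<^esub> Id B (FO F ?z))"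
      by (simp add: F.target.TA_merge)
    have 2: "Mult F (?h (i + j) ?XY, ?z) \<cdot>\<^bsub>B\<^esub> ((FA F ?k2 \<odot>\<^bsub>B\<^esub> FA F (Id A ?z)) \<cdot>\<^bsub>B\<^esub>
          (Mult F (?x, ?y) \<odot>\<^bsub>B\<^esub> Id B (FO F ?z))) =
        FA F (?k2 \<odot>\<^bsub>A\<^esub> Id A ?z) \<cdot>\<^bsub>B\<^esub> (?M1 \<cdot>\<^bsub>B\<^esub> (Mult F (?x, ?y) \<odot>\<^bsub>B\<^esub> Id B (FO F ?z)))"
      by (rule F.target.comp_extend)
        (use F.Mult_natural[of ?k2 "Id A ?z"] in \<open>simp_all del: F.FA_Id\<close>)
    have "Kap ?K (i + j) k (?XY, Z) \<cdot>\<^bsub>B\<^esub> (Kap ?K i j (X, Y) \<odot>\<^bsub>B\<^esub> Id B (FO (Coh ?K k) Z)) =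
        FA F ?k1 \<cdot>\<^bsub>B\<^esub> (Mult F (?h (i + j) ?XY, ?z) \<cdot>\<^bsub>B\<^esub>
          ((FA F ?k2 \<cdot>\<^bsub>B\<^esub> Mult F (?x, ?y)) \<odot>\<^bsub>B\<^esub> Id B (FO F ?z)))"
      by simp
    also have "\<dots> = FA F (?k1 \<cdot>\<^bsub>A\<^esub> (?k2 \<odot>\<^bsub>A\<^esub> Id A ?z)) \<cdot>\<^bsub>B\<^esub>
        (?M1 \<cdot>\<^bsub>B\<^esub> (Mult F (?x, ?y) \<odot>\<^bsub>B\<^esub> Id B (FO F ?z)))"
      unfolding 1 2 by (simp add: F.FA_Comp)
    also have "?k1 \<cdot>\<^bsub>A\<^esub> (?k2 \<odot>\<^bsub>A\<^esub> Id A ?z) =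
        ?a \<cdot>\<^bsub>A\<^esub> (?k3 \<cdot>\<^bsub>A\<^esub> ((Id A ?x \<odot>\<^bsub>A\<^esub> ?k4) \<cdot>\<^bsub>A\<^esub> Assoc A ?x ?y ?z))"
      by (rule H.Kap_Assoc) auto
    also have "FA F \<dots> \<cdot>\<^bsub>B\<^esub> (?M1 \<cdot>\<^bsub>B\<^esub> (Mult F (?x, ?y) \<odot>\<^bsub>B\<^esub> Id B (FO F ?z))) =
        FA F ?a \<cdot>\<^bsub>B\<^esub> (FA F ?k3 \<cdot>\<^bsub>B\<^esub> (FA F (Id A ?x \<odot>\<^bsub>A\<^esub> ?k4) \<cdot>\<^bsub>B\<^esub> (FA F (Assoc A ?x ?y ?z) \<cdot>\<^bsub>B\<^esub>
          (?M1 \<cdot>\<^bsub>B\<^esub> (Mult F (?x, ?y) \<odot>\<^bsub>B\<^esub> Id B (FO F ?z))))))"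
      by (simp add: F.FA_Comp add.assoc)
    also have "FA F (Assoc A ?x ?y ?z) \<cdot>\<^bsub>B\<^esub> (?M1 \<cdot>\<^bsub>B\<^esub> (Mult F (?x, ?y) \<odot>\<^bsub>B\<^esub> Id B (FO F ?z))) =
        ?M2 \<cdot>\<^bsub>B\<^esub> ((Id B (FO F ?x) \<odot>\<^bsub>B\<^esub> Mult F (?y, ?z)) \<cdot>\<^bsub>B\<^esub> Assoc B (FO F ?x) (FO F ?y) (FO F ?z))"
      by (rule F.Mult_Assoc) auto
    also have "FA F (Id A ?x \<odot>\<^bsub>A\<^esub> ?k4) \<cdot>\<^bsub>B\<^esub> \<dots> = Mult F (?x, ?h (j + k) ?YZ) \<cdot>\<^bsub>B\<^esub>
        ((FA F (Id A ?x) \<odot>\<^bsub>B\<^esub> FA F ?k4) \<cdot>\<^bsub>B\<^esub>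
          ((Id B (FO F ?x) \<odot>\<^bsub>B\<^esub> Mult F (?y, ?z)) \<cdot>\<^bsub>B\<^esub> Assoc B (FO F ?x) (FO F ?y) (FO F ?z)))"
      by (rule F.target.comp_extend)
        (use F.Mult_natural[of "Id A ?x" ?k4] in \<open>simp_all del: F.FA_Id\<close>)
    also have "(FA F (Id A ?x) \<odot>\<^bsub>B\<^esub> FA F ?k4) \<cdot>\<^bsub>B\<^esub>
          ((Id B (FO F ?x) \<odot>\<^bsub>B\<^esub> Mult F (?y, ?z)) \<cdot>\<^bsub>B\<^esub> Assoc B (FO F ?x) (FO F ?y) (FO F ?z)) =
        (Id B (FO F ?x) \<odot>\<^bsub>B\<^esub> (FA F ?k4 \<cdot>\<^bsub>B\<^esub> Mult F (?y, ?z))) \<cdot>\<^bsub>B\<^esub> Assoc B (FO F ?x) (FO F ?y) (FO F ?z)"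
      by (simp add: F.target.TA_merge2)
    finally show "Kap ?K (i + j) k (?XY, Z) \<cdot>\<^bsub>B\<^esub> (Kap ?K i j (X, Y) \<odot>\<^bsub>B\<^esub> Id B (FO (Coh ?K k) Z)) =
        FA (Coh ?K (i + j + k)) (Assoc T X Y Z) \<cdot>\<^bsub>B\<^esub> (Kap ?K i (j + k) (X, ?YZ) \<cdot>\<^bsub>B\<^esub>
          ((Id B (FO (Coh ?K i) X) \<odot>\<^bsub>B\<^esub> Kap ?K j k (Y, Z)) \<cdot>\<^bsub>B\<^esub>
            Assoc B (FO (Coh ?K i) X) (FO (Coh ?K j) Y) (FO (Coh ?K k) Z)))"
      by (simp add: add.assoc)
  next
    fix X i assume [simp]: "X \<in> Ob T"
    let ?x = "?h i X" and ?o = "?h 0 \<one>\<^bsub>T\<^esub>"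
    have "Mult F (\<one>\<^bsub>A\<^esub>, ?x) \<cdot>\<^bsub>B\<^esub> (FA F (Ups H) \<odot>\<^bsub>B\<^esub> FA F (Id A ?x)) =
        FA F (Ups H \<odot>\<^bsub>A\<^esub> Id A ?x) \<cdot>\<^bsub>B\<^esub> Mult F (?o, ?x)"
      using F.Mult_natural[of "Ups H" "Id A ?x"] by simp
    \<comment> \<open>The unit map of the push-forward contains the inverse of
      \<open>Unit F\<close>. Inserting \<open>Unit F\<close> next to it brings in the combination
      that occurs in \<open>Mult_Lun\<close>.\<close>
    moreover have "FA F (Ups H) \<odot>\<^bsub>B\<^esub> FA F (Id A ?x) = (Unit F \<odot>\<^bsub>B\<^esub> Id B (FO F ?x)) \<cdot>\<^bsub>B\<^esub>
        ((inv_arrow B (Unit F) \<cdot>\<^bsub>B\<^esub> FA F (Ups H)) \<odot>\<^bsub>B\<^esub> Id B (FO F ?x))"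
      by (simp add: F.target.TA_merge)
    ultimately have "FA F (Ups H \<odot>\<^bsub>A\<^esub> Id A ?x) \<cdot>\<^bsub>B\<^esub> Mult F (?o, ?x) = Mult F (\<one>\<^bsub>A\<^esub>, ?x) \<cdot>\<^bsub>B\<^esub>
        ((Unit F \<odot>\<^bsub>B\<^esub> Id B (FO F ?x)) \<cdot>\<^bsub>B\<^esub> ((inv_arrow B (Unit F) \<cdot>\<^bsub>B\<^esub> FA F (Ups H)) \<odot>\<^bsub>B\<^esub> Id B (FO F ?x)))"
      by simp
    then have *: "FA F (Lun A ?x) \<cdot>\<^bsub>B\<^esub> (FA F (Ups H \<odot>\<^bsub>A\<^esub> Id A ?x) \<cdot>\<^bsub>B\<^esub> Mult F (?o, ?x)) =
      (FA F (Lun A ?x) \<cdot>\<^bsub>B\<^esub> (Mult F (\<one>\<^bsub>A\<^esub>, ?x) \<cdot>\<^bsub>B\<^esub> (Unit F \<odot>\<^bsub>B\<^esub> Id B (FO F ?x)))) \<cdot>\<^bsub>B\<^esub>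
        ((inv_arrow B (Unit F) \<cdot>\<^bsub>B\<^esub> FA F (Ups H)) \<odot>\<^bsub>B\<^esub> Id B (FO F ?x))"
      by simp
    show "Kap ?K 0 i (\<one>\<^bsub>T\<^esub>, X) = FA (Coh ?K i) (Lun T X) \<cdot>\<^bsub>B\<^esub>
          (Lun B (FO (Coh ?K i) X) \<cdot>\<^bsub>B\<^esub> (Ups ?K \<odot>\<^bsub>B\<^esub> Id B (FO (Coh ?K i) X)))"
      using * unfolding F.Mult_Lun[OF H.Coh_simps(1)[OF \<open>X \<in> Ob T\<close>]]
      by (simp add: H.Kap_Lun F.FA_Comp)
  next
    fix X i assume [simp]: "X \<in> Ob T"
    let ?x = "?h i X" and ?o = "?h 0 \<one>\<^bsub>T\<^esub>"
    have "Mult F (?x, \<one>\<^bsub>A\<^esub>) \<cdot>\<^bsub>B\<^esub> (FA F (Id A ?x) \<odot>\<^bsub>B\<^esub> FA F (Ups H)) =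
        FA F (Id A ?x \<odot>\<^bsub>A\<^esub> Ups H) \<cdot>\<^bsub>B\<^esub> Mult F (?x, ?o)"
      using F.Mult_natural[of "Id A ?x" "Ups H"] by simp
    moreover have "FA F (Id A ?x) \<odot>\<^bsub>B\<^esub> FA F (Ups H) = (Id B (FO F ?x) \<odot>\<^bsub>B\<^esub> Unit F) \<cdot>\<^bsub>B\<^esub>
        (Id B (FO F ?x) \<odot>\<^bsub>B\<^esub> (inv_arrow B (Unit F) \<cdot>\<^bsub>B\<^esub> FA F (Ups H)))"
      by (simp add: F.target.TA_merge)
    ultimately have "FA F (Id A ?x \<odot>\<^bsub>A\<^esub> Ups H) \<cdot>\<^bsub>B\<^esub> Mult F (?x, ?o) = Mult F (?x, \<one>\<^bsub>A\<^esub>) \<cdot>\<^bsub>B\<^esub>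
        ((Id B (FO F ?x) \<odot>\<^bsub>B\<^esub> Unit F) \<cdot>\<^bsub>B\<^esub> (Id B (FO F ?x) \<odot>\<^bsub>B\<^esub> (inv_arrow B (Unit F) \<cdot>\<^bsub>B\<^esub> FA F (Ups H))))"
      by simp
    then have *: "FA F (Run A ?x) \<cdot>\<^bsub>B\<^esub> (FA F (Id A ?x \<odot>\<^bsub>A\<^esub> Ups H) \<cdot>\<^bsub>B\<^esub> Mult F (?x, ?o)) =
      (FA F (Run A ?x) \<cdot>\<^bsub>B\<^esub> (Mult F (?x, \<one>\<^bsub>A\<^esub>) \<cdot>\<^bsub>B\<^esub> (Id B (FO F ?x) \<odot>\<^bsub>B\<^esub> Unit F))) \<cdot>\<^bsub>B\<^esub>
        (Id B (FO F ?x) \<odot>\<^bsub>B\<^esub> (inv_arrow B (Unit F) \<cdot>\<^bsub>B\<^esub> FA F (Ups H)))"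
      by simp
    show "Kap ?K i 0 (X, \<one>\<^bsub>T\<^esub>) = FA (Coh ?K i) (Run T X) \<cdot>\<^bsub>B\<^esub>
          (Run B (FO (Coh ?K i) X) \<cdot>\<^bsub>B\<^esub> (Id B (FO (Coh ?K i) X) \<odot>\<^bsub>B\<^esub> Ups ?K))"
      using * unfolding F.Mult_Run[OF H.Coh_simps(1)[OF \<open>X \<in> Ob T\<close>]]
      by (simp add: H.Kap_Run F.FA_Comp)
  next
    fix X Y k S \<iota> s
    assume [simp]: "X \<in> Ob T" "Y \<in> Ob T"
      and c: "is_coproduct B {(i, j). i + j = k} (\<lambda>(i, j). FO (Coh ?K i) X \<otimes>\<^bsub>B\<^esub> FO (Coh ?K j) Y) S \<iota>"
        "s \<in> hom B S (FO (Coh ?K k) (X \<otimes>\<^bsub>T\<^esub> Y))"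
        "\<And>i j. i + j = k \<Longrightarrow> s \<cdot>\<^bsub>B\<^esub> \<iota> (i, j) = Kap ?K i j (X, Y)"
    obtain \<pi> where \<pi>: "bsys A k (\<lambda>n. ?h n X \<otimes>\<^bsub>A\<^esub> ?h (k - n) Y) (?h k (X \<otimes>\<^bsub>T\<^esub> Y))
      (\<lambda>n. Kap H n (k - n) (X, Y)) \<pi>"
      using H.kunneth_bsys[of X Y k] by auto
    let ?M = "\<lambda>n. Mult F (?h n X, ?h (k - n) Y)"
    \<comment> \<open>The new injections are those of the image system precomposed with the
      isomorphisms \<open>?M n\<close>, so the projections are followed by their inverses.\<close>
    have "bsys B k (\<lambda>n. FO F (?h n X) \<otimes>\<^bsub>B\<^esub> FO F (?h (k - n) Y)) (FO F (?h k (X \<otimes>\<^bsub>T\<^esub> Y)))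
      (\<lambda>n. FA F (Kap H n (k - n) (X, Y)) \<cdot>\<^bsub>B\<^esub> ?M n) (\<lambda>n. inv_arrow B (?M n) \<cdot>\<^bsub>B\<^esub> FA F (\<pi> n))"
      by (rule F.target.bsys_iso_source[OF F.ef.F_bsys[OF \<pi>]]) auto
    then have "bsys B k (\<lambda>n. FO (Coh ?K n) X \<otimes>\<^bsub>B\<^esub> FO (Coh ?K (k - n)) Y) (FO (Coh ?K k) (X \<otimes>\<^bsub>T\<^esub> Y))
      (\<lambda>n. Kap ?K n (k - n) (X, Y)) (\<lambda>n. inv_arrow B (?M n) \<cdot>\<^bsub>B\<^esub> FA F (\<pi> n))"
      by simp
    then show "iso_arrow B s"
      by (rule Kunneth_iso_of_bsys[OF F.target.linear_category_axioms _ c(1,2)]) (rule c(3))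
  next
    fix t i assume t: "t \<in> Tri D"
    then show "Bd ?K i t \<in> hom B (FO (Coh ?K i) (snd t)) (FO (Coh ?K (Suc i)) (fst t))"
      using H.Tri_wf[OF t] by (simp add: hom_iff)
  next
    fix t t' f g i assume n: "(t, t', f, g) \<in> NatC D"
    then show "Bd ?K i t \<cdot>\<^bsub>B\<^esub> FA (Coh ?K i) g = FA (Coh ?K (Suc i)) f \<cdot>\<^bsub>B\<^esub> Bd ?K i t'"
      using H.NatC_wf[OF n] H.Bd_natural[OF n, of i] by (simp add: hom_iff flip: F.FA_Comp)
  next
    fix f assume "f \<in> MonC D"
    then show "monic B (FA (Coh ?K 0) f)"
      using H.MonC_wf H.MonC_monic F.ef.F_monic by simp
  next
    fix f g i assume "(f, g) \<in> ExA D"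
    then show "exact_at B (FA (Coh ?K i) f) (FA (Coh ?K i) g)"
      using H.ExA_wf H.ExA_exact[of f g i] F.ef.F_exact_at by simp
  next
    fix f t i assume "(f, t) \<in> ExB D"
    then show "exact_at B (FA (Coh ?K i) f) (Bd ?K i t)"
      using H.ExB_wf H.ExB_exact[of f t i] F.ef.F_exact_at by simp
  next
    fix f t i assume "(t, f) \<in> ExC D"
    then show "exact_at B (Bd ?K i t) (FA (Coh ?K (Suc i)) f)"
      using H.ExC_wf H.ExC_exact[of t f i] F.ef.F_exact_at by simp
  next
    fix f i assume "f \<in> IsoC D"
    then show "iso_arrow B (FA (Coh ?K i) f)"
      using H.IsoC_wf H.IsoC_iso[of f i] F.FA_iso by simp
  next
    fix t Y t' b c i j assume p: "(t, Y, t', b, c) \<in> ProdC D"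
    note w = H.ProdC_wf[OF p]
    then have b: "b \<in> Ar T" "iso_arrow A (FA (Coh H (i + j)) b)"
      using H.IsoC_wf[of b] H.IsoC_iso[of b "i + j"] by auto
    have [simp]: "fst t \<in> Ob T" "snd t \<in> Ob T" "fst t' \<in> Ob T" "snd t' \<in> Ob T" "Y \<in> Ob T"
      using w H.Tri_wf by auto
    have "FA F (Kap H (Suc i) j (fst t, Y)) \<cdot>\<^bsub>B\<^esub> (Mult F (?h (Suc i) (fst t), ?h j Y) \<cdot>\<^bsub>B\<^esub>
        (FA F (Bd H i t) \<odot>\<^bsub>B\<^esub> FA F (Id A (?h j Y)))) =
      FA F (Kap H (Suc i) j (fst t, Y) \<cdot>\<^bsub>A\<^esub> (Bd H i t \<odot>\<^bsub>A\<^esub> Id A (?h j Y))) \<cdot>\<^bsub>B\<^esub>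
        Mult F (?h i (snd t), ?h j Y)"
      using F.Mult_natural[of "Bd H i t" "Id A (?h j Y)"] w by (simp add: F.FA_Comp)
    also have "\<dots> = FA F (Bd H (i + j) t') \<cdot>\<^bsub>B\<^esub> (inv_arrow B (FA F (FA (Coh H (i + j)) b)) \<cdot>\<^bsub>B\<^esub>
          (FA F (FA (Coh H (i + j)) c) \<cdot>\<^bsub>B\<^esub> (FA F (Kap H i j (snd t, Y)) \<cdot>\<^bsub>B\<^esub>
            Mult F (?h i (snd t), ?h j Y))))"
      unfolding H.ProdC_eq[OF p] using w b by (simp add: F.FA_Comp F.FA_iso)
    finally show "Kap ?K (Suc i) j (fst t, Y) \<cdot>\<^bsub>B\<^esub> (Bd ?K i t \<odot>\<^bsub>B\<^esub> Id B (FO (Coh ?K j) Y)) =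
        Bd ?K (i + j) t' \<cdot>\<^bsub>B\<^esub> (inv_arrow B (FA (Coh ?K (i + j)) b) \<cdot>\<^bsub>B\<^esub>
          (FA (Coh ?K (i + j)) c \<cdot>\<^bsub>B\<^esub> Kap ?K i j (snd t, Y)))"
      using w b by simp
  qed
qed

section \<open>Cohomologies assembled from their components\<close>

context joint_tensor
begin

text \<open>Equations, exactness, monicity and invertibility are reflected by the projections. The
  Kuenneth axiom is reflected in its form by projections of a biproduct; for this the hypothesis
  \<open>P\<close> provides arrows of \<open>S\<close> whose components are such projections for the
  given cohomologies.\<close>

theorem reflect_bkunneth:
  fixes H :: "('x, 'y, 'o, 'a, 'h) rel_kunneth_scheme"
    and K :: "'i \<Rightarrow> ('x, 'y, 'p, 'b, 'k) rel_kunneth_scheme"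
  assumes D: "boundary_data T D" and K: "\<And>i. i \<in> I \<Longrightarrow> bkunneth T D (A i) (K i)"
    and FO: "\<And>n X. X \<in> Ob T \<Longrightarrow> FO (Coh H n) X \<in> Ob S"
    and FO_ext: "\<And>n. FO (Coh H n) \<in> extensional (Ob T)"
    and FA: "\<And>n f X Y. f \<in> hom T X Y \<Longrightarrow> FA (Coh H n) f \<in> hom S (FO (Coh H n) Y) (FO (Coh H n) X)"
    and FA_ext: "\<And>n. FA (Coh H n) \<in> extensional (Ar T)"
    and Kap: "\<And>n m X Y. X \<in> Ob T \<Longrightarrow> Y \<in> Ob T \<Longrightarrow> Kap H n m (X, Y) \<in>
        hom S (FO (Coh H n) X \<otimes>\<^bsub>S\<^esub> FO (Coh H m) Y) (FO (Coh H (n + m)) (X \<otimes>\<^bsub>T\<^esub> Y))"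
    and Kap_ext: "\<And>n m. Kap H n m \<in> extensional (Ob T \<times> Ob T)"
    and Ups: "Ups H \<in> hom S (FO (Coh H 0) \<one>\<^bsub>T\<^esub>) \<one>\<^bsub>S\<^esub>"
    and Bd: "\<And>n t. t \<in> Tri D \<Longrightarrow> Bd H n t \<in> hom S (FO (Coh H n) (snd t)) (FO (Coh H (Suc n)) (fst t))"
    and Bd_ext: "\<And>n. Bd H n \<in> extensional (Tri D)"
    and QF: "\<And>i n X. i \<in> I \<Longrightarrow> X \<in> Ob T \<Longrightarrow> Q i (FO (Coh H n) X) = FO (Coh (K i) n) X"
    and VF: "\<And>i n f. i \<in> I \<Longrightarrow> f \<in> Ar T \<Longrightarrow> V i (FA (Coh H n) f) = FA (Coh (K i) n) f"
    and VK: "\<And>i n m X Y. i \<in> I \<Longrightarrow> X \<in> Ob T \<Longrightarrow> Y \<in> Ob T \<Longrightarrow>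
        V i (Kap H n m (X, Y)) = Kap (K i) n m (X, Y)"
    and VU: "\<And>i. i \<in> I \<Longrightarrow> V i (Ups H) = Ups (K i)"
    and VB: "\<And>i n t. i \<in> I \<Longrightarrow> t \<in> Tri D \<Longrightarrow> V i (Bd H n t) = Bd (K i) n t"
    and P: "\<And>k X Y. X \<in> Ob T \<Longrightarrow> Y \<in> Ob T \<Longrightarrow> \<exists>\<pi>. (\<forall>n\<le>k. \<pi> n \<in>
        hom S (FO (Coh H k) (X \<otimes>\<^bsub>T\<^esub> Y)) (FO (Coh H n) X \<otimes>\<^bsub>S\<^esub> FO (Coh H (k - n)) Y)) \<and>
        (\<forall>i\<in>I. bsys (A i) k (\<lambda>n. FO (Coh (K i) n) X \<otimes>\<^bsub>A i\<^esub> FO (Coh (K i) (k - n)) Y)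
          (FO (Coh (K i) k) (X \<otimes>\<^bsub>T\<^esub> Y)) (\<lambda>n. Kap (K i) n (k - n) (X, Y)) (\<lambda>n. V i (\<pi> n)))"
  shows "bkunneth T D S H"
proof -
  interpret D: boundary_data T D by fact
  note kc = bkunneth.axioms(2)[OF K]
  have fa [simp]: "FA (Coh H n) f \<in> Ar S" "Dom S (FA (Coh H n) f) = FO (Coh H n) (Cod T f)"
    "Cod S (FA (Coh H n) f) = FO (Coh H n) (Dom T f)" if "f \<in> Ar T" for n f
    using FA[of f "Dom T f" "Cod T f" n] that by (auto simp: hom_iff)
  have kap [simp]: "Kap H n m (X, Y) \<in> Ar S"
    "Dom S (Kap H n m (X, Y)) = FO (Coh H n) X \<otimes>\<^bsub>S\<^esub> FO (Coh H m) Y"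
    "Cod S (Kap H n m (X, Y)) = FO (Coh H (n + m)) (X \<otimes>\<^bsub>T\<^esub> Y)" if "X \<in> Ob T" "Y \<in> Ob T" for n m X Y
    using Kap[OF that, of n m] by (auto simp: hom_iff)
  have ups [simp]: "Ups H \<in> Ar S" "Dom S (Ups H) = FO (Coh H 0) \<one>\<^bsub>T\<^esub>" "Cod S (Ups H) = \<one>\<^bsub>S\<^esub>"
    using Ups by (auto simp: hom_iff)
  have bd [simp]: "Bd H n t \<in> Ar S" "Dom S (Bd H n t) = FO (Coh H n) (snd t)"
    "Cod S (Bd H n t) = FO (Coh H (Suc n)) (fst t)" if "t \<in> Tri D" for n t
    using Bd[OF that, of n] by (auto simp: hom_iff)
  have tri [simp]: "fst t \<in> Ob T" "snd t \<in> Ob T" if "t \<in> Tri D" for t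
    using D.Tri_wf[OF that] by auto
  note [simp] = QF VF VK VU VB FO
  have iso: "iso_arrow S (FA (Coh H n) f)" if "f \<in> IsoC D" for n f
    by (rule reflect_iso) (use that D.IsoC_wf bkunneth.IsoC_iso[OF K] in auto)
  show ?thesis
  proof unfold_locales
    show "FA (Coh H i) (g \<cdot>\<^bsub>opposite T\<^esub> f) = FA (Coh H i) g \<cdot>\<^bsub>S\<^esub> FA (Coh H i) f"
      if "f \<in> hom (opposite T) X Y" "g \<in> hom (opposite T) Y Z" for i f g X Y Z
      by (rule eqI) (use that in \<open>auto simp: hom_iff V_Comp kunneth_cohomology.Coh_Comp[OF kc]\<close>)
    show "FA (Coh H i) (Id (opposite T) X) = Id S (FO (Coh H i) X)" if "X \<in> Ob (opposite T)" for i X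
      by (rule eqI) (use that in \<open>auto simp: kunneth_cohomology.Coh_simps[OF kc]\<close>)
    show "Kap H i j (X, Y) \<cdot>\<^bsub>S\<^esub> (FA (Coh H i) f \<odot>\<^bsub>S\<^esub> FA (Coh H j) g) =
        FA (Coh H (i + j)) (f \<odot>\<^bsub>T\<^esub> g) \<cdot>\<^bsub>S\<^esub> Kap H i j (X', Y')"
      if *: "f \<in> hom T X X'" "g \<in> hom T Y Y'" for f g X X' Y Y' i j
    proof -
      have [simp]: "f \<in> Ar T" "g \<in> Ar T" "Dom T f = X" "Dom T g = Y" "Cod T f = X'" "Cod T g = Y'"
        using * by (auto simp: hom_iff)
      have [simp]: "X \<in> Ob T" "Y \<in> Ob T" "X' \<in> Ob T" "Y' \<in> Ob T"
        using * D.Dom_Ob[of f] D.Dom_Ob[of g] D.Cod_Ob[of f] D.Cod_Ob[of g] by (auto simp: hom_iff)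
      show ?thesis
        by (rule eqI) (auto simp: V_Comp intro!: kunneth_cohomology.Kap_nat[OF kc] *)
    qed
    show "Kap H (i + j) k (X \<otimes>\<^bsub>T\<^esub> Y, Z) \<cdot>\<^bsub>S\<^esub> (Kap H i j (X, Y) \<odot>\<^bsub>S\<^esub> Id S (FO (Coh H k) Z)) =
        FA (Coh H (i + j + k)) (Assoc T X Y Z) \<cdot>\<^bsub>S\<^esub> (Kap H i (j + k) (X, Y \<otimes>\<^bsub>T\<^esub> Z) \<cdot>\<^bsub>S\<^esub>
          ((Id S (FO (Coh H i) X) \<odot>\<^bsub>S\<^esub> Kap H j k (Y, Z)) \<cdot>\<^bsub>S\<^esub>
            Assoc S (FO (Coh H i) X) (FO (Coh H j) Y) (FO (Coh H k) Z)))"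
      if "X \<in> Ob T" "Y \<in> Ob T" "Z \<in> Ob T" for X Y Z i j k
      by (rule eqI) (use that kunneth_cohomology.Kap_Assoc[OF kc that, of _ i j k] in
          \<open>auto simp: V_Comp add.assoc\<close>)
    show "iso_arrow S (Ups H)"
      by (rule reflect_iso) (auto intro: kunneth_cohomology.Ups_iso[OF kc])
    show "zero_object S (FO (Coh H i) \<one>\<^bsub>T\<^esub>)" if "i \<noteq> 0" for i
      by (rule reflect_zero) (use that in \<open>auto intro: kunneth_cohomology.Coh_One[OF kc]\<close>)
    show "Kap H 0 i (\<one>\<^bsub>T\<^esub>, X) = FA (Coh H i) (Lun T X) \<cdot>\<^bsub>S\<^esub>
          (Lun S (FO (Coh H i) X) \<cdot>\<^bsub>S\<^esub> (Ups H \<odot>\<^bsub>S\<^esub> Id S (FO (Coh H i) X)))" if "X \<in> Ob T" for X i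
      by (rule eqI) (use that in \<open>auto simp: V_Comp kunneth_cohomology.Kap_Lun[OF kc]\<close>)
    show "Kap H i 0 (X, \<one>\<^bsub>T\<^esub>) = FA (Coh H i) (Run T X) \<cdot>\<^bsub>S\<^esub>
          (Run S (FO (Coh H i) X) \<cdot>\<^bsub>S\<^esub> (Id S (FO (Coh H i) X) \<odot>\<^bsub>S\<^esub> Ups H))" if "X \<in> Ob T" for X i
      by (rule eqI) (use that in \<open>auto simp: V_Comp kunneth_cohomology.Kap_Run[OF kc]\<close>)
    show "FA (Coh H (i + j)) (Sym T X Y) \<cdot>\<^bsub>S\<^esub>
          (Kap H j i (Y, X) \<cdot>\<^bsub>S\<^esub> Sym S (FO (Coh H i) X) (FO (Coh H j) Y)) =
        Scale S ((-1) ^ (i * j)) (Kap H i j (X, Y))" if "X \<in> Ob T" "Y \<in> Ob T" for X Y i j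
      by (rule eqI)
        (use that in \<open>auto simp: V_Comp add.commute[of j i] kunneth_cohomology.Kap_Sym[OF kc]\<close>)
    show "iso_arrow S s" if XY: "X \<in> Ob T" "Y \<in> Ob T" and
      c: "is_coproduct S {(i, j). i + j = k} (\<lambda>(i, j). FO (Coh H i) X \<otimes>\<^bsub>S\<^esub> FO (Coh H j) Y) R \<iota>"
        "s \<in> hom S R (FO (Coh H k) (X \<otimes>\<^bsub>T\<^esub> Y))"
        "\<And>i j. i + j = k \<Longrightarrow> s \<cdot>\<^bsub>S\<^esub> \<iota> (i, j) = Kap H i j (X, Y)" for X Y k R \<iota> s
    proof -
      obtain \<pi> where \<pi>: "\<And>n. n \<le> k \<Longrightarrow> \<pi> n \<in>
        hom S (FO (Coh H k) (X \<otimes>\<^bsub>T\<^esub> Y)) (FO (Coh H n) X \<otimes>\<^bsub>S\<^esub> FO (Coh H (k - n)) Y)"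
        "\<And>i. i \<in> I \<Longrightarrow> bsys (A i) k (\<lambda>n. FO (Coh (K i) n) X \<otimes>\<^bsub>A i\<^esub> FO (Coh (K i) (k - n)) Y)
          (FO (Coh (K i) k) (X \<otimes>\<^bsub>T\<^esub> Y)) (\<lambda>n. Kap (K i) n (k - n) (X, Y)) (\<lambda>n. V i (\<pi> n))"
        using P[OF XY, of k] by blast
      have "bsys S k (\<lambda>n. FO (Coh H n) X \<otimes>\<^bsub>S\<^esub> FO (Coh H (k - n)) Y)
          (FO (Coh H k) (X \<otimes>\<^bsub>T\<^esub> Y)) (\<lambda>n. Kap H n (k - n) (X, Y)) \<pi>"
        by (rule reflect_bsys) (use XY \<pi> in \<open>auto simp: hom_iff\<close>)
      then show ?thesis
        by (rule Kunneth_iso_of_bsys[OF S.linear_category_axioms _ c(1,2)]) (rule c(3))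
    qed
    show "Bd H i t \<cdot>\<^bsub>S\<^esub> FA (Coh H i) g = FA (Coh H (Suc i)) f \<cdot>\<^bsub>S\<^esub> Bd H i t'"
      if n: "(t, t', f, g) \<in> NatC D" for t t' f g i
      by (rule eqI) (use D.NatC_wf[OF n] bkunneth.Bd_natural[OF K n] in \<open>auto simp: hom_iff V_Comp\<close>)
    show "monic S (FA (Coh H 0) f)" if "f \<in> MonC D" for f
      by (rule reflect_monic) (use that D.MonC_wf bkunneth.MonC_monic[OF K] in auto)
    show "exact_at S (FA (Coh H i) f) (FA (Coh H i) g)" if "(f, g) \<in> ExA D" for f g i
      by (rule reflect_exact_at) (use that D.ExA_wf[OF that] bkunneth.ExA_exact[OF K] in auto)
    show "exact_at S (FA (Coh H i) f) (Bd H i t)" if "(f, t) \<in> ExB D" for f t i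
      by (rule reflect_exact_at) (use that D.ExB_wf[OF that] bkunneth.ExB_exact[OF K] in auto)
    show "exact_at S (Bd H i t) (FA (Coh H (Suc i)) f)" if "(t, f) \<in> ExC D" for f t i
      by (rule reflect_exact_at) (use that D.ExC_wf[OF that] bkunneth.ExC_exact[OF K] in auto)
    show "iso_arrow S (FA (Coh H i) f)" if "f \<in> IsoC D" for f i by (rule iso[OF that])
    show "Kap H (Suc i) j (fst t, Y) \<cdot>\<^bsub>S\<^esub> (Bd H i t \<odot>\<^bsub>S\<^esub> Id S (FO (Coh H j) Y)) =
        Bd H (i + j) t' \<cdot>\<^bsub>S\<^esub> (inv_arrow S (FA (Coh H (i + j)) b) \<cdot>\<^bsub>S\<^esub>
          (FA (Coh H (i + j)) c \<cdot>\<^bsub>S\<^esub> Kap H i j (snd t, Y)))"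
      if p: "(t, Y, t', b, c) \<in> ProdC D" for t Y t' b c i j
    proof -
      note w = D.ProdC_wf[OF p]
      then have b: "b \<in> Ar T" "iso_arrow S (FA (Coh H (i + j)) b)"
        using D.IsoC_wf[of b] iso[of b "i + j"] by auto
      show ?thesis
        by (rule eqI) (use w b bkunneth.ProdC_eq[OF K p, where i = i and j = j] in
          \<open>auto simp: V_Comp V_iso(2)[symmetric]\<close>)
    qed
  qed (use assms in \<open>auto simp: hom_iff\<close>)
qed

end

section \<open>Models\<close>

text \<open>The choices are stored because a generated arrow has to be a function of the model.
  \<open>MBip\<close> holds the two injections at 0 and 1 and the two projections at 2 and 3; the
  biproduct object is the target of the first injection.\<close>

record ('o, 'a, 'u) model =
  MCat :: "('u, 'u) ltcat"
  MCoh :: "('o, 'a, 'u, 'u) rel_kunneth"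
  MKer :: "'u \<Rightarrow> 'u"
  MCok :: "'u \<Rightarrow> 'u"
  MBip :: "nat \<Rightarrow> 'u \<Rightarrow> 'u \<Rightarrow> 'u"

definition is_model :: "('o, 'a, 'z) tcat_scheme \<Rightarrow> ('o, 'a) bdata \<Rightarrow> ('o, 'a, 'u) model \<Rightarrow> bool" where
  "is_model T D M \<longleftrightarrow> ex_tensor_category (MCat M) \<and> bkunneth T D (MCat M) (MCoh M) \<and>
    (\<forall>f\<in>Ar (MCat M). is_kernel (MCat M) (MKer M f) f \<and> is_cokernel (MCat M) (MCok M f) f) \<and>
    (\<forall>x\<in>Ob (MCat M). \<forall>y\<in>Ob (MCat M).
      is_biproduct (MCat M) x y (Cod (MCat M) (MBip M 0 x y))
        (MBip M 0 x y) (MBip M 1 x y) (MBip M 2 x y) (MBip M 3 x y))"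

lemma model_exists:
  assumes A: "ex_tensor_category A" and H: "bkunneth T D A H"
  shows "\<exists>M. is_model T D M \<and> MCat M = A \<and> MCoh M = H"
proof -
  interpret A: ex_tensor_category A by fact
  obtain K where K: "\<And>f. f \<in> Ar A \<Longrightarrow> is_kernel A (K f) f" using A.ex_kernel by metis
  obtain L where L: "\<And>f. f \<in> Ar A \<Longrightarrow> is_cokernel A (L f) f" using A.ex_cokernel by metis
  have "\<exists>b :: nat \<Rightarrow> _. is_biproduct A x y (Cod A (b 0)) (b 0) (b 1) (b 2) (b 3)"
    if xy: "x \<in> Ob A" "y \<in> Ob A" for x y
  proof -
    obtain s i1 i2 p1 p2 where b: "is_biproduct A x y s i1 i2 p1 p2"
      using A.ex_biproduct[OF xy] by (elim exE)
    then have "s = Cod A i1" by (simp add: is_biproduct_def hom_iff)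
    then show ?thesis using b by (intro exI[of _ "\<lambda>n. [i1, i2, p1, p2] ! n"]) simp
  qed
  then have "\<exists>b :: nat \<Rightarrow> _. x \<in> Ob A \<and> y \<in> Ob A \<longrightarrow> is_biproduct A x y (Cod A (b 0)) (b 0) (b 1) (b 2) (b 3)"
    for x y by blast
  then obtain B :: "_ \<Rightarrow> _ \<Rightarrow> nat \<Rightarrow> _" where "\<And>x y. x \<in> Ob A \<and> y \<in> Ob A \<longrightarrow>
      is_biproduct A x y (Cod A (B x y 0)) (B x y 0) (B x y 1) (B x y 2) (B x y 3)"
    by metis
  then show ?thesis
    using A H K L
    by (intro exI[of _ "\<lparr>MCat = A, MCoh = H, MKer = K, MCok = L, MBip = (\<lambda>n x y. B x y n)\<rparr>"])
      (simp add: is_model_def)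
qed

text \<open>The components of the inverse Kuenneth isomorphisms; they are generators of the universal category
  because nothing else makes its Kuenneth maps invertible.\<close>

definition kproj :: "('o, 'a, 'z) tcat_scheme \<Rightarrow> ('o, 'a, 'u) model \<Rightarrow> nat \<Rightarrow> 'o \<Rightarrow> 'o \<Rightarrow> nat \<Rightarrow> 'u" where
  "kproj T M k X Y = (SOME \<pi>. bsys (MCat M) k
    (\<lambda>n. FO (Coh (MCoh M) n) X \<otimes>\<^bsub>MCat M\<^esub> FO (Coh (MCoh M) (k - n)) Y)
    (FO (Coh (MCoh M) k) (X \<otimes>\<^bsub>T\<^esub> Y)) (\<lambda>n. Kap (MCoh M) n (k - n) (X, Y)) \<pi>)"

text \<open>There are no generators for objects: the cohomology of \<open>X\<close> in degree
  \<open>i\<close> enters through \<open>GCoh i (Id T X)\<close>.\<close>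

datatype ('o, 'a) gen =
  GCoh nat 'a | GKap nat nat 'o 'o | GUps | GProj nat nat 'o 'o | GBd nat 'o 'o

primrec gval :: "('o, 'a, 'z) tcat_scheme \<Rightarrow> ('o, 'a, 'u) model \<Rightarrow> ('o, 'a) gen \<Rightarrow> 'u" where
  "gval T M (GCoh i f) = FA (Coh (MCoh M) i) f"
| "gval T M (GKap i j X Y) = Kap (MCoh M) i j (X, Y)"
| "gval T M GUps = Ups (MCoh M)"
| "gval T M (GProj k n X Y) = kproj T M k X Y n"
| "gval T M (GBd i X Y) = Bd (MCoh M) i (X, Y)"

definition gens :: "('o, 'a, 'z) tcat_scheme \<Rightarrow> ('o, 'a) bdata \<Rightarrow> ('o, 'a) gen set" where
  "gens T D = {GCoh i f | i f. f \<in> Ar T} \<union> {GKap i j X Y | i j X Y. X \<in> Ob T \<and> Y \<in> Ob T} \<union> {GUps} \<union>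
    {GProj k n X Y | k n X Y. n \<le> k \<and> X \<in> Ob T \<and> Y \<in> Ob T} \<union> {GBd i X Y | i X Y. (X, Y) \<in> Tri D}"

text \<open>The value of an arrow off the class of models is arbitrary, by \<open>cong\<close>. Objects are represented by
  their identities.\<close>

inductive_set arrs :: "('o, 'a, 'z) tcat_scheme \<Rightarrow> ('o, 'a) bdata \<Rightarrow> (('o, 'a, 'u) model \<Rightarrow> 'u) set"
  for T :: "('o, 'a, 'z) tcat_scheme" and D :: "('o, 'a) bdata" where
  gen: "g \<in> gens T D \<Longrightarrow> (\<lambda>M. gval T M g) \<in> arrs T D"
| cong: "f \<in> arrs T D \<Longrightarrow> (\<And>M. is_model T D M \<Longrightarrow> g M = f M) \<Longrightarrow> g \<in> arrs T D"
| dom: "f \<in> arrs T D \<Longrightarrow> (\<lambda>M. Id (MCat M) (Dom (MCat M) (f M))) \<in> arrs T D"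
| cod: "f \<in> arrs T D \<Longrightarrow> (\<lambda>M. Id (MCat M) (Cod (MCat M) (f M))) \<in> arrs T D"
| one: "(\<lambda>M. Id (MCat M) \<one>\<^bsub>MCat M\<^esub>) \<in> arrs T D"
| comp: "f \<in> arrs T D \<Longrightarrow> g \<in> arrs T D \<Longrightarrow>
    (\<And>M. is_model T D M \<Longrightarrow> Dom (MCat M) (g M) = Cod (MCat M) (f M)) \<Longrightarrow>
    (\<lambda>M. g M \<cdot>\<^bsub>MCat M\<^esub> f M) \<in> arrs T D"
| plus: "f \<in> arrs T D \<Longrightarrow> g \<in> arrs T D \<Longrightarrow>
    (\<And>M. is_model T D M \<Longrightarrow> Dom (MCat M) (g M) = Dom (MCat M) (f M) \<and>
      Cod (MCat M) (g M) = Cod (MCat M) (f M)) \<Longrightarrow>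
    (\<lambda>M. f M \<oplus>\<^bsub>MCat M\<^esub> g M) \<in> arrs T D"
| scale: "f \<in> arrs T D \<Longrightarrow> (\<lambda>M. Scale (MCat M) r (f M)) \<in> arrs T D"
| tensor: "f \<in> arrs T D \<Longrightarrow> g \<in> arrs T D \<Longrightarrow> (\<lambda>M. f M \<odot>\<^bsub>MCat M\<^esub> g M) \<in> arrs T D"
| assoc: "f \<in> arrs T D \<Longrightarrow> g \<in> arrs T D \<Longrightarrow> h \<in> arrs T D \<Longrightarrow>
    (\<lambda>M. Assoc (MCat M) (Dom (MCat M) (f M)) (Dom (MCat M) (g M)) (Dom (MCat M) (h M))) \<in> arrs T D"
| lun: "f \<in> arrs T D \<Longrightarrow> (\<lambda>M. Lun (MCat M) (Dom (MCat M) (f M))) \<in> arrs T D"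
| run: "f \<in> arrs T D \<Longrightarrow> (\<lambda>M. Run (MCat M) (Dom (MCat M) (f M))) \<in> arrs T D"
| sym: "f \<in> arrs T D \<Longrightarrow> g \<in> arrs T D \<Longrightarrow>
    (\<lambda>M. Sym (MCat M) (Dom (MCat M) (f M)) (Dom (MCat M) (g M))) \<in> arrs T D"
| ker: "f \<in> arrs T D \<Longrightarrow> (\<lambda>M. MKer M (f M)) \<in> arrs T D"
| cok: "f \<in> arrs T D \<Longrightarrow> (\<lambda>M. MCok M (f M)) \<in> arrs T D"
| bip: "f \<in> arrs T D \<Longrightarrow> g \<in> arrs T D \<Longrightarrow> n < 4 \<Longrightarrow>
    (\<lambda>M. MBip M n (Dom (MCat M) (f M)) (Dom (MCat M) (g M))) \<in> arrs T D"
| lift: "m \<in> arrs T D \<Longrightarrow> h \<in> arrs T D \<Longrightarrow>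
    (\<And>M. is_model T D M \<Longrightarrow> monic (MCat M) (m M) \<and> factors (MCat M) (h M) (m M)) \<Longrightarrow>
    (\<lambda>M. factor (MCat M) (h M) (m M)) \<in> arrs T D"
| ext: "e \<in> arrs T D \<Longrightarrow> h \<in> arrs T D \<Longrightarrow>
    (\<And>M. is_model T D M \<Longrightarrow> epic (MCat M) (e M) \<and> factors (dual (MCat M)) (h M) (e M)) \<Longrightarrow>
    (\<lambda>M. factor (dual (MCat M)) (h M) (e M)) \<in> arrs T D"


section \<open>The generated arrows fit into the universe\<close>

text \<open>Terms only serve to bound the number of generated arrows. So the side conditions of
  \<open>arrs\<close> are dropped, and all operations other than scaling and the unit are made
  ternary, with spare arguments filled by repetition.\<close>

datatype ('o, 'a) trm = TGen "('o, 'a) gen" | TOne | TScale rat "('o, 'a) trm"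
  | TOp nat "('o, 'a) trm" "('o, 'a) trm" "('o, 'a) trm"

text \<open>The position in the list is the code of the operation. The four biproduct arrows come
  last, so that their code is 13 plus the index in \<open>MBip\<close>.\<close>

definition opval :: "nat \<Rightarrow> ('o, 'a, 'u) model \<Rightarrow> 'u \<Rightarrow> 'u \<Rightarrow> 'u \<Rightarrow> 'u" where
  "opval n M f g h = (let A = MCat M; d = Dom A in
    [Id A (d f), Id A (Cod A f), g \<cdot>\<^bsub>A\<^esub> f, f \<oplus>\<^bsub>A\<^esub> g, f \<odot>\<^bsub>A\<^esub> g, Assoc A (d f) (d g) (d h), Lun A (d f),
     Run A (d f), Sym A (d f) (d g), MKer M f, MCok M f, factor A g f, factor (dual A) g f,
     MBip M 0 (d f) (d g), MBip M 1 (d f) (d g), MBip M 2 (d f) (d g), MBip M 3 (d f) (d g)] ! n)"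

primrec tval :: "('o, 'a, 'z) tcat_scheme \<Rightarrow> ('o, 'a) trm \<Rightarrow> ('o, 'a, 'u) model \<Rightarrow> 'u" where
  "tval T (TGen g) M = gval T M g"
| "tval T TOne M = Id (MCat M) \<one>\<^bsub>MCat M\<^esub>"
| "tval T (TScale r t) M = Scale (MCat M) r (tval T t M)"
| "tval T (TOp n a b c) M = opval n M (tval T a M) (tval T b M) (tval T c M)"

lemma tval_TOp:
  "tval T (TOp 0 a b c) M = Id (MCat M) (Dom (MCat M) (tval T a M))"
  "tval T (TOp 1 a b c) M = Id (MCat M) (Cod (MCat M) (tval T a M))"
  "tval T (TOp 2 a b c) M = tval T b M \<cdot>\<^bsub>MCat M\<^esub> tval T a M"
  "tval T (TOp 3 a b c) M = tval T a M \<oplus>\<^bsub>MCat M\<^esub> tval T b M"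
  "tval T (TOp 4 a b c) M = tval T a M \<odot>\<^bsub>MCat M\<^esub> tval T b M"
  "tval T (TOp 5 a b c) M = Assoc (MCat M) (Dom (MCat M) (tval T a M)) (Dom (MCat M) (tval T b M))
    (Dom (MCat M) (tval T c M))"
  "tval T (TOp 6 a b c) M = Lun (MCat M) (Dom (MCat M) (tval T a M))"
  "tval T (TOp 7 a b c) M = Run (MCat M) (Dom (MCat M) (tval T a M))"
  "tval T (TOp 8 a b c) M = Sym (MCat M) (Dom (MCat M) (tval T a M)) (Dom (MCat M) (tval T b M))"
  "tval T (TOp 9 a b c) M = MKer M (tval T a M)"
  "tval T (TOp 10 a b c) M = MCok M (tval T a M)"
  "tval T (TOp 11 a b c) M = factor (MCat M) (tval T b M) (tval T a M)"
  "tval T (TOp 12 a b c) M = factor (dual (MCat M)) (tval T b M) (tval T a M)"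
  "n < 4 \<Longrightarrow> tval T (TOp (13 + n) a b c) M =
    MBip M n (Dom (MCat M) (tval T a M)) (Dom (MCat M) (tval T b M))"
proof -
  assume "n < 4"
  then consider "n = 0" | "n = 1" | "n = 2" | "n = 3" by linarith
  then show "tval T (TOp (13 + n) a b c) M =
    MBip M n (Dom (MCat M) (tval T a M)) (Dom (MCat M) (tval T b M))"
    by cases (simp_all add: opval_def Let_def)
qed (simp_all add: opval_def Let_def)

text \<open>Agreement is claimed on models only, since \<open>cong\<close> leaves the values
  elsewhere arbitrary.\<close>

lemma arrs_terms:
  assumes "f \<in> arrs T D"
  shows "\<exists>t. \<forall>M. is_model T D M \<longrightarrow> f M = tval T t M"
  using assms
proof induction
  case (gen g) then show ?case by (intro exI[of _ "TGen g"]) simp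
next
  case (cong f g) then show ?case by metis
next
  case one then show ?case by (intro exI[of _ TOne]) simp
next
  case (scale f r)
  then obtain t where "\<forall>M. is_model T D M \<longrightarrow> f M = tval T t M" by blast
  then show ?case by (intro exI[of _ "TScale r t"]) simp
next
  case (dom f)
  then obtain t where "\<forall>M. is_model T D M \<longrightarrow> f M = tval T t M" by blast
  then show ?case by (intro exI[of _ "TOp 0 t t t"]) (auto simp only: tval_TOp)
next
  case (cod f)
  then obtain t where "\<forall>M. is_model T D M \<longrightarrow> f M = tval T t M" by blast
  then show ?case by (intro exI[of _ "TOp 1 t t t"]) (auto simp only: tval_TOp)
next
  case (lun f)
  then obtain t where "\<forall>M. is_model T D M \<longrightarrow> f M = tval T t M" by blast
  then show ?case by (intro exI[of _ "TOp 6 t t t"]) (auto simp only: tval_TOp)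
next
  case (run f)
  then obtain t where "\<forall>M. is_model T D M \<longrightarrow> f M = tval T t M" by blast
  then show ?case by (intro exI[of _ "TOp 7 t t t"]) (auto simp only: tval_TOp)
next
  case (ker f)
  then obtain t where "\<forall>M. is_model T D M \<longrightarrow> f M = tval T t M" by blast
  then show ?case by (intro exI[of _ "TOp 9 t t t"]) (auto simp only: tval_TOp)
next
  case (cok f)
  then obtain t where "\<forall>M. is_model T D M \<longrightarrow> f M = tval T t M" by blast
  then show ?case by (intro exI[of _ "TOp 10 t t t"]) (auto simp only: tval_TOp)
next
  case (comp f g)
  then obtain t s where "\<forall>M. is_model T D M \<longrightarrow> f M = tval T t M"
    "\<forall>M. is_model T D M \<longrightarrow> g M = tval T s M" by blast
  then show ?case by (intro exI[of _ "TOp 2 t s t"]) (auto simp only: tval_TOp)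
next
  case (plus f g)
  then obtain t s where "\<forall>M. is_model T D M \<longrightarrow> f M = tval T t M"
    "\<forall>M. is_model T D M \<longrightarrow> g M = tval T s M" by blast
  then show ?case by (intro exI[of _ "TOp 3 t s t"]) (auto simp only: tval_TOp)
next
  case (tensor f g)
  then obtain t s where "\<forall>M. is_model T D M \<longrightarrow> f M = tval T t M"
    "\<forall>M. is_model T D M \<longrightarrow> g M = tval T s M" by blast
  then show ?case by (intro exI[of _ "TOp 4 t s t"]) (auto simp only: tval_TOp)
next
  case (assoc f g h)
  then obtain t s r where "\<forall>M. is_model T D M \<longrightarrow> f M = tval T t M"
    "\<forall>M. is_model T D M \<longrightarrow> g M = tval T s M" "\<forall>M. is_model T D M \<longrightarrow> h M = tval T r M" by blast
  then show ?case by (intro exI[of _ "TOp 5 t s r"]) (auto simp only: tval_TOp)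
next
  case (sym f g)
  then obtain t s where "\<forall>M. is_model T D M \<longrightarrow> f M = tval T t M"
    "\<forall>M. is_model T D M \<longrightarrow> g M = tval T s M" by blast
  then show ?case by (intro exI[of _ "TOp 8 t s t"]) (auto simp only: tval_TOp)
next
  case (bip f g n)
  then obtain t s where "\<forall>M. is_model T D M \<longrightarrow> f M = tval T t M"
    "\<forall>M. is_model T D M \<longrightarrow> g M = tval T s M" by blast
  then show ?case by (intro exI[of _ "TOp (13 + n) t s t"]) (auto simp only: tval_TOp(14)[OF bip(3)])
next
  case (lift f g)
  then obtain t s where "\<forall>M. is_model T D M \<longrightarrow> f M = tval T t M"
    "\<forall>M. is_model T D M \<longrightarrow> g M = tval T s M" by blast
  then show ?case by (intro exI[of _ "TOp 11 t s t"]) (auto simp only: tval_TOp)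
next
  case (ext f g)
  then obtain t s where "\<forall>M. is_model T D M \<longrightarrow> f M = tval T t M"
    "\<forall>M. is_model T D M \<longrightarrow> g M = tval T s M" by blast
  then show ?case by (intro exI[of _ "TOp 12 t s t"]) (auto simp only: tval_TOp)
qed

lemma pairing_exists:
  assumes "infinite (UNIV :: 'u set)"
  shows "\<exists>p :: 'u \<times> 'u \<Rightarrow> 'u. inj p"
proof -
  have "\<exists>p :: 'u \<times> 'u \<Rightarrow> 'u. bij_betw p (UNIV \<times> UNIV) UNIV"
    using card_of_Times_same_infinite[OF assms] card_of_ordIso by blast
  then show ?thesis by (auto simp: bij_betw_def)
qed

text \<open>An infinite type absorbs pairs and natural numbers, hence lists. A term is coded by the
  list of a tag and the codes of its parts, with rational scalars entering through
  \<open>to_nat\<close>.\<close>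

lemma trm_inject:
  fixes eo :: "'o \<Rightarrow> 'u" and ea :: "'a \<Rightarrow> 'u"
  assumes inf: "infinite (UNIV :: 'u set)" and eo: "inj eo" and ea: "inj ea"
  shows "\<exists>e :: ('o, 'a) trm \<Rightarrow> 'u. inj e"
proof -
  obtain p :: "'u \<times> 'u \<Rightarrow> 'u" where p: "inj p" using pairing_exists[OF inf] by blast
  obtain n :: "nat \<Rightarrow> 'u" where n: "inj n" using infinite_countable_subset[OF inf] by blast
  \<comment> \<open>The tags \<open>n 0\<close> and \<open>n 1\<close> keep the empty list apart
    from the nonempty ones.\<close>
  define l :: "'u list \<Rightarrow> 'u" where "l = rec_list (p (n 0, n 0)) (\<lambda>x _ y. p (n 1, p (x, y)))"
  have l_simps: "l [] = p (n 0, n 0)" "l (x # xs) = p (n 1, p (x, l xs))" for x xs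
    by (simp_all add: l_def)
  have p' [simp]: "p x = p y \<longleftrightarrow> x = y" for x y using p by (simp add: inj_eq)
  have n' [simp]: "n x = n y \<longleftrightarrow> x = y" for x y using n by (simp add: inj_eq)
  have l' [simp]: "l xs = l ys \<longleftrightarrow> xs = ys" for xs ys
  proof (induction xs arbitrary: ys)
    case Nil then show ?case by (cases ys) (simp_all add: l_simps)
  next
    case (Cons x xs) then show ?case by (cases ys) (simp_all add: l_simps)
  qed
  have eo' [simp]: "eo x = eo y \<longleftrightarrow> x = y" for x y using eo by (simp add: inj_eq)
  have ea' [simp]: "ea x = ea y \<longleftrightarrow> x = y" for x y using ea by (simp add: inj_eq)
  define g :: "('o, 'a) gen \<Rightarrow> 'u" where
    "g = rec_gen (\<lambda>i f. l [n 0, n i, ea f]) (\<lambda>i j x y. l [n 1, n i, n j, eo x, eo y]) (l [n 2])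
      (\<lambda>i j x y. l [n 3, n i, n j, eo x, eo y]) (\<lambda>i x y. l [n 4, n i, eo x, eo y])"
  have g [simp]: "g a = g b \<longleftrightarrow> a = b" for a b
    by (cases a; cases b) (simp_all add: g_def)
  define e :: "('o, 'a) trm \<Rightarrow> 'u" where
    "e = rec_trm (\<lambda>x. l [n 0, g x]) (l [n 1]) (\<lambda>r _ x. l [n 2, n (to_nat r), x])
      (\<lambda>k _ _ _ x y z. l [n 3, n k, x, y, z])"
  have e_simps: "e (TGen x) = l [n 0, g x]" "e TOne = l [n 1]"
    "e (TScale r t) = l [n 2, n (to_nat r), e t]" "e (TOp k a b c) = l [n 3, n k, e a, e b, e c]"
    for x r t k a b c
    by (simp_all add: e_def)
  have "e s = e t \<longleftrightarrow> s = t" for s t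
  proof (induction s arbitrary: t)
    case (TGen x) then show ?case by (cases t) (simp_all add: e_simps)
  next
    case TOne then show ?case by (cases t) (simp_all add: e_simps)
  next
    case (TScale r s) then show ?case by (cases t) (simp_all add: e_simps)
  next
    case (TOp k a b c) then show ?case by (cases t) (simp_all add: e_simps)
  qed
  then show ?thesis by (auto simp: inj_def intro!: exI[of _ e])
qed

text \<open>Each generated arrow, restricted to the models, is the restricted value of some term.
  Choosing such a term and coding it is injective because the term determines the restricted
  arrow.\<close>

lemma arrs_inject:
  fixes T :: "('o, 'a, 'z) tcat_scheme" and eo :: "'o \<Rightarrow> 'u" and ea :: "'a \<Rightarrow> 'u"
  assumes "infinite (UNIV :: 'u set)" "inj eo" "inj ea"
  shows "\<exists>e :: (('o, 'a, 'u) model \<Rightarrow> 'u) \<Rightarrow> 'u.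
    inj_on e ((\<lambda>f. restrict f {M. is_model T D M}) ` arrs T D)"
proof -
  let ?MM = "{M :: ('o, 'a, 'u) model. is_model T D M}"
  obtain e :: "('o, 'a) trm \<Rightarrow> 'u" where e: "inj e" using trm_inject[OF assms] by blast
  have "\<exists>t. f = restrict (tval T t) ?MM" if "f \<in> (\<lambda>f. restrict f ?MM) ` arrs T D" for f
  proof -
    obtain f' where f': "f = restrict f' ?MM" "f' \<in> arrs T D" using \<open>f \<in> _\<close> by blast
    obtain t where "\<forall>M. is_model T D M \<longrightarrow> f' M = tval T t M" using arrs_terms[OF f'(2)] by blast
    then show ?thesis unfolding f'(1) by (intro exI[of _ t] restrict_ext) auto
  qed
  then obtain t where t: "\<And>f. f \<in> (\<lambda>f. restrict f ?MM) ` arrs T D \<Longrightarrow> f = restrict (tval T (t f)) ?MM"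
    by metis
  have "inj_on (\<lambda>f. e (t f)) ((\<lambda>f. restrict f ?MM) ` arrs T D)"
  proof (rule inj_onI)
    fix f g assume fg: "f \<in> (\<lambda>f. restrict f ?MM) ` arrs T D" "g \<in> (\<lambda>f. restrict f ?MM) ` arrs T D"
      and "e (t f) = e (t g)"
    then have "t f = t g" using e by (simp add: inj_eq)
    then show "f = g" using t[OF fg(1)] t[OF fg(2)] by simp
  qed
  then show ?thesis by blast
qed

section \<open>The universal category\<close>

text \<open>Injectivity of \<open>e\<close> concerns arrows restricted to the models, so families
  that agree on all models become one arrow of the universal category.\<close>

locale universal_category = boundary_data T D
  for T :: "('o, 'a, 'z) tcat_scheme" and D :: "('o, 'a) bdata" +
  fixes e :: "(('o, 'a, 'u) model \<Rightarrow> 'u) \<Rightarrow> 'u"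
  assumes e_inj: "inj_on e ((\<lambda>f. restrict f {M. is_model T D M}) ` arrs T D)"
begin

abbreviation MM :: "('o, 'a, 'u) model set" where "MM \<equiv> {M. is_model T D M}"

abbreviation RR :: "(('o, 'a, 'u) model \<Rightarrow> 'u) set" where "RR \<equiv> arrs T D"

text \<open>\<open>mk \<phi>\<close> is the code of the family \<open>\<phi>\<close>; \<open>v M\<close> and \<open>q M\<close> are the projections to the model \<open>M\<close>.\<close>

definition mk :: "(('o, 'a, 'u) model \<Rightarrow> 'u) \<Rightarrow> 'u" where
  "mk \<phi> = e (restrict \<phi> MM)"

definition v :: "('o, 'a, 'u) model \<Rightarrow> 'u \<Rightarrow> 'u" where
  "v M c = inv_into ((\<lambda>f. restrict f MM) ` RR) e c M"

definition q :: "('o, 'a, 'u) model \<Rightarrow> 'u \<Rightarrow> 'u" where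
  "q M c = Dom (MCat M) (v M c)"

lemma v_mk [simp]: "\<phi> \<in> RR \<Longrightarrow> M \<in> MM \<Longrightarrow> v M (mk \<phi>) = \<phi> M"
  unfolding v_def mk_def using inv_into_f_f[OF e_inj, of "restrict \<phi> MM"] by simp

lemma mk_cong: "(\<And>M. M \<in> MM \<Longrightarrow> \<phi> M = \<psi> M) \<Longrightarrow> mk \<phi> = mk \<psi>"
  unfolding mk_def by (rule arg_cong[where f = e], rule restrict_ext)

lemma mo_ex: "M \<in> MM \<Longrightarrow> ex_tensor_category (MCat M)"
  and mo_bk: "M \<in> MM \<Longrightarrow> bkunneth T D (MCat M) (MCoh M)"
  and mo_ker: "M \<in> MM \<Longrightarrow> f \<in> Ar (MCat M) \<Longrightarrow> is_kernel (MCat M) (MKer M f) f"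
  and mo_cok: "M \<in> MM \<Longrightarrow> f \<in> Ar (MCat M) \<Longrightarrow> is_cokernel (MCat M) (MCok M f) f"
  and mo_bip: "M \<in> MM \<Longrightarrow> x \<in> Ob (MCat M) \<Longrightarrow> y \<in> Ob (MCat M) \<Longrightarrow>
    is_biproduct (MCat M) x y (Cod (MCat M) (MBip M 0 x y))
      (MBip M 0 x y) (MBip M 1 x y) (MBip M 2 x y) (MBip M 3 x y)"
  by (simp_all add: is_model_def)

lemma mo_kc: "M \<in> MM \<Longrightarrow> kunneth_cohomology T (MCat M) (MCoh M)"
  using mo_bk bkunneth.axioms(2) by blast

lemma mo_ab: "M \<in> MM \<Longrightarrow> abelian_category (MCat M)"
  and mo_tc: "M \<in> MM \<Longrightarrow> tensor_category (MCat M)"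
  using mo_ex by (auto simp: ex_tensor_category_def)

lemma mo_lin: "M \<in> MM \<Longrightarrow> linear_category (MCat M)"
  using mo_ab by (auto simp: abelian_category_def)

lemma mo_cat: "M \<in> MM \<Longrightarrow> category (MCat M)"
  using mo_lin by (auto simp: linear_category_def)

lemma kproj_bsys:
  assumes "M \<in> MM" "X \<in> Ob T" "Y \<in> Ob T"
  shows "bsys (MCat M) k (\<lambda>n. FO (Coh (MCoh M) n) X \<otimes>\<^bsub>MCat M\<^esub> FO (Coh (MCoh M) (k - n)) Y)
    (FO (Coh (MCoh M) k) (X \<otimes>\<^bsub>T\<^esub> Y)) (\<lambda>n. Kap (MCoh M) n (k - n) (X, Y)) (kproj T M k X Y)"
  unfolding kproj_def using kunneth_cohomology.kunneth_bsys[OF mo_kc[OF assms(1)] assms(2,3)]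
  by (rule someI_ex)

lemma gval_Ar:
  assumes "g \<in> gens T D" "M \<in> MM"
  shows "gval T M g \<in> Ar (MCat M)"
proof -
  interpret H: bkunneth T D "MCat M" "MCoh M" by (rule mo_bk[OF assms(2)])
  show ?thesis
    using assms(1) H.target.bsysD(6)[OF kproj_bsys[OF assms(2)]] unfolding gens_def by auto
qed

lemma arrs_Ar: "\<phi> \<in> RR \<Longrightarrow> M \<in> MM \<Longrightarrow> \<phi> M \<in> Ar (MCat M)"
proof (induction rule: arrs.induct)
  case (gen g) then show ?case by (rule gval_Ar)
next
  case (lift m h)
  then show ?case
    using category.monic_factor(1)[OF mo_cat[OF lift.prems], of "m M" "h M"] by (auto simp: hom_iff)
next
  case (ext m h)
  then show ?case
    using category.monic_factor(1)[OF category_dual[OF mo_cat[OF ext.prems]], of "m M" "h M"]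
    by (auto simp: hom_iff)
next
  case (bip f g n)
  interpret A: ex_tensor_category "MCat M" by (rule mo_ex[OF bip.prems])
  from bip(3) consider "n = 0" | "n = 1" | "n = 2" | "n = 3" by linarith
  then show ?case
    using mo_bip[OF bip.prems, of "Dom (MCat M) (f M)" "Dom (MCat M) (g M)"] bip
    by cases (auto simp: is_biproduct_def hom_iff)
next
  case (ker f)
  then show ?case using mo_ker[OF ker.prems] by (auto simp: is_kernel_def)
next
  case (cok f)
  then show ?case using mo_cok[OF cok.prems] by (auto simp: is_cokernel_def)
next
  case (comp f g)
  interpret A: ex_tensor_category "MCat M" by (rule mo_ex[OF comp.prems])
  show ?case using comp by simp
next
  case (plus f g)
  interpret A: ex_tensor_category "MCat M" by (rule mo_ex[OF plus.prems])
  show ?case using plus by simp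
next
  case (dom f)
  interpret A: ex_tensor_category "MCat M" by (rule mo_ex[OF dom.prems])
  show ?case using dom by simp
next
  case (cod f)
  interpret A: ex_tensor_category "MCat M" by (rule mo_ex[OF cod.prems])
  show ?case using cod by simp
next
  case one
  interpret A: ex_tensor_category "MCat M" by (rule mo_ex[OF one.prems])
  show ?case by simp
next
  case (scale f r)
  interpret A: ex_tensor_category "MCat M" by (rule mo_ex[OF scale.prems])
  show ?case using scale by simp
next
  case (tensor f g)
  interpret A: ex_tensor_category "MCat M" by (rule mo_ex[OF tensor.prems])
  show ?case using tensor by simp
next
  case (assoc f g h)
  interpret A: ex_tensor_category "MCat M" by (rule mo_ex[OF assoc.prems])
  show ?case using assoc by simp
next
  case (lun f)
  interpret A: ex_tensor_category "MCat M" by (rule mo_ex[OF lun.prems])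
  show ?case using lun by simp
next
  case (run f)
  interpret A: ex_tensor_category "MCat M" by (rule mo_ex[OF run.prems])
  show ?case using run by simp
next
  case (sym f g)
  interpret A: ex_tensor_category "MCat M" by (rule mo_ex[OF sym.prems])
  show ?case using sym by simp
qed simp

text \<open>Since an object is an arrow all of whose components are identities, \<open>Ob\<close> is
  contained in \<open>Ar\<close>, \<open>Id\<close> is the identity map, and the tensor product of
  objects is given by the same formula as that of arrows. The object of a model underlying such a
  component is recovered by \<open>q\<close>.\<close>

definition A0 :: "('u, 'u) ltcat" where
  "A0 = \<lparr>Ob = {c \<in> mk ` RR. \<forall>M\<in>MM. v M c = Id (MCat M) (q M c)},
    Ar = mk ` RR,
    Dom = (\<lambda>c. mk (\<lambda>M. Id (MCat M) (Dom (MCat M) (v M c)))),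
    Cod = (\<lambda>c. mk (\<lambda>M. Id (MCat M) (Cod (MCat M) (v M c)))),
    Id = (\<lambda>c. c),
    Comp = (\<lambda>g f. mk (\<lambda>M. v M g \<cdot>\<^bsub>MCat M\<^esub> v M f)),
    TO = (\<lambda>x y. mk (\<lambda>M. v M x \<odot>\<^bsub>MCat M\<^esub> v M y)),
    TA = (\<lambda>x y. mk (\<lambda>M. v M x \<odot>\<^bsub>MCat M\<^esub> v M y)),
    One = mk (\<lambda>M. Id (MCat M) \<one>\<^bsub>MCat M\<^esub>),
    Assoc = (\<lambda>x y z. mk (\<lambda>M. Assoc (MCat M) (q M x) (q M y) (q M z))),
    Lun = (\<lambda>x. mk (\<lambda>M. Lun (MCat M) (q M x))),
    Run = (\<lambda>x. mk (\<lambda>M. Run (MCat M) (q M x))),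
    Sym = (\<lambda>x y. mk (\<lambda>M. Sym (MCat M) (q M x) (q M y))),
    Null = (\<lambda>x y. mk (\<lambda>M. Null (MCat M) (q M x) (q M y))),
    Plus = (\<lambda>f g. mk (\<lambda>M. v M f \<oplus>\<^bsub>MCat M\<^esub> v M g)),
    Scale = (\<lambda>r f. mk (\<lambda>M. Scale (MCat M) r (v M f)))\<rparr>"

lemma A0_Ar: "c \<in> Ar A0 \<longleftrightarrow> c \<in> mk ` RR"
  and A0_Ob: "c \<in> Ob A0 \<longleftrightarrow> c \<in> mk ` RR \<and> (\<forall>M\<in>MM. v M c = Id (MCat M) (q M c))"
  by (auto simp: A0_def)

lemma mk_Ar [simp]: "\<phi> \<in> RR \<Longrightarrow> mk \<phi> \<in> Ar A0"
  by (simp add: A0_Ar)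

lemma v_RR: "c \<in> Ar A0 \<Longrightarrow> (\<lambda>M. v M c) \<in> RR"
  unfolding A0_Ar by (auto intro: arrs.cong)

lemma v_Ar: "c \<in> Ar A0 \<Longrightarrow> M \<in> MM \<Longrightarrow> v M c \<in> Ar (MCat M)"
  using arrs_Ar[OF v_RR] by blast

lemma arr_eqI: "c \<in> Ar A0 \<Longrightarrow> c' \<in> Ar A0 \<Longrightarrow> (\<And>M. M \<in> MM \<Longrightarrow> v M c = v M c') \<Longrightarrow> c = c'"
  unfolding A0_Ar by (auto intro!: mk_cong)

lemma Ob_Ar: "x \<in> Ob A0 \<Longrightarrow> x \<in> Ar A0"
  by (simp add: A0_Ob A0_Ar)

lemma v_Ob: "x \<in> Ob A0 \<Longrightarrow> M \<in> MM \<Longrightarrow> v M x = Id (MCat M) (q M x)"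
  by (simp add: A0_Ob)

lemma q_Ob: "x \<in> Ob A0 \<Longrightarrow> M \<in> MM \<Longrightarrow> q M x \<in> Ob (MCat M)"
  unfolding q_def using v_Ar[OF Ob_Ar] category.Dom_Ob[OF mo_cat] by blast

lemma ob_eqI: "x \<in> Ob A0 \<Longrightarrow> y \<in> Ob A0 \<Longrightarrow> (\<And>M. M \<in> MM \<Longrightarrow> q M x = q M y) \<Longrightarrow> x = y"
  by (rule arr_eqI) (auto simp: Ob_Ar v_Ob)

lemma mk_Ob:
  assumes "\<phi> \<in> RR" "\<And>M. M \<in> MM \<Longrightarrow> \<phi> M = Id (MCat M) (x M)" "\<And>M. M \<in> MM \<Longrightarrow> x M \<in> Ob (MCat M)"
  shows "mk \<phi> \<in> Ob A0" "M \<in> MM \<Longrightarrow> q M (mk \<phi>) = x M"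
proof -
  show q: "q M (mk \<phi>) = x M" if "M \<in> MM" for M
    using assms that category.Id_simps(2)[OF mo_cat[OF that], of "x M"] unfolding q_def by simp
  show "mk \<phi> \<in> Ob A0" using assms q by (simp add: A0_Ob)
qed

lemma q_Dom [simp]:
  assumes "c \<in> Ar A0"
  shows "Dom A0 c \<in> Ob A0" "Cod A0 c \<in> Ob A0"
    "M \<in> MM \<Longrightarrow> q M (Dom A0 c) = Dom (MCat M) (v M c)"
    "M \<in> MM \<Longrightarrow> q M (Cod A0 c) = Cod (MCat M) (v M c)"
proof -
  have d: "Dom A0 c = mk (\<lambda>M. Id (MCat M) (Dom (MCat M) (v M c)))"
    "Cod A0 c = mk (\<lambda>M. Id (MCat M) (Cod (MCat M) (v M c)))"
    by (simp_all add: A0_def)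
  have ob: "Dom (MCat M) (v M c) \<in> Ob (MCat M)" "Cod (MCat M) (v M c) \<in> Ob (MCat M)" if "M \<in> MM" for M
    using v_Ar[OF assms that] category.Dom_Ob[OF mo_cat[OF that]] category.Cod_Ob[OF mo_cat[OF that]]
    by auto
  show "Dom A0 c \<in> Ob A0" "M \<in> MM \<Longrightarrow> q M (Dom A0 c) = Dom (MCat M) (v M c)"
    unfolding d
    by (rule mk_Ob[OF arrs.dom[OF v_RR[OF assms]], where x = "\<lambda>M. Dom (MCat M) (v M c)"]; use ob in simp)+
  show "Cod A0 c \<in> Ob A0" "M \<in> MM \<Longrightarrow> q M (Cod A0 c) = Cod (MCat M) (v M c)"
    unfolding d
    by (rule mk_Ob[OF arrs.cod[OF v_RR[OF assms]], where x = "\<lambda>M. Cod (MCat M) (v M c)"]; use ob in simp)+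
qed

lemma mk_hom:
  assumes "\<phi> \<in> RR" "x \<in> Ob A0" "y \<in> Ob A0"
    "\<And>M. M \<in> MM \<Longrightarrow> Dom (MCat M) (\<phi> M) = q M x" "\<And>M. M \<in> MM \<Longrightarrow> Cod (MCat M) (\<phi> M) = q M y"
  shows "mk \<phi> \<in> hom A0 x y"
proof -
  have "Dom A0 (mk \<phi>) = x" "Cod A0 (mk \<phi>) = y"
    by (rule ob_eqI; use assms in simp)+
  then show ?thesis using assms by (simp add: hom_iff)
qed

lemma hom_A0:
  assumes "c \<in> hom A0 x y"
  shows "c \<in> Ar A0" "x \<in> Ob A0" "y \<in> Ob A0" "(\<lambda>M. v M c) \<in> RR"
    "M \<in> MM \<Longrightarrow> v M c \<in> Ar (MCat M)" "M \<in> MM \<Longrightarrow> Dom (MCat M) (v M c) = q M x"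
    "M \<in> MM \<Longrightarrow> Cod (MCat M) (v M c) = q M y"
proof -
  have c: "c \<in> Ar A0" "Dom A0 c = x" "Cod A0 c = y" using assms by (auto simp: hom_iff)
  show "c \<in> Ar A0" "x \<in> Ob A0" "y \<in> Ob A0" "(\<lambda>M. v M c) \<in> RR"
    "M \<in> MM \<Longrightarrow> v M c \<in> Ar (MCat M)" "M \<in> MM \<Longrightarrow> Dom (MCat M) (v M c) = q M x"
    "M \<in> MM \<Longrightarrow> Cod (MCat M) (v M c) = q M y"
    using c v_RR v_Ar q_Dom[OF c(1)] by auto
qed

lemma A0_ops:
  "Id A0 x = x" "g \<cdot>\<^bsub>A0\<^esub> f = mk (\<lambda>M. v M g \<cdot>\<^bsub>MCat M\<^esub> v M f)"
  "x \<otimes>\<^bsub>A0\<^esub> y = mk (\<lambda>M. v M x \<odot>\<^bsub>MCat M\<^esub> v M y)" "f \<odot>\<^bsub>A0\<^esub> g = mk (\<lambda>M. v M f \<odot>\<^bsub>MCat M\<^esub> v M g)"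
  "\<one>\<^bsub>A0\<^esub> = mk (\<lambda>M. Id (MCat M) \<one>\<^bsub>MCat M\<^esub>)"
  "Assoc A0 x y z = mk (\<lambda>M. Assoc (MCat M) (q M x) (q M y) (q M z))"
  "Lun A0 x = mk (\<lambda>M. Lun (MCat M) (q M x))" "Run A0 x = mk (\<lambda>M. Run (MCat M) (q M x))"
  "Sym A0 x y = mk (\<lambda>M. Sym (MCat M) (q M x) (q M y))"
  "Null A0 x y = mk (\<lambda>M. Null (MCat M) (q M x) (q M y))"
  "f \<oplus>\<^bsub>A0\<^esub> g = mk (\<lambda>M. v M f \<oplus>\<^bsub>MCat M\<^esub> v M g)" "Scale A0 r f = mk (\<lambda>M. Scale (MCat M) r (v M f))"
  by (simp_all add: A0_def)

lemma bip_RR: "x \<in> Ob A0 \<Longrightarrow> y \<in> Ob A0 \<Longrightarrow> n < 4 \<Longrightarrow> (\<lambda>M. MBip M n (q M x) (q M y)) \<in> RR"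
  unfolding q_def by (rule arrs.bip[OF v_RR v_RR]) (auto intro: Ob_Ar)

text \<open>No rule generates zero arrows directly, and scaling by 0 only yields them between
  objects already joined by an arrow. The cross term of a biproduct, second projection after first
  injection, is the zero arrow between two arbitrary objects.\<close>

lemma Null_RR:
  assumes "x \<in> Ob A0" "y \<in> Ob A0"
  shows "(\<lambda>M. Null (MCat M) (q M x) (q M y)) \<in> RR"
proof -
  have b: "is_biproduct (MCat M) (q M x) (q M y) (Cod (MCat M) (MBip M 0 (q M x) (q M y)))
      (MBip M 0 (q M x) (q M y)) (MBip M 1 (q M x) (q M y)) (MBip M 2 (q M x) (q M y))
      (MBip M 3 (q M x) (q M y))" if "M \<in> MM" for M
    using mo_bip q_Ob assms that by blast
  have "(\<lambda>M. MBip M 3 (q M x) (q M y) \<cdot>\<^bsub>MCat M\<^esub> MBip M 0 (q M x) (q M y)) \<in> RR"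
    by (rule arrs.comp[OF bip_RR bip_RR]) (use assms b in \<open>auto simp: is_biproduct_def hom_iff\<close>)
  then show ?thesis by (rule arrs.cong) (use b in \<open>auto simp: is_biproduct_def\<close>)
qed

lemma structure_RR:
  assumes "x \<in> Ob A0" "y \<in> Ob A0" "z \<in> Ob A0"
  shows "(\<lambda>M. Assoc (MCat M) (q M x) (q M y) (q M z)) \<in> RR" "(\<lambda>M. Lun (MCat M) (q M x)) \<in> RR"
    "(\<lambda>M. Run (MCat M) (q M x)) \<in> RR" "(\<lambda>M. Sym (MCat M) (q M x) (q M y)) \<in> RR"
  unfolding q_def by (intro arrs.assoc arrs.lun arrs.run arrs.sym v_RR Ob_Ar assms)+

lemma TO_A0:
  assumes "x \<in> Ob A0" "y \<in> Ob A0"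
  shows "x \<otimes>\<^bsub>A0\<^esub> y \<in> Ob A0" "M \<in> MM \<Longrightarrow> q M (x \<otimes>\<^bsub>A0\<^esub> y) = q M x \<otimes>\<^bsub>MCat M\<^esub> q M y"
proof -
  have *: "(\<lambda>M. v M x \<odot>\<^bsub>MCat M\<^esub> v M y) \<in> RR" by (intro arrs.tensor v_RR Ob_Ar assms)
  have i: "v M x \<odot>\<^bsub>MCat M\<^esub> v M y = Id (MCat M) (q M x \<otimes>\<^bsub>MCat M\<^esub> q M y)"
    "q M x \<otimes>\<^bsub>MCat M\<^esub> q M y \<in> Ob (MCat M)" if "M \<in> MM" for M
    using assms that tensor_category.TA_Id[OF mo_tc] tensor_category.TO_Ob[OF mo_tc] q_Ob v_Ob by auto
  show "x \<otimes>\<^bsub>A0\<^esub> y \<in> Ob A0" "M \<in> MM \<Longrightarrow> q M (x \<otimes>\<^bsub>A0\<^esub> y) = q M x \<otimes>\<^bsub>MCat M\<^esub> q M y"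
    unfolding A0_ops
    by (rule mk_Ob[OF *, where x = "\<lambda>M. q M x \<otimes>\<^bsub>MCat M\<^esub> q M y"]; use i in simp)+
qed

lemma One_A0: "\<one>\<^bsub>A0\<^esub> \<in> Ob A0" "M \<in> MM \<Longrightarrow> q M \<one>\<^bsub>A0\<^esub> = \<one>\<^bsub>MCat M\<^esub>"
  unfolding A0_ops
  by (rule mk_Ob[OF arrs.one, where x = "\<lambda>M. \<one>\<^bsub>MCat M\<^esub>"]; use tensor_category.One_Ob[OF mo_tc] in simp)+

lemma comp_RR:
  assumes "f \<in> hom A0 x y" "g \<in> hom A0 y z"
  shows "(\<lambda>M. v M g \<cdot>\<^bsub>MCat M\<^esub> v M f) \<in> RR"
  by (rule arrs.comp) (use hom_A0[OF assms(1)] hom_A0[OF assms(2)] in simp_all)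

lemma plus_RR:
  assumes "f \<in> hom A0 x y" "g \<in> hom A0 x y"
  shows "(\<lambda>M. v M f \<oplus>\<^bsub>MCat M\<^esub> v M g) \<in> RR"
  by (rule arrs.plus) (use hom_A0[OF assms(1)] hom_A0[OF assms(2)] in simp_all)

lemma A0_joint_abelian: "joint_abelian A0 MM MCat q v"
proof (rule joint_abelian.intro)
  show "abelian_category (MCat M)" if "M \<in> MM" for M by (rule mo_ab[OF that])
  show "Dom A0 f \<in> Ob A0 \<and> Cod A0 f \<in> Ob A0" if "f \<in> Ar A0" for f using that by simp
  show "Id A0 x \<in> hom A0 x x" if x: "x \<in> Ob A0" for x
  proof -
    have "Dom A0 x = x" "Cod A0 x = x"
      by (rule ob_eqI; use x Ob_Ar v_Ob q_Ob category.Id_simps[OF mo_cat] in simp)+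
    then show ?thesis using x by (simp add: A0_ops hom_iff Ob_Ar)
  qed
  show "v M (Id A0 x) = Id (MCat M) (q M x)" if "M \<in> MM" "x \<in> Ob A0" for M x
    using that by (simp add: A0_ops v_Ob)
  show "q M x \<in> Ob (MCat M)" if "M \<in> MM" "x \<in> Ob A0" for M x using q_Ob that by blast
  show "v M f \<in> hom (MCat M) (q M x) (q M y)" if "M \<in> MM" "f \<in> hom A0 x y" for M f x y
    using hom_A0[OF that(2)] that(1) by (simp add: hom_iff)
  show "Null A0 x y \<in> hom A0 x y" "M \<in> MM \<Longrightarrow> v M (Null A0 x y) = Null (MCat M) (q M x) (q M y)"
    if xy: "x \<in> Ob A0" "y \<in> Ob A0" for M x y
    unfolding A0_ops
    by (rule mk_hom[OF Null_RR[OF xy] xy]; use xy q_Ob linear_category.Null_simps[OF mo_lin] in simp)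
      (simp add: Null_RR[OF xy])
  show "f = g" if "f \<in> hom A0 x y" "g \<in> hom A0 x y" "\<And>M. M \<in> MM \<Longrightarrow> v M f = v M g" for f g x y
    by (rule arr_eqI) (use that hom_A0 in auto)
next
  fix f g x y z assume fg: "f \<in> hom A0 x y" "g \<in> hom A0 y z"
  note f = hom_A0[OF fg(1)] and g = hom_A0[OF fg(2)]
  show "g \<cdot>\<^bsub>A0\<^esub> f \<in> hom A0 x z" unfolding A0_ops
    by (rule mk_hom[OF comp_RR[OF fg]]) (use f g category.comp_simps[OF mo_cat] in auto)
  show "v M (g \<cdot>\<^bsub>A0\<^esub> f) = v M g \<cdot>\<^bsub>MCat M\<^esub> v M f" if "M \<in> MM" for M
    unfolding A0_ops using comp_RR[OF fg] that by simp
next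
  fix f g x y assume fg: "f \<in> hom A0 x y" "g \<in> hom A0 x y"
  note f = hom_A0[OF fg(1)] and g = hom_A0[OF fg(2)]
  show "f \<oplus>\<^bsub>A0\<^esub> g \<in> hom A0 x y" unfolding A0_ops
    by (rule mk_hom[OF plus_RR[OF fg]]) (use f g linear_category.Plus_simps[OF mo_lin] in auto)
  show "v M (f \<oplus>\<^bsub>A0\<^esub> g) = v M f \<oplus>\<^bsub>MCat M\<^esub> v M g" if "M \<in> MM" for M
    unfolding A0_ops using plus_RR[OF fg] that by simp
next
  fix f x y r assume fg: "f \<in> hom A0 x y"
  note f = hom_A0[OF fg(1)]
  show "Scale A0 r f \<in> hom A0 x y" unfolding A0_ops
    by (rule mk_hom[OF arrs.scale[OF f(4)]]) (use f linear_category.Scale_simps[OF mo_lin] in auto)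
  show "v M (Scale A0 r f) = Scale (MCat M) r (v M f)" if "M \<in> MM" for M
    unfolding A0_ops using arrs.scale[OF f(4)] that by simp
next
  \<comment> \<open>The source of a kernel of an identity is a zero object, and the identity of the
    unit object is at hand in every model.\<close>
  define k where "k = mk (\<lambda>M. MKer M (Id (MCat M) \<one>\<^bsub>MCat M\<^esub>))"
  have R: "(\<lambda>M. MKer M (Id (MCat M) \<one>\<^bsub>MCat M\<^esub>)) \<in> RR" by (intro arrs.ker arrs.one)
  have "zero_object (MCat M) (q M (Dom A0 k))" if M: "M \<in> MM" for M
  proof -
    interpret A: ex_tensor_category "MCat M" by (rule mo_ex[OF M])
    let ?k = "MKer M (Id (MCat M) \<one>\<^bsub>MCat M\<^esub>)"
    have ker: "is_kernel (MCat M) ?k (Id (MCat M) \<one>\<^bsub>MCat M\<^esub>)" using mo_ker[OF M] by simp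
    note k' = A.kernel_simps[OF ker]
    have "Id (MCat M) (Dom (MCat M) ?k) = Null (MCat M) (Dom (MCat M) ?k) (Dom (MCat M) ?k)"
      by (rule A.monic_cancel[OF A.kernel_monic[OF ker]]) (use k' in auto)
    then show ?thesis using R M k' by (simp add: k_def A.zero_object_iff)
  qed
  then show "\<exists>z\<in>Ob A0. \<forall>M\<in>MM. zero_object (MCat M) (q M z)"
    using R by (intro bexI[of _ "Dom A0 k"]) (auto simp: k_def)
next
  fix x y assume xy: "x \<in> Ob A0" "y \<in> Ob A0"
  let ?b = "\<lambda>n M. MBip M n (q M x) (q M y)"
  have R: "?b n \<in> RR" if "n < 4" for n by (rule bip_RR[OF xy that])
  have b: "is_biproduct (MCat M) (q M x) (q M y) (Cod (MCat M) (?b 0 M))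
      (?b 0 M) (?b 1 M) (?b 2 M) (?b 3 M)" if "M \<in> MM" for M
    using mo_bip q_Ob xy that by blast
  then have b': "Dom (MCat M) (?b 0 M) = q M x" "Dom (MCat M) (?b 1 M) = q M y"
    "Cod (MCat M) (?b 2 M) = q M x" "Cod (MCat M) (?b 3 M) = q M y"
    "Cod (MCat M) (?b 1 M) = Cod (MCat M) (?b 0 M)" "Dom (MCat M) (?b 2 M) = Cod (MCat M) (?b 0 M)"
    "Dom (MCat M) (?b 3 M) = Cod (MCat M) (?b 0 M)" if "M \<in> MM" for M
    using that by (auto simp: is_biproduct_def hom_iff)
  let ?s = "Cod A0 (mk (?b 0))"
  have s: "?s \<in> Ob A0" "\<And>M. M \<in> MM \<Longrightarrow> q M ?s = Cod (MCat M) (?b 0 M)" using R[of 0] by simp_all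
  have "mk (?b 0) \<in> hom A0 x ?s" "mk (?b 1) \<in> hom A0 y ?s" "mk (?b 2) \<in> hom A0 ?s x"
    "mk (?b 3) \<in> hom A0 ?s y"
    by (rule mk_hom[OF R _ _]; use s xy b' in simp)+
  then show "\<exists>s i1 i2 p1 p2. s \<in> Ob A0 \<and> i1 \<in> hom A0 x s \<and> i2 \<in> hom A0 y s \<and> p1 \<in> hom A0 s x \<and>
      p2 \<in> hom A0 s y \<and>
      (\<forall>M\<in>MM. is_biproduct (MCat M) (q M x) (q M y) (q M s) (v M i1) (v M i2) (v M p1) (v M p2))"
    using s b R
    by (intro exI[of _ ?s] exI[of _ "mk (?b 0)"] exI[of _ "mk (?b 1)"] exI[of _ "mk (?b 2)"]
      exI[of _ "mk (?b 3)"]) (simp add: R)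
next
  fix f assume f: "f \<in> Ar A0"
  have R: "(\<lambda>M. MKer M (v M f)) \<in> RR" "(\<lambda>M. MCok M (v M f)) \<in> RR"
    by (intro arrs.ker arrs.cok v_RR f)+
  have k: "is_kernel (MCat M) (MKer M (v M f)) (v M f)" "is_cokernel (MCat M) (MCok M (v M f)) (v M f)"
    if "M \<in> MM" for M
    using mo_ker[OF that] mo_cok[OF that] v_Ar[OF f that] by auto
  have "Cod A0 (mk (\<lambda>M. MKer M (v M f))) = Dom A0 f"
    by (rule ob_eqI) (use f R k in \<open>auto simp: is_kernel_def\<close>)
  then show "\<exists>k\<in>Ar A0. Cod A0 k = Dom A0 f \<and> (\<forall>M\<in>MM. is_kernel (MCat M) (v M k) (v M f))"
    using R k by (intro bexI[of _ "mk (\<lambda>M. MKer M (v M f))"]) auto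
  have "Dom A0 (mk (\<lambda>M. MCok M (v M f))) = Cod A0 f"
    by (rule ob_eqI) (use f R k in \<open>auto simp: is_cokernel_def\<close>)
  then show "\<exists>k\<in>Ar A0. Dom A0 k = Cod A0 f \<and> (\<forall>M\<in>MM. is_cokernel (MCat M) (v M k) (v M f))"
    using R k by (intro bexI[of _ "mk (\<lambda>M. MCok M (v M f))"]) auto
next
  fix m h assume mh: "m \<in> Ar A0" "h \<in> Ar A0" "Cod A0 h = Cod A0 m"
    and f: "\<And>M. M \<in> MM \<Longrightarrow> monic (MCat M) (v M m) \<and> factors (MCat M) (v M h) (v M m)"
  let ?u = "\<lambda>M. factor (MCat M) (v M h) (v M m)"
  \<comment> \<open>The guard of the rule \<open>lift\<close> is the hypothesis itself: in every
    model the factorisation through a monic exists.\<close>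
  have R: "?u \<in> RR" by (rule arrs.lift) (use f mh in \<open>auto intro: v_RR\<close>)
  have u: "?u M \<in> hom (MCat M) (Dom (MCat M) (v M h)) (Dom (MCat M) (v M m))"
    "v M m \<cdot>\<^bsub>MCat M\<^esub> ?u M = v M h" if "M \<in> MM" for M
    using category.monic_factor[OF mo_cat[OF that]] f[OF that] by blast+
  have hom: "mk ?u \<in> hom A0 (Dom A0 h) (Dom A0 m)"
    by (rule mk_hom[OF R]) (use u mh in \<open>auto simp: hom_iff\<close>)
  moreover have "m \<cdot>\<^bsub>A0\<^esub> mk ?u = h"
  proof -
    have "m \<in> hom A0 (Dom A0 m) (Cod A0 m)" using mh by (simp add: hom_iff)
    note c = comp_RR[OF hom this]
    show ?thesis unfolding A0_ops
      by (rule arr_eqI[OF mk_Ar[OF c] mh(2)]) (use c R u in simp)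
  qed
  ultimately show "\<exists>u\<in>hom A0 (Dom A0 h) (Dom A0 m). m \<cdot>\<^bsub>A0\<^esub> u = h" by blast
next
  fix m h assume mh: "m \<in> Ar A0" "h \<in> Ar A0" "Dom A0 h = Dom A0 m"
    and f: "\<And>M. M \<in> MM \<Longrightarrow> epic (MCat M) (v M m) \<and> factors (dual (MCat M)) (v M h) (v M m)"
  let ?u = "\<lambda>M. factor (dual (MCat M)) (v M h) (v M m)"
  have R: "?u \<in> RR" by (rule arrs.ext) (use f mh in \<open>auto intro: v_RR\<close>)
  have u: "?u M \<in> hom (MCat M) (Cod (MCat M) (v M m)) (Cod (MCat M) (v M h))"
    "?u M \<cdot>\<^bsub>MCat M\<^esub> v M m = v M h" if "M \<in> MM" for M
    using category.monic_factor[OF category_dual[OF mo_cat[OF that]], of "v M m" "v M h"] f[OF that] by auto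
  have hom: "mk ?u \<in> hom A0 (Cod A0 m) (Cod A0 h)"
    by (rule mk_hom[OF R]) (use u mh in \<open>auto simp: hom_iff\<close>)
  moreover have "mk ?u \<cdot>\<^bsub>A0\<^esub> m = h"
  proof -
    have "m \<in> hom A0 (Dom A0 m) (Cod A0 m)" using mh by (simp add: hom_iff)
    note c = comp_RR[OF this hom]
    show ?thesis unfolding A0_ops
      by (rule arr_eqI[OF mk_Ar[OF c] mh(2)]) (use c R u in simp)
  qed
  ultimately show "\<exists>u\<in>hom A0 (Cod A0 m) (Cod A0 h). u \<cdot>\<^bsub>A0\<^esub> m = h" by blast
qed

lemma A0_joint_tensor: "joint_tensor A0 MM MCat q v"
proof (rule joint_tensor.intro[OF A0_joint_abelian], rule joint_tensor_axioms.intro)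
  show "ex_tensor_category (MCat M)" if "M \<in> MM" for M by (rule mo_ex[OF that])
  show "\<one>\<^bsub>A0\<^esub> \<in> Ob A0" "M \<in> MM \<Longrightarrow> q M \<one>\<^bsub>A0\<^esub> = \<one>\<^bsub>MCat M\<^esub>" for M by (fact One_A0)+
  show "x \<otimes>\<^bsub>A0\<^esub> y \<in> Ob A0" "M \<in> MM \<Longrightarrow> q M (x \<otimes>\<^bsub>A0\<^esub> y) = q M x \<otimes>\<^bsub>MCat M\<^esub> q M y"
    if "x \<in> Ob A0" "y \<in> Ob A0" for x y M
    using TO_A0[OF that] by blast+
  show "f \<odot>\<^bsub>A0\<^esub> g \<in> hom A0 (x \<otimes>\<^bsub>A0\<^esub> y) (x' \<otimes>\<^bsub>A0\<^esub> y')"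
    if "f \<in> hom A0 x x'" "g \<in> hom A0 y y'" for f g x y x' y'
    unfolding A0_ops(4)
    by (rule mk_hom[OF arrs.tensor]; use hom_A0[OF that(1)] hom_A0[OF that(2)]
      tensor_category.TA_simps[OF mo_tc] TO_A0 in simp)
  show "v M (f \<odot>\<^bsub>A0\<^esub> g) = v M f \<odot>\<^bsub>MCat M\<^esub> v M g" if "M \<in> MM" "f \<in> Ar A0" "g \<in> Ar A0" for M f g
    unfolding A0_ops using that by (simp add: arrs.tensor v_RR)
  fix x y z assume xyz: "x \<in> Ob A0" "y \<in> Ob A0" "z \<in> Ob A0"
  note R = structure_RR[OF xyz]
  show "Assoc A0 x y z \<in> hom A0 ((x \<otimes>\<^bsub>A0\<^esub> y) \<otimes>\<^bsub>A0\<^esub> z) (x \<otimes>\<^bsub>A0\<^esub> (y \<otimes>\<^bsub>A0\<^esub> z))"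
    unfolding A0_ops(6)
    by (rule mk_hom[OF R(1)]; use xyz q_Ob tensor_category.Assoc_simps[OF mo_tc] TO_A0 in simp)
  show "Lun A0 x \<in> hom A0 (\<one>\<^bsub>A0\<^esub> \<otimes>\<^bsub>A0\<^esub> x) x"
    unfolding A0_ops(7)
    by (rule mk_hom[OF R(2)]; use xyz q_Ob tensor_category.Lun_simps[OF mo_tc] TO_A0 One_A0 in simp)
  show "Run A0 x \<in> hom A0 (x \<otimes>\<^bsub>A0\<^esub> \<one>\<^bsub>A0\<^esub>) x"
    unfolding A0_ops(8)
    by (rule mk_hom[OF R(3)]; use xyz q_Ob tensor_category.Run_simps[OF mo_tc] TO_A0 One_A0 in simp)
  show "Sym A0 x y \<in> hom A0 (x \<otimes>\<^bsub>A0\<^esub> y) (y \<otimes>\<^bsub>A0\<^esub> x)"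
    unfolding A0_ops(9)
    by (rule mk_hom[OF R(4)]; use xyz q_Ob tensor_category.Sym_simps[OF mo_tc] TO_A0 in simp)
  fix M assume "M \<in> MM"
  then show "v M (Assoc A0 x y z) = Assoc (MCat M) (q M x) (q M y) (q M z)"
    "v M (Lun A0 x) = Lun (MCat M) (q M x)" "v M (Run A0 x) = Run (MCat M) (q M x)"
    "v M (Sym A0 x y) = Sym (MCat M) (q M x) (q M y)"
    unfolding A0_ops using R by simp_all
qed

declare q_Dom(3,4) [simp del]

sublocale U: joint_tensor A0 MM MCat q v by (rule A0_joint_tensor)

definition UU :: "('o, 'a, 'u, 'u) rel_kunneth" where
  "UU = \<lparr>Coh = (\<lambda>i. \<lparr>FO = (\<lambda>X\<in>Ob T. mk (\<lambda>M. gval T M (GCoh i (Id T X)))),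
      FA = (\<lambda>f\<in>Ar T. mk (\<lambda>M. gval T M (GCoh i f)))\<rparr>),
    Kap = (\<lambda>i j. \<lambda>(X, Y)\<in>Ob T \<times> Ob T. mk (\<lambda>M. gval T M (GKap i j X Y))),
    Ups = mk (\<lambda>M. gval T M GUps),
    Bd = (\<lambda>i. \<lambda>t\<in>Tri D. mk (\<lambda>M. gval T M (GBd i (fst t) (snd t))))\<rparr>"

lemma gens_in [simp]:
  "f \<in> Ar T \<Longrightarrow> GCoh i f \<in> gens T D" "X \<in> Ob T \<Longrightarrow> Y \<in> Ob T \<Longrightarrow> GKap i j X Y \<in> gens T D"
  "GUps \<in> gens T D" "n \<le> k \<Longrightarrow> X \<in> Ob T \<Longrightarrow> Y \<in> Ob T \<Longrightarrow> GProj k n X Y \<in> gens T D"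
  "t \<in> Tri D \<Longrightarrow> GBd i (fst t) (snd t) \<in> gens T D"
  by (auto simp: gens_def)

lemma v_UU:
  assumes "M \<in> MM"
  shows "f \<in> Ar T \<Longrightarrow> v M (FA (Coh UU i) f) = FA (Coh (MCoh M) i) f"
    "X \<in> Ob T \<Longrightarrow> Y \<in> Ob T \<Longrightarrow> v M (Kap UU i j (X, Y)) = Kap (MCoh M) i j (X, Y)"
    "v M (Ups UU) = Ups (MCoh M)"
    "t \<in> Tri D \<Longrightarrow> v M (Bd UU i t) = Bd (MCoh M) i t"
  using assms v_mk[OF arrs.gen assms] by (simp_all add: UU_def del: gval.simps) simp_all

lemma UU_Ar:
  "f \<in> Ar T \<Longrightarrow> FA (Coh UU i) f \<in> Ar A0"
  "X \<in> Ob T \<Longrightarrow> Y \<in> Ob T \<Longrightarrow> Kap UU i j (X, Y) \<in> Ar A0"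
  "Ups UU \<in> Ar A0"
  "t \<in> Tri D \<Longrightarrow> Bd UU i t \<in> Ar A0"
  using mk_Ar[OF arrs.gen] by (simp_all add: UU_def del: gval.simps)

lemma FO_UU:
  assumes "X \<in> Ob T"
  shows "FO (Coh UU i) X \<in> Ob A0" "M \<in> MM \<Longrightarrow> q M (FO (Coh UU i) X) = FO (Coh (MCoh M) i) X"
proof -
  have e: "FO (Coh UU i) X = mk (\<lambda>M. gval T M (GCoh i (Id T X)))" using assms by (simp add: UU_def)
  have i: "gval T M (GCoh i (Id T X)) = Id (MCat M) (FO (Coh (MCoh M) i) X)"
    "FO (Coh (MCoh M) i) X \<in> Ob (MCat M)" if "M \<in> MM" for M
    using kunneth_cohomology.Coh_simps[OF mo_kc[OF that]] assms by auto
  show "FO (Coh UU i) X \<in> Ob A0" "M \<in> MM \<Longrightarrow> q M (FO (Coh UU i) X) = FO (Coh (MCoh M) i) X"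
    unfolding e
    by (rule mk_Ob[OF arrs.gen, where x = "\<lambda>M. FO (Coh (MCoh M) i) X"];
      use assms i in \<open>simp del: gval.simps\<close>)+
qed

lemma UU_homI:
  assumes "c \<in> Ar A0" "x \<in> Ob A0" "y \<in> Ob A0"
    "\<And>M. M \<in> MM \<Longrightarrow> Dom (MCat M) (v M c) = q M x" "\<And>M. M \<in> MM \<Longrightarrow> Cod (MCat M) (v M c) = q M y"
  shows "c \<in> hom A0 x y"
proof -
  have "Dom A0 c = x" "Cod A0 c = y" by (rule ob_eqI; use assms in \<open>simp flip: U.V_simps(2,3)\<close>)+
  then show ?thesis using assms by (simp add: hom_iff)
qed

text \<open>Its component at a model is the cohomology of that model, so the axioms are reflected
  from all models at once; the generators \<open>GProj\<close> supply the projections asked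
  for.\<close>

theorem UU_bkunneth: "bkunneth T D A0 UU"
proof (rule U.reflect_bkunneth[where K = MCoh])
  show "boundary_data T D" by (rule boundary_data_axioms)
  show "bkunneth T D (MCat M) (MCoh M)" if "M \<in> MM" for M by (rule mo_bk[OF that])
  show "FO (Coh UU n) X \<in> Ob A0" if "X \<in> Ob T" for n X by (rule FO_UU[OF that])
  show "FO (Coh UU n) \<in> extensional (Ob T)" "FA (Coh UU n) \<in> extensional (Ar T)"
    "Kap UU n m \<in> extensional (Ob T \<times> Ob T)" "Bd UU n \<in> extensional (Tri D)" for n m
    by (auto simp: UU_def)
  show "FA (Coh UU n) f \<in> hom A0 (FO (Coh UU n) Y) (FO (Coh UU n) X)" if f: "f \<in> hom T X Y" for n f X Y
  proof -
    have f': "f \<in> Ar T" "X \<in> Ob T" "Y \<in> Ob T" "Dom T f = X" "Cod T f = Y"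
      using f Dom_Ob[of f] Cod_Ob[of f] by (auto simp: hom_iff)
    show ?thesis
      by (rule UU_homI; use f' FO_UU UU_Ar v_UU kunneth_cohomology.Coh_simps[OF mo_kc] in simp)
  qed
  show "Kap UU n m (X, Y) \<in>
      hom A0 (FO (Coh UU n) X \<otimes>\<^bsub>A0\<^esub> FO (Coh UU m) Y) (FO (Coh UU (n + m)) (X \<otimes>\<^bsub>T\<^esub> Y))"
    if "X \<in> Ob T" "Y \<in> Ob T" for n m X Y
    by (rule UU_homI; use that FO_UU UU_Ar v_UU TO_A0 kunneth_cohomology.Kap_simps[OF mo_kc] in simp)
  show "Ups UU \<in> hom A0 (FO (Coh UU 0) \<one>\<^bsub>T\<^esub>) \<one>\<^bsub>A0\<^esub>"
    by (rule UU_homI; use FO_UU UU_Ar v_UU One_A0 kunneth_cohomology.Ups_simps[OF mo_kc] in simp)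
  show "Bd UU n t \<in> hom A0 (FO (Coh UU n) (snd t)) (FO (Coh UU (Suc n)) (fst t))"
    if "t \<in> Tri D" for n t
    by (rule UU_homI; use that FO_UU UU_Ar v_UU Tri_wf bkunneth.Bd_simps[OF mo_bk] in simp)
  show "\<exists>\<pi>. (\<forall>n\<le>k. \<pi> n \<in>
        hom A0 (FO (Coh UU k) (X \<otimes>\<^bsub>T\<^esub> Y)) (FO (Coh UU n) X \<otimes>\<^bsub>A0\<^esub> FO (Coh UU (k - n)) Y)) \<and>
        (\<forall>M\<in>MM. bsys (MCat M) k (\<lambda>n. FO (Coh (MCoh M) n) X \<otimes>\<^bsub>MCat M\<^esub> FO (Coh (MCoh M) (k - n)) Y)
          (FO (Coh (MCoh M) k) (X \<otimes>\<^bsub>T\<^esub> Y)) (\<lambda>n. Kap (MCoh M) n (k - n) (X, Y)) (\<lambda>n. v M (\<pi> n)))"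
    if XY: "X \<in> Ob T" "Y \<in> Ob T" for k X Y
  proof (intro exI[of _ "\<lambda>n. mk (\<lambda>M. gval T M (GProj k n X Y))"] conjI allI impI ballI)
    fix n assume n: "n \<le> k"
    have R: "(\<lambda>M. gval T M (GProj k n X Y)) \<in> RR" by (rule arrs.gen) (use XY n in simp)
    show "mk (\<lambda>M. gval T M (GProj k n X Y)) \<in>
      hom A0 (FO (Coh UU k) (X \<otimes>\<^bsub>T\<^esub> Y)) (FO (Coh UU n) X \<otimes>\<^bsub>A0\<^esub> FO (Coh UU (k - n)) Y)"
      by (rule mk_hom[OF R]; use XY FO_UU TO_A0 n
        linear_category.bsysD(7,8)[OF mo_lin kproj_bsys] in simp)
  next
    fix M assume M: "M \<in> MM"
    have "v M (mk (\<lambda>M. gval T M (GProj k n X Y))) = kproj T M k X Y n" if "n \<le> k" for n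
      using v_mk[OF arrs.gen M, of "GProj k n X Y"] XY that by simp
    moreover from this have "hsum (MCat M) (\<lambda>n. Kap (MCoh M) n (k - n) (X, Y) \<cdot>\<^bsub>MCat M\<^esub> kproj T M k X Y n) k =
      hsum (MCat M) (\<lambda>n. Kap (MCoh M) n (k - n) (X, Y) \<cdot>\<^bsub>MCat M\<^esub>
        v M (mk (\<lambda>M. gval T M (GProj k n X Y)))) k"
      by (intro hsum_cong) (simp del: gval.simps)
    ultimately show "bsys (MCat M) k (\<lambda>n. FO (Coh (MCoh M) n) X \<otimes>\<^bsub>MCat M\<^esub> FO (Coh (MCoh M) (k - n)) Y)
          (FO (Coh (MCoh M) k) (X \<otimes>\<^bsub>T\<^esub> Y)) (\<lambda>n. Kap (MCoh M) n (k - n) (X, Y))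
          (\<lambda>n. v M (mk (\<lambda>M. gval T M (GProj k n X Y))))"
      using kproj_bsys[OF M XY, of k] unfolding bsys_def by (simp del: gval.simps)
  qed
qed (use v_UU FO_UU in auto)

sublocale UK: bkunneth T D A0 UU by (rule UU_bkunneth)

text \<open>The structure maps of \<open>U.proj M\<close> are identities, and the extensionality
  conditions settle the values outside the source. This is why the two records are equal and not
  just isomorphic.\<close>

theorem push_proj:
  assumes M: "M \<in> MM"
  shows "push_bk T D (MCat M) UU (U.proj M) = MCoh M"
proof -
  interpret H: bkunneth T D "MCat M" "MCoh M" by (rule mo_bk[OF M])
  have "Coh (push_bk T D (MCat M) UU (U.proj M)) i = Coh (MCoh M) i" for i
  proof -
    interpret c: cat_functor "opposite T" "MCat M" "Coh (MCoh M) i" by (rule H.Coh_functor)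
    show ?thesis
    proof (rule func.equality)
      show "FO (Coh (push_bk T D (MCat M) UU (U.proj M)) i) = FO (Coh (MCoh M) i)"
        by (rule extensionalityI[of _ "Ob T"])
          (use c.FO_ext FO_UU M in \<open>auto simp: func_comp_def U.proj_def\<close>)
      show "FA (Coh (push_bk T D (MCat M) UU (U.proj M)) i) = FA (Coh (MCoh M) i)"
        by (rule extensionalityI[of _ "Ar T"])
          (use c.FA_ext UU_Ar v_UU M in \<open>auto simp: func_comp_def U.proj_def\<close>)
    qed simp
  qed
  moreover have "Kap (push_bk T D (MCat M) UU (U.proj M)) i j = Kap (MCoh M) i j" for i j
    by (rule extensionalityI[of _ "Ob T \<times> Ob T"])
      (use H.Kap_ext FO_UU UU_Ar v_UU M in \<open>auto simp: U.proj_def\<close>)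
  moreover have "Ups (push_bk T D (MCat M) UU (U.proj M)) = Ups (MCoh M)"
    using UU_Ar v_UU M by (simp add: U.proj_def)
  moreover have "Bd (push_bk T D (MCat M) UU (U.proj M)) i = Bd (MCoh M) i" for i
    by (rule extensionalityI[of _ "Tri D"])
      (use H.Bd_extensional UU_Ar v_UU M in \<open>auto simp: U.proj_def\<close>)
  ultimately show ?thesis by (intro rel_kunneth.equality ext) auto
qed

end

section \<open>Transport along isomorphisms\<close>

text \<open>\<open>a\<close> and its inverse restrict to the kernels, and the restrictions are
  mutually inverse because kernels are monic. Applied to the images of one kernel under two exact
  functors, this carries a compatible pair of isomorphisms over to the kernel object.\<close>

lemma (in linear_category) kernel_transfer:
  assumes k: "is_kernel C k f" and k': "is_kernel C k' f'"
    and a: "iso_arrow C a" "Dom C a = Dom C f" "Cod C a = Dom C f'"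
    and b: "iso_arrow C b" "Dom C b = Cod C f" "Cod C b = Cod C f'"
    and ab: "f' \<cdot> a = b \<cdot> f"
  shows "\<exists>\<gamma>. iso_arrow C \<gamma> \<and> Dom C \<gamma> = Dom C k \<and> Cod C \<gamma> = Dom C k' \<and> k' \<cdot> \<gamma> = a \<cdot> k"
proof -
  note K = kernel_simps[OF k] and K' = kernel_simps[OF k']
  note aA = iso_Ar[OF a(1)] and bA = iso_Ar[OF b(1)]
  have "f' \<cdot> (a \<cdot> k) = b \<cdot> (f \<cdot> k)"
    by (rule comp_extend[OF ab]) (use K K' a b aA bA in simp_all)
  then have "f' \<cdot> (a \<cdot> k) = Null C (Dom C (a \<cdot> k)) (Cod C f')" using K a b aA bA by simp
  then obtain u where u: "u \<in> Ar C" "Dom C u = Dom C k" "Cod C u = Dom C k'" "k' \<cdot> u = a \<cdot> k"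
    using kernel_lift[OF k', of "a \<cdot> k"] K a aA by auto
  let ?a = "inv_arrow C a" and ?b = "inv_arrow C b"
  have ba: "f \<cdot> ?a = ?b \<cdot> f'"
    by (rule inv_square[OF ab a(1) b(1)]) (use K K' a b in auto)
  have "f \<cdot> (?a \<cdot> k') = ?b \<cdot> (f' \<cdot> k')"
    by (rule comp_extend[OF ba]) (use K K' a b in simp_all)
  then have "f \<cdot> (?a \<cdot> k') = Null C (Dom C (?a \<cdot> k')) (Cod C f)" using K K' a b by simp
  then obtain w where w: "w \<in> Ar C" "Dom C w = Dom C k'" "Cod C w = Dom C k" "k \<cdot> w = ?a \<cdot> k'"
    using kernel_lift[OF k, of "?a \<cdot> k'"] K K' a by auto
  have "k \<cdot> (w \<cdot> u) = (?a \<cdot> k') \<cdot> u" by (rule comp_extend1[OF w(4)]) (use w u K in auto)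
  also have "\<dots> = ?a \<cdot> (k' \<cdot> u)" using u K' a by simp
  also have "\<dots> = k \<cdot> Id C (Dom C u)" unfolding u(4) using u K a aA by simp
  finally have "w \<cdot> u = Id C (Dom C u)"
    by (rule monic_cancel[OF kernel_monic[OF k]]) (use u w K in auto)
  moreover
  have "k' \<cdot> (u \<cdot> w) = (a \<cdot> k) \<cdot> w" by (rule comp_extend1[OF u(4)]) (use w u K' in auto)
  then have "k' \<cdot> (u \<cdot> w) = a \<cdot> (k \<cdot> w)" using w K a aA by simp
  then have "k' \<cdot> (u \<cdot> w) = k' \<cdot> Id C (Cod C u)" unfolding w(4) using w u K' a aA by simp
  then have "u \<cdot> w = Id C (Cod C u)"
    by (rule monic_cancel[OF kernel_monic[OF k']]) (use u w K' in auto)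
  ultimately have "iso_arrow C u" using u w iso_arrowI(1)[of u w] by simp
  then show ?thesis using u by blast
qed

lemma (in linear_category) cokernel_transfer:
  assumes "is_cokernel C q f" and "is_cokernel C q' f'"
    and "iso_arrow C a" "Dom C a = Cod C f" "Cod C a = Cod C f'"
    and "iso_arrow C b" "Dom C b = Dom C f" "Cod C b = Dom C f'"
    and "f' \<cdot> b = a \<cdot> f"
  shows "\<exists>\<gamma>. iso_arrow C \<gamma> \<and> Dom C \<gamma> = Cod C q \<and> Cod C \<gamma> = Cod C q' \<and> \<gamma> \<cdot> q = q' \<cdot> a"
  using linear_category.kernel_transfer[OF linear_category_dual, of q' f' q f a b] assms by auto

text \<open>The isomorphism is the diagonal matrix with entries \<open>a\<close> and
  \<open>b\<close>. All four compatibilities are recorded because both injections and both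
  projections have to become arrows of the category \<open>E\<close> below.\<close>

lemma (in linear_category) biproduct_transfer:
  assumes s: "is_biproduct C x y s i1 i2 p1 p2" and s': "is_biproduct C x' y' s' j1 j2 r1 r2"
    and a: "iso_arrow C a" "Dom C a = x" "Cod C a = x'"
    and b: "iso_arrow C b" "Dom C b = y" "Cod C b = y'"
  shows "\<exists>\<gamma>. iso_arrow C \<gamma> \<and> Dom C \<gamma> = s \<and> Cod C \<gamma> = s' \<and> \<gamma> \<cdot> i1 = j1 \<cdot> a \<and> \<gamma> \<cdot> i2 = j2 \<cdot> b \<and>
    r1 \<cdot> \<gamma> = a \<cdot> p1 \<and> r2 \<cdot> \<gamma> = b \<cdot> p2"
proof -
  note aA = iso_Ar[OF a(1)] and bA = iso_Ar[OF b(1)]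
  \<comment> \<open>Stated for arbitrary arrows \<open>a\<close> and \<open>b\<close>, so that it
    applies a second time to their inverses.\<close>
  have *: "\<exists>\<gamma>. \<gamma> \<in> Ar C \<and> Dom C \<gamma> = s \<and> Cod C \<gamma> = s' \<and> \<gamma> \<cdot> i1 = j1 \<cdot> a \<and> \<gamma> \<cdot> i2 = j2 \<cdot> b \<and>
    r1 \<cdot> \<gamma> = a \<cdot> p1 \<and> r2 \<cdot> \<gamma> = b \<cdot> p2"
    if S: "is_biproduct C x y s i1 i2 p1 p2" and S': "is_biproduct C x' y' s' j1 j2 r1 r2"
      and a: "a \<in> Ar C" "Dom C a = x" "Cod C a = x'" and b: "b \<in> Ar C" "Dom C b = y" "Cod C b = y'"
    for x y s i1 i2 p1 p2 x' y' s' j1 j2 r1 r2 a b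
  proof -
    have xy: "x \<in> Ob C" "y \<in> Ob C" "x' \<in> Ob C" "y' \<in> Ob C" using a b by auto
    have t: "s \<in> Ob C" "i1 \<in> Ar C" "Dom C i1 = x" "Cod C i1 = s" "i2 \<in> Ar C" "Dom C i2 = y" "Cod C i2 = s"
      "p1 \<in> Ar C" "Dom C p1 = s" "Cod C p1 = x" "p2 \<in> Ar C" "Dom C p2 = s" "Cod C p2 = y"
      "s' \<in> Ob C" "j1 \<in> Ar C" "Dom C j1 = x'" "Cod C j1 = s'" "j2 \<in> Ar C" "Dom C j2 = y'" "Cod C j2 = s'"
      "r1 \<in> Ar C" "Dom C r1 = s'" "Cod C r1 = x'" "r2 \<in> Ar C" "Dom C r2 = s'" "Cod C r2 = y'"
      using S S' by (auto simp: is_biproduct_def hom_iff)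
    have e: "p1 \<cdot> i1 = Id C x" "p2 \<cdot> i2 = Id C y" "p2 \<cdot> i1 = Null C x y" "p1 \<cdot> i2 = Null C y x"
      using S by (auto simp: is_biproduct_def)
    have e': "r1 \<cdot> j1 = Id C x'" "r2 \<cdot> j2 = Id C y'" "r2 \<cdot> j1 = Null C x' y'" "r1 \<cdot> j2 = Null C y' x'"
      using S' by (auto simp: is_biproduct_def)
    have e'': "r1 \<cdot> (j1 \<cdot> h) = h" "r2 \<cdot> (j1 \<cdot> h) = Null C (Dom C h) y'"
      if "h \<in> Ar C" "Cod C h = x'" for h
      using comp_extend1[OF e'(1), of h] comp_extend1[OF e'(3), of h] t that xy by auto
    have e3: "r2 \<cdot> (j2 \<cdot> h) = h" "r1 \<cdot> (j2 \<cdot> h) = Null C (Dom C h) x'"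
      if "h \<in> Ar C" "Cod C h = y'" for h
      using comp_extend1[OF e'(2), of h] comp_extend1[OF e'(4), of h] t that xy by auto
    let ?g = "(j1 \<cdot> (a \<cdot> p1)) \<oplus> (j2 \<cdot> (b \<cdot> p2))"
    have "?g \<cdot> i1 = j1 \<cdot> a" "?g \<cdot> i2 = j2 \<cdot> b" "r1 \<cdot> ?g = a \<cdot> p1" "r2 \<cdot> ?g = b \<cdot> p2"
      using t a b xy by (simp_all add: Plus_comp comp_Plus e e'' e3)
    then show ?thesis using t a b by (intro exI[of _ ?g]) simp
  qed
  obtain g where g: "g \<in> Ar C" "Dom C g = s" "Cod C g = s'" "g \<cdot> i1 = j1 \<cdot> a" "g \<cdot> i2 = j2 \<cdot> b"
    "r1 \<cdot> g = a \<cdot> p1" "r2 \<cdot> g = b \<cdot> p2"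
    using *[OF s s' aA a(2,3) bA b(2,3)] by blast
  obtain h where h: "h \<in> Ar C" "Dom C h = s'" "Cod C h = s" "h \<cdot> j1 = i1 \<cdot> inv_arrow C a"
    "h \<cdot> j2 = i2 \<cdot> inv_arrow C b" "p1 \<cdot> h = inv_arrow C a \<cdot> r1" "p2 \<cdot> h = inv_arrow C b \<cdot> r2"
    using *[OF s' s, of "inv_arrow C a" "inv_arrow C b"] a b by auto
  \<comment> \<open>An endomorphism fixing both injections is trivial, because the identity of a
    biproduct is the sum of the composites of projections and injections.\<close>
  have sep: "u = Id C s"
    if S: "is_biproduct C x y s i1 i2 p1 p2" and u: "u \<in> Ar C" "Dom C u = s" "Cod C u = s"
      "u \<cdot> i1 = i1" "u \<cdot> i2 = i2" for x y s i1 i2 p1 p2 u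
  proof -
    have t: "i1 \<in> Ar C" "Dom C i1 = x" "Cod C i1 = s" "i2 \<in> Ar C" "Dom C i2 = y" "Cod C i2 = s"
      "p1 \<in> Ar C" "Dom C p1 = s" "Cod C p1 = x" "p2 \<in> Ar C" "Dom C p2 = s" "Cod C p2 = y"
      "(i1 \<cdot> p1) \<oplus> (i2 \<cdot> p2) = Id C s"
      using S by (auto simp: is_biproduct_def hom_iff)
    have "u \<cdot> ((i1 \<cdot> p1) \<oplus> (i2 \<cdot> p2)) = (u \<cdot> (i1 \<cdot> p1)) \<oplus> (u \<cdot> (i2 \<cdot> p2))"
      by (rule comp_Plus) (use t(1-12) u in auto)
    also have "u \<cdot> (i1 \<cdot> p1) = i1 \<cdot> p1" by (rule comp_extend1) (use t(1-12) u in auto)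
    also have "u \<cdot> (i2 \<cdot> p2) = i2 \<cdot> p2" by (rule comp_extend1) (use t(1-12) u in auto)
    finally show "u = Id C s" using t(13) u by simp
  qed
  have t: "i1 \<in> Ar C" "Dom C i1 = x" "Cod C i1 = s" "i2 \<in> Ar C" "Dom C i2 = y" "Cod C i2 = s"
      "j1 \<in> Ar C" "Dom C j1 = x'" "Cod C j1 = s'" "j2 \<in> Ar C" "Dom C j2 = y'" "Cod C j2 = s'"
    using s s' by (auto simp: is_biproduct_def hom_iff)
  have 1: "h \<cdot> (j1 \<cdot> a) = i1" "h \<cdot> (j2 \<cdot> b) = i2"
    using comp_extend1[OF h(4), of a] comp_extend1[OF h(5), of b] t h a b aA bA by simp_all
  have 2: "g \<cdot> (i1 \<cdot> inv_arrow C a) = j1" "g \<cdot> (i2 \<cdot> inv_arrow C b) = j2"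
    using comp_extend1[OF g(4), of "inv_arrow C a"] comp_extend1[OF g(5), of "inv_arrow C b"]
      t g a b aA bA by simp_all
  have "h \<cdot> g = Id C s"
  proof (rule sep[OF s])
    show "(h \<cdot> g) \<cdot> i1 = i1" "(h \<cdot> g) \<cdot> i2 = i2"
      using assoc[of i1 g h] assoc[of i2 g h] t g(1-3) h(1-3) unfolding g(4,5) 1 by simp_all
  qed (use g h in auto)
  moreover have "g \<cdot> h = Id C s'"
  proof (rule sep[OF s'])
    show "(g \<cdot> h) \<cdot> j1 = j1" "(g \<cdot> h) \<cdot> j2 = j2"
      using assoc[of j1 h g] assoc[of j2 h g] t g(1-3) h(1-3) unfolding h(4,5) 2 by simp_all
  qed (use g h in auto)
  ultimately have "iso_arrow C g" using g h iso_arrowI(1)[of g h] by simp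
  then show ?thesis using g by blast
qed

text \<open>Injections determine projections, also along a map between two systems:
  \<open>\<pi>' n \<cdot> g\<close> is expanded along the source system, and only the n-th term
  survives.\<close>

lemma (in linear_category) bsys_transfer:
  assumes b: "bsys C k X s \<kappa> \<pi>" and b': "bsys C k X' s' \<kappa>' \<pi>'"
    and g: "g \<in> Ar C" "Dom C g = s" "Cod C g = s'"
    and a: "\<And>n. n \<le> k \<Longrightarrow> a n \<in> Ar C" "\<And>n. n \<le> k \<Longrightarrow> Dom C (a n) = X n"
      "\<And>n. n \<le> k \<Longrightarrow> Cod C (a n) = X' n" "\<And>n. n \<le> k \<Longrightarrow> g \<cdot> \<kappa> n = \<kappa>' n \<cdot> a n"
    and n: "n \<le> k"
  shows "\<pi>' n \<cdot> g = a n \<cdot> \<pi> n"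
proof -
  note B = bsysD[OF b] and B' = bsysD[OF b']
  have *: "(\<pi>' n \<cdot> g) \<cdot> \<kappa> m = (\<pi>' n \<cdot> \<kappa>' m) \<cdot> a m" if "m \<le> k" for m
  proof -
    have "(\<pi>' n \<cdot> g) \<cdot> \<kappa> m = \<pi>' n \<cdot> (g \<cdot> \<kappa> m)" by (rule assoc) (use B B' g n that in auto)
    also have "\<dots> = \<pi>' n \<cdot> (\<kappa>' m \<cdot> a m)" using a(4)[OF that] by simp
    also have "\<dots> = (\<pi>' n \<cdot> \<kappa>' m) \<cdot> a m" by (rule assoc[symmetric]) (use B B' a g n that in auto)
    finally show ?thesis .
  qed
  have "\<pi>' n \<cdot> g = hsum C (\<lambda>m. ((\<pi>' n \<cdot> g) \<cdot> \<kappa> m) \<cdot> \<pi> m) k"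
    by (rule bsys_expand_left[OF b]) (use B' g n in auto)
  also have "\<dots> = ((\<pi>' n \<cdot> g) \<cdot> \<kappa> n) \<cdot> \<pi> n"
  proof (rule hsum_delta[OF n, where x = s and y = "X' n"])
    fix m assume m: "m \<le> k" "m \<noteq> n"
    show "((\<pi>' n \<cdot> g) \<cdot> \<kappa> m) \<cdot> \<pi> m = Null C s (X' n)"
      unfolding *[OF m(1)] B'(10)[OF m(1) n m(2)] using B B' a m n by simp
  qed (use B B' g n in \<open>simp add: hom_iff\<close>)
  also have "\<dots> = a n \<cdot> \<pi> n"
    unfolding *[OF n] B'(9)[OF n] using B B' a n by simp
  finally show ?thesis .
qed


section \<open>The category of objects with an isomorphism between their images\<close>

definition bk_iso :: "('o, 'a, 'z) tcat_scheme \<Rightarrow> ('o, 'a) bdata \<Rightarrow> ('p, 'b, 'w) ltcat_scheme \<Rightarrow>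
    ('o, 'a, 'p, 'b, 'v) rel_kunneth_scheme \<Rightarrow> ('o, 'a, 'p, 'b, 'v) rel_kunneth_scheme \<Rightarrow>
    (nat \<Rightarrow> 'o \<Rightarrow> 'b) \<Rightarrow> bool" where
  "bk_iso T D A H K \<phi> \<longleftrightarrow> kunneth_iso T A H K \<phi> \<and>
    (\<forall>i. \<forall>t\<in>Tri D. Bd K i t \<cdot>\<^bsub>A\<^esub> \<phi> i (snd t) = \<phi> (Suc i) (fst t) \<cdot>\<^bsub>A\<^esub> Bd H i t)"

text \<open>The invertible inserter of \<open>F\<close> and \<open>G\<close>. Coding by
  \<open>p\<close> keeps its objects and arrows in \<open>'u\<close>; otherwise it could not carry a
  model and the universal category would have no projection to it.\<close>

locale inserter =
  fixes T :: "('o, 'a, 'z) tcat_scheme" and D :: "('o, 'a) bdata" and M :: "('o, 'a, 'u) model"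
    and A :: "('u, 'u) ltcat" and F G :: "('u, 'u, 'u, 'u) tfunc" and \<phi> :: "nat \<Rightarrow> 'o \<Rightarrow> 'u"
    and p :: "'u \<times> 'u \<Rightarrow> 'u"
  assumes M: "is_model T D M"
    and F: "exact_tensor_functor (MCat M) A F" and G: "exact_tensor_functor (MCat M) A G"
    and \<phi>: "bk_iso T D A (push_bk T D A (MCoh M) F) (push_bk T D A (MCoh M) G) \<phi>"
    and p: "inj p"
begin

abbreviation B where "B \<equiv> MCat M"
abbreviation H where "H \<equiv> MCoh M"

sublocale F: exact_tensor_functor B A F by (rule F)
sublocale G: exact_tensor_functor B A G by (rule G)
sublocale H: bkunneth T D B H using M by (simp add: is_model_def)

text \<open>An object of the category \<open>E\<close> is the code \<open>p (x, \<alpha>)\<close> of an isomorphism \<open>\<alpha> : F x \<rightarrow> G x\<close>; an arrow \<open>ar X f Y\<close>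
  is an arrow \<open>f\<close> of \<open>B\<close> compatible with the isomorphisms of \<open>X\<close> and \<open>Y\<close>.\<close>

definition ar :: "'u \<Rightarrow> 'u \<Rightarrow> 'u \<Rightarrow> 'u" where "ar X f Y = p (X, p (f, Y))"
definition qE :: "'u \<Rightarrow> 'u" where "qE X = fst (inv p X)"
definition aE :: "'u \<Rightarrow> 'u" where "aE X = snd (inv p X)"
definition vE :: "'u \<Rightarrow> 'u" where "vE c = fst (inv p (snd (inv p c)))"
definition cE :: "'u \<Rightarrow> 'u" where "cE c = snd (inv p (snd (inv p c)))"

text \<open>\<open>qE\<close> reads the first entry of a code. Applied to an object of
  \<open>E\<close> it gives the underlying object of \<open>B\<close>; applied to an arrow of
  \<open>E\<close> it gives the source.\<close>

lemma decode [simp]: "qE (p (x, y)) = x" "aE (p (x, y)) = y" "qE (ar X f Y) = X" "vE (ar X f Y) = f"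
  "cE (ar X f Y) = Y" "ar X f Y = ar X' f' Y' \<longleftrightarrow> X = X' \<and> f = f' \<and> Y = Y'"
  using p by (auto simp: qE_def aE_def vE_def cE_def ar_def inj_eq)

definition obE :: "'u set" where
  "obE = {p (x, \<alpha>) | x \<alpha>. x \<in> Ob B \<and> iso_arrow A \<alpha> \<and> Dom A \<alpha> = FO F x \<and> Cod A \<alpha> = FO G x}"

definition compat :: "'u \<Rightarrow> 'u \<Rightarrow> 'u \<Rightarrow> bool" where
  "compat X f Y \<longleftrightarrow> FA G f \<cdot>\<^bsub>A\<^esub> aE X = aE Y \<cdot>\<^bsub>A\<^esub> FA F f"

definition arE :: "'u set" where
  "arE = {ar X f Y | X f Y. X \<in> obE \<and> Y \<in> obE \<and> f \<in> hom B (qE X) (qE Y) \<and> compat X f Y}"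

text \<open>The isomorphism attached to a tensor product is forced: it is obtained by solving the
  condition that relates a tensor isomorphism to \<open>Mult\<close>. In the same way,
  \<open>oneE\<close> solves the condition on \<open>Unit\<close>.\<close>

definition tens :: "'u \<Rightarrow> 'u \<Rightarrow> 'u" where
  "tens X Y = p (qE X \<otimes>\<^bsub>B\<^esub> qE Y, Mult G (qE X, qE Y) \<cdot>\<^bsub>A\<^esub> ((aE X \<odot>\<^bsub>A\<^esub> aE Y) \<cdot>\<^bsub>A\<^esub>
    inv_arrow A (Mult F (qE X, qE Y))))"

definition oneE :: "'u" where
  "oneE = p (\<one>\<^bsub>B\<^esub>, Unit G \<cdot>\<^bsub>A\<^esub> inv_arrow A (Unit F))"

definition E :: "('u, 'u) ltcat" where
  "E = \<lparr>Ob = obE, Ar = arE, Dom = qE, Cod = cE, Id = (\<lambda>X. ar X (Id B (qE X)) X),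
    Comp = (\<lambda>g f. ar (qE f) (vE g \<cdot>\<^bsub>B\<^esub> vE f) (cE g)),
    TO = tens, TA = (\<lambda>f g. ar (tens (qE f) (qE g)) (vE f \<odot>\<^bsub>B\<^esub> vE g) (tens (cE f) (cE g))),
    One = oneE,
    Assoc = (\<lambda>X Y Z. ar (tens (tens X Y) Z) (Assoc B (qE X) (qE Y) (qE Z)) (tens X (tens Y Z))),
    Lun = (\<lambda>X. ar (tens oneE X) (Lun B (qE X)) X),
    Run = (\<lambda>X. ar (tens X oneE) (Run B (qE X)) X),
    Sym = (\<lambda>X Y. ar (tens X Y) (Sym B (qE X) (qE Y)) (tens Y X)),
    Null = (\<lambda>X Y. ar X (Null B (qE X) (qE Y)) Y),
    Plus = (\<lambda>f g. ar (qE f) (vE f \<oplus>\<^bsub>B\<^esub> vE g) (cE f)),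
    Scale = (\<lambda>r f. ar (qE f) (Scale B r (vE f)) (cE f))\<rparr>"

lemma E_simps:
  "Ob E = obE" "Ar E = arE" "Dom E = qE" "Cod E = cE" "Id E X = ar X (Id B (qE X)) X"
  "g \<cdot>\<^bsub>E\<^esub> f = ar (qE f) (vE g \<cdot>\<^bsub>B\<^esub> vE f) (cE g)" "X \<otimes>\<^bsub>E\<^esub> Y = tens X Y"
  "f \<odot>\<^bsub>E\<^esub> g = ar (tens (qE f) (qE g)) (vE f \<odot>\<^bsub>B\<^esub> vE g) (tens (cE f) (cE g))"
  "\<one>\<^bsub>E\<^esub> = oneE"
  "Assoc E X Y Z = ar (tens (tens X Y) Z) (Assoc B (qE X) (qE Y) (qE Z)) (tens X (tens Y Z))"
  "Lun E X = ar (tens oneE X) (Lun B (qE X)) X" "Run E X = ar (tens X oneE) (Run B (qE X)) X"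
  "Sym E X Y = ar (tens X Y) (Sym B (qE X) (qE Y)) (tens Y X)"
  "Null E X Y = ar X (Null B (qE X) (qE Y)) Y" "f \<oplus>\<^bsub>E\<^esub> g = ar (qE f) (vE f \<oplus>\<^bsub>B\<^esub> vE g) (cE f)"
  "Scale E r f = ar (qE f) (Scale B r (vE f)) (cE f)"
  by (simp_all add: E_def)

lemma obE_simps [simp]:
  assumes "X \<in> obE"
  shows "qE X \<in> Ob B" "aE X \<in> Ar A" "iso_arrow A (aE X)" "Dom A (aE X) = FO F (qE X)"
    "Cod A (aE X) = FO G (qE X)"
  using assms F.target.iso_Ar[of "aE X"] by (auto simp: obE_def)

lemma obEI: "x \<in> Ob B \<Longrightarrow> iso_arrow A \<alpha> \<Longrightarrow> Dom A \<alpha> = FO F x \<Longrightarrow> Cod A \<alpha> = FO G x \<Longrightarrow> p (x, \<alpha>) \<in> obE"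
  by (auto simp: obE_def)

lemma arE_iff: "ar X f Y \<in> arE \<longleftrightarrow> X \<in> obE \<and> Y \<in> obE \<and> f \<in> hom B (qE X) (qE Y) \<and> compat X f Y"
  by (auto simp: arE_def)

lemma hom_E: "c \<in> hom E X Y \<longleftrightarrow> X \<in> obE \<and> Y \<in> obE \<and> c = ar X (vE c) Y \<and>
    vE c \<in> Ar B \<and> Dom B (vE c) = qE X \<and> Cod B (vE c) = qE Y \<and> compat X (vE c) Y"
  unfolding hom_iff E_simps arE_def by auto (metis decode(3), metis decode(5))

lemma compatD: "compat X f Y \<Longrightarrow> FA G f \<cdot>\<^bsub>A\<^esub> aE X = aE Y \<cdot>\<^bsub>A\<^esub> FA F f"
  by (simp add: compat_def)

lemma tens_ob [simp]: "X \<in> obE \<Longrightarrow> Y \<in> obE \<Longrightarrow> tens X Y \<in> obE"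
  unfolding tens_def
  by (rule obEI) (simp_all add: F.target.iso_comp F.target.TA_iso)

lemma q_tens [simp]: "qE (tens X Y) = qE X \<otimes>\<^bsub>B\<^esub> qE Y"
  by (simp add: tens_def)

lemma one_ob [simp]: "oneE \<in> obE"
  unfolding oneE_def by (rule obEI) (simp_all add: F.target.iso_comp)

lemma q_one [simp]: "qE oneE = \<one>\<^bsub>B\<^esub>"
  by (simp add: oneE_def)

lemma tens_Mult:
  "X \<in> obE \<Longrightarrow> Y \<in> obE \<Longrightarrow> aE (tens X Y) \<cdot>\<^bsub>A\<^esub> Mult F (qE X, qE Y) =
    Mult G (qE X, qE Y) \<cdot>\<^bsub>A\<^esub> (aE X \<odot>\<^bsub>A\<^esub> aE Y)"
  by (simp add: tens_def)

lemma one_Unit: "aE oneE \<cdot>\<^bsub>A\<^esub> Unit F = Unit G"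
  by (simp add: oneE_def)

text \<open>Cancelling \<open>Mult F\<close> on the right removes the inverse hidden in
  \<open>tens\<close>, so that only the multiplications of \<open>F\<close> and \<open>G\<close>
  remain to be compared.\<close>

lemma compat_tensI:
  assumes "X \<in> obE" "Y \<in> obE" "Z \<in> obE" "h \<in> Ar B" "Dom B h = qE X \<otimes>\<^bsub>B\<^esub> qE Y" "Cod B h = qE Z"
    and "FA G h \<cdot>\<^bsub>A\<^esub> (Mult G (qE X, qE Y) \<cdot>\<^bsub>A\<^esub> (aE X \<odot>\<^bsub>A\<^esub> aE Y)) =
      aE Z \<cdot>\<^bsub>A\<^esub> (FA F h \<cdot>\<^bsub>A\<^esub> Mult F (qE X, qE Y))"
  shows "compat (tens X Y) h Z"
  unfolding compat_def
proof (rule F.target.iso_epi_cancel[where f = "Mult F (qE X, qE Y)"])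
  show "(FA G h \<cdot>\<^bsub>A\<^esub> aE (tens X Y)) \<cdot>\<^bsub>A\<^esub> Mult F (qE X, qE Y) =
      (aE Z \<cdot>\<^bsub>A\<^esub> FA F h) \<cdot>\<^bsub>A\<^esub> Mult F (qE X, qE Y)"
    using assms(1-6) by (simp add: tens_Mult assms(7))
qed (use assms in simp_all)

lemma compat_tensor:
  assumes "X \<in> obE" "Y \<in> obE" "X' \<in> obE" "Y' \<in> obE" "f \<in> Ar B" "g \<in> Ar B" "Dom B f = qE X"
    "Cod B f = qE X'" "Dom B g = qE Y" "Cod B g = qE Y'" "compat X f X'" "compat Y g Y'"
  shows "compat (tens X Y) (f \<odot>\<^bsub>B\<^esub> g) (tens X' Y')"
proof (rule compat_tensI)
  have "FA G (f \<odot>\<^bsub>B\<^esub> g) \<cdot>\<^bsub>A\<^esub> (Mult G (qE X, qE Y) \<cdot>\<^bsub>A\<^esub> (aE X \<odot>\<^bsub>A\<^esub> aE Y)) =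
      Mult G (qE X', qE Y') \<cdot>\<^bsub>A\<^esub> ((FA G f \<odot>\<^bsub>A\<^esub> FA G g) \<cdot>\<^bsub>A\<^esub> (aE X \<odot>\<^bsub>A\<^esub> aE Y))"
    by (rule F.target.comp_extend) (use assms G.Mult_natural[of f g] in simp_all)
  also have "(FA G f \<odot>\<^bsub>A\<^esub> FA G g) \<cdot>\<^bsub>A\<^esub> (aE X \<odot>\<^bsub>A\<^esub> aE Y) =
      (aE X' \<odot>\<^bsub>A\<^esub> aE Y') \<cdot>\<^bsub>A\<^esub> (FA F f \<odot>\<^bsub>A\<^esub> FA F g)"
    using assms compatD[OF assms(11)] compatD[OF assms(12)] by (simp add: F.target.TA_merge)
  also have "Mult G (qE X', qE Y') \<cdot>\<^bsub>A\<^esub> \<dots> =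
      aE (tens X' Y') \<cdot>\<^bsub>A\<^esub> (Mult F (qE X', qE Y') \<cdot>\<^bsub>A\<^esub> (FA F f \<odot>\<^bsub>A\<^esub> FA F g))"
    by (rule F.target.comp_extend[symmetric]) (use assms tens_Mult in simp_all)
  also have "Mult F (qE X', qE Y') \<cdot>\<^bsub>A\<^esub> (FA F f \<odot>\<^bsub>A\<^esub> FA F g) =
      FA F (f \<odot>\<^bsub>B\<^esub> g) \<cdot>\<^bsub>A\<^esub> Mult F (qE X, qE Y)"
    using assms F.Mult_natural[of f g] by simp
  finally show "FA G (f \<odot>\<^bsub>B\<^esub> g) \<cdot>\<^bsub>A\<^esub> (Mult G (qE X, qE Y) \<cdot>\<^bsub>A\<^esub> (aE X \<odot>\<^bsub>A\<^esub> aE Y)) =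
      aE (tens X' Y') \<cdot>\<^bsub>A\<^esub> (FA F (f \<odot>\<^bsub>B\<^esub> g) \<cdot>\<^bsub>A\<^esub> Mult F (qE X, qE Y))" .
qed (use assms in simp_all)

lemma compat_Sym:
  assumes "X \<in> obE" "Y \<in> obE"
  shows "compat (tens X Y) (Sym B (qE X) (qE Y)) (tens Y X)"
proof (rule compat_tensI)
  let ?s = "Sym B (qE X) (qE Y)"
  have "FA G ?s \<cdot>\<^bsub>A\<^esub> (Mult G (qE X, qE Y) \<cdot>\<^bsub>A\<^esub> (aE X \<odot>\<^bsub>A\<^esub> aE Y)) = Mult G (qE Y, qE X) \<cdot>\<^bsub>A\<^esub>
      (Sym A (FO G (qE X)) (FO G (qE Y)) \<cdot>\<^bsub>A\<^esub> (aE X \<odot>\<^bsub>A\<^esub> aE Y))"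
    by (rule F.target.comp_extend) (use assms G.Mult_Sym[of "qE X" "qE Y"] in simp_all)
  also have "Sym A (FO G (qE X)) (FO G (qE Y)) \<cdot>\<^bsub>A\<^esub> (aE X \<odot>\<^bsub>A\<^esub> aE Y) =
      (aE Y \<odot>\<^bsub>A\<^esub> aE X) \<cdot>\<^bsub>A\<^esub> Sym A (FO F (qE X)) (FO F (qE Y))"
    using F.target.Sym_natural[of "aE X" "aE Y"] assms by simp
  also have "Mult G (qE Y, qE X) \<cdot>\<^bsub>A\<^esub> \<dots> = aE (tens Y X) \<cdot>\<^bsub>A\<^esub>
      (Mult F (qE Y, qE X) \<cdot>\<^bsub>A\<^esub> Sym A (FO F (qE X)) (FO F (qE Y)))"
    by (rule F.target.comp_extend[symmetric]) (use assms tens_Mult in simp_all)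
  also have "Mult F (qE Y, qE X) \<cdot>\<^bsub>A\<^esub> Sym A (FO F (qE X)) (FO F (qE Y)) =
      FA F ?s \<cdot>\<^bsub>A\<^esub> Mult F (qE X, qE Y)"
    using F.Mult_Sym[of "qE X" "qE Y"] assms by simp
  finally show "FA G ?s \<cdot>\<^bsub>A\<^esub> (Mult G (qE X, qE Y) \<cdot>\<^bsub>A\<^esub> (aE X \<odot>\<^bsub>A\<^esub> aE Y)) =
      aE (tens Y X) \<cdot>\<^bsub>A\<^esub> (FA F ?s \<cdot>\<^bsub>A\<^esub> Mult F (qE X, qE Y))" .
qed (use assms in simp_all)

lemma compat_Lun:
  assumes "X \<in> obE"
  shows "compat (tens oneE X) (Lun B (qE X)) X"
proof (rule compat_tensI)
  let ?x = "qE X" and ?l = "Lun B (qE X)"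
  \<comment> \<open>Splitting off \<open>Unit G\<close> prepares \<open>Mult_Lun\<close> for
    \<open>G\<close>; the inverse of \<open>Unit F\<close> that remains is absorbed by
    \<open>Mult_Lun\<close> for \<open>F\<close>.\<close>
  have 1: "aE oneE \<odot>\<^bsub>A\<^esub> aE X = (Unit G \<odot>\<^bsub>A\<^esub> Id A (FO G ?x)) \<cdot>\<^bsub>A\<^esub>
      ((Id A \<one>\<^bsub>A\<^esub> \<odot>\<^bsub>A\<^esub> aE X) \<cdot>\<^bsub>A\<^esub> (inv_arrow A (Unit F) \<odot>\<^bsub>A\<^esub> Id A (FO F ?x)))"
    using assms by (simp add: F.target.TA_merge oneE_def)
  have lf: "FA F ?l \<cdot>\<^bsub>A\<^esub> Mult F (\<one>\<^bsub>B\<^esub>, ?x) = Lun A (FO F ?x) \<cdot>\<^bsub>A\<^esub> (inv_arrow A (Unit F) \<odot>\<^bsub>A\<^esub> Id A (FO F ?x))"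
    using assms by (simp flip: F.Mult_Lun add: F.target.TA_merge)
  have "FA G ?l \<cdot>\<^bsub>A\<^esub> (Mult G (\<one>\<^bsub>B\<^esub>, ?x) \<cdot>\<^bsub>A\<^esub> (aE oneE \<odot>\<^bsub>A\<^esub> aE X)) =
      (FA G ?l \<cdot>\<^bsub>A\<^esub> (Mult G (\<one>\<^bsub>B\<^esub>, ?x) \<cdot>\<^bsub>A\<^esub> (Unit G \<odot>\<^bsub>A\<^esub> Id A (FO G ?x)))) \<cdot>\<^bsub>A\<^esub>
      ((Id A \<one>\<^bsub>A\<^esub> \<odot>\<^bsub>A\<^esub> aE X) \<cdot>\<^bsub>A\<^esub> (inv_arrow A (Unit F) \<odot>\<^bsub>A\<^esub> Id A (FO F ?x)))"
    unfolding 1 using assms by simp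
  also have "\<dots> = Lun A (FO G ?x) \<cdot>\<^bsub>A\<^esub>
      ((Id A \<one>\<^bsub>A\<^esub> \<odot>\<^bsub>A\<^esub> aE X) \<cdot>\<^bsub>A\<^esub> (inv_arrow A (Unit F) \<odot>\<^bsub>A\<^esub> Id A (FO F ?x)))"
    using G.Mult_Lun[of ?x] assms by simp
  also have "\<dots> = aE X \<cdot>\<^bsub>A\<^esub> (Lun A (FO F ?x) \<cdot>\<^bsub>A\<^esub> (inv_arrow A (Unit F) \<odot>\<^bsub>A\<^esub> Id A (FO F ?x)))"
    by (rule F.target.comp_extend) (use F.target.Lun_natural[of "aE X"] assms in simp_all)
  finally show "FA G ?l \<cdot>\<^bsub>A\<^esub> (Mult G (qE oneE, ?x) \<cdot>\<^bsub>A\<^esub> (aE oneE \<odot>\<^bsub>A\<^esub> aE X)) =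
      aE X \<cdot>\<^bsub>A\<^esub> (FA F ?l \<cdot>\<^bsub>A\<^esub> Mult F (qE oneE, ?x))"
    using lf by simp
qed (use assms in simp_all)

lemma compat_Run:
  assumes "X \<in> obE"
  shows "compat (tens X oneE) (Run B (qE X)) X"
proof (rule compat_tensI)
  let ?x = "qE X" and ?l = "Run B (qE X)"
  have 1: "aE X \<odot>\<^bsub>A\<^esub> aE oneE = (Id A (FO G ?x) \<odot>\<^bsub>A\<^esub> Unit G) \<cdot>\<^bsub>A\<^esub>
      ((aE X \<odot>\<^bsub>A\<^esub> Id A \<one>\<^bsub>A\<^esub>) \<cdot>\<^bsub>A\<^esub> (Id A (FO F ?x) \<odot>\<^bsub>A\<^esub> inv_arrow A (Unit F)))"
    using assms by (simp add: F.target.TA_merge oneE_def)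
  have lf: "FA F ?l \<cdot>\<^bsub>A\<^esub> Mult F (?x, \<one>\<^bsub>B\<^esub>) = Run A (FO F ?x) \<cdot>\<^bsub>A\<^esub> (Id A (FO F ?x) \<odot>\<^bsub>A\<^esub> inv_arrow A (Unit F))"
    using assms by (simp flip: F.Mult_Run add: F.target.TA_merge)
  have "FA G ?l \<cdot>\<^bsub>A\<^esub> (Mult G (?x, \<one>\<^bsub>B\<^esub>) \<cdot>\<^bsub>A\<^esub> (aE X \<odot>\<^bsub>A\<^esub> aE oneE)) =
      (FA G ?l \<cdot>\<^bsub>A\<^esub> (Mult G (?x, \<one>\<^bsub>B\<^esub>) \<cdot>\<^bsub>A\<^esub> (Id A (FO G ?x) \<odot>\<^bsub>A\<^esub> Unit G))) \<cdot>\<^bsub>A\<^esub>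
      ((aE X \<odot>\<^bsub>A\<^esub> Id A \<one>\<^bsub>A\<^esub>) \<cdot>\<^bsub>A\<^esub> (Id A (FO F ?x) \<odot>\<^bsub>A\<^esub> inv_arrow A (Unit F)))"
    unfolding 1 using assms by simp
  also have "\<dots> = Run A (FO G ?x) \<cdot>\<^bsub>A\<^esub>
      ((aE X \<odot>\<^bsub>A\<^esub> Id A \<one>\<^bsub>A\<^esub>) \<cdot>\<^bsub>A\<^esub> (Id A (FO F ?x) \<odot>\<^bsub>A\<^esub> inv_arrow A (Unit F)))"
    using G.Mult_Run[of ?x] assms by simp
  also have "\<dots> = aE X \<cdot>\<^bsub>A\<^esub> (Run A (FO F ?x) \<cdot>\<^bsub>A\<^esub> (Id A (FO F ?x) \<odot>\<^bsub>A\<^esub> inv_arrow A (Unit F)))"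
    by (rule F.target.comp_extend) (use F.target.Run_natural[of "aE X"] assms in simp_all)
  finally show "FA G ?l \<cdot>\<^bsub>A\<^esub> (Mult G (?x, qE oneE) \<cdot>\<^bsub>A\<^esub> (aE X \<odot>\<^bsub>A\<^esub> aE oneE)) =
      aE X \<cdot>\<^bsub>A\<^esub> (FA F ?l \<cdot>\<^bsub>A\<^esub> Mult F (?x, qE oneE))"
    using lf by simp
qed (use assms in simp_all)

lemma compat_Assoc:
  assumes X: "X \<in> obE" "Y \<in> obE" "Z \<in> obE"
  shows "compat (tens (tens X Y) Z) (Assoc B (qE X) (qE Y) (qE Z)) (tens X (tens Y Z))"
proof (rule compat_tensI)
  let ?x = "qE X" and ?y = "qE Y" and ?z = "qE Z"
  let ?s = "Assoc B ?x ?y ?z"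
  let ?aF = "Assoc A (FO F ?x) (FO F ?y) (FO F ?z)" and ?aG = "Assoc A (FO G ?x) (FO G ?y) (FO G ?z)"
  \<comment> \<open>Composing further with \<open>Mult F (?x, ?y)\<close> tensored with an identity,
    which is invertible, removes the inverse inside the inner \<open>tens\<close> and lets
    \<open>Mult_Assoc\<close> be applied to both functors.\<close>
  have "(FA G ?s \<cdot>\<^bsub>A\<^esub> (Mult G (?x \<otimes>\<^bsub>B\<^esub> ?y, ?z) \<cdot>\<^bsub>A\<^esub> (aE (tens X Y) \<odot>\<^bsub>A\<^esub> aE Z))) \<cdot>\<^bsub>A\<^esub>
      (Mult F (?x, ?y) \<odot>\<^bsub>A\<^esub> Id A (FO F ?z)) =
    (aE (tens X (tens Y Z)) \<cdot>\<^bsub>A\<^esub> (FA F ?s \<cdot>\<^bsub>A\<^esub> Mult F (?x \<otimes>\<^bsub>B\<^esub> ?y, ?z))) \<cdot>\<^bsub>A\<^esub>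
      (Mult F (?x, ?y) \<odot>\<^bsub>A\<^esub> Id A (FO F ?z))"
  proof -
    have "(FA G ?s \<cdot>\<^bsub>A\<^esub> (Mult G (?x \<otimes>\<^bsub>B\<^esub> ?y, ?z) \<cdot>\<^bsub>A\<^esub> (aE (tens X Y) \<odot>\<^bsub>A\<^esub> aE Z))) \<cdot>\<^bsub>A\<^esub>
      (Mult F (?x, ?y) \<odot>\<^bsub>A\<^esub> Id A (FO F ?z)) =
      FA G ?s \<cdot>\<^bsub>A\<^esub> (Mult G (?x \<otimes>\<^bsub>B\<^esub> ?y, ?z) \<cdot>\<^bsub>A\<^esub>
        ((aE (tens X Y) \<cdot>\<^bsub>A\<^esub> Mult F (?x, ?y)) \<odot>\<^bsub>A\<^esub> aE Z))"
      using X by (simp add: F.target.TA_merge)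
    also have "(aE (tens X Y) \<cdot>\<^bsub>A\<^esub> Mult F (?x, ?y)) \<odot>\<^bsub>A\<^esub> aE Z =
        (Mult G (?x, ?y) \<odot>\<^bsub>A\<^esub> Id A (FO G ?z)) \<cdot>\<^bsub>A\<^esub> ((aE X \<odot>\<^bsub>A\<^esub> aE Y) \<odot>\<^bsub>A\<^esub> aE Z)"
      using X by (simp add: tens_Mult F.target.TA_merge)
    also have "FA G ?s \<cdot>\<^bsub>A\<^esub> (Mult G (?x \<otimes>\<^bsub>B\<^esub> ?y, ?z) \<cdot>\<^bsub>A\<^esub> \<dots>) =
        (FA G ?s \<cdot>\<^bsub>A\<^esub> (Mult G (?x \<otimes>\<^bsub>B\<^esub> ?y, ?z) \<cdot>\<^bsub>A\<^esub> (Mult G (?x, ?y) \<odot>\<^bsub>A\<^esub> Id A (FO G ?z)))) \<cdot>\<^bsub>A\<^esub>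
          ((aE X \<odot>\<^bsub>A\<^esub> aE Y) \<odot>\<^bsub>A\<^esub> aE Z)"
      using X by simp
    also have "\<dots> = Mult G (?x, ?y \<otimes>\<^bsub>B\<^esub> ?z) \<cdot>\<^bsub>A\<^esub> ((Id A (FO G ?x) \<odot>\<^bsub>A\<^esub> Mult G (?y, ?z)) \<cdot>\<^bsub>A\<^esub>
        (?aG \<cdot>\<^bsub>A\<^esub> ((aE X \<odot>\<^bsub>A\<^esub> aE Y) \<odot>\<^bsub>A\<^esub> aE Z)))"
      unfolding G.Mult_Assoc[OF obE_simps(1)[OF X(1)] obE_simps(1)[OF X(2)] obE_simps(1)[OF X(3)]]
      using X by simp
    also have "?aG \<cdot>\<^bsub>A\<^esub> ((aE X \<odot>\<^bsub>A\<^esub> aE Y) \<odot>\<^bsub>A\<^esub> aE Z) = (aE X \<odot>\<^bsub>A\<^esub> (aE Y \<odot>\<^bsub>A\<^esub> aE Z)) \<cdot>\<^bsub>A\<^esub> ?aF"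
      using F.target.Assoc_natural[of "aE X" "aE Y" "aE Z"] X by simp
    also have "(Id A (FO G ?x) \<odot>\<^bsub>A\<^esub> Mult G (?y, ?z)) \<cdot>\<^bsub>A\<^esub> \<dots> =
        ((aE X \<odot>\<^bsub>A\<^esub> aE (tens Y Z)) \<cdot>\<^bsub>A\<^esub> (Id A (FO F ?x) \<odot>\<^bsub>A\<^esub> Mult F (?y, ?z))) \<cdot>\<^bsub>A\<^esub> ?aF"
      using X tens_Mult[of Y Z] by (simp add: F.target.TA_merge2)
    also have "Mult G (?x, ?y \<otimes>\<^bsub>B\<^esub> ?z) \<cdot>\<^bsub>A\<^esub> \<dots> = (Mult G (?x, ?y \<otimes>\<^bsub>B\<^esub> ?z) \<cdot>\<^bsub>A\<^esub> (aE X \<odot>\<^bsub>A\<^esub> aE (tens Y Z))) \<cdot>\<^bsub>A\<^esub>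
        ((Id A (FO F ?x) \<odot>\<^bsub>A\<^esub> Mult F (?y, ?z)) \<cdot>\<^bsub>A\<^esub> ?aF)"
      using X by simp
    also have "Mult G (?x, ?y \<otimes>\<^bsub>B\<^esub> ?z) \<cdot>\<^bsub>A\<^esub> (aE X \<odot>\<^bsub>A\<^esub> aE (tens Y Z)) =
        aE (tens X (tens Y Z)) \<cdot>\<^bsub>A\<^esub> Mult F (?x, ?y \<otimes>\<^bsub>B\<^esub> ?z)"
      using X tens_Mult[of X "tens Y Z"] by simp
    also have "(aE (tens X (tens Y Z)) \<cdot>\<^bsub>A\<^esub> Mult F (?x, ?y \<otimes>\<^bsub>B\<^esub> ?z)) \<cdot>\<^bsub>A\<^esub>
        ((Id A (FO F ?x) \<odot>\<^bsub>A\<^esub> Mult F (?y, ?z)) \<cdot>\<^bsub>A\<^esub> ?aF) =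
        aE (tens X (tens Y Z)) \<cdot>\<^bsub>A\<^esub> (Mult F (?x, ?y \<otimes>\<^bsub>B\<^esub> ?z) \<cdot>\<^bsub>A\<^esub>
        ((Id A (FO F ?x) \<odot>\<^bsub>A\<^esub> Mult F (?y, ?z)) \<cdot>\<^bsub>A\<^esub> ?aF))"
      using X by simp
    also have "Mult F (?x, ?y \<otimes>\<^bsub>B\<^esub> ?z) \<cdot>\<^bsub>A\<^esub> ((Id A (FO F ?x) \<odot>\<^bsub>A\<^esub> Mult F (?y, ?z)) \<cdot>\<^bsub>A\<^esub> ?aF) =
        FA F ?s \<cdot>\<^bsub>A\<^esub> (Mult F (?x \<otimes>\<^bsub>B\<^esub> ?y, ?z) \<cdot>\<^bsub>A\<^esub> (Mult F (?x, ?y) \<odot>\<^bsub>A\<^esub> Id A (FO F ?z)))"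
      using X by (simp add: F.Mult_Assoc)
    finally show ?thesis using X by simp
  qed
  then show "FA G ?s \<cdot>\<^bsub>A\<^esub> (Mult G (qE (tens X Y), ?z) \<cdot>\<^bsub>A\<^esub> (aE (tens X Y) \<odot>\<^bsub>A\<^esub> aE Z)) =
      aE (tens X (tens Y Z)) \<cdot>\<^bsub>A\<^esub> (FA F ?s \<cdot>\<^bsub>A\<^esub> Mult F (qE (tens X Y), ?z))"
    unfolding q_tens by (rule F.target.iso_epi_cancel) (use X in \<open>simp_all add: F.target.TA_iso\<close>)
qed (use X in simp_all)

end

section \<open>Abelian tensor structure on objects with an isomorphism\<close>

context inserter
begin

lemma compat_Id: "X \<in> obE \<Longrightarrow> compat X (Id B (qE X)) X"
  by (simp add: compat_def)

lemma compat_comp: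
  assumes "X \<in> obE" "Y \<in> obE" "Z \<in> obE" "f \<in> Ar B" "g \<in> Ar B" "Dom B f = qE X" "Cod B f = qE Y"
    "Dom B g = qE Y" "Cod B g = qE Z" "compat X f Y" "compat Y g Z"
  shows "compat X (g \<cdot>\<^bsub>B\<^esub> f) Z"
proof -
  have "FA G g \<cdot>\<^bsub>A\<^esub> (aE Y \<cdot>\<^bsub>A\<^esub> FA F f) = aE Z \<cdot>\<^bsub>A\<^esub> (FA F g \<cdot>\<^bsub>A\<^esub> FA F f)"
    by (rule F.target.comp_extend[OF compatD[OF assms(11)]]) (use assms in simp_all)
  then show ?thesis
    using assms(1-9) unfolding compat_def
    by (simp add: F.FA_Comp G.FA_Comp compatD[OF assms(10)])
qed

lemma compat_Plus:
  assumes "X \<in> obE" "Y \<in> obE" "f \<in> Ar B" "g \<in> Ar B" "Dom B f = qE X" "Cod B f = qE Y"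
    "Dom B g = qE X" "Cod B g = qE Y" "compat X f Y" "compat X g Y"
  shows "compat X (f \<oplus>\<^bsub>B\<^esub> g) Y" "compat X (Scale B r f) Y"
  using assms unfolding compat_def
  by (simp_all add: F.ef.F_Plus G.ef.F_Plus F.ef.F_Scale G.ef.F_Scale F.target.comp_Plus
      F.target.Plus_comp)

lemma compat_Null: "X \<in> obE \<Longrightarrow> Y \<in> obE \<Longrightarrow> compat X (Null B (qE X) (qE Y)) Y"
  by (simp add: compat_def)

lemma arE_D:
  assumes "c \<in> arE"
  shows "qE c \<in> obE" "cE c \<in> obE" "vE c \<in> Ar B" "Dom B (vE c) = qE (qE c)" "Cod B (vE c) = qE (cE c)"
    "compat (qE c) (vE c) (cE c)" "ar (qE c) (vE c) (cE c) = c"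
  using assms by (auto simp: arE_def hom_iff)

lemma arE_I: "X \<in> obE \<Longrightarrow> Y \<in> obE \<Longrightarrow> f \<in> Ar B \<Longrightarrow> Dom B f = qE X \<Longrightarrow> Cod B f = qE Y \<Longrightarrow>
    compat X f Y \<Longrightarrow> ar X f Y \<in> arE"
  by (simp add: arE_iff hom_iff)

lemma M_ker: "f \<in> Ar B \<Longrightarrow> is_kernel B (MKer M f) f"
  and M_cok: "f \<in> Ar B \<Longrightarrow> is_cokernel B (MCok M f) f"
  and M_bip: "x \<in> Ob B \<Longrightarrow> y \<in> Ob B \<Longrightarrow> is_biproduct B x y (Cod B (MBip M 0 x y))
        (MBip M 0 x y) (MBip M 1 x y) (MBip M 2 x y) (MBip M 3 x y)"
  using M by (simp_all add: is_model_def)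

text \<open>The underlying arrow is the kernel chosen in \<open>M\<close>; only the isomorphism on
  the kernel object is new. Since the choices lie over those of \<open>M\<close>, the forgetful
  functor preserves them strictly, as the induction over generated arrows requires.\<close>

definition kerE :: "'u \<Rightarrow> 'u" where
  "kerE c = (let k = MKer M (vE c); w = Dom B k in
    ar (p (w, SOME \<gamma>. iso_arrow A \<gamma> \<and> Dom A \<gamma> = FO F w \<and> Cod A \<gamma> = FO G w \<and>
      FA G k \<cdot>\<^bsub>A\<^esub> \<gamma> = aE (qE c) \<cdot>\<^bsub>A\<^esub> FA F k)) k (qE c))"

definition cokE :: "'u \<Rightarrow> 'u" where
  "cokE c = (let k = MCok M (vE c); w = Cod B k in
    ar (cE c) k (p (w, SOME \<gamma>. iso_arrow A \<gamma> \<and> Dom A \<gamma> = FO F w \<and> Cod A \<gamma> = FO G w \<and>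
      \<gamma> \<cdot>\<^bsub>A\<^esub> FA F k = FA G k \<cdot>\<^bsub>A\<^esub> aE (cE c))))"

text \<open>One isomorphism has to serve both injections and both projections, so it is chosen once,
  subject to all four conditions.\<close>

definition bipS :: "'u \<Rightarrow> 'u \<Rightarrow> 'u" where
  "bipS X Y = (let b = (\<lambda>n. MBip M n (qE X) (qE Y)); s = Cod B (b 0) in
    p (s, SOME \<gamma>. iso_arrow A \<gamma> \<and> Dom A \<gamma> = FO F s \<and> Cod A \<gamma> = FO G s \<and>
      \<gamma> \<cdot>\<^bsub>A\<^esub> FA F (b 0) = FA G (b 0) \<cdot>\<^bsub>A\<^esub> aE X \<and> \<gamma> \<cdot>\<^bsub>A\<^esub> FA F (b 1) = FA G (b 1) \<cdot>\<^bsub>A\<^esub> aE Y \<and>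
      FA G (b 2) \<cdot>\<^bsub>A\<^esub> \<gamma> = aE X \<cdot>\<^bsub>A\<^esub> FA F (b 2) \<and> FA G (b 3) \<cdot>\<^bsub>A\<^esub> \<gamma> = aE Y \<cdot>\<^bsub>A\<^esub> FA F (b 3)))"

definition bipE :: "nat \<Rightarrow> 'u \<Rightarrow> 'u \<Rightarrow> 'u" where
  "bipE n X Y = (if n < 2 then ar (if n = 0 then X else Y) (MBip M n (qE X) (qE Y)) (bipS X Y)
    else ar (bipS X Y) (MBip M n (qE X) (qE Y)) (if n = 2 then X else Y))"

lemma kerE:
  assumes "c \<in> arE"
  shows "kerE c \<in> arE" "cE (kerE c) = qE c" "vE (kerE c) = MKer M (vE c)"
proof -
  note c = arE_D[OF assms]
  let ?k = "MKer M (vE c)"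
  have k: "is_kernel B ?k (vE c)" using M_ker c by blast
  note k' = F.source.kernel_simps[OF k]
  let ?P = "\<lambda>\<gamma>. iso_arrow A \<gamma> \<and> Dom A \<gamma> = FO F (Dom B ?k) \<and> Cod A \<gamma> = FO G (Dom B ?k) \<and>
      FA G ?k \<cdot>\<^bsub>A\<^esub> \<gamma> = aE (qE c) \<cdot>\<^bsub>A\<^esub> FA F ?k"
  have "\<exists>\<gamma>. iso_arrow A \<gamma> \<and> Dom A \<gamma> = Dom A (FA F ?k) \<and> Cod A \<gamma> = Dom A (FA G ?k) \<and>
      FA G ?k \<cdot>\<^bsub>A\<^esub> \<gamma> = aE (qE c) \<cdot>\<^bsub>A\<^esub> FA F ?k"
    by (rule F.target.kernel_transfer[OF F.ef.F_kernel[OF k] G.ef.F_kernel[OF k], where b = "aE (cE c)"])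
      (use c compatD[OF c(6)] in simp_all)
  then have "\<exists>\<gamma>. ?P \<gamma>" using k' by simp
  then have g: "?P (SOME \<gamma>. ?P \<gamma>)" by (rule someI_ex)
  then have "p (Dom B ?k, SOME \<gamma>. ?P \<gamma>) \<in> obE" using k' by (intro obEI) auto
  then show "kerE c \<in> arE"
    unfolding kerE_def Let_def using c k' g by (intro arE_I) (auto simp: compat_def)
  show "cE (kerE c) = qE c" "vE (kerE c) = ?k" by (simp_all add: kerE_def Let_def)
qed

lemma cokE:
  assumes "c \<in> arE"
  shows "cokE c \<in> arE" "qE (cokE c) = cE c" "vE (cokE c) = MCok M (vE c)"
proof -
  note c = arE_D[OF assms]
  let ?k = "MCok M (vE c)"
  have k: "is_cokernel B ?k (vE c)" using M_cok c by blast
  then have k': "?k \<in> Ar B" "Dom B ?k = Cod B (vE c)" by (auto simp: is_cokernel_def)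
  let ?P = "\<lambda>\<gamma>. iso_arrow A \<gamma> \<and> Dom A \<gamma> = FO F (Cod B ?k) \<and> Cod A \<gamma> = FO G (Cod B ?k) \<and>
      \<gamma> \<cdot>\<^bsub>A\<^esub> FA F ?k = FA G ?k \<cdot>\<^bsub>A\<^esub> aE (cE c)"
  have "\<exists>\<gamma>. iso_arrow A \<gamma> \<and> Dom A \<gamma> = Cod A (FA F ?k) \<and> Cod A \<gamma> = Cod A (FA G ?k) \<and>
      \<gamma> \<cdot>\<^bsub>A\<^esub> FA F ?k = FA G ?k \<cdot>\<^bsub>A\<^esub> aE (cE c)"
    by (rule F.target.cokernel_transfer[OF F.ef.F_cokernel[OF k] G.ef.F_cokernel[OF k],
          where b = "aE (qE c)"])
      (use c compatD[OF c(6)] in simp_all)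
  then have "\<exists>\<gamma>. ?P \<gamma>" using k' by simp
  then have g: "?P (SOME \<gamma>. ?P \<gamma>)" by (rule someI_ex)
  then have "p (Cod B ?k, SOME \<gamma>. ?P \<gamma>) \<in> obE" using k' by (intro obEI) auto
  then show "cokE c \<in> arE"
    unfolding cokE_def Let_def using c k' g by (intro arE_I) (auto simp: compat_def)
  show "qE (cokE c) = cE c" "vE (cokE c) = ?k" by (simp_all add: cokE_def Let_def)
qed

lemma bipE:
  assumes X: "X \<in> obE" "Y \<in> obE"
  shows "bipS X Y \<in> obE" "qE (bipS X Y) = Cod B (MBip M 0 (qE X) (qE Y))"
    "bipE 0 X Y \<in> hom E X (bipS X Y)" "bipE 1 X Y \<in> hom E Y (bipS X Y)"
    "bipE 2 X Y \<in> hom E (bipS X Y) X" "bipE 3 X Y \<in> hom E (bipS X Y) Y"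
    "n < 4 \<Longrightarrow> vE (bipE n X Y) = MBip M n (qE X) (qE Y)"
proof -
  let ?b = "\<lambda>n. MBip M n (qE X) (qE Y)"
  let ?s = "Cod B (?b 0)"
  have b: "is_biproduct B (qE X) (qE Y) ?s (?b 0) (?b 1) (?b 2) (?b 3)" using M_bip X by simp
  then have b': "?s \<in> Ob B" "?b 0 \<in> Ar B" "Dom B (?b 0) = qE X" "?b 1 \<in> Ar B" "Dom B (?b 1) = qE Y"
    "Cod B (?b 1) = ?s" "?b 2 \<in> Ar B" "Dom B (?b 2) = ?s" "Cod B (?b 2) = qE X" "?b 3 \<in> Ar B"
    "Dom B (?b 3) = ?s" "Cod B (?b 3) = qE Y"
    by (auto simp: is_biproduct_def hom_iff)
  let ?P = "\<lambda>\<gamma>. iso_arrow A \<gamma> \<and> Dom A \<gamma> = FO F ?s \<and> Cod A \<gamma> = FO G ?s \<and>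
      \<gamma> \<cdot>\<^bsub>A\<^esub> FA F (?b 0) = FA G (?b 0) \<cdot>\<^bsub>A\<^esub> aE X \<and> \<gamma> \<cdot>\<^bsub>A\<^esub> FA F (?b 1) = FA G (?b 1) \<cdot>\<^bsub>A\<^esub> aE Y \<and>
      FA G (?b 2) \<cdot>\<^bsub>A\<^esub> \<gamma> = aE X \<cdot>\<^bsub>A\<^esub> FA F (?b 2) \<and> FA G (?b 3) \<cdot>\<^bsub>A\<^esub> \<gamma> = aE Y \<cdot>\<^bsub>A\<^esub> FA F (?b 3)"
  have "\<exists>\<gamma>. ?P \<gamma>"
    by (rule F.target.biproduct_transfer[OF F.ef.F_biproduct[OF b] G.ef.F_biproduct[OF b]])
      (use X in simp_all)
  then have "?P (SOME \<gamma>. ?P \<gamma>)" by (rule someI_ex)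
  moreover have e: "bipS X Y = p (?s, SOME \<gamma>. ?P \<gamma>)" unfolding bipS_def Let_def ..
  ultimately have g: "?P (aE (bipS X Y))" by simp
  show s: "bipS X Y \<in> obE" unfolding e by (rule obEI) (use b' g e in auto)
  show q: "qE (bipS X Y) = ?s" unfolding e by simp
  show "n < 4 \<Longrightarrow> vE (bipE n X Y) = ?b n" by (simp add: bipE_def)
  show "bipE 0 X Y \<in> hom E X (bipS X Y)" "bipE 1 X Y \<in> hom E Y (bipS X Y)"
    "bipE 2 X Y \<in> hom E (bipS X Y) X" "bipE 3 X Y \<in> hom E (bipS X Y) Y"
    unfolding hom_E using X s q b' g by (simp_all add: bipE_def compat_def)
qed

text \<open>The forgetful functor to \<open>B\<close> alone is a jointly faithful family, indexed by
  a singleton. So \<open>E\<close> is abelian as soon as kernels, cokernels, biproducts and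
  factorisations in \<open>B\<close> are seen to be compatible with the isomorphisms.\<close>

lemma E_joint_abelian: "joint_abelian E {()} (\<lambda>_. B) (\<lambda>_. qE) (\<lambda>_. vE)"
proof (rule joint_abelian.intro)
  show "abelian_category B" by (rule F.source.abelian_category_axioms)
  show "Dom E f \<in> Ob E \<and> Cod E f \<in> Ob E" if "f \<in> Ar E" for f
    using that arE_D[of f] by (simp add: E_simps)
  show "Id E X \<in> hom E X X" if "X \<in> Ob E" for X
    using that unfolding hom_E by (simp add: E_simps compat_Id)
  show "g \<cdot>\<^bsub>E\<^esub> f \<in> hom E X Z" "vE (g \<cdot>\<^bsub>E\<^esub> f) = vE g \<cdot>\<^bsub>B\<^esub> vE f"
    if "f \<in> hom E X Y" "g \<in> hom E Y Z" for f g X Y Z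
  proof -
    have "qE f = X" "cE g = Z" using that unfolding hom_E by (metis decode)+
    then show "g \<cdot>\<^bsub>E\<^esub> f \<in> hom E X Z" "vE (g \<cdot>\<^bsub>E\<^esub> f) = vE g \<cdot>\<^bsub>B\<^esub> vE f"
      using that compat_comp[of X Y Z "vE f" "vE g"] unfolding hom_E by (simp_all add: E_simps)
  qed
  show "Null E X Y \<in> hom E X Y" if "X \<in> Ob E" "Y \<in> Ob E" for X Y
    using that unfolding hom_E by (simp add: E_simps compat_Null)
  show "f \<oplus>\<^bsub>E\<^esub> g \<in> hom E X Y" if "f \<in> hom E X Y" "g \<in> hom E X Y" for f g X Y
  proof -
    have "qE f = X" "cE f = Y" using that unfolding hom_E by (metis decode)+
    then show ?thesis
      using that compat_Plus(1)[of X Y "vE f" "vE g"] unfolding hom_E by (simp add: E_simps)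
  qed
  show "Scale E r f \<in> hom E X Y" if "f \<in> hom E X Y" for f X Y r
  proof -
    have "qE f = X" "cE f = Y" using that unfolding hom_E by (metis decode)+
    then show ?thesis
      using that compat_Plus(2)[of X Y "vE f" "vE f"] unfolding hom_E by (simp add: E_simps)
  qed
  show "f = g" if "f \<in> hom E X Y" "g \<in> hom E X Y" "\<And>i. i \<in> {()} \<Longrightarrow> vE f = vE g" for f g X Y
    using that(3)[of "()"] that(1,2) unfolding hom_E by auto
  show "\<exists>z\<in>Ob E. \<forall>i\<in>{()}. zero_object B (qE z)"
  proof -
    obtain z where z: "zero_object B z" using F.source.ex_zero ..
    then have zB: "z \<in> Ob B" by (simp add: F.source.zero_object_iff)
    have "zero_object A (FO F z)" "zero_object A (FO G z)" using z F.ef.F_zero G.ef.F_zero by auto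
    \<comment> \<open>Between zero objects the zero arrow is invertible, so a zero object of
      \<open>B\<close> lifts to \<open>E\<close>.\<close>
    then have "iso_arrow A (Null A (FO F z) (FO G z))"
      using zB by (intro F.target.iso_arrowI(1)[where g = "Null A (FO G z) (FO F z)"])
        (auto simp: F.target.zero_object_iff)
    then have "p (z, Null A (FO F z) (FO G z)) \<in> obE" using zB by (intro obEI) auto
    then show ?thesis using z by (intro bexI[of _ "p (z, Null A (FO F z) (FO G z))"]) (auto simp: E_simps)
  qed
  show "\<exists>s i1 i2 p1 p2. s \<in> Ob E \<and> i1 \<in> hom E X s \<and> i2 \<in> hom E Y s \<and> p1 \<in> hom E s X \<and> p2 \<in> hom E s Y \<and>
        (\<forall>i\<in>{()}. is_biproduct B (qE X) (qE Y) (qE s) (vE i1) (vE i2) (vE p1) (vE p2))"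
    if XY: "X \<in> Ob E" "Y \<in> Ob E" for X Y
  proof -
    have X: "X \<in> obE" "Y \<in> obE" using XY by (simp_all add: E_simps)
    show ?thesis
      using bipE[OF X] M_bip[of "qE X" "qE Y"] X
      by (intro exI[of _ "bipS X Y"] exI[of _ "bipE 0 X Y"] exI[of _ "bipE 1 X Y"]
          exI[of _ "bipE 2 X Y"] exI[of _ "bipE 3 X Y"]) (simp add: E_simps)
  qed
  show "\<exists>k\<in>Ar E. Cod E k = Dom E f \<and> (\<forall>i\<in>{()}. is_kernel B (vE k) (vE f))" if "f \<in> Ar E" for f
    using kerE[of f] that M_ker arE_D(3)[of f] by (intro bexI[of _ "kerE f"]) (auto simp: E_simps)
  show "\<exists>k\<in>Ar E. Dom E k = Cod E f \<and> (\<forall>i\<in>{()}. is_cokernel B (vE k) (vE f))" if "f \<in> Ar E" for f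
    using cokE[of f] that M_cok arE_D(3)[of f] by (intro bexI[of _ "cokE f"]) (auto simp: E_simps)
next
  fix m h assume mh: "m \<in> Ar E" "h \<in> Ar E" "Cod E h = Cod E m"
    and f: "\<And>i. i \<in> {()} \<Longrightarrow> monic B (vE m) \<and> factors B (vE h) (vE m)"
  note m = arE_D[OF mh(1)[unfolded E_simps]] and h = arE_D[OF mh(2)[unfolded E_simps]]
  have ch: "cE h = cE m" using mh(3) by (simp add: E_simps)
  obtain u where u: "u \<in> Ar B" "Dom B u = qE (qE h)" "Cod B u = qE (qE m)" "vE m \<cdot>\<^bsub>B\<^esub> u = vE h"
    using f[of "()"] h m by (auto simp: factors_def hom_iff)
  \<comment> \<open>The factorisation \<open>u\<close> exists in \<open>B\<close>. Its compatibility
    is checked after composing with \<open>FA G (vE m)\<close>, which is monic because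
    \<open>G\<close> is exact.\<close>
  have "FA G (vE m) \<cdot>\<^bsub>A\<^esub> (FA G u \<cdot>\<^bsub>A\<^esub> aE (qE h)) = FA G (vE h) \<cdot>\<^bsub>A\<^esub> aE (qE h)"
    by (rule F.target.comp_extend1) (use u m h in \<open>simp_all flip: G.FA_Comp\<close>)
  also have "\<dots> = aE (cE m) \<cdot>\<^bsub>A\<^esub> (FA F (vE m) \<cdot>\<^bsub>A\<^esub> FA F u)"
    using compatD[OF h(6)] u m h ch by (simp flip: F.FA_Comp)
  also have "\<dots> = FA G (vE m) \<cdot>\<^bsub>A\<^esub> (aE (qE m) \<cdot>\<^bsub>A\<^esub> FA F u)"
    by (rule F.target.comp_extend[OF compatD[OF m(6)], symmetric]) (use u m h in simp_all)
  finally have "compat (qE h) u (qE m)" unfolding compat_def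
    by (rule F.target.monic_cancel[OF G.ef.F_monic, rotated]) (use f u m h in auto)
  then show "\<exists>u\<in>hom E (Dom E h) (Dom E m). m \<cdot>\<^bsub>E\<^esub> u = h"
    using u m h ch by (intro bexI[of _ "ar (qE h) u (qE m)"]) (auto simp: hom_E E_simps)
next
  fix m h assume mh: "m \<in> Ar E" "h \<in> Ar E" "Dom E h = Dom E m"
    and f: "\<And>i. i \<in> {()} \<Longrightarrow> epic B (vE m) \<and> factors (dual B) (vE h) (vE m)"
  note m = arE_D[OF mh(1)[unfolded E_simps]] and h = arE_D[OF mh(2)[unfolded E_simps]]
  have ch: "qE h = qE m" using mh(3) by (simp add: E_simps)
  obtain u where u: "u \<in> Ar B" "Dom B u = qE (cE m)" "Cod B u = qE (cE h)" "u \<cdot>\<^bsub>B\<^esub> vE m = vE h"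
    using f[of "()"] h m by (auto simp: factors_def hom_iff)
  \<comment> \<open>Dually, compatibility is checked after precomposing with
    \<open>FA F (vE m)\<close>, which is epic because \<open>F\<close> is exact.\<close>
  have "(FA G u \<cdot>\<^bsub>A\<^esub> aE (cE m)) \<cdot>\<^bsub>A\<^esub> FA F (vE m) = FA G u \<cdot>\<^bsub>A\<^esub> (FA G (vE m) \<cdot>\<^bsub>A\<^esub> aE (qE m))"
    using u m h by (simp add: compatD[OF m(6)])
  also have "\<dots> = FA G (vE h) \<cdot>\<^bsub>A\<^esub> aE (qE m)"
    by (rule F.target.comp_extend1) (use u m h in \<open>simp_all flip: G.FA_Comp\<close>)
  also have "\<dots> = aE (cE h) \<cdot>\<^bsub>A\<^esub> (FA F u \<cdot>\<^bsub>A\<^esub> FA F (vE m))"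
    using compatD[OF h(6)] u m h ch by (simp flip: F.FA_Comp)
  also have "\<dots> = (aE (cE h) \<cdot>\<^bsub>A\<^esub> FA F u) \<cdot>\<^bsub>A\<^esub> FA F (vE m)"
    using u m h by simp
  finally have "compat (cE m) u (cE h)" unfolding compat_def
    by (rule F.target.epic_cancel[OF F.ef.F_epic, rotated]) (use f u m h in auto)
  then show "\<exists>u\<in>hom E (Cod E m) (Cod E h). u \<cdot>\<^bsub>E\<^esub> m = h"
    using u m h ch by (intro bexI[of _ "ar (cE m) u (cE h)"]) (auto simp: hom_E E_simps)
qed (auto simp: E_simps hom_E hom_iff arE_D)

lemma E_joint_tensor: "joint_tensor E {()} (\<lambda>_. B) (\<lambda>_. qE) (\<lambda>_. vE)"
proof (rule joint_tensor.intro[OF E_joint_abelian], rule joint_tensor_axioms.intro)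
  show "ex_tensor_category B" by (rule F.source.ex_tensor_category_axioms)
  show "f \<odot>\<^bsub>E\<^esub> g \<in> hom E (X \<otimes>\<^bsub>E\<^esub> Y) (X' \<otimes>\<^bsub>E\<^esub> Y')" if "f \<in> hom E X X'" "g \<in> hom E Y Y'" for f g X X' Y Y'
  proof -
    have "qE f = X" "cE f = X'" "qE g = Y" "cE g = Y'" using that unfolding hom_E by (metis decode)+
    then show ?thesis
      using that compat_tensor[of X Y X' Y' "vE f" "vE g"] unfolding hom_E by (simp add: E_simps)
  qed
qed (use compat_Assoc compat_Lun compat_Run compat_Sym in \<open>auto simp: E_simps hom_E oneE_def[symmetric]\<close>)

sublocale E: joint_tensor E "{()}" "\<lambda>_. B" "\<lambda>_. qE" "\<lambda>_. vE" by (rule E_joint_tensor)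

section \<open>The cohomology equipped with its isomorphism, and the resulting model\<close>

lemma phi_ob:
  assumes "X \<in> Ob T"
  shows "\<phi> i X \<in> Ar A" "iso_arrow A (\<phi> i X)" "Dom A (\<phi> i X) = FO F (FO (Coh H i) X)"
    "Cod A (\<phi> i X) = FO G (FO (Coh H i) X)"
  using \<phi> assms unfolding bk_iso_def kunneth_iso_def nat_iso_def by (auto simp: hom_iff)

lemma phi_nat:
  assumes "f \<in> Ar T"
  shows "FA G (FA (Coh H i) f) \<cdot>\<^bsub>A\<^esub> \<phi> i (Cod T f) = \<phi> i (Dom T f) \<cdot>\<^bsub>A\<^esub> FA F (FA (Coh H i) f)"
proof -
  have "\<forall>x\<in>Ob T. \<forall>y\<in>Ob T. \<forall>f\<in>hom T y x. \<phi> i y \<cdot>\<^bsub>A\<^esub> FA (func_comp (opposite T) F (Coh H i)) f =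
      FA (func_comp (opposite T) G (Coh H i)) f \<cdot>\<^bsub>A\<^esub> \<phi> i x"
    using \<phi> unfolding bk_iso_def kunneth_iso_def nat_iso_def by simp
  from this[rule_format, of "Cod T f" "Dom T f" f] show ?thesis using assms by (simp add: hom_iff)
qed

lemma phi_kap:
  assumes "X \<in> Ob T" "Y \<in> Ob T"
  shows "\<phi> (i + j) (X \<otimes>\<^bsub>T\<^esub> Y) \<cdot>\<^bsub>A\<^esub> (FA F (Kap H i j (X, Y)) \<cdot>\<^bsub>A\<^esub> Mult F (FO (Coh H i) X, FO (Coh H j) Y)) =
    (FA G (Kap H i j (X, Y)) \<cdot>\<^bsub>A\<^esub> Mult G (FO (Coh H i) X, FO (Coh H j) Y)) \<cdot>\<^bsub>A\<^esub> (\<phi> i X \<odot>\<^bsub>A\<^esub> \<phi> j Y)"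
  using \<phi> assms unfolding bk_iso_def kunneth_iso_def by simp

lemma phi_ups:
  "(inv_arrow A (Unit G) \<cdot>\<^bsub>A\<^esub> FA G (Ups H)) \<cdot>\<^bsub>A\<^esub> \<phi> 0 \<one>\<^bsub>T\<^esub> = inv_arrow A (Unit F) \<cdot>\<^bsub>A\<^esub> FA F (Ups H)"
  using \<phi> unfolding bk_iso_def kunneth_iso_def by simp

lemma phi_bd: "t \<in> Tri D \<Longrightarrow> FA G (Bd H i t) \<cdot>\<^bsub>A\<^esub> \<phi> i (snd t) = \<phi> (Suc i) (fst t) \<cdot>\<^bsub>A\<^esub> FA F (Bd H i t)"
  using \<phi> unfolding bk_iso_def by simp

definition hob :: "nat \<Rightarrow> 'o \<Rightarrow> 'u" where
  "hob i X = p (FO (Coh H i) X, \<phi> i X)"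

lemma hob [simp]:
  "X \<in> Ob T \<Longrightarrow> hob i X \<in> obE" "qE (hob i X) = FO (Coh H i) X" "aE (hob i X) = \<phi> i X"
  by (auto simp: hob_def phi_ob intro!: obEI)

definition HE :: "('o, 'a, 'u, 'u) rel_kunneth" where
  "HE = \<lparr>Coh = (\<lambda>i. \<lparr>FO = (\<lambda>X\<in>Ob T. hob i X),
      FA = (\<lambda>f\<in>Ar T. ar (hob i (Cod T f)) (FA (Coh H i) f) (hob i (Dom T f)))\<rparr>),
    Kap = (\<lambda>i j. \<lambda>(X, Y)\<in>Ob T \<times> Ob T.
      ar (tens (hob i X) (hob j Y)) (Kap H i j (X, Y)) (hob (i + j) (X \<otimes>\<^bsub>T\<^esub> Y))),
    Ups = ar (hob 0 \<one>\<^bsub>T\<^esub>) (Ups H) oneE,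
    Bd = (\<lambda>i. \<lambda>t\<in>Tri D. ar (hob i (snd t)) (Bd H i t) (hob (Suc i) (fst t)))\<rparr>"

lemma compat_Kap:
  assumes "X \<in> Ob T" "Y \<in> Ob T"
  shows "compat (tens (hob i X) (hob j Y)) (Kap H i j (X, Y)) (hob (i + j) (X \<otimes>\<^bsub>T\<^esub> Y))"
  by (rule compat_tensI) (use assms phi_kap[OF assms, of i j] in \<open>simp_all add: phi_ob\<close>)

lemma compat_Ups: "compat (hob 0 \<one>\<^bsub>T\<^esub>) (Ups H) oneE"
proof -
  have "Unit G \<cdot>\<^bsub>A\<^esub> ((inv_arrow A (Unit G) \<cdot>\<^bsub>A\<^esub> FA G (Ups H)) \<cdot>\<^bsub>A\<^esub> \<phi> 0 \<one>\<^bsub>T\<^esub>) =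
      Unit G \<cdot>\<^bsub>A\<^esub> (inv_arrow A (Unit F) \<cdot>\<^bsub>A\<^esub> FA F (Ups H))"
    using phi_ups by simp
  then show ?thesis by (simp add: compat_def oneE_def phi_ob)
qed

text \<open>The axioms hold in \<open>B\<close> and are reflected by the forgetful functor;
  compatibility with \<open>\<phi>\<close> enters in showing that the structure maps are arrows of
  \<open>E\<close>.\<close>

lemma HE_bkunneth: "bkunneth T D E HE"
proof (rule E.reflect_bkunneth[where K = "\<lambda>_. H"])
  show "boundary_data T D" by (rule H.boundary_data_axioms)
  show "bkunneth T D B H" by (rule H.bkunneth_axioms)
  show "FO (Coh HE n) \<in> extensional (Ob T)" "FA (Coh HE n) \<in> extensional (Ar T)"
    "Kap HE n m \<in> extensional (Ob T \<times> Ob T)" "Bd HE n \<in> extensional (Tri D)" for n m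
    by (auto simp: HE_def)
  show "FO (Coh HE n) X \<in> Ob E" if "X \<in> Ob T" for n X using that by (simp add: HE_def E_simps)
  show "FA (Coh HE n) f \<in> hom E (FO (Coh HE n) Y) (FO (Coh HE n) X)" if f: "f \<in> hom T X Y" for n f X Y
  proof -
    have "f \<in> Ar T" "Dom T f = X" "Cod T f = Y" "X \<in> Ob T" "Y \<in> Ob T"
      using f H.Dom_Ob[of f] H.Cod_Ob[of f] by (auto simp: hom_iff)
    then show ?thesis using phi_nat[of f n] by (auto simp: HE_def hom_E compat_def)
  qed
  show "Kap HE n m (X, Y) \<in>
      hom E (FO (Coh HE n) X \<otimes>\<^bsub>E\<^esub> FO (Coh HE m) Y) (FO (Coh HE (n + m)) (X \<otimes>\<^bsub>T\<^esub> Y))"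
    if "X \<in> Ob T" "Y \<in> Ob T" for n m X Y
    using that compat_Kap[OF that] by (auto simp: HE_def hom_E E_simps)
  show "Ups HE \<in> hom E (FO (Coh HE 0) \<one>\<^bsub>T\<^esub>) \<one>\<^bsub>E\<^esub>"
    using compat_Ups by (auto simp: HE_def hom_E E_simps)
  show "Bd HE n t \<in> hom E (FO (Coh HE n) (snd t)) (FO (Coh HE (Suc n)) (fst t))" if "t \<in> Tri D" for n t
    using that H.Tri_wf[OF that] phi_bd[OF that] by (auto simp: HE_def hom_E compat_def)
  show "\<exists>\<pi>. (\<forall>n\<le>k. \<pi> n \<in>
        hom E (FO (Coh HE k) (X \<otimes>\<^bsub>T\<^esub> Y)) (FO (Coh HE n) X \<otimes>\<^bsub>E\<^esub> FO (Coh HE (k - n)) Y)) \<and>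
        (\<forall>i\<in>{()}. bsys B k (\<lambda>n. FO (Coh H n) X \<otimes>\<^bsub>B\<^esub> FO (Coh H (k - n)) Y)
          (FO (Coh H k) (X \<otimes>\<^bsub>T\<^esub> Y)) (\<lambda>n. Kap H n (k - n) (X, Y)) (\<lambda>n. vE (\<pi> n)))"
    if XY: "X \<in> Ob T" "Y \<in> Ob T" for k X Y
  proof -
    obtain \<pi> where \<pi>: "bsys B k (\<lambda>n. FO (Coh H n) X \<otimes>\<^bsub>B\<^esub> FO (Coh H (k - n)) Y)
          (FO (Coh H k) (X \<otimes>\<^bsub>T\<^esub> Y)) (\<lambda>n. Kap H n (k - n) (X, Y)) \<pi>"
      using H.kunneth_bsys[OF XY, of k] by blast
    note b = F.source.bsysD[OF \<pi>]
    let ?t = "\<lambda>n. tens (hob n X) (hob (k - n) Y)" and ?Z = "X \<otimes>\<^bsub>T\<^esub> Y"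
    \<comment> \<open>Compatibility of \<open>\<phi>\<close> is assumed for the external products,
      not for the Kuenneth projections. It passes to them because projections are determined by
      injections.\<close>
    have "FA G (\<pi> n) \<cdot>\<^bsub>A\<^esub> \<phi> k ?Z = aE (?t n) \<cdot>\<^bsub>A\<^esub> FA F (\<pi> n)" if n: "n \<le> k" for n
    proof (rule F.target.bsys_transfer[OF F.ef.F_bsys[OF \<pi>] G.ef.F_bsys[OF \<pi>] _ _ _ _ _ _ _ n])
      fix m assume m: "m \<le> k"
      show "\<phi> k ?Z \<cdot>\<^bsub>A\<^esub> FA F (Kap H m (k - m) (X, Y)) = FA G (Kap H m (k - m) (X, Y)) \<cdot>\<^bsub>A\<^esub> aE (?t m)"
        using compat_Kap[OF XY, of m "k - m"] m by (simp add: compat_def)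
      show "aE (?t m) \<in> Ar A"
        "Dom A (aE (?t m)) = FO F (FO (Coh H m) X \<otimes>\<^bsub>B\<^esub> FO (Coh H (k - m)) Y)"
        "Cod A (aE (?t m)) = FO G (FO (Coh H m) X \<otimes>\<^bsub>B\<^esub> FO (Coh H (k - m)) Y)"
        using XY obE_simps[of "?t m"] by simp_all
    qed (use XY phi_ob in simp_all)
    then show ?thesis
      using \<pi> XY b
      by (intro exI[of _ "\<lambda>n. ar (hob k ?Z) (\<pi> n) (?t n)"])
        (simp add: hom_E E_simps compat_def HE_def)
  qed
qed (auto simp: HE_def)

definition ME :: "('o, 'a, 'u) model" where
  "ME = \<lparr>MCat = E, MCoh = HE, MKer = kerE, MCok = cokE, MBip = bipE\<rparr>"

lemma ME_model: "is_model T D ME"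
proof -
  have k: "is_kernel E (kerE c) c" if "c \<in> Ar E" for c
  proof -
    note c = that[unfolded E_simps]
    show ?thesis
      by (rule E.reflect_kernel) (use c kerE[OF c] arE_D[OF c] M_ker in \<open>auto simp: E_simps\<close>)
  qed
  have q: "is_cokernel E (cokE c) c" if "c \<in> Ar E" for c
  proof -
    note c = that[unfolded E_simps]
    show ?thesis
      by (rule E.reflect_cokernel) (use c cokE[OF c] arE_D[OF c] M_cok in \<open>auto simp: E_simps\<close>)
  qed
  have b: "is_biproduct E X Y (Cod E (bipE 0 X Y)) (bipE 0 X Y) (bipE 1 X Y) (bipE 2 X Y) (bipE 3 X Y)"
    if "X \<in> Ob E" "Y \<in> Ob E" for X Y
  proof -
    have X: "X \<in> obE" "Y \<in> obE" using that by (simp_all add: E_simps)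
    note b = bipE[OF X]
    have cod: "Cod E (bipE 0 X Y) = bipS X Y" using b(3) by (simp add: hom_iff)
    have B: "is_biproduct B (qE X) (qE Y) (qE (bipS X Y)) (vE (bipE 0 X Y)) (vE (bipE 1 X Y))
        (vE (bipE 2 X Y)) (vE (bipE 3 X Y))"
      using M_bip[of "qE X" "qE Y"] X b by simp
    have "bipE 2 X Y \<cdot>\<^bsub>E\<^esub> bipE 0 X Y = Id E X" "bipE 3 X Y \<cdot>\<^bsub>E\<^esub> bipE 1 X Y = Id E Y"
      "bipE 3 X Y \<cdot>\<^bsub>E\<^esub> bipE 0 X Y = Null E X Y" "bipE 2 X Y \<cdot>\<^bsub>E\<^esub> bipE 1 X Y = Null E Y X"
      "(bipE 0 X Y \<cdot>\<^bsub>E\<^esub> bipE 2 X Y) \<oplus>\<^bsub>E\<^esub> (bipE 1 X Y \<cdot>\<^bsub>E\<^esub> bipE 3 X Y) = Id E (bipS X Y)"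
      by (rule E.eqI; use b(1-6) B that in \<open>auto simp: is_biproduct_def hom_iff E.V_Comp E_simps(1)\<close>)+
    then show ?thesis using b(1-6) unfolding cod by (simp add: is_biproduct_def E_simps(1))
  qed
  show ?thesis
    using k q b HE_bkunneth E.ex_tensor_category_S by (simp add: is_model_def ME_def)
qed

end

section \<open>The universal category as one of its own models\<close>

context universal_category
begin

text \<open>The choices of kernels, cokernels and biproducts are assembled from those of all models,
  so that each projection carries them to the choices of its model.\<close>

definition M0 :: "('o, 'a, 'u) model" where
  "M0 = \<lparr>MCat = A0, MCoh = UU, MKer = (\<lambda>f. mk (\<lambda>M. MKer M (v M f))),
    MCok = (\<lambda>f. mk (\<lambda>M. MCok M (v M f))),
    MBip = (\<lambda>n x y. mk (\<lambda>M. MBip M n (q M x) (q M y)))\<rparr>"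

lemma M0_simps [simp]: "MCat M0 = A0" "MCoh M0 = UU"
  by (simp_all add: M0_def)

lemma v_M0:
  assumes "M \<in> MM"
  shows "c \<in> Ar A0 \<Longrightarrow> v M (MKer M0 c) = MKer M (v M c)"
    "c \<in> Ar A0 \<Longrightarrow> v M (MCok M0 c) = MCok M (v M c)"
    "x \<in> Ob A0 \<Longrightarrow> y \<in> Ob A0 \<Longrightarrow> n < 4 \<Longrightarrow> v M (MBip M0 n x y) = MBip M n (q M x) (q M y)"
  using v_mk[OF arrs.ker[OF v_RR] assms] v_mk[OF arrs.cok[OF v_RR] assms]
    v_mk[OF bip_RR assms] by (simp_all add: M0_def)

lemma M0_Ar:
  "c \<in> Ar A0 \<Longrightarrow> MKer M0 c \<in> Ar A0" "c \<in> Ar A0 \<Longrightarrow> MCok M0 c \<in> Ar A0"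
  "x \<in> Ob A0 \<Longrightarrow> y \<in> Ob A0 \<Longrightarrow> n < 4 \<Longrightarrow> MBip M0 n x y \<in> Ar A0"
  using mk_Ar[OF arrs.ker[OF v_RR]] mk_Ar[OF arrs.cok[OF v_RR]] mk_Ar[OF bip_RR]
  by (simp_all add: M0_def)

lemma M0_model: "is_model T D M0"
proof -
  have k: "is_kernel A0 (MKer M0 c) c" if c: "c \<in> Ar A0" for c
  proof (rule U.reflect_kernel)
    show "Cod A0 (MKer M0 c) = Dom A0 c"
    proof (rule ob_eqI)
      fix M assume M: "M \<in> MM"
      have "is_kernel (MCat M) (v M (MKer M0 c)) (v M c)" using mo_ker M v_Ar c v_M0(1) by simp
      then show "q M (Cod A0 (MKer M0 c)) = q M (Dom A0 c)"
        using M c M0_Ar(1)[OF c] by (simp add: is_kernel_def)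
    qed (use c M0_Ar(1) in simp_all)
  qed (use c M0_Ar v_M0 mo_ker v_Ar in simp_all)
  have q': "is_cokernel A0 (MCok M0 c) c" if c: "c \<in> Ar A0" for c
  proof (rule U.reflect_cokernel)
    show "Dom A0 (MCok M0 c) = Cod A0 c"
    proof (rule ob_eqI)
      fix M assume M: "M \<in> MM"
      have "is_cokernel (MCat M) (v M (MCok M0 c)) (v M c)" using mo_cok M v_Ar c v_M0(2) by simp
      then show "q M (Dom A0 (MCok M0 c)) = q M (Cod A0 c)"
        using M c M0_Ar(2)[OF c] by (simp add: is_cokernel_def)
    qed (use c M0_Ar(2) in simp_all)
  qed (use c M0_Ar v_M0 mo_cok v_Ar in simp_all)
  have b: "is_biproduct A0 x y (Cod A0 (MBip M0 0 x y)) (MBip M0 0 x y) (MBip M0 1 x y)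
      (MBip M0 2 x y) (MBip M0 3 x y)" if xy: "x \<in> Ob A0" "y \<in> Ob A0" for x y
  proof -
    let ?b = "\<lambda>n. MBip M0 n x y" let ?s = "Cod A0 (?b 0)"
    have b: "is_biproduct (MCat M) (q M x) (q M y) (Cod (MCat M) (v M (?b 0)))
      (v M (?b 0)) (v M (?b 1)) (v M (?b 2)) (v M (?b 3))" if "M \<in> MM" for M
      using mo_bip q_Ob xy that v_M0(3)[OF that xy] by simp
    have s: "?s \<in> Ob A0" "\<And>M. M \<in> MM \<Longrightarrow> q M ?s = Cod (MCat M) (v M (?b 0))"
      using M0_Ar(3)[OF xy] by simp_all
    have B: "is_biproduct (MCat M) (q M x) (q M y) (q M ?s)
      (v M (?b 0)) (v M (?b 1)) (v M (?b 2)) (v M (?b 3))" if "M \<in> MM" for M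
      using b[OF that] s(2)[OF that] by simp
    have h: "?b 0 \<in> hom A0 x ?s" "?b 1 \<in> hom A0 y ?s" "?b 2 \<in> hom A0 ?s x" "?b 3 \<in> hom A0 ?s y"
      by (rule UU_homI; use M0_Ar(3)[OF xy] xy s(1) B in \<open>auto simp: is_biproduct_def hom_iff\<close>)+
    have "?b 2 \<cdot>\<^bsub>A0\<^esub> ?b 0 = Id A0 x" "?b 3 \<cdot>\<^bsub>A0\<^esub> ?b 1 = Id A0 y" "?b 3 \<cdot>\<^bsub>A0\<^esub> ?b 0 = Null A0 x y"
      "?b 2 \<cdot>\<^bsub>A0\<^esub> ?b 1 = Null A0 y x" "(?b 0 \<cdot>\<^bsub>A0\<^esub> ?b 2) \<oplus>\<^bsub>A0\<^esub> (?b 1 \<cdot>\<^bsub>A0\<^esub> ?b 3) = Id A0 ?s"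
      by (rule U.eqI; use h B xy in \<open>auto simp: is_biproduct_def hom_iff U.V_Comp\<close>)+
    then show ?thesis using h s(1) by (simp add: is_biproduct_def)
  qed
  show ?thesis
    using k q' b UU_bkunneth U.ex_tensor_category_S by (simp add: is_model_def)
qed

text \<open>Only \<open>GProj\<close> needs an argument, since the projections at \<open>M0\<close>
  are picked by \<open>SOME\<close> without regard to the models. Their components are again
  projections for the prescribed injections, hence equal to the ones picked there, by
  uniqueness.\<close>

lemma gval_M0:
  assumes "g \<in> gens T D"
  shows "gval T M0 g = mk (\<lambda>M. gval T M g)"
proof (cases g)
  case (GProj k n X Y)
  then have XY: "X \<in> Ob T" "Y \<in> Ob T" "n \<le> k" using assms by (auto simp: gens_def)
  have M0': "M0 \<in> MM" using M0_model by simp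
  note b0 = kproj_bsys[OF M0' XY(1,2), of k]
  show ?thesis
  proof (rule arr_eqI)
    show "gval T M0 g \<in> Ar A0" using gval_Ar[OF assms M0'] by simp
    show "mk (\<lambda>M. gval T M g) \<in> Ar A0" using assms by (intro mk_Ar arrs.gen)
    fix M assume M: "M \<in> MM"
    interpret A: ex_tensor_category "MCat M" by (rule mo_ex[OF M])
    have "bsys (MCat M) k (\<lambda>n. q M (FO (Coh UU n) X \<otimes>\<^bsub>A0\<^esub> FO (Coh UU (k - n)) Y))
        (q M (FO (Coh UU k) (X \<otimes>\<^bsub>T\<^esub> Y))) (\<lambda>n. v M (Kap UU n (k - n) (X, Y)))
        (\<lambda>n. v M (kproj T M0 k X Y n))"
      by (rule U.V_bsys[OF _ M]) (use b0 in simp)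
    then have "bsys (MCat M) k (\<lambda>n. FO (Coh (MCoh M) n) X \<otimes>\<^bsub>MCat M\<^esub> FO (Coh (MCoh M) (k - n)) Y)
        (FO (Coh (MCoh M) k) (X \<otimes>\<^bsub>T\<^esub> Y)) (\<lambda>n. Kap (MCoh M) n (k - n) (X, Y))
        (\<lambda>n. v M (kproj T M0 k X Y n))"
      using FO_UU v_UU[OF M] XY M by (simp add: FO_UU(2))
    from A.bsys_unique[OF kproj_bsys[OF M XY(1,2)] this XY(3)]
    show "v M (gval T M0 g) = v M (mk (\<lambda>M. gval T M g))"
      using v_mk[OF arrs.gen[OF assms] M] GProj by simp
  qed
qed (use assms in \<open>auto simp: gens_def UU_def\<close>)

lemma A0_lift:
  assumes "monic A0 m" "factors A0 h m"
  shows "factor A0 h m \<in> Ar A0" "Dom A0 (factor A0 h m) = Dom A0 h"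
    "Cod A0 (factor A0 h m) = Dom A0 m" "m \<cdot>\<^bsub>A0\<^esub> factor A0 h m = h"
  using U.S.monic_factor[OF assms] by (auto simp: hom_iff)

lemma A0_ext:
  assumes "epic A0 m" "factors (dual A0) h m"
  shows "factor (dual A0) h m \<in> Ar A0" "Cod A0 (factor (dual A0) h m) = Cod A0 h"
    "Dom A0 (factor (dual A0) h m) = Cod A0 m" "factor (dual A0) h m \<cdot>\<^bsub>A0\<^esub> m = h"
  using category.monic_factor[OF category_dual[OF U.S.category_axioms], of m h] assms
  by (auto simp: hom_iff)

text \<open>The rules of \<open>arrs\<close>, read inside \<open>A0\<close>: families become arrows
  of \<open>A0\<close>, guards over all models become statements about \<open>A0\<close>, and
  \<open>cong\<close> disappears because families agreeing on all models have the same code.\<close>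

lemma A0_induct [consumes 1, case_names gen dom cod one comp plus scale tensor assoc lun run sym
    ker cok bip lift ext]:
  assumes c: "c \<in> Ar A0"
    and gen: "\<And>g. g \<in> gens T D \<Longrightarrow> P (gval T M0 g)"
    and dom: "\<And>c. c \<in> Ar A0 \<Longrightarrow> P c \<Longrightarrow> P (Id A0 (Dom A0 c))"
    and cod: "\<And>c. c \<in> Ar A0 \<Longrightarrow> P c \<Longrightarrow> P (Id A0 (Cod A0 c))"
    and one: "P (Id A0 \<one>\<^bsub>A0\<^esub>)"
    and comp: "\<And>c d. c \<in> Ar A0 \<Longrightarrow> d \<in> Ar A0 \<Longrightarrow> Dom A0 d = Cod A0 c \<Longrightarrow> P c \<Longrightarrow> P d \<Longrightarrow> P (d \<cdot>\<^bsub>A0\<^esub> c)"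
    and plus: "\<And>c d. c \<in> Ar A0 \<Longrightarrow> d \<in> Ar A0 \<Longrightarrow> Dom A0 d = Dom A0 c \<Longrightarrow> Cod A0 d = Cod A0 c \<Longrightarrow>
      P c \<Longrightarrow> P d \<Longrightarrow> P (c \<oplus>\<^bsub>A0\<^esub> d)"
    and scale: "\<And>c r. c \<in> Ar A0 \<Longrightarrow> P c \<Longrightarrow> P (Scale A0 r c)"
    and tensor: "\<And>c d. c \<in> Ar A0 \<Longrightarrow> d \<in> Ar A0 \<Longrightarrow> P c \<Longrightarrow> P d \<Longrightarrow> P (c \<odot>\<^bsub>A0\<^esub> d)"
    and assoc: "\<And>c d e. c \<in> Ar A0 \<Longrightarrow> d \<in> Ar A0 \<Longrightarrow> e \<in> Ar A0 \<Longrightarrow> P c \<Longrightarrow> P d \<Longrightarrow> P e \<Longrightarrow>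
      P (Assoc A0 (Dom A0 c) (Dom A0 d) (Dom A0 e))"
    and lun: "\<And>c. c \<in> Ar A0 \<Longrightarrow> P c \<Longrightarrow> P (Lun A0 (Dom A0 c))"
    and run: "\<And>c. c \<in> Ar A0 \<Longrightarrow> P c \<Longrightarrow> P (Run A0 (Dom A0 c))"
    and sym: "\<And>c d. c \<in> Ar A0 \<Longrightarrow> d \<in> Ar A0 \<Longrightarrow> P c \<Longrightarrow> P d \<Longrightarrow> P (Sym A0 (Dom A0 c) (Dom A0 d))"
    and ker: "\<And>c. c \<in> Ar A0 \<Longrightarrow> P c \<Longrightarrow> P (MKer M0 c)"
    and cok: "\<And>c. c \<in> Ar A0 \<Longrightarrow> P c \<Longrightarrow> P (MCok M0 c)"
    and bip: "\<And>c d n. c \<in> Ar A0 \<Longrightarrow> d \<in> Ar A0 \<Longrightarrow> n < 4 \<Longrightarrow> P c \<Longrightarrow> P d \<Longrightarrow>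
      P (MBip M0 n (Dom A0 c) (Dom A0 d))"
    and lift: "\<And>m h. m \<in> Ar A0 \<Longrightarrow> h \<in> Ar A0 \<Longrightarrow> monic A0 m \<Longrightarrow> factors A0 h m \<Longrightarrow> P m \<Longrightarrow> P h \<Longrightarrow>
      P (factor A0 h m)"
    and ext: "\<And>m h. m \<in> Ar A0 \<Longrightarrow> h \<in> Ar A0 \<Longrightarrow> epic A0 m \<Longrightarrow> factors (dual A0) h m \<Longrightarrow> P m \<Longrightarrow> P h \<Longrightarrow>
      P (factor (dual A0) h m)"
  shows "P c"
proof -
  have qd: "q M (Dom A0 (mk f)) = Dom (MCat M) (f M)" "q M (Cod A0 (mk f)) = Cod (MCat M) (f M)"
    if "f \<in> RR" "M \<in> MM" for f M
    using that q_Dom(3,4)[OF mk_Ar[OF that(1)] that(2)] by simp_all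
  have "P (mk f)" if "f \<in> RR" for f
    using that
  proof induction
    case (gen g) then show ?case using assms(2) gval_M0 by metis
  next
    case (cong f g)
    then have "mk g = mk f" by (intro mk_cong) simp
    then show ?case using cong by simp
  next
    case (dom f)
    have "mk (\<lambda>M. Id (MCat M) (Dom (MCat M) (f M))) = Id A0 (Dom A0 (mk f))"
      unfolding A0_ops A0_def by (simp, rule mk_cong) (use dom in simp)
    then show ?case using assms(3)[OF mk_Ar] dom by simp
  next
    case (cod f)
    have "mk (\<lambda>M. Id (MCat M) (Cod (MCat M) (f M))) = Id A0 (Cod A0 (mk f))"
      unfolding A0_ops A0_def by (simp, rule mk_cong) (use cod in simp)
    then show ?case using assms(4)[OF mk_Ar] cod by simp
  next
    case one then show ?case using assms(5) unfolding A0_ops by simp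
  next
    case (comp f g)
    have "mk (\<lambda>M. g M \<cdot>\<^bsub>MCat M\<^esub> f M) = mk g \<cdot>\<^bsub>A0\<^esub> mk f"
      unfolding A0_ops by (rule mk_cong) (use comp in simp)
    moreover have "Dom A0 (mk g) = Cod A0 (mk f)" by (rule ob_eqI) (use comp qd in auto)
    ultimately show ?case using assms(6)[OF mk_Ar mk_Ar] comp by simp
  next
    case (plus f g)
    have "mk (\<lambda>M. f M \<oplus>\<^bsub>MCat M\<^esub> g M) = mk f \<oplus>\<^bsub>A0\<^esub> mk g"
      unfolding A0_ops by (rule mk_cong) (use plus in simp)
    moreover have "Dom A0 (mk g) = Dom A0 (mk f)" "Cod A0 (mk g) = Cod A0 (mk f)"
      by (rule ob_eqI; use plus qd in auto)+
    ultimately show ?case using assms(7)[OF mk_Ar mk_Ar] plus by simp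
  next
    case (scale f r)
    have "mk (\<lambda>M. Scale (MCat M) r (f M)) = Scale A0 r (mk f)"
      unfolding A0_ops by (rule mk_cong) (use scale in simp)
    then show ?case using assms(8)[OF mk_Ar] scale by simp
  next
    case (tensor f g)
    have "mk (\<lambda>M. f M \<odot>\<^bsub>MCat M\<^esub> g M) = mk f \<odot>\<^bsub>A0\<^esub> mk g"
      unfolding A0_ops by (rule mk_cong) (use tensor in simp)
    then show ?case using assms(9)[OF mk_Ar mk_Ar] tensor by simp
  next
    case (assoc f g h)
    have "mk (\<lambda>M. Assoc (MCat M) (Dom (MCat M) (f M)) (Dom (MCat M) (g M)) (Dom (MCat M) (h M))) =
        Assoc A0 (Dom A0 (mk f)) (Dom A0 (mk g)) (Dom A0 (mk h))"
      unfolding A0_ops by (rule mk_cong) (use assoc qd in simp)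
    then show ?case using assms(10)[OF mk_Ar mk_Ar mk_Ar] assoc by simp
  next
    case (lun f)
    have "mk (\<lambda>M. Lun (MCat M) (Dom (MCat M) (f M))) = Lun A0 (Dom A0 (mk f))"
      unfolding A0_ops by (rule mk_cong) (use lun qd in simp)
    then show ?case using assms(11)[OF mk_Ar] lun by simp
  next
    case (run f)
    have "mk (\<lambda>M. Run (MCat M) (Dom (MCat M) (f M))) = Run A0 (Dom A0 (mk f))"
      unfolding A0_ops by (rule mk_cong) (use run qd in simp)
    then show ?case using assms(12)[OF mk_Ar] run by simp
  next
    case (sym f g)
    have "mk (\<lambda>M. Sym (MCat M) (Dom (MCat M) (f M)) (Dom (MCat M) (g M))) =
        Sym A0 (Dom A0 (mk f)) (Dom A0 (mk g))"
      unfolding A0_ops by (rule mk_cong) (use sym qd in simp)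
    then show ?case using assms(13)[OF mk_Ar mk_Ar] sym by simp
  next
    case (ker f)
    have "mk (\<lambda>M. MKer M (f M)) = MKer M0 (mk f)"
      unfolding M0_def by (simp, rule mk_cong) (use ker in simp)
    then show ?case using assms(14)[OF mk_Ar] ker by simp
  next
    case (cok f)
    have "mk (\<lambda>M. MCok M (f M)) = MCok M0 (mk f)"
      unfolding M0_def by (simp, rule mk_cong) (use cok in simp)
    then show ?case using assms(15)[OF mk_Ar] cok by simp
  next
    case (bip f g n)
    have "mk (\<lambda>M. MBip M n (Dom (MCat M) (f M)) (Dom (MCat M) (g M))) =
        MBip M0 n (Dom A0 (mk f)) (Dom A0 (mk g))"
      unfolding M0_def by (simp, rule mk_cong) (use bip qd in simp)
    then show ?case using assms(16)[OF mk_Ar mk_Ar] bip by simp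
  next
    case (lift m h)
    let ?u = "\<lambda>M. factor (MCat M) (h M) (m M)"
    have u: "?u \<in> RR" using lift(1,2,3) by (rule arrs.lift)
    have u': "?u M \<in> Ar (MCat M)" "Dom (MCat M) (?u M) = Dom (MCat M) (h M)"
      "Cod (MCat M) (?u M) = Dom (MCat M) (m M)" "m M \<cdot>\<^bsub>MCat M\<^esub> ?u M = h M" if "M \<in> MM" for M
      using category.monic_factor[OF mo_cat[OF that], of "m M" "h M"] lift(3)[of M] that
      by (auto simp: hom_iff)
    \<comment> \<open>An arrow monic in all models is monic in \<open>A0\<close>. The family of
      factorisations then is a factorisation there, and uniqueness identifies it with
      \<open>factor\<close>.\<close>
    have mon: "monic A0 (mk m)" by (rule U.reflect_monic) (use lift in auto)
    have D: "Cod A0 (mk ?u) = Dom A0 (mk m)" by (rule ob_eqI) (use u u' qd lift in auto)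
    have "mk m \<cdot>\<^bsub>A0\<^esub> mk ?u = mk h"
      unfolding A0_ops by (rule mk_cong) (use u u' lift in simp)
    from U.S.factor_eq[OF mon mk_Ar[OF u] D this] have "factors A0 (mk h) (mk m)"
      "mk ?u = factor A0 (mk h) (mk m)" by auto
    then show ?case using assms(17)[OF mk_Ar mk_Ar mon] lift by simp
  next
    case (ext m h)
    let ?u = "\<lambda>M. factor (dual (MCat M)) (h M) (m M)"
    interpret d: category "dual A0" by (rule category_dual[OF U.S.category_axioms])
    have u: "?u \<in> RR" using ext(1,2,3) by (rule arrs.ext)
    have u': "?u M \<in> Ar (MCat M)" "Cod (MCat M) (?u M) = Cod (MCat M) (h M)"
      "Dom (MCat M) (?u M) = Cod (MCat M) (m M)" "?u M \<cdot>\<^bsub>MCat M\<^esub> m M = h M" if "M \<in> MM" for M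
      using category.monic_factor[OF category_dual[OF mo_cat[OF that]], of "m M" "h M"] ext(3)[of M] that
      by (auto simp: hom_iff)
    have mon: "epic A0 (mk m)" by (rule U.reflect_epic) (use ext in auto)
    have D: "Dom A0 (mk ?u) = Cod A0 (mk m)" by (rule ob_eqI) (use u u' qd ext in auto)
    have "mk ?u \<cdot>\<^bsub>A0\<^esub> mk m = mk h"
      unfolding A0_ops by (rule mk_cong) (use u u' ext in simp)
    then have "factors (dual A0) (mk h) (mk m)" "mk ?u = factor (dual A0) (mk h) (mk m)"
      using d.factor_eq[of "mk m" "mk ?u" "mk h"] mon mk_Ar[OF u] D by auto
    then show ?case using assms(18)[OF mk_Ar mk_Ar mon] ext by simp
  qed
  then show ?thesis using c by (auto simp: A0_Ar)
qed

section \<open>Surjectivity, fullness and faithfulness of push-forward\<close>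

theorem push_surjective:
  fixes A :: "('u, 'u) ltcat" and H :: "('o, 'a, 'u, 'u) rel_kunneth"
  assumes "ex_tensor_category A" "bkunneth T D A H"
  shows "\<exists>F. exact_tensor_functor A0 A F \<and> push_bk T D A UU F = H"
proof -
  obtain M where M: "is_model T D M" "MCat M = A" "MCoh M = H"
    using model_exists[OF assms] by blast
  then show ?thesis
    using push_proj[of M] U.proj_exact_tensor_functor[of M] by (intro exI[of _ "U.proj M"]) simp
qed

theorem push_full:
  fixes A :: "('u, 'u) ltcat" and p :: "'u \<times> 'u \<Rightarrow> 'u"
  assumes F: "exact_tensor_functor A0 A F" and G: "exact_tensor_functor A0 A G"
    and \<phi>: "bk_iso T D A (push_bk T D A UU F) (push_bk T D A UU G) \<phi>" and p: "inj p"
  shows "\<exists>\<eta>. tensor_iso A0 A F G \<eta> \<and> (\<lambda>i. \<lambda>X\<in>Ob T. \<eta> (FO (Coh UU i) X)) = \<phi>"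
proof -
  interpret I: inserter T D M0 A F G \<phi> p
    by (rule inserter.intro) (use M0_model F G \<phi> p in simp_all)
  have ME: "I.ME \<in> MM" using I.ME_model by simp
  have cat: "MCat I.ME = I.E" "MCoh I.ME = I.HE" "MKer I.ME = I.kerE" "MCok I.ME = I.cokE"
    "MBip I.ME = I.bipE"
    by (simp_all add: I.ME_def)
  have [simp]: "v I.ME c \<in> I.arE" if "c \<in> Ar A0" for c
    using v_Ar[OF that ME] by (simp add: cat I.E_simps)
  have dq [simp]: "I.qE (v I.ME c) = q I.ME (Dom A0 c)" "I.cE (v I.ME c) = q I.ME (Cod A0 c)"
    if "c \<in> Ar A0" for c
    using q_Dom(3,4)[OF that ME] by (simp_all add: cat I.E_simps)
  have [simp]: "q I.ME x \<in> I.obE" if "x \<in> Ob A0" for x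
    using q_Ob[OF that ME] by (simp add: cat I.E_simps)
  \<comment> \<open>\<open>?m\<close> is the composite of the projection to \<open>E\<close> with
    the forgetful functor, an endofunctor of \<open>A0\<close> on arrows.\<close>
  let ?m = "\<lambda>c. I.vE (v I.ME c)"
  have ops: "?m (d \<cdot>\<^bsub>A0\<^esub> c) = ?m d \<cdot>\<^bsub>A0\<^esub> ?m c" if "c \<in> Ar A0" "d \<in> Ar A0" "Dom A0 d = Cod A0 c" for c d
    using U.V_Comp[OF ME that] by (simp add: cat I.E_simps)
  have mAr: "?m c \<in> Ar A0" "Dom A0 (?m c) = I.qE (q I.ME (Dom A0 c))"
    "Cod A0 (?m c) = I.qE (q I.ME (Cod A0 c))" if "c \<in> Ar A0" for c
    using that I.arE_D(3-5)[of "v I.ME c"] by simp_all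
  have mId: "?m (Id A0 x) = I.qE (q I.ME x)" if "x \<in> Ob A0" for x
    using U.V_ops(1)[OF ME that] by (simp add: cat I.E_simps A0_ops)
  \<comment> \<open>The choices of \<open>E\<close> lie over those of \<open>M0\<close>, so
    \<open>?m\<close> respects the operations by which \<open>A0\<close> is generated. On arrows
    obtained by factorisation it is pinned down by cancelling the monic or epic.\<close>
  have m: "?m c = c" if "c \<in> Ar A0" for c
    using that
  proof (induction rule: A0_induct)
    case (gen g)
    have "v I.ME (gval T M0 g) = gval T I.ME g"
      unfolding gval_M0[OF gen] using v_mk[OF arrs.gen[OF gen] ME] by simp
    moreover have "I.vE (gval T I.ME g) = gval T M0 g"
    proof (cases g)
      case (GProj k n X Y)
      then have XY: "X \<in> Ob T" "Y \<in> Ob T" "n \<le> k" using gen by (auto simp: gens_def)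
      \<comment> \<open>The Kuenneth projections in \<open>E\<close> are picked independently of
        those in \<open>A0\<close>. Their underlying arrows are projections for the same injections,
        so uniqueness applies.\<close>
      have "bsys I.E k (\<lambda>n. FO (Coh I.HE n) X \<otimes>\<^bsub>I.E\<^esub> FO (Coh I.HE (k - n)) Y)
          (FO (Coh I.HE k) (X \<otimes>\<^bsub>T\<^esub> Y)) (\<lambda>n. Kap I.HE n (k - n) (X, Y)) (kproj T I.ME k X Y)"
        using kproj_bsys[OF ME XY(1,2), of k] by (simp add: cat)
      from I.E.V_bsys[OF this, of "()"]
      have "bsys A0 k (\<lambda>n. FO (Coh UU n) X \<otimes>\<^bsub>A0\<^esub> FO (Coh UU (k - n)) Y)
          (FO (Coh UU k) (X \<otimes>\<^bsub>T\<^esub> Y)) (\<lambda>n. Kap UU n (k - n) (X, Y)) (\<lambda>n. I.vE (kproj T I.ME k X Y n))"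
        using XY by (simp add: I.HE_def I.E_simps)
      moreover have "bsys A0 k (\<lambda>n. FO (Coh UU n) X \<otimes>\<^bsub>A0\<^esub> FO (Coh UU (k - n)) Y)
          (FO (Coh UU k) (X \<otimes>\<^bsub>T\<^esub> Y)) (\<lambda>n. Kap UU n (k - n) (X, Y)) (kproj T M0 k X Y)"
        using kproj_bsys[of M0 X Y k] XY M0_model by simp
      ultimately show ?thesis
        using U.S.bsys_unique XY(3) GProj by simp
    qed (use gen in \<open>auto simp: gens_def cat I.HE_def\<close>)
    ultimately show ?case by simp
  next
    case (dom c)
    then show ?case using mId mAr(2)[of c] by (simp add: A0_ops)
  next
    case (cod c)
    then show ?case using mId mAr(3)[of c] by (simp add: A0_ops)
  next
    case one
    then show ?case using mId[of "\<one>\<^bsub>A0\<^esub>"] U.Q_One[OF ME] by (simp add: cat I.E_simps A0_ops(1))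
  next
    case (comp c d) then show ?case by (simp add: ops)
  next
    case (plus c d)
    then show ?case using U.V_ops(3)[OF ME, of c d] by (simp add: cat I.E_simps)
  next
    case (scale c r)
    then show ?case using U.V_ops(4)[OF ME, of c r] by (simp add: cat I.E_simps)
  next
    case (tensor c d)
    then show ?case using U.V_TA[OF ME, of c d] by (simp add: cat I.E_simps)
  next
    case (assoc c d e)
    then show ?case
      using U.V_Assoc[OF ME, of "Dom A0 c" "Dom A0 d" "Dom A0 e"] mAr(2)[of c] mAr(2)[of d] mAr(2)[of e]
      by (simp add: cat I.E_simps)
  next
    case (lun c)
    then show ?case using U.V_Lun[OF ME, of "Dom A0 c"] mAr(2)[of c] by (simp add: cat I.E_simps)
  next
    case (run c)
    then show ?case using U.V_Run[OF ME, of "Dom A0 c"] mAr(2)[of c] by (simp add: cat I.E_simps)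
  next
    case (sym c d)
    then show ?case
      using U.V_Sym[OF ME, of "Dom A0 c" "Dom A0 d"] mAr(2)[of c] mAr(2)[of d] by (simp add: cat I.E_simps)
  next
    case (ker c)
    then show ?case using v_M0(1)[OF ME, of c] I.kerE[of "v I.ME c"] by (simp add: cat)
  next
    case (cok c)
    then show ?case using v_M0(2)[OF ME, of c] I.cokE[of "v I.ME c"] by (simp add: cat)
  next
    case (bip c d n)
    have "v I.ME (MBip M0 n (Dom A0 c) (Dom A0 d)) = I.bipE n (q I.ME (Dom A0 c)) (q I.ME (Dom A0 d))"
      using v_M0(3)[OF ME, of "Dom A0 c" "Dom A0 d" n] bip by (simp add: cat)
    then show ?case
      using I.bipE(7)[of "q I.ME (Dom A0 c)" "q I.ME (Dom A0 d)" n] bip mAr(2)[of c] mAr(2)[of d] by simp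
  next
    case (lift m h)
    note u = A0_lift[OF lift(3,4)]
    have "m \<cdot>\<^bsub>A0\<^esub> ?m (factor A0 h m) = m \<cdot>\<^bsub>A0\<^esub> factor A0 h m"
      using ops[of "factor A0 h m" m] u lift by simp
    then show ?case
      by (rule U.S.monic_cancel[OF lift(3)])
        (use u mAr[OF u(1)] mAr[of m] mAr[of h] lift in simp_all)
  next
    case (ext m h)
    note u = A0_ext[OF ext(3,4)]
    have "?m (factor (dual A0) h m) \<cdot>\<^bsub>A0\<^esub> m = factor (dual A0) h m \<cdot>\<^bsub>A0\<^esub> m"
      using ops[of m "factor (dual A0) h m"] u ext by simp
    then show ?case
      by (rule U.S.epic_cancel[OF ext(3)])
        (use u mAr[OF u(1)] mAr[of m] mAr[of h] ext in simp_all)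
  qed
  \<comment> \<open>This is an equality of objects, so the isomorphism stored in the object of
    \<open>E\<close> over \<open>x\<close> goes from \<open>FO F x\<close> to \<open>FO G x\<close>
    without any correction.\<close>
  have qq [simp]: "I.qE (q I.ME x) = x" if "x \<in> Ob A0" for x
    using mId[OF that] m[of x] Ob_Ar[OF that] by (simp add: A0_ops)
  define \<eta> where "\<eta> = (\<lambda>x\<in>Ob A0. I.aE (q I.ME x))"
  have "tensor_iso A0 A F G \<eta>"
    unfolding tensor_iso_def nat_iso_def
  proof (intro conjI ballI)
    fix x assume x: "x \<in> Ob A0"
    show "\<eta> x \<in> hom A (FO F x) (FO G x)" "iso_arrow A (\<eta> x)"
      using x I.obE_simps[of "q I.ME x"] by (simp_all add: \<eta>_def hom_iff)
    fix y assume y: "y \<in> Ob A0"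
    show "\<eta> (x \<otimes>\<^bsub>A0\<^esub> y) \<cdot>\<^bsub>A\<^esub> Mult F (x, y) = Mult G (x, y) \<cdot>\<^bsub>A\<^esub> (\<eta> x \<odot>\<^bsub>A\<^esub> \<eta> y)"
      using x y I.tens_Mult[of "q I.ME x" "q I.ME y"] U.Q_TO[OF ME x y]
      by (simp add: \<eta>_def cat I.E_simps)
    fix f assume f: "f \<in> hom A0 x y"
    then have "f \<in> Ar A0" "Dom A0 f = x" "Cod A0 f = y" by (auto simp: hom_iff)
    then show "\<eta> y \<cdot>\<^bsub>A\<^esub> FA F f = FA G f \<cdot>\<^bsub>A\<^esub> \<eta> x"
      using x y I.arE_D(6)[of "v I.ME f"] m[of f] by (simp add: \<eta>_def I.compat_def)
  next
    show "\<eta> \<one>\<^bsub>A0\<^esub> \<cdot>\<^bsub>A\<^esub> Unit F = Unit G"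
      using I.one_Unit U.Q_One[OF ME] by (simp add: \<eta>_def cat I.E_simps)
  qed (simp add: \<eta>_def)
  moreover have "(\<lambda>i. \<lambda>X\<in>Ob T. \<eta> (FO (Coh UU i) X)) = \<phi>"
  proof
    fix i
    have ext: "\<phi> i \<in> extensional (Ob T)"
      using \<phi> by (simp add: bk_iso_def kunneth_iso_def nat_iso_def)
    show "(\<lambda>X\<in>Ob T. \<eta> (FO (Coh UU i) X)) = \<phi> i"
    proof (rule extensionalityI[OF _ ext])
      fix X assume X: "X \<in> Ob T"
      have "q I.ME (FO (Coh UU i) X) = I.hob i X"
        using FO_UU(2)[OF X ME] X by (simp add: cat I.HE_def)
      then show "(\<lambda>X\<in>Ob T. \<eta> (FO (Coh UU i) X)) X = \<phi> i X"
        using X FO_UU(1)[OF X] by (simp add: \<eta>_def)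
    qed simp
  qed
  ultimately show ?thesis by blast
qed

text \<open>The objects on which both isomorphisms agree are closed under subobjects, since
  \<open>G\<close> preserves monics, under quotients, since \<open>F\<close> preserves epics, and
  under tensor products and biproducts. By induction they include the source and target of every
  generated arrow.\<close>

theorem push_faithful:
  assumes F: "exact_tensor_functor A0 A F" and G: "exact_tensor_functor A0 A G"
    and \<eta>: "tensor_iso A0 A F G \<eta>" and \<theta>: "tensor_iso A0 A F G \<theta>"
    and eq: "\<And>i X. X \<in> Ob T \<Longrightarrow> \<eta> (FO (Coh UU i) X) = \<theta> (FO (Coh UU i) X)"
  shows "\<eta> = \<theta>"
proof -
  interpret F: exact_tensor_functor A0 A F by fact
  interpret G: exact_tensor_functor A0 A G by fact
  have M0: "M0 \<in> MM" using M0_model by simp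
  have t: "\<alpha> x \<in> Ar A" "Dom A (\<alpha> x) = FO F x" "Cod A (\<alpha> x) = FO G x"
    if "x \<in> Ob A0" "tensor_iso A0 A F G \<alpha>" for x \<alpha>
    using that by (auto simp: tensor_iso_def nat_iso_def hom_iff)
  have nat: "\<alpha> (Cod A0 c) \<cdot>\<^bsub>A\<^esub> FA F c = FA G c \<cdot>\<^bsub>A\<^esub> \<alpha> (Dom A0 c)"
    if "c \<in> Ar A0" "tensor_iso A0 A F G \<alpha>" for c \<alpha>
    using that q_Dom(1,2)[OF that(1)] unfolding tensor_iso_def nat_iso_def by (auto simp: hom_iff)
  let ?P = "\<lambda>x. \<eta> x = \<theta> x"
  have mon: "?P (Dom A0 c)" if "monic A0 c" "?P (Cod A0 c)" for c
  proof (rule F.target.monic_cancel[OF G.ef.F_monic[OF that(1)]])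
    have c: "c \<in> Ar A0" using that U.S.monic_Ar by blast
    show "FA G c \<cdot>\<^bsub>A\<^esub> \<eta> (Dom A0 c) = FA G c \<cdot>\<^bsub>A\<^esub> \<theta> (Dom A0 c)"
      using nat[OF c \<eta>] nat[OF c \<theta>] that(2) by simp
  qed (use that U.S.monic_Ar[OF that(1)] t \<eta> \<theta> in simp_all)
  have epi: "?P (Cod A0 c)" if "epic A0 c" "?P (Dom A0 c)" for c
  proof (rule F.target.epic_cancel[OF F.ef.F_epic[OF that(1)]])
    have c: "c \<in> Ar A0" using that U.S.epic_Ar by blast
    show "\<eta> (Cod A0 c) \<cdot>\<^bsub>A\<^esub> FA F c = \<theta> (Cod A0 c) \<cdot>\<^bsub>A\<^esub> FA F c"
      using nat[OF c \<eta>] nat[OF c \<theta>] that(2) by simp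
  qed (use that U.S.epic_Ar[OF that(1)] t \<eta> \<theta> in simp_all)
  have ten: "?P (x \<otimes>\<^bsub>A0\<^esub> y)" if "x \<in> Ob A0" "y \<in> Ob A0" "?P x" "?P y" for x y
  proof (rule F.target.iso_epi_cancel[where f = "Mult F (x, y)"])
    show "\<eta> (x \<otimes>\<^bsub>A0\<^esub> y) \<cdot>\<^bsub>A\<^esub> Mult F (x, y) = \<theta> (x \<otimes>\<^bsub>A0\<^esub> y) \<cdot>\<^bsub>A\<^esub> Mult F (x, y)"
      using that \<eta> \<theta> unfolding tensor_iso_def by simp
  qed (use that t \<eta> \<theta> in simp_all)
  have one: "?P \<one>\<^bsub>A0\<^esub>"
  proof (rule F.target.iso_epi_cancel[where f = "Unit F"])
    show "\<eta> \<one>\<^bsub>A0\<^esub> \<cdot>\<^bsub>A\<^esub> Unit F = \<theta> \<one>\<^bsub>A0\<^esub> \<cdot>\<^bsub>A\<^esub> Unit F"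
      using \<eta> \<theta> unfolding tensor_iso_def by simp
  qed (use t \<eta> \<theta> in simp_all)
  have main: "?P (Dom A0 c) \<and> ?P (Cod A0 c)" if "c \<in> Ar A0" for c
    using that
  proof (induction rule: A0_induct)
    case (gen g)
    show ?case
    proof (cases g)
      case (GProj k n X Y)
      then have XY: "X \<in> Ob T" "Y \<in> Ob T" "n \<le> k" using gen by (auto simp: gens_def)
      then show ?thesis
        using U.S.bsysD(7,8)[OF kproj_bsys[OF M0 XY(1,2), of k, simplified] XY(3)] GProj eq ten FO_UU by simp
    qed (use gen eq ten one FO_UU Tri_wf in \<open>auto simp: gens_def\<close>)
  next
    case (ker c)
    have k: "is_kernel A0 (MKer M0 c) c" using mo_ker[OF M0] ker by simp
    show ?case using mon[OF U.S.kernel_monic[OF k]] U.S.kernel_simps[OF k] ker by simp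
  next
    case (cok c)
    have k: "is_cokernel A0 (MCok M0 c) c" using mo_cok[OF M0] cok by simp
    have e: "epic A0 (MCok M0 c)"
      using linear_category.kernel_monic[OF U.S.linear_category_dual, of "MCok M0 c" c] k by simp
    show ?case using epi[OF e] k cok by (auto simp: is_cokernel_def)
  next
    case (bip c d n)
    let ?x = "Dom A0 c" and ?y = "Dom A0 d"
    let ?b = "\<lambda>n. MBip M0 n ?x ?y"
    let ?s = "Cod A0 (?b 0)"
    have b: "is_biproduct A0 ?x ?y ?s (?b 0) (?b 1) (?b 2) (?b 3)"
      using mo_bip[OF M0, of ?x ?y] bip by simp
    then have b': "?s \<in> Ob A0" "?b 0 \<in> Ar A0" "Dom A0 (?b 0) = ?x" "?b 1 \<in> Ar A0" "Dom A0 (?b 1) = ?y"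
      "Cod A0 (?b 1) = ?s" "?b 2 \<in> Ar A0" "Dom A0 (?b 2) = ?s" "Cod A0 (?b 2) = ?x" "?b 3 \<in> Ar A0"
      "Dom A0 (?b 3) = ?s" "Cod A0 (?b 3) = ?y"
      by (auto simp: is_biproduct_def hom_iff)
    have xy: "?P ?x" "?P ?y" using bip by auto
    \<comment> \<open>Naturality at the two injections expresses the value at a biproduct through
      the values at its summands.\<close>
    have e: "\<alpha> ?s = ((FA G (?b 0) \<cdot>\<^bsub>A\<^esub> \<alpha> ?x) \<cdot>\<^bsub>A\<^esub> FA F (?b 2)) \<oplus>\<^bsub>A\<^esub> ((FA G (?b 1) \<cdot>\<^bsub>A\<^esub> \<alpha> ?y) \<cdot>\<^bsub>A\<^esub> FA F (?b 3))"
      if \<alpha>: "tensor_iso A0 A F G \<alpha>" for \<alpha>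
    proof -
      have B: "is_biproduct A (FO F ?x) (FO F ?y) (FO F ?s) (FA F (?b 0)) (FA F (?b 1)) (FA F (?b 2)) (FA F (?b 3))"
        by (rule F.ef.F_biproduct[OF b])
      have "\<alpha> ?s = \<alpha> ?s \<cdot>\<^bsub>A\<^esub> ((FA F (?b 0) \<cdot>\<^bsub>A\<^esub> FA F (?b 2)) \<oplus>\<^bsub>A\<^esub> (FA F (?b 1) \<cdot>\<^bsub>A\<^esub> FA F (?b 3)))"
        using B t[OF b'(1) \<alpha>] by (simp add: is_biproduct_def)
      also have "\<dots> = ((\<alpha> ?s \<cdot>\<^bsub>A\<^esub> FA F (?b 0)) \<cdot>\<^bsub>A\<^esub> FA F (?b 2)) \<oplus>\<^bsub>A\<^esub> ((\<alpha> ?s \<cdot>\<^bsub>A\<^esub> FA F (?b 1)) \<cdot>\<^bsub>A\<^esub> FA F (?b 3))"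
        using b' t[OF b'(1) \<alpha>] by (simp add: F.target.comp_Plus)
      finally show ?thesis using nat[OF b'(2) \<alpha>] nat[OF b'(4) \<alpha>] b' by simp
    qed
    have s: "?P ?s" unfolding e[OF \<eta>] e[OF \<theta>] xy ..
    from bip(3) consider "n = 0" | "n = 1" | "n = 2" | "n = 3" by linarith
    then show ?case by cases (use b' s xy in simp_all)
  next
    case (lift m h) then show ?case using A0_lift[OF lift(3,4)] by simp
  next
    case (ext m h) then show ?case using A0_ext[OF ext(3,4)] by simp
  qed (use ten one in auto)
  show ?thesis
  proof (rule extensionalityI[of _ "Ob A0"])
    show "\<eta> \<in> extensional (Ob A0)" "\<theta> \<in> extensional (Ob A0)"
      using \<eta> \<theta> by (simp_all add: tensor_iso_def nat_iso_def)
    fix x assume x: "x \<in> Ob A0"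
    then show "\<eta> x = \<theta> x" using main[of "Id A0 x"] by simp
  qed
qed

end

text \<open>Fullness and faithfulness are merged into unique existence, and the coding by
  \<open>e\<close> and \<open>p\<close> disappears from the conclusion; what follows uses only these
  properties.\<close>

theorem universal_category_exists:
  fixes T :: "('o, 'a, 'z) tcat_scheme" and eo :: "'o \<Rightarrow> 'u" and ea :: "'a \<Rightarrow> 'u"
  assumes D: "boundary_data T D" and inf: "infinite (UNIV :: 'u set)" and eo: "inj eo" and ea: "inj ea"
  obtains A0 :: "('u, 'u) ltcat" and U where "ex_tensor_category A0" "bkunneth T D A0 U"
    "\<And>(A :: ('u, 'u) ltcat) H. ex_tensor_category A \<Longrightarrow> bkunneth T D A H \<Longrightarrow>
      \<exists>F. exact_tensor_functor A0 A F \<and> push_bk T D A U F = H"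
    "\<And>(A :: ('u, 'u) ltcat) F G \<phi>. exact_tensor_functor A0 A F \<Longrightarrow> exact_tensor_functor A0 A G \<Longrightarrow>
      bk_iso T D A (push_bk T D A U F) (push_bk T D A U G) \<phi> \<Longrightarrow>
      \<exists>!\<eta>. tensor_iso A0 A F G \<eta> \<and> (\<lambda>i. \<lambda>X\<in>Ob T. \<eta> (FO (Coh U i) X)) = \<phi>"
proof -
  obtain e :: "(('o, 'a, 'u) model \<Rightarrow> 'u) \<Rightarrow> 'u" where
    "inj_on e ((\<lambda>f. restrict f {M. is_model T D M}) ` arrs T D)"
    using arrs_inject[OF inf eo ea] by blast
  then interpret C: universal_category T D e
    using D by (simp add: universal_category_def universal_category_axioms_def)
  obtain p :: "'u \<times> 'u \<Rightarrow> 'u" where p: "inj p" using pairing_exists[OF inf] by blast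
  show thesis
  proof (rule that[OF C.U.ex_tensor_category_S C.UU_bkunneth C.push_surjective])
    fix A :: "('u, 'u) ltcat" and F G \<phi>
    assume F: "exact_tensor_functor C.A0 A F" and G: "exact_tensor_functor C.A0 A G"
      and \<phi>: "bk_iso T D A (push_bk T D A C.UU F) (push_bk T D A C.UU G) \<phi>"
    obtain \<eta> where \<eta>: "tensor_iso C.A0 A F G \<eta>" "(\<lambda>i. \<lambda>X\<in>Ob T. \<eta> (FO (Coh C.UU i) X)) = \<phi>"
      using C.push_full[OF F G \<phi> p] by blast
    moreover have "\<theta> = \<eta>"
      if "tensor_iso C.A0 A F G \<theta>" "(\<lambda>i. \<lambda>X\<in>Ob T. \<theta> (FO (Coh C.UU i) X)) = \<phi>" for \<theta>
    proof (rule C.push_faithful[OF F G that(1) \<eta>(1)])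
      fix i X assume "X \<in> Ob T"
      then show "\<theta> (FO (Coh C.UU i) X) = \<eta> (FO (Coh C.UU i) X)"
        using fun_cong[OF fun_cong[OF trans[OF that(2) \<eta>(2)[symmetric]], of i], of X] by simp
    qed
    ultimately show "\<exists>!\<eta>. tensor_iso C.A0 A F G \<eta> \<and> (\<lambda>i. \<lambda>X\<in>Ob T. \<eta> (FO (Coh C.UU i) X)) = \<phi>"
      by blast
  qed
qed


section \<open>Groupoids of functors and of cohomologies\<close>

lemma nat_isoD:
  assumes "nat_iso C D F G \<eta>" "category D"
  shows "x \<in> Ob C \<Longrightarrow> \<eta> x \<in> Ar D" "x \<in> Ob C \<Longrightarrow> Dom D (\<eta> x) = FO F x"
    "x \<in> Ob C \<Longrightarrow> Cod D (\<eta> x) = FO G x" "x \<in> Ob C \<Longrightarrow> iso_arrow D (\<eta> x)"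
    "f \<in> Ar C \<Longrightarrow> Dom C f \<in> Ob C \<Longrightarrow> Cod C f \<in> Ob C \<Longrightarrow>
      \<eta> (Cod C f) \<cdot>\<^bsub>D\<^esub> FA F f = FA G f \<cdot>\<^bsub>D\<^esub> \<eta> (Dom C f)"
    "\<eta> \<in> extensional (Ob C)"
  using assms by (auto simp: nat_iso_def hom_iff)

lemma nat_isoI:
  assumes "category D" "\<And>x. x \<in> Ob C \<Longrightarrow> iso_arrow D (\<eta> x)"
    "\<And>x. x \<in> Ob C \<Longrightarrow> Dom D (\<eta> x) = FO F x" "\<And>x. x \<in> Ob C \<Longrightarrow> Cod D (\<eta> x) = FO G x"
    "\<And>f. f \<in> Ar C \<Longrightarrow> Dom C f \<in> Ob C \<Longrightarrow> Cod C f \<in> Ob C \<Longrightarrow>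
      \<eta> (Cod C f) \<cdot>\<^bsub>D\<^esub> FA F f = FA G f \<cdot>\<^bsub>D\<^esub> \<eta> (Dom C f)"
    "\<eta> \<in> extensional (Ob C)"
  shows "nat_iso C D F G \<eta>"
  using assms category.iso_Ar[OF assms(1)] by (auto simp: nat_iso_def hom_iff)

lemma nat_iso_Id:
  assumes "cat_functor C D F"
  shows "nat_iso C D F F (\<lambda>x\<in>Ob C. Id D (FO F x))"
proof -
  interpret F: cat_functor C D F by fact
  show ?thesis by (rule nat_isoI) (simp_all add: F.target.category_axioms)
qed

lemma nat_iso_comp:
  assumes "cat_functor C D F" "cat_functor C D G" "cat_functor C D K"
    and \<eta>: "nat_iso C D F G \<eta>" and \<theta>: "nat_iso C D G K \<theta>"
  shows "nat_iso C D F K (\<lambda>x\<in>Ob C. \<theta> x \<cdot>\<^bsub>D\<^esub> \<eta> x)"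
proof -
  interpret F: cat_functor C D F by fact
  interpret G: cat_functor C D G by fact
  interpret K: cat_functor C D K by fact
  note h = nat_isoD[OF \<eta> F.target.category_axioms] and t = nat_isoD[OF \<theta> F.target.category_axioms]
  show ?thesis
  proof (rule nat_isoI)
    fix f assume f: "f \<in> Ar C"
    let ?x = "Dom C f" and ?y = "Cod C f"
    have "(\<theta> ?y \<cdot>\<^bsub>D\<^esub> \<eta> ?y) \<cdot>\<^bsub>D\<^esub> FA F f = \<theta> ?y \<cdot>\<^bsub>D\<^esub> (\<eta> ?y \<cdot>\<^bsub>D\<^esub> FA F f)"
      using f h(1-3) t(1-3) by simp
    also have "\<eta> ?y \<cdot>\<^bsub>D\<^esub> FA F f = FA G f \<cdot>\<^bsub>D\<^esub> \<eta> ?x" using f h(5) by simp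
    also have "\<theta> ?y \<cdot>\<^bsub>D\<^esub> (FA G f \<cdot>\<^bsub>D\<^esub> \<eta> ?x) = FA K f \<cdot>\<^bsub>D\<^esub> (\<theta> ?x \<cdot>\<^bsub>D\<^esub> \<eta> ?x)"
      by (rule F.target.comp_extend) (use f h(1-3) t(1-3,5) in simp_all)
    finally show "(\<lambda>x\<in>Ob C. \<theta> x \<cdot>\<^bsub>D\<^esub> \<eta> x) ?y \<cdot>\<^bsub>D\<^esub> FA F f =
        FA K f \<cdot>\<^bsub>D\<^esub> (\<lambda>x\<in>Ob C. \<theta> x \<cdot>\<^bsub>D\<^esub> \<eta> x) ?x"
      using f by simp
  qed (use h t in \<open>simp_all add: F.target.iso_comp F.target.category_axioms\<close>)
qed

lemma tensor_iso_Id: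
  assumes "exact_tensor_functor A B F"
  shows "tensor_iso A B F F (\<lambda>x\<in>Ob A. Id B (FO F x))"
proof -
  interpret F: exact_tensor_functor A B F by fact
  show ?thesis unfolding tensor_iso_def by (simp add: nat_iso_Id[OF F.cat_functor_axioms])
qed

lemma tensor_iso_comp:
  assumes "exact_tensor_functor A B F" "exact_tensor_functor A B G" "exact_tensor_functor A B K"
    and \<eta>: "tensor_iso A B F G \<eta>" and \<theta>: "tensor_iso A B G K \<theta>"
  shows "tensor_iso A B F K (\<lambda>x\<in>Ob A. \<theta> x \<cdot>\<^bsub>B\<^esub> \<eta> x)"
proof -
  interpret F: exact_tensor_functor A B F by fact
  interpret G: exact_tensor_functor A B G by fact
  interpret K: exact_tensor_functor A B K by fact
  have n: "nat_iso A B F G \<eta>" "nat_iso A B G K \<theta>" using \<eta> \<theta> by (auto simp: tensor_iso_def)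
  note h = nat_isoD[OF n(1) F.target.category_axioms] and t = nat_isoD[OF n(2) F.target.category_axioms]
  have "(\<theta> (x \<otimes>\<^bsub>A\<^esub> y) \<cdot>\<^bsub>B\<^esub> \<eta> (x \<otimes>\<^bsub>A\<^esub> y)) \<cdot>\<^bsub>B\<^esub> Mult F (x, y) =
      Mult K (x, y) \<cdot>\<^bsub>B\<^esub> ((\<theta> x \<cdot>\<^bsub>B\<^esub> \<eta> x) \<odot>\<^bsub>B\<^esub> (\<theta> y \<cdot>\<^bsub>B\<^esub> \<eta> y))"
    if xy: "x \<in> Ob A" "y \<in> Ob A" for x y
  proof -
    have "(\<theta> (x \<otimes>\<^bsub>A\<^esub> y) \<cdot>\<^bsub>B\<^esub> \<eta> (x \<otimes>\<^bsub>A\<^esub> y)) \<cdot>\<^bsub>B\<^esub> Mult F (x, y) =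
        \<theta> (x \<otimes>\<^bsub>A\<^esub> y) \<cdot>\<^bsub>B\<^esub> (\<eta> (x \<otimes>\<^bsub>A\<^esub> y) \<cdot>\<^bsub>B\<^esub> Mult F (x, y))"
      using xy h(1-3) t(1-3) by simp
    also have "\<eta> (x \<otimes>\<^bsub>A\<^esub> y) \<cdot>\<^bsub>B\<^esub> Mult F (x, y) = Mult G (x, y) \<cdot>\<^bsub>B\<^esub> (\<eta> x \<odot>\<^bsub>B\<^esub> \<eta> y)"
      using \<eta> xy by (simp add: tensor_iso_def)
    also have "\<theta> (x \<otimes>\<^bsub>A\<^esub> y) \<cdot>\<^bsub>B\<^esub> \<dots> = Mult K (x, y) \<cdot>\<^bsub>B\<^esub> ((\<theta> x \<odot>\<^bsub>B\<^esub> \<theta> y) \<cdot>\<^bsub>B\<^esub> (\<eta> x \<odot>\<^bsub>B\<^esub> \<eta> y))"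
      by (rule F.target.comp_extend) (use \<theta> xy h(1-3) t(1-3) in \<open>simp_all add: tensor_iso_def\<close>)
    also have "(\<theta> x \<odot>\<^bsub>B\<^esub> \<theta> y) \<cdot>\<^bsub>B\<^esub> (\<eta> x \<odot>\<^bsub>B\<^esub> \<eta> y) = (\<theta> x \<cdot>\<^bsub>B\<^esub> \<eta> x) \<odot>\<^bsub>B\<^esub> (\<theta> y \<cdot>\<^bsub>B\<^esub> \<eta> y)"
      by (rule F.target.TA_merge) (use xy h(1-3) t(1-3) in simp_all)
    finally show ?thesis .
  qed
  moreover have "(\<theta> \<one>\<^bsub>A\<^esub> \<cdot>\<^bsub>B\<^esub> \<eta> \<one>\<^bsub>A\<^esub>) \<cdot>\<^bsub>B\<^esub> Unit F = Unit K"
    using \<eta> \<theta> h(1-3)[of "\<one>\<^bsub>A\<^esub>"] t(1-3)[of "\<one>\<^bsub>A\<^esub>"] by (simp add: tensor_iso_def)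
  ultimately show ?thesis
    unfolding tensor_iso_def
    using nat_iso_comp[OF F.cat_functor_axioms G.cat_functor_axioms K.cat_functor_axioms n] by simp
qed

lemma category_tensor_functor_groupoid: "category (tensor_functor_groupoid A B)"
proof unfold_locales
  fix f g x y z
  assume "f \<in> hom (tensor_functor_groupoid A B) x y" "g \<in> hom (tensor_functor_groupoid A B) y z"
  then show "g \<cdot>\<^bsub>tensor_functor_groupoid A B\<^esub> f \<in> hom (tensor_functor_groupoid A B) x z"
    by (auto simp: hom_iff tensor_functor_groupoid_def tensor_iso_comp)
next
  fix f g h w x y z
  assume *: "f \<in> hom (tensor_functor_groupoid A B) w x" "g \<in> hom (tensor_functor_groupoid A B) x y"
    "h \<in> hom (tensor_functor_groupoid A B) y z"
  obtain a b c where abc: "f = (w, a, x)" "g = (x, b, y)" "h = (y, c, z)"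
    using * by (auto simp: hom_iff tensor_functor_groupoid_def)
  then have n: "category B" "nat_iso A B w x a" "nat_iso A B x y b" "nat_iso A B y z c"
    using * by (auto simp: hom_iff tensor_functor_groupoid_def tensor_iso_def
        exact_tensor_functor_def cat_functor_def)
  have "(\<lambda>x\<in>Ob A. (c x \<cdot>\<^bsub>B\<^esub> b x) \<cdot>\<^bsub>B\<^esub> a x) = (\<lambda>x\<in>Ob A. c x \<cdot>\<^bsub>B\<^esub> (b x \<cdot>\<^bsub>B\<^esub> a x))"
    by (rule restrict_ext, rule category.assoc[OF n(1)])
      (use nat_isoD[OF n(2,1)] nat_isoD[OF n(3,1)] nat_isoD[OF n(4,1)] in auto)
  then show "(h \<cdot>\<^bsub>tensor_functor_groupoid A B\<^esub> g) \<cdot>\<^bsub>tensor_functor_groupoid A B\<^esub> f =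
      h \<cdot>\<^bsub>tensor_functor_groupoid A B\<^esub> (g \<cdot>\<^bsub>tensor_functor_groupoid A B\<^esub> f)"
    using abc by (simp add: tensor_functor_groupoid_def restrict_def cong: if_cong)
next
  fix f x y assume *: "f \<in> hom (tensor_functor_groupoid A B) x y"
  obtain a where a: "f = (x, a, y)" using * by (auto simp: hom_iff tensor_functor_groupoid_def)
  then have n: "category B" "nat_iso A B x y a"
    using * by (auto simp: hom_iff tensor_functor_groupoid_def tensor_iso_def
        exact_tensor_functor_def cat_functor_def)
  note a' = nat_isoD[OF n(2,1)]
  have "(\<lambda>t\<in>Ob A. (\<lambda>t\<in>Ob A. Id B (FO y t)) t \<cdot>\<^bsub>B\<^esub> a t) = a"
    "(\<lambda>t\<in>Ob A. a t \<cdot>\<^bsub>B\<^esub> (\<lambda>t\<in>Ob A. Id B (FO x t)) t) = a"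
    by (rule extensionalityI[of _ "Ob A"]; use a' category.Id_comp[OF n(1)] category.comp_Id[OF n(1)] in simp)+
  then show "Id (tensor_functor_groupoid A B) y \<cdot>\<^bsub>tensor_functor_groupoid A B\<^esub> f = f"
    "f \<cdot>\<^bsub>tensor_functor_groupoid A B\<^esub> Id (tensor_functor_groupoid A B) x = f"
    using a by (simp_all add: tensor_functor_groupoid_def)
qed (auto simp: hom_iff tensor_functor_groupoid_def tensor_iso_Id)

text \<open>The parameter \<open>E\<close> completes an object by its boundary maps, which are vacuous in the absolute
  case and part of the object in the relative case.\<close>

definition bk_groupoid :: "('o, 'a, 'z) tcat_scheme \<Rightarrow> ('o, 'a) bdata \<Rightarrow> ('p, 'b, 'w) ltcat_scheme \<Rightarrow>
    ('h \<Rightarrow> ('o, 'a, 'p, 'b) rel_kunneth) \<Rightarrow> ('h, 'h \<times> (nat \<Rightarrow> 'o \<Rightarrow> 'b) \<times> 'h) cat" where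
  "bk_groupoid T D A E =
    \<lparr>Ob = {H. bkunneth T D A (E H)},
     Ar = {(H, \<phi>, K). bkunneth T D A (E H) \<and> bkunneth T D A (E K) \<and> bk_iso T D A (E H) (E K) \<phi>},
     Dom = (\<lambda>(H, \<phi>, K). H), Cod = (\<lambda>(H, \<phi>, K). K),
     Id = (\<lambda>H. (H, (\<lambda>i. \<lambda>X\<in>Ob T. Id A (FO (Coh (E H) i) X)), H)),
     Comp = (\<lambda>(K', \<psi>, L) (H, \<phi>, K). (H, (\<lambda>i. \<lambda>X\<in>Ob T. \<psi> i X \<cdot>\<^bsub>A\<^esub> \<phi> i X), L))\<rparr>"

lemma bk_isoD:
  assumes "bk_iso T D A H K \<phi>" "category A"
  shows "X \<in> Ob T \<Longrightarrow> \<phi> i X \<in> Ar A" "X \<in> Ob T \<Longrightarrow> Dom A (\<phi> i X) = FO (Coh H i) X"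
    "X \<in> Ob T \<Longrightarrow> Cod A (\<phi> i X) = FO (Coh K i) X" "\<phi> i \<in> extensional (Ob T)"
  using assms nat_isoD[of "opposite T" A "Coh H i" "Coh K i" "\<phi> i"]
  by (simp_all add: bk_iso_def kunneth_iso_def)

lemma bk_iso_Id:
  assumes "bkunneth T D A H"
  shows "bk_iso T D A H H (\<lambda>i. \<lambda>X\<in>Ob T. Id A (FO (Coh H i) X))"
proof -
  interpret H: bkunneth T D A H by fact
  show ?thesis
    using nat_iso_Id[OF H.Coh_functor] H.Tri_wf by (simp add: bk_iso_def kunneth_iso_def)
qed

lemma bk_iso_comp:
  assumes "bkunneth T D A H" "bkunneth T D A K" "bkunneth T D A L"
    and \<phi>: "bk_iso T D A H K \<phi>" and \<psi>: "bk_iso T D A K L \<psi>"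
  shows "bk_iso T D A H L (\<lambda>i. \<lambda>X\<in>Ob T. \<psi> i X \<cdot>\<^bsub>A\<^esub> \<phi> i X)"
proof -
  interpret H: bkunneth T D A H by fact
  interpret K: bkunneth T D A K by fact
  interpret L: bkunneth T D A L by fact
  note p = bk_isoD(1-3)[OF \<phi> H.target.category_axioms] and s = bk_isoD(1-3)[OF \<psi> H.target.category_axioms]
  have "(\<psi> (i + j) (X \<otimes>\<^bsub>T\<^esub> Y) \<cdot>\<^bsub>A\<^esub> \<phi> (i + j) (X \<otimes>\<^bsub>T\<^esub> Y)) \<cdot>\<^bsub>A\<^esub> Kap H i j (X, Y) =
      Kap L i j (X, Y) \<cdot>\<^bsub>A\<^esub> ((\<psi> i X \<cdot>\<^bsub>A\<^esub> \<phi> i X) \<odot>\<^bsub>A\<^esub> (\<psi> j Y \<cdot>\<^bsub>A\<^esub> \<phi> j Y))"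
    if X: "X \<in> Ob T" "Y \<in> Ob T" for X Y i j
  proof -
    have "(\<psi> (i + j) (X \<otimes>\<^bsub>T\<^esub> Y) \<cdot>\<^bsub>A\<^esub> \<phi> (i + j) (X \<otimes>\<^bsub>T\<^esub> Y)) \<cdot>\<^bsub>A\<^esub> Kap H i j (X, Y) =
        \<psi> (i + j) (X \<otimes>\<^bsub>T\<^esub> Y) \<cdot>\<^bsub>A\<^esub> (\<phi> (i + j) (X \<otimes>\<^bsub>T\<^esub> Y) \<cdot>\<^bsub>A\<^esub> Kap H i j (X, Y))"
      using X p s by simp
    also have "\<phi> (i + j) (X \<otimes>\<^bsub>T\<^esub> Y) \<cdot>\<^bsub>A\<^esub> Kap H i j (X, Y) = Kap K i j (X, Y) \<cdot>\<^bsub>A\<^esub> (\<phi> i X \<odot>\<^bsub>A\<^esub> \<phi> j Y)"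
      using \<phi> X by (simp add: bk_iso_def kunneth_iso_def)
    also have "\<psi> (i + j) (X \<otimes>\<^bsub>T\<^esub> Y) \<cdot>\<^bsub>A\<^esub> \<dots> =
        Kap L i j (X, Y) \<cdot>\<^bsub>A\<^esub> ((\<psi> i X \<odot>\<^bsub>A\<^esub> \<psi> j Y) \<cdot>\<^bsub>A\<^esub> (\<phi> i X \<odot>\<^bsub>A\<^esub> \<phi> j Y))"
      by (rule H.target.comp_extend) (use X p s \<psi> in \<open>simp_all add: bk_iso_def kunneth_iso_def\<close>)
    also have "(\<psi> i X \<odot>\<^bsub>A\<^esub> \<psi> j Y) \<cdot>\<^bsub>A\<^esub> (\<phi> i X \<odot>\<^bsub>A\<^esub> \<phi> j Y) = (\<psi> i X \<cdot>\<^bsub>A\<^esub> \<phi> i X) \<odot>\<^bsub>A\<^esub> (\<psi> j Y \<cdot>\<^bsub>A\<^esub> \<phi> j Y)"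
      by (rule H.target.TA_merge) (use X p s in simp_all)
    finally show ?thesis .
  qed
  moreover have "Ups L \<cdot>\<^bsub>A\<^esub> (\<psi> 0 \<one>\<^bsub>T\<^esub> \<cdot>\<^bsub>A\<^esub> \<phi> 0 \<one>\<^bsub>T\<^esub>) = Ups H"
  proof -
    have "Ups L \<cdot>\<^bsub>A\<^esub> \<psi> 0 \<one>\<^bsub>T\<^esub> = Ups K" "Ups K \<cdot>\<^bsub>A\<^esub> \<phi> 0 \<one>\<^bsub>T\<^esub> = Ups H"
      using \<phi> \<psi> by (auto simp: bk_iso_def kunneth_iso_def)
    then show ?thesis using p s H.target.comp_extend1[of "Ups L" "\<psi> 0 \<one>\<^bsub>T\<^esub>" "Ups K" "\<phi> 0 \<one>\<^bsub>T\<^esub>"] by simp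
  qed
  moreover have "Bd L i t \<cdot>\<^bsub>A\<^esub> (\<psi> i (snd t) \<cdot>\<^bsub>A\<^esub> \<phi> i (snd t)) =
      (\<psi> (Suc i) (fst t) \<cdot>\<^bsub>A\<^esub> \<phi> (Suc i) (fst t)) \<cdot>\<^bsub>A\<^esub> Bd H i t" if t: "t \<in> Tri D" for i t
  proof -
    have t': "fst t \<in> Ob T" "snd t \<in> Ob T" using H.Tri_wf[OF t] by auto
    have "Bd L i t \<cdot>\<^bsub>A\<^esub> (\<psi> i (snd t) \<cdot>\<^bsub>A\<^esub> \<phi> i (snd t)) =
        \<psi> (Suc i) (fst t) \<cdot>\<^bsub>A\<^esub> (Bd K i t \<cdot>\<^bsub>A\<^esub> \<phi> i (snd t))"
      by (rule H.target.comp_extend) (use \<psi> t t' p s in \<open>simp_all add: bk_iso_def\<close>)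
    also have "Bd K i t \<cdot>\<^bsub>A\<^esub> \<phi> i (snd t) = \<phi> (Suc i) (fst t) \<cdot>\<^bsub>A\<^esub> Bd H i t"
      using \<phi> t by (simp add: bk_iso_def)
    finally show ?thesis using t t' p s by simp
  qed
  moreover have "nat_iso (opposite T) A (Coh H i) (Coh L i) (\<lambda>X\<in>Ob T. \<psi> i X \<cdot>\<^bsub>A\<^esub> \<phi> i X)" for i
  proof -
    have "nat_iso (opposite T) A (Coh H i) (Coh K i) (\<phi> i)"
      "nat_iso (opposite T) A (Coh K i) (Coh L i) (\<psi> i)"
      using \<phi> \<psi> by (auto simp: bk_iso_def kunneth_iso_def)
    from nat_iso_comp[OF H.Coh_functor K.Coh_functor L.Coh_functor this] show ?thesis by simp
  qed
  ultimately show ?thesis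
    using H.Tri_wf by (simp add: bk_iso_def kunneth_iso_def)
qed

lemma category_bk_groupoid: "category (bk_groupoid T D A E)"
proof unfold_locales
  fix f g x y z assume "f \<in> hom (bk_groupoid T D A E) x y" "g \<in> hom (bk_groupoid T D A E) y z"
  then show "g \<cdot>\<^bsub>bk_groupoid T D A E\<^esub> f \<in> hom (bk_groupoid T D A E) x z"
    by (auto simp: hom_iff bk_groupoid_def bk_iso_comp)
next
  fix f g h w x y z
  assume *: "f \<in> hom (bk_groupoid T D A E) w x" "g \<in> hom (bk_groupoid T D A E) x y"
    "h \<in> hom (bk_groupoid T D A E) y z"
  obtain a b c where abc: "f = (w, a, x)" "g = (x, b, y)" "h = (y, c, z)"
    using * by (auto simp: hom_iff bk_groupoid_def)
  then have b: "bkunneth T D A (E w)" and n: "bk_iso T D A (E w) (E x) a" "bk_iso T D A (E x) (E y) b"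
    "bk_iso T D A (E y) (E z) c"
    using * by (auto simp: hom_iff bk_groupoid_def)
  interpret bkunneth T D A "E w" by (rule b)
  note C = target.category_axioms
  have "(\<lambda>X\<in>Ob T. (c i X \<cdot>\<^bsub>A\<^esub> b i X) \<cdot>\<^bsub>A\<^esub> a i X) = (\<lambda>X\<in>Ob T. c i X \<cdot>\<^bsub>A\<^esub> (b i X \<cdot>\<^bsub>A\<^esub> a i X))" for i
    by (rule restrict_ext, rule target.assoc)
      (use bk_isoD[OF n(1) C] bk_isoD[OF n(2) C] bk_isoD[OF n(3) C] in auto)
  then show "(h \<cdot>\<^bsub>bk_groupoid T D A E\<^esub> g) \<cdot>\<^bsub>bk_groupoid T D A E\<^esub> f =
      h \<cdot>\<^bsub>bk_groupoid T D A E\<^esub> (g \<cdot>\<^bsub>bk_groupoid T D A E\<^esub> f)"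
    using abc by (simp add: bk_groupoid_def restrict_def cong: if_cong)
next
  fix f x y assume *: "f \<in> hom (bk_groupoid T D A E) x y"
  obtain a where a: "f = (x, a, y)" using * by (auto simp: hom_iff bk_groupoid_def)
  then have b: "bkunneth T D A (E x)" and n: "bk_iso T D A (E x) (E y) a"
    using * by (auto simp: hom_iff bk_groupoid_def)
  interpret bkunneth T D A "E x" by (rule b)
  note a' = bk_isoD[OF n target.category_axioms]
  have "(\<lambda>t\<in>Ob T. (\<lambda>t\<in>Ob T. Id A (FO (Coh (E y) i) t)) t \<cdot>\<^bsub>A\<^esub> a i t) = a i"
    "(\<lambda>t\<in>Ob T. a i t \<cdot>\<^bsub>A\<^esub> (\<lambda>t\<in>Ob T. Id A (FO (Coh (E x) i) t)) t) = a i" for i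
    by (rule extensionalityI[of _ "Ob T"]; use a' in simp)+
  then show "Id (bk_groupoid T D A E) y \<cdot>\<^bsub>bk_groupoid T D A E\<^esub> f = f"
    "f \<cdot>\<^bsub>bk_groupoid T D A E\<^esub> Id (bk_groupoid T D A E) x = f"
    using a by (simp_all add: bk_groupoid_def)
qed (auto simp: hom_iff bk_groupoid_def bk_iso_Id)

lemma bk_iso_push:
  assumes "bkunneth T D A0 U" "exact_tensor_functor A0 A F" "exact_tensor_functor A0 A G"
    and \<eta>: "tensor_iso A0 A F G \<eta>"
  shows "bk_iso T D A (push_bk T D A U F) (push_bk T D A U G) (\<lambda>i. \<lambda>X\<in>Ob T. \<eta> (FO (Coh U i) X))"
proof -
  interpret U: bkunneth T D A0 U by fact
  interpret F: exact_tensor_functor A0 A F by fact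
  interpret G: exact_tensor_functor A0 A G by fact
  have n: "nat_iso A0 A F G \<eta>" using \<eta> by (simp add: tensor_iso_def)
  note h = nat_isoD[OF n F.target.category_axioms]
  have nat: "\<eta> (Cod A0 c) \<cdot>\<^bsub>A\<^esub> FA F c = FA G c \<cdot>\<^bsub>A\<^esub> \<eta> (Dom A0 c)" if "c \<in> Ar A0" for c
    using h(5)[OF that] that by simp
  let ?h = "\<lambda>i X. FO (Coh U i) X"
  have "\<eta> (?h i (Dom T f)) \<cdot>\<^bsub>A\<^esub> FA F (FA (Coh U i) f) = FA G (FA (Coh U i) f) \<cdot>\<^bsub>A\<^esub> \<eta> (?h i (Cod T f))"
    if "f \<in> Ar T" for i f
    using nat[of "FA (Coh U i) f"] that by simp
  then have "nat_iso (opposite T) A (Coh (push_bk T D A U F) i) (Coh (push_bk T D A U G) i)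
      (\<lambda>X\<in>Ob T. \<eta> (?h i X))" for i
    by (intro nat_isoI) (use h in \<open>simp_all add: F.target.category_axioms\<close>)
  moreover have "\<eta> (?h (i + j) (X \<otimes>\<^bsub>T\<^esub> Y)) \<cdot>\<^bsub>A\<^esub> (FA F (Kap U i j (X, Y)) \<cdot>\<^bsub>A\<^esub> Mult F (?h i X, ?h j Y)) =
      (FA G (Kap U i j (X, Y)) \<cdot>\<^bsub>A\<^esub> Mult G (?h i X, ?h j Y)) \<cdot>\<^bsub>A\<^esub> (\<eta> (?h i X) \<odot>\<^bsub>A\<^esub> \<eta> (?h j Y))"
    if X: "X \<in> Ob T" "Y \<in> Ob T" for X Y i j
  proof -
    have "\<eta> (?h (i + j) (X \<otimes>\<^bsub>T\<^esub> Y)) \<cdot>\<^bsub>A\<^esub> (FA F (Kap U i j (X, Y)) \<cdot>\<^bsub>A\<^esub> Mult F (?h i X, ?h j Y)) =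
        FA G (Kap U i j (X, Y)) \<cdot>\<^bsub>A\<^esub> (\<eta> (?h i X \<otimes>\<^bsub>A0\<^esub> ?h j Y) \<cdot>\<^bsub>A\<^esub> Mult F (?h i X, ?h j Y))"
      by (rule F.target.comp_extend) (use X h(1-3) nat[of "Kap U i j (X, Y)"] in simp_all)
    also have "\<eta> (?h i X \<otimes>\<^bsub>A0\<^esub> ?h j Y) \<cdot>\<^bsub>A\<^esub> Mult F (?h i X, ?h j Y) =
        Mult G (?h i X, ?h j Y) \<cdot>\<^bsub>A\<^esub> (\<eta> (?h i X) \<odot>\<^bsub>A\<^esub> \<eta> (?h j Y))"
      using \<eta> X by (simp add: tensor_iso_def)
    finally show ?thesis using X h(1-3) by simp
  qed
  moreover have "(inv_arrow A (Unit G) \<cdot>\<^bsub>A\<^esub> FA G (Ups U)) \<cdot>\<^bsub>A\<^esub> \<eta> (?h 0 \<one>\<^bsub>T\<^esub>) =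
      inv_arrow A (Unit F) \<cdot>\<^bsub>A\<^esub> FA F (Ups U)"
  proof -
    have u: "\<eta> \<one>\<^bsub>A0\<^esub> \<cdot>\<^bsub>A\<^esub> Unit F = Unit G" using \<eta> by (simp add: tensor_iso_def)
    \<comment> \<open>The condition on units is multiplied by \<open>Unit G\<close>, because there
      the unit condition on \<open>\<eta>\<close> and naturality at \<open>Ups U\<close>
      apply.\<close>
    have "Unit G \<cdot>\<^bsub>A\<^esub> (inv_arrow A (Unit F) \<cdot>\<^bsub>A\<^esub> FA F (Ups U)) =
        \<eta> \<one>\<^bsub>A0\<^esub> \<cdot>\<^bsub>A\<^esub> FA F (Ups U)"
      using F.target.comp_extend1[OF u, of "inv_arrow A (Unit F) \<cdot>\<^bsub>A\<^esub> FA F (Ups U)"] h(1-3)[of "\<one>\<^bsub>A0\<^esub>"]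
      by simp
    also have "\<dots> = FA G (Ups U) \<cdot>\<^bsub>A\<^esub> \<eta> (?h 0 \<one>\<^bsub>T\<^esub>)" using nat[of "Ups U"] by simp
    finally have "inv_arrow A (Unit G) \<cdot>\<^bsub>A\<^esub> (Unit G \<cdot>\<^bsub>A\<^esub> (inv_arrow A (Unit F) \<cdot>\<^bsub>A\<^esub> FA F (Ups U))) =
        inv_arrow A (Unit G) \<cdot>\<^bsub>A\<^esub> (FA G (Ups U) \<cdot>\<^bsub>A\<^esub> \<eta> (?h 0 \<one>\<^bsub>T\<^esub>))"
      by simp
    then show ?thesis using h(1-3) by simp
  qed
  moreover have "FA G (Bd U i t) \<cdot>\<^bsub>A\<^esub> \<eta> (?h i (snd t)) = \<eta> (?h (Suc i) (fst t)) \<cdot>\<^bsub>A\<^esub> FA F (Bd U i t)"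
    if "t \<in> Tri D" for i t
    using nat[of "Bd U i t"] that by simp
  ultimately show ?thesis
    using U.Tri_wf by (simp add: bk_iso_def kunneth_iso_def)
qed

text \<open>Pushed-forward cohomologies are compared after completion by \<open>E\<close>. Its
  injectivity turns an equality of completed cohomologies into an equality of objects of the
  groupoid, so strict surjectivity is available in the absolute and the relative case alike.\<close>

theorem push_equivalence:
  assumes U: "ex_tensor_category A0" "bkunneth T D A0 U" and A: "ex_tensor_category A"
    and surj: "\<And>H. bkunneth T D A H \<Longrightarrow> \<exists>F. exact_tensor_functor A0 A F \<and> push_bk T D A U F = H"
    and ff: "\<And>F G \<phi>. exact_tensor_functor A0 A F \<Longrightarrow> exact_tensor_functor A0 A G \<Longrightarrow>
      bk_iso T D A (push_bk T D A U F) (push_bk T D A U G) \<phi> \<Longrightarrow>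
      \<exists>!\<eta>. tensor_iso A0 A F G \<eta> \<and> (\<lambda>i. \<lambda>X\<in>Ob T. \<eta> (FO (Coh U i) X)) = \<phi>"
    and E: "inj E" and push: "\<And>F. E (push F) = push_bk T D A U F"
  shows "equivalence_of_categories (tensor_functor_groupoid A0 A) (bk_groupoid T D A E)
    \<lparr>FO = (\<lambda>F\<in>Ob (tensor_functor_groupoid A0 A). push F),
     FA = (\<lambda>(F, \<eta>, G)\<in>Ar (tensor_functor_groupoid A0 A).
       (push F, (\<lambda>i. \<lambda>X\<in>Ob T. \<eta> (FO (Coh U i) X)), push G))\<rparr>" (is "equivalence_of_categories ?C ?D ?F")
proof (rule equivalence_of_surjective)
  interpret U: bkunneth T D A0 U by (rule U(2))
  interpret C: category ?C by (rule category_tensor_functor_groupoid)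
  interpret D: category ?D by (rule category_bk_groupoid)
  have C_simps: "Ob ?C = {F. exact_tensor_functor A0 A F}"
    "Ar ?C = {(F, \<eta>, G). exact_tensor_functor A0 A F \<and> exact_tensor_functor A0 A G \<and> tensor_iso A0 A F G \<eta>}"
    "Dom ?C (F, \<eta>, G) = F" "Cod ?C (F, \<eta>, G) = G" "Id ?C F = (F, (\<lambda>x\<in>Ob A0. Id A (FO F x)), F)"
    "(G', \<theta>, K) \<cdot>\<^bsub>?C\<^esub> (F, \<eta>, G) = (F, (\<lambda>x\<in>Ob A0. \<theta> x \<cdot>\<^bsub>A\<^esub> \<eta> x), K)" for F G G' K \<eta> \<theta>
    by (simp_all add: tensor_functor_groupoid_def)
  have D_simps: "Ob ?D = {H. bkunneth T D A (E H)}"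
    "Ar ?D = {(H, \<phi>, K). bkunneth T D A (E H) \<and> bkunneth T D A (E K) \<and> bk_iso T D A (E H) (E K) \<phi>}"
    "Dom ?D (H, \<phi>, K) = H" "Cod ?D (H, \<phi>, K) = K"
    "Id ?D H = (H, (\<lambda>i. \<lambda>X\<in>Ob T. Id A (FO (Coh (E H) i) X)), H)"
    "(K', \<psi>, L) \<cdot>\<^bsub>?D\<^esub> (H, \<phi>, K) = (H, (\<lambda>i. \<lambda>X\<in>Ob T. \<psi> i X \<cdot>\<^bsub>A\<^esub> \<phi> i X), L)" for H K K' L \<phi> \<psi>
    by (simp_all add: bk_groupoid_def)
  show "cat_functor ?C ?D ?F"
  proof unfold_locales
    fix F assume "F \<in> Ob ?C"
    then have F: "exact_tensor_functor A0 A F" by (simp add: C_simps)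
    interpret F: exact_tensor_functor A0 A F by (rule F)
    show "FO ?F F \<in> Ob ?D" using F by (simp add: C_simps D_simps push bkunneth_push[OF U(2)])
    show "FA ?F (Id ?C F) = Id ?D (FO ?F F)"
      using F by (auto simp: C_simps D_simps push tensor_iso_Id intro!: restrict_ext)
  next
    fix f x y assume "f \<in> hom ?C x y"
    then show "FA ?F f \<in> hom ?D (FO ?F x) (FO ?F y)"
      by (auto simp: hom_iff C_simps D_simps push bkunneth_push[OF U(2)] bk_iso_push[OF U(2)])
  next
    fix f g x y z assume fg: "f \<in> hom ?C x y" "g \<in> hom ?C y z"
    then obtain \<eta> \<theta> where e: "f = (x, \<eta>, y)" "g = (y, \<theta>, z)" by (auto simp: hom_iff C_simps)
    have "f \<in> Ar ?C" "g \<in> Ar ?C" "g \<cdot>\<^bsub>?C\<^esub> f \<in> Ar ?C" using fg by (auto simp: hom_iff)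
    then show "FA ?F (g \<cdot>\<^bsub>?C\<^esub> f) = FA ?F g \<cdot>\<^bsub>?D\<^esub> FA ?F f"
      using e by (auto simp: C_simps D_simps intro!: restrict_ext)
  qed auto
  fix H assume "H \<in> Ob ?D"
  then have "bkunneth T D A (E H)" by (simp add: D_simps)
  from surj[OF this] obtain F where F: "exact_tensor_functor A0 A F" "push_bk T D A U F = E H" by blast
  then have "push F = H" using push[of F] E by (simp add: inj_eq)
  then show "\<exists>x\<in>Ob ?C. FO ?F x = H" using F by (intro bexI[of _ F]) (auto simp: C_simps)
next
  fix F G c
  assume FG: "F \<in> Ob (tensor_functor_groupoid A0 A)" "G \<in> Ob (tensor_functor_groupoid A0 A)"
    and c: "c \<in> hom (bk_groupoid T D A E) (FO ?F F) (FO ?F G)"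
  have F: "exact_tensor_functor A0 A F" "exact_tensor_functor A0 A G"
    using FG by (simp_all add: tensor_functor_groupoid_def)
  obtain \<phi> where \<phi>: "c = (push F, \<phi>, push G)" "bk_iso T D A (push_bk T D A U F) (push_bk T D A U G) \<phi>"
    using c FG by (auto simp: hom_iff bk_groupoid_def push)
  from ff[OF F \<phi>(2)] obtain \<eta> where
    \<eta>: "tensor_iso A0 A F G \<eta>" "(\<lambda>i. \<lambda>X\<in>Ob T. \<eta> (FO (Coh U i) X)) = \<phi>"
    and un: "\<And>\<theta>. tensor_iso A0 A F G \<theta> \<and> (\<lambda>i. \<lambda>X\<in>Ob T. \<theta> (FO (Coh U i) X)) = \<phi> \<Longrightarrow> \<theta> = \<eta>"
    by (elim ex1E) blast
  show "\<exists>!f. f \<in> hom (tensor_functor_groupoid A0 A) F G \<and> FA ?F f = c"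
  proof (rule ex1I[of _ "(F, \<eta>, G)"])
    show "(F, \<eta>, G) \<in> hom (tensor_functor_groupoid A0 A) F G \<and> FA ?F (F, \<eta>, G) = c"
      using F \<eta> \<phi> by (simp add: hom_iff tensor_functor_groupoid_def)
    fix f assume f: "f \<in> hom (tensor_functor_groupoid A0 A) F G \<and> FA ?F f = c"
    then obtain \<theta> where \<theta>: "f = (F, \<theta>, G)" "tensor_iso A0 A F G \<theta>"
      by (auto simp: hom_iff tensor_functor_groupoid_def)
    then have "(\<lambda>i. \<lambda>X\<in>Ob T. \<theta> (FO (Coh U i) X)) = \<phi>"
      using f F \<phi> by (simp add: hom_iff tensor_functor_groupoid_def)
    then show "f = (F, \<eta>, G)" using un \<theta> by blast
  qed
qed

section \<open>The tensor structure given by products\<close>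

context cartesian_category
begin

lemma product_simps [simp]:
  assumes "x \<in> Ob C" "y \<in> Ob C"
  shows "Prod C x y \<in> Ob C" "Fst C x y \<in> Ar C" "Dom C (Fst C x y) = Prod C x y"
    "Cod C (Fst C x y) = x" "Snd C x y \<in> Ar C" "Dom C (Snd C x y) = Prod C x y"
    "Cod C (Snd C x y) = y"
  using product[OF assms] by (auto simp: is_product_def hom_iff)

lemma pairing_unique:
  assumes "f \<in> Ar C" "g \<in> Ar C" "Dom C g = Dom C f"
  shows "\<exists>!h. h \<in> hom C (Dom C f) (Prod C (Cod C f) (Cod C g)) \<and>
    Fst C (Cod C f) (Cod C g) \<cdot>\<^bsub>C\<^esub> h = f \<and> Snd C (Cod C f) (Cod C g) \<cdot>\<^bsub>C\<^esub> h = g"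
  using product[of "Cod C f" "Cod C g"] assms by (auto simp: is_product_def hom_iff)

lemma pairing_simps [simp]:
  assumes "f \<in> Ar C" "g \<in> Ar C" "Dom C g = Dom C f"
  shows "pairing C f g \<in> Ar C" "Dom C (pairing C f g) = Dom C f"
    "Cod C (pairing C f g) = Prod C (Cod C f) (Cod C g)"
    "Cod C f = x \<Longrightarrow> Cod C g = y \<Longrightarrow> Fst C x y \<cdot>\<^bsub>C\<^esub> pairing C f g = f"
    "Cod C f = x \<Longrightarrow> Cod C g = y \<Longrightarrow> Snd C x y \<cdot>\<^bsub>C\<^esub> pairing C f g = g"
  using theI'[OF pairing_unique[OF assms]] unfolding pairing_def by (auto simp: hom_iff)

lemma prod_eqI:
  assumes "h \<in> Ar C" "h' \<in> Ar C" "Dom C h' = Dom C h" "Cod C h = Prod C x y" "Cod C h' = Prod C x y"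
    "x \<in> Ob C" "y \<in> Ob C" "Fst C x y \<cdot>\<^bsub>C\<^esub> h = Fst C x y \<cdot>\<^bsub>C\<^esub> h'" "Snd C x y \<cdot>\<^bsub>C\<^esub> h = Snd C x y \<cdot>\<^bsub>C\<^esub> h'"
  shows "h = h'"
proof -
  have "\<exists>!k. k \<in> hom C (Dom C h) (Prod C x y) \<and> Fst C x y \<cdot>\<^bsub>C\<^esub> k = Fst C x y \<cdot>\<^bsub>C\<^esub> h \<and>
      Snd C x y \<cdot>\<^bsub>C\<^esub> k = Snd C x y \<cdot>\<^bsub>C\<^esub> h"
    using pairing_unique[of "Fst C x y \<cdot>\<^bsub>C\<^esub> h" "Snd C x y \<cdot>\<^bsub>C\<^esub> h"] assms(1,4,6,7) by simp
  then show ?thesis using assms by (auto simp: hom_iff)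
qed

lemma pairing_comp [simp]:
  assumes "f \<in> Ar C" "g \<in> Ar C" "Dom C g = Dom C f" "t \<in> Ar C" "Cod C t = Dom C f"
  shows "pairing C f g \<cdot>\<^bsub>C\<^esub> t = pairing C (f \<cdot>\<^bsub>C\<^esub> t) (g \<cdot>\<^bsub>C\<^esub> t)"
proof (rule prod_eqI[where x = "Cod C f" and y = "Cod C g"])
  show "Fst C (Cod C f) (Cod C g) \<cdot>\<^bsub>C\<^esub> (pairing C f g \<cdot>\<^bsub>C\<^esub> t) =
      Fst C (Cod C f) (Cod C g) \<cdot>\<^bsub>C\<^esub> pairing C (f \<cdot>\<^bsub>C\<^esub> t) (g \<cdot>\<^bsub>C\<^esub> t)"
    using assms comp_extend1[of "Fst C (Cod C f) (Cod C g)" "pairing C f g" f t] by simp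
  show "Snd C (Cod C f) (Cod C g) \<cdot>\<^bsub>C\<^esub> (pairing C f g \<cdot>\<^bsub>C\<^esub> t) =
      Snd C (Cod C f) (Cod C g) \<cdot>\<^bsub>C\<^esub> pairing C (f \<cdot>\<^bsub>C\<^esub> t) (g \<cdot>\<^bsub>C\<^esub> t)"
    using assms comp_extend1[of "Snd C (Cod C f) (Cod C g)" "pairing C f g" g t] by simp
qed (use assms in simp_all)

lemma pairing_Fst_Snd [simp]:
  "x \<in> Ob C \<Longrightarrow> y \<in> Ob C \<Longrightarrow> pairing C (Fst C x y) (Snd C x y) = Id C (Prod C x y)"
  by (rule prod_eqI[where x = x and y = y]) simp_all

lemma prod_arrow_simps [simp]:
  assumes "f \<in> Ar C" "g \<in> Ar C"
  shows "prod_arrow C f g \<in> Ar C" "Dom C (prod_arrow C f g) = Prod C (Dom C f) (Dom C g)"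
    "Cod C (prod_arrow C f g) = Prod C (Cod C f) (Cod C g)"
  using assms by (simp_all add: prod_arrow_def)

lemma prod_arrow_comp:
  assumes "f \<in> Ar C" "g \<in> Ar C" "f' \<in> Ar C" "g' \<in> Ar C" "Dom C f' = Cod C f" "Dom C g' = Cod C g"
  shows "prod_arrow C f' g' \<cdot>\<^bsub>C\<^esub> prod_arrow C f g = prod_arrow C (f' \<cdot>\<^bsub>C\<^esub> f) (g' \<cdot>\<^bsub>C\<^esub> g)"
  using assms by (simp add: prod_arrow_def)

lemma prod_arrow_Id [simp]:
  "x \<in> Ob C \<Longrightarrow> y \<in> Ob C \<Longrightarrow> prod_arrow C (Id C x) (Id C y) = Id C (Prod C x y)"
  by (simp add: prod_arrow_def)

lemma Final_Ob [simp]: "Final C \<in> Ob C"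
  using final by (simp add: terminal_object_def)

lemma Final_unique:
  "f \<in> Ar C \<Longrightarrow> g \<in> Ar C \<Longrightarrow> Dom C f = Dom C g \<Longrightarrow> Cod C f = Final C \<Longrightarrow> Cod C g = Final C \<Longrightarrow> f = g"
  using final Dom_Ob[of g] unfolding terminal_object_def hom_iff by metis

definition bang :: "'o \<Rightarrow> 'a" where
  "bang x = (SOME f. f \<in> hom C x (Final C))"

lemma bang [simp]:
  assumes "x \<in> Ob C"
  shows "bang x \<in> Ar C" "Dom C (bang x) = x" "Cod C (bang x) = Final C"
proof -
  have "\<exists>f. f \<in> hom C x (Final C)" using final assms by (auto simp: terminal_object_def)
  from someI_ex[OF this] show "bang x \<in> Ar C" "Dom C (bang x) = x" "Cod C (bang x) = Final C"
    by (auto simp: bang_def hom_iff)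
qed

definition assc :: "'o \<Rightarrow> 'o \<Rightarrow> 'o \<Rightarrow> 'a" where
  "assc x y z = pairing C (Fst C x y \<cdot>\<^bsub>C\<^esub> Fst C (Prod C x y) z)
    (pairing C (Snd C x y \<cdot>\<^bsub>C\<^esub> Fst C (Prod C x y) z) (Snd C (Prod C x y) z))"

definition assc' :: "'o \<Rightarrow> 'o \<Rightarrow> 'o \<Rightarrow> 'a" where
  "assc' x y z = pairing C (pairing C (Fst C x (Prod C y z)) (Fst C y z \<cdot>\<^bsub>C\<^esub> Snd C x (Prod C y z)))
    (Snd C y z \<cdot>\<^bsub>C\<^esub> Snd C x (Prod C y z))"

definition swap :: "'o \<Rightarrow> 'o \<Rightarrow> 'a" where
  "swap x y = pairing C (Snd C x y) (Fst C x y)"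

lemma swap_simps [simp]:
  assumes "x \<in> Ob C" "y \<in> Ob C"
  shows "swap x y \<in> Ar C" "Dom C (swap x y) = Prod C x y" "Cod C (swap x y) = Prod C y x"
    "swap y x \<cdot>\<^bsub>C\<^esub> swap x y = Id C (Prod C x y)"
  using assms by (simp_all add: swap_def)

lemma swap_natural:
  assumes "f \<in> Ar C" "g \<in> Ar C"
  shows "swap (Cod C f) (Cod C g) \<cdot>\<^bsub>C\<^esub> prod_arrow C f g = prod_arrow C g f \<cdot>\<^bsub>C\<^esub> swap (Dom C f) (Dom C g)"
  using assms by (simp add: swap_def prod_arrow_def)

lemma assc_simps [simp]:
  assumes "x \<in> Ob C" "y \<in> Ob C" "z \<in> Ob C"
  shows "assc x y z \<in> Ar C" "Dom C (assc x y z) = Prod C (Prod C x y) z"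
    "Cod C (assc x y z) = Prod C x (Prod C y z)"
    "assc' x y z \<in> Ar C" "Dom C (assc' x y z) = Prod C x (Prod C y z)"
    "Cod C (assc' x y z) = Prod C (Prod C x y) z"
  using assms by (simp_all add: assc_def assc'_def)

lemma pairing_Fst_Snd_comp:
  assumes "h \<in> Ar C" "Cod C h = Prod C x y" "x \<in> Ob C" "y \<in> Ob C"
  shows "pairing C (Fst C x y \<cdot>\<^bsub>C\<^esub> h) (Snd C x y \<cdot>\<^bsub>C\<^esub> h) = h"
  using pairing_comp[of "Fst C x y" "Snd C x y" h] assms by simp

lemma assc_inverse:
  assumes "x \<in> Ob C" "y \<in> Ob C" "z \<in> Ob C"
  shows "assc' x y z \<cdot>\<^bsub>C\<^esub> assc x y z = Id C (Prod C (Prod C x y) z)"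
    "assc x y z \<cdot>\<^bsub>C\<^esub> assc' x y z = Id C (Prod C x (Prod C y z))"
  using assms by (simp_all add: assc_def assc'_def pairing_Fst_Snd_comp)

lemma assc_natural:
  assumes "f \<in> Ar C" "g \<in> Ar C" "h \<in> Ar C"
  shows "assc (Cod C f) (Cod C g) (Cod C h) \<cdot>\<^bsub>C\<^esub> prod_arrow C (prod_arrow C f g) h =
      prod_arrow C f (prod_arrow C g h) \<cdot>\<^bsub>C\<^esub> assc (Dom C f) (Dom C g) (Dom C h)"
    "assc' (Cod C f) (Cod C g) (Cod C h) \<cdot>\<^bsub>C\<^esub> prod_arrow C f (prod_arrow C g h) =
      prod_arrow C (prod_arrow C f g) h \<cdot>\<^bsub>C\<^esub> assc' (Dom C f) (Dom C g) (Dom C h)"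
  using assms by (simp_all add: assc_def assc'_def prod_arrow_def)

lemma unit_inverse:
  assumes "x \<in> Ob C"
  shows "pairing C (bang x) (Id C x) \<cdot>\<^bsub>C\<^esub> Snd C (Final C) x = Id C (Prod C (Final C) x)"
    "pairing C (Id C x) (bang x) \<cdot>\<^bsub>C\<^esub> Fst C x (Final C) = Id C (Prod C x (Final C))"
proof -
  have "bang x \<cdot>\<^bsub>C\<^esub> Snd C (Final C) x = Fst C (Final C) x"
    "bang x \<cdot>\<^bsub>C\<^esub> Fst C x (Final C) = Snd C x (Final C)"
    by (rule Final_unique; use assms in simp)+
  then show "pairing C (bang x) (Id C x) \<cdot>\<^bsub>C\<^esub> Snd C (Final C) x = Id C (Prod C (Final C) x)"
    "pairing C (Id C x) (bang x) \<cdot>\<^bsub>C\<^esub> Fst C x (Final C) = Id C (Prod C x (Final C))"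
    using assms by simp_all
qed

lemma cartesian_tensor_simps [simp]:
  "Ob (cartesian_tensor C) = Ob C" "Ar (cartesian_tensor C) = Ar C"
  "Dom (cartesian_tensor C) = Dom C" "Cod (cartesian_tensor C) = Cod C"
  "Id (cartesian_tensor C) = Id C" "g \<cdot>\<^bsub>cartesian_tensor C\<^esub> f = g \<cdot>\<^bsub>C\<^esub> f"
  "x \<otimes>\<^bsub>cartesian_tensor C\<^esub> y = Prod C x y" "f \<odot>\<^bsub>cartesian_tensor C\<^esub> g = prod_arrow C f g"
  "\<one>\<^bsub>cartesian_tensor C\<^esub> = Final C" "Assoc (cartesian_tensor C) x y z = assc x y z"
  "Lun (cartesian_tensor C) x = Snd C (Final C) x" "Run (cartesian_tensor C) x = Fst C x (Final C)"
  "Sym (cartesian_tensor C) x y = swap x y"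
  by (simp_all add: cartesian_tensor_def assc_def swap_def)

lemma tensor_category_cartesian: "tensor_category (cartesian_tensor C)"
proof -
  have hom [simp]: "hom (cartesian_tensor C) x y = hom C x y" for x y by (simp add: hom_def)
  have iso: "iso_arrow (cartesian_tensor C) f" if "f \<in> Ar C" "g \<in> Ar C" "Dom C g = Cod C f"
    "Cod C g = Dom C f" "g \<cdot>\<^bsub>C\<^esub> f = Id C (Dom C f)" "f \<cdot>\<^bsub>C\<^esub> g = Id C (Cod C f)" for f g
    using that by (auto simp: iso_arrow_def inverse_arrows_def hom_iff intro!: exI[of _ g])
  show ?thesis
  proof unfold_locales
    fix w x y z
    assume o: "x \<in> Ob (cartesian_tensor C)" "y \<in> Ob (cartesian_tensor C)" "z \<in> Ob (cartesian_tensor C)"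
    show "iso_arrow (cartesian_tensor C) (Assoc (cartesian_tensor C) x y z)"
      using o assc_inverse[of x y z] by (intro iso[of _ "assc' x y z"]) simp_all
    show "Assoc (cartesian_tensor C) y z x \<cdot>\<^bsub>cartesian_tensor C\<^esub>
        (Sym (cartesian_tensor C) x (y \<otimes>\<^bsub>cartesian_tensor C\<^esub> z) \<cdot>\<^bsub>cartesian_tensor C\<^esub> Assoc (cartesian_tensor C) x y z) =
      (Id (cartesian_tensor C) y \<odot>\<^bsub>cartesian_tensor C\<^esub> Sym (cartesian_tensor C) x z) \<cdot>\<^bsub>cartesian_tensor C\<^esub>
        (Assoc (cartesian_tensor C) y x z \<cdot>\<^bsub>cartesian_tensor C\<^esub>
          (Sym (cartesian_tensor C) x y \<odot>\<^bsub>cartesian_tensor C\<^esub> Id (cartesian_tensor C) z))"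
      using o by (simp add: assc_def swap_def prod_arrow_def)
    assume "w \<in> Ob (cartesian_tensor C)"
    then show "(Id (cartesian_tensor C) w \<odot>\<^bsub>cartesian_tensor C\<^esub> Assoc (cartesian_tensor C) x y z) \<cdot>\<^bsub>cartesian_tensor C\<^esub>
        (Assoc (cartesian_tensor C) w (x \<otimes>\<^bsub>cartesian_tensor C\<^esub> y) z \<cdot>\<^bsub>cartesian_tensor C\<^esub>
          (Assoc (cartesian_tensor C) w x y \<odot>\<^bsub>cartesian_tensor C\<^esub> Id (cartesian_tensor C) z)) =
      Assoc (cartesian_tensor C) w x (y \<otimes>\<^bsub>cartesian_tensor C\<^esub> z) \<cdot>\<^bsub>cartesian_tensor C\<^esub>
        Assoc (cartesian_tensor C) (w \<otimes>\<^bsub>cartesian_tensor C\<^esub> x) y z"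
      using o by (simp add: assc_def prod_arrow_def)
  next
    fix x assume o: "x \<in> Ob (cartesian_tensor C)"
    show "iso_arrow (cartesian_tensor C) (Lun (cartesian_tensor C) x)"
      using o unit_inverse(1)[of x] by (intro iso[of _ "pairing C (bang x) (Id C x)"]) (simp_all del: pairing_comp)
    show "iso_arrow (cartesian_tensor C) (Run (cartesian_tensor C) x)"
      using o unit_inverse(2)[of x] by (intro iso[of _ "pairing C (Id C x) (bang x)"]) (simp_all del: pairing_comp)
  qed (auto simp: hom_iff assc_def swap_def prod_arrow_def)
qed

end

section \<open>The tensor category of pairs\<close>

context category
begin

lemma factorsI: "u \<in> Ar C \<Longrightarrow> Dom C u = Dom C f \<Longrightarrow> Cod C u = Dom C m \<Longrightarrow> m \<cdot> u = f \<Longrightarrow> factors C f m"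
  by (auto simp: factors_def hom_iff)

lemma factors_self: "m \<in> Ar C \<Longrightarrow> factors C m m"
  by (rule factorsI[of "Id C (Dom C m)"]) auto

lemma factors_comp:
  assumes "factors C f m" "f \<in> Ar C" "m \<in> Ar C" "g \<in> Ar C" "Cod C g = Dom C f"
  shows "factors C (f \<cdot> g) m"
proof -
  obtain u where u: "u \<in> Ar C" "Dom C u = Dom C f" "Cod C u = Dom C m" "m \<cdot> u = f"
    using assms(1) by (auto simp: factors_def hom_iff)
  have "m \<cdot> (u \<cdot> g) = f \<cdot> g" by (rule comp_extend1[OF u(4)]) (use u assms in auto)
  then show ?thesis using u assms by (intro factorsI[of "u \<cdot> g"]) auto
qed

lemma factors_trans:
  assumes "factors C f m" "factors C (g \<cdot> m) n" "f \<in> Ar C" "m \<in> Ar C" "g \<in> Ar C" "n \<in> Ar C"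
    "Cod C m = Dom C g"
  shows "factors C (g \<cdot> f) n"
proof -
  obtain u where u: "u \<in> Ar C" "Dom C u = Dom C f" "Cod C u = Dom C m" "m \<cdot> u = f"
    using assms(1) by (auto simp: factors_def hom_iff)
  have "factors C ((g \<cdot> m) \<cdot> u) n" by (rule factors_comp[OF assms(2)]) (use u assms in auto)
  moreover have "(g \<cdot> m) \<cdot> u = g \<cdot> f" using u assms by simp
  ultimately show ?thesis by simp
qed

lemma factors_trans1:
  assumes "factors C f m" "factors C m n" "f \<in> Ar C" "m \<in> Ar C" "n \<in> Ar C"
  shows "factors C f n"
proof -
  obtain u where u: "u \<in> Ar C" "Dom C u = Dom C f" "Cod C u = Dom C m" "m \<cdot> u = f"
    using assms(1) by (auto simp: factors_def hom_iff)
  show ?thesis using factors_comp[OF assms(2), of u] u assms by simp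
qed

end

context pair_structure
begin

lemma Dist_Ar [simp]: "m \<in> Dist P \<Longrightarrow> m \<in> Ar C"
  using Dist_monic monic_Ar by blast

lemma swap_iso: "x \<in> Ob C \<Longrightarrow> y \<in> Ob C \<Longrightarrow> iso_arrow C (swap x y)"
  by (rule iso_arrowI(1)[where g = "swap y x"]) simp_all

abbreviation pr :: "'a \<Rightarrow> 'a \<Rightarrow> 'a" where "pr \<equiv> prod_pair C P"

text \<open>The axiom \<open>Dist_prod\<close> covers subobjects of the right factor. Conjugating by
  the symmetry, whose components are isomorphisms and hence distinguished, gives those of the left
  factor.\<close>

lemma prod_Dist [simp]:
  assumes "m \<in> Dist P" "X \<in> Ob C"
  shows "prod_arrow C (Id C X) m \<in> Dist P" "prod_arrow C m (Id C X) \<in> Dist P"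
proof -
  show r: "prod_arrow C (Id C X) m \<in> Dist P" by (rule Dist_prod) fact+
  have m: "m \<in> Ar C" using assms by simp
  have "swap X (Cod C m) \<cdot>\<^bsub>C\<^esub> (prod_arrow C (Id C X) m \<cdot>\<^bsub>C\<^esub> swap (Dom C m) X) \<in> Dist P"
    by (intro Dist_comp Dist_iso[OF swap_iso] r) (use m assms(2) in simp_all)
  moreover have "swap X (Cod C m) \<cdot>\<^bsub>C\<^esub> (prod_arrow C (Id C X) m \<cdot>\<^bsub>C\<^esub> swap (Dom C m) X) =
      prod_arrow C m (Id C X)"
    using m assms(2) by (simp add: swap_def prod_arrow_def)
  ultimately show "prod_arrow C m (Id C X) \<in> Dist P" by simp
qed

lemma pr_simps [simp]:
  assumes "m \<in> Dist P" "n \<in> Dist P"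
  shows "pr m n \<in> Dist P" "Cod C (pr m n) = Prod C (Cod C m) (Cod C n)"
    "factors C (prod_arrow C (Id C (Cod C m)) n) (pr m n)"
    "factors C (prod_arrow C m (Id C (Cod C n))) (pr m n)"
  using assms Union_Dist[of "prod_arrow C (Id C (Cod C m)) n" "prod_arrow C m (Id C (Cod C n))"]
    Union_Cod[of "prod_arrow C (Id C (Cod C m)) n" "prod_arrow C m (Id C (Cod C n))"]
    Union_upper[of "prod_arrow C (Id C (Cod C m)) n" "prod_arrow C m (Id C (Cod C n))"]
  by (simp_all add: prod_pair_def)

text \<open>Stated for an arbitrary map \<open>f\<close> out of the ambient product and not just for
  inclusions, as morphisms of pairs require.\<close>

lemma pr_least:
  assumes "m \<in> Dist P" "n \<in> Dist P" "t \<in> Dist P" "f \<in> Ar C" "Dom C f = Prod C (Cod C m) (Cod C n)"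
    "Cod C f = Cod C t" "factors C (f \<cdot>\<^bsub>C\<^esub> prod_arrow C (Id C (Cod C m)) n) t"
    "factors C (f \<cdot>\<^bsub>C\<^esub> prod_arrow C m (Id C (Cod C n))) t"
  shows "factors C (f \<cdot>\<^bsub>C\<^esub> pr m n) t"
  unfolding prod_pair_def
  by (rule Union_least[where X = "Prod C (Cod C m) (Cod C n)"]) (use assms in \<open>simp_all add: hom_iff\<close>)

text \<open>By \<open>Union_prod\<close>, multiplying a union by \<open>X\<close> stays inside the
  union of the multiplied pieces; so it is enough to test \<open>f\<close> on these pieces.\<close>

lemma prod_pr_least_right:
  assumes X: "X \<in> Ob C" and m: "m \<in> Dist P" and n: "n \<in> Dist P" and t: "t \<in> Dist P"
    and f: "f \<in> Ar C" "Dom C f = Prod C X (Prod C (Cod C m) (Cod C n))" "Cod C f = Cod C t"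
    and 1: "factors C (f \<cdot>\<^bsub>C\<^esub> prod_arrow C (Id C X) (prod_arrow C (Id C (Cod C m)) n)) t"
    and 2: "factors C (f \<cdot>\<^bsub>C\<^esub> prod_arrow C (Id C X) (prod_arrow C m (Id C (Cod C n)))) t"
  shows "factors C (f \<cdot>\<^bsub>C\<^esub> prod_arrow C (Id C X) (pr m n)) t"
proof -
  let ?a = "prod_arrow C (Id C (Cod C m)) n" and ?b = "prod_arrow C m (Id C (Cod C n))"
  let ?U = "Union P (prod_arrow C (Id C X) ?a) (prod_arrow C (Id C X) ?b)"
  have U: "?U \<in> Dist P" "Cod C ?U = Prod C X (Prod C (Cod C m) (Cod C n))"
    using Union_Dist[of "prod_arrow C (Id C X) ?a" "prod_arrow C (Id C X) ?b"]
      Union_Cod[of "prod_arrow C (Id C X) ?a" "prod_arrow C (Id C X) ?b"] X m n by simp_all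
  have "factors C (prod_arrow C (Id C X) (pr m n)) ?U"
    unfolding prod_pair_def by (rule Union_prod) (use X m n in simp_all)
  moreover have "factors C (f \<cdot>\<^bsub>C\<^esub> ?U) t"
    by (rule Union_least[where X = "Prod C X (Prod C (Cod C m) (Cod C n))"])
      (use X m n t f 1 2 in \<open>simp_all add: hom_iff\<close>)
  ultimately show ?thesis
    by (rule factors_trans) (use X m n t f U in simp_all)
qed

text \<open>Reduced to the other side by the symmetry, since \<open>Union_prod\<close> speaks of a
  factor on the left of the union.\<close>

lemma prod_pr_least_left:
  assumes X: "X \<in> Ob C" and m: "m \<in> Dist P" and n: "n \<in> Dist P" and t: "t \<in> Dist P"
    and f: "f \<in> Ar C" "Dom C f = Prod C (Prod C (Cod C m) (Cod C n)) X" "Cod C f = Cod C t"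
    and 1: "factors C (f \<cdot>\<^bsub>C\<^esub> prod_arrow C (prod_arrow C (Id C (Cod C m)) n) (Id C X)) t"
    and 2: "factors C (f \<cdot>\<^bsub>C\<^esub> prod_arrow C (prod_arrow C m (Id C (Cod C n))) (Id C X)) t"
  shows "factors C (f \<cdot>\<^bsub>C\<^esub> prod_arrow C (pr m n) (Id C X)) t"
proof -
  let ?Z = "Prod C (Cod C m) (Cod C n)"
  have sw: "(f \<cdot>\<^bsub>C\<^esub> swap X ?Z) \<cdot>\<^bsub>C\<^esub> prod_arrow C (Id C X) a =
      (f \<cdot>\<^bsub>C\<^esub> prod_arrow C a (Id C X)) \<cdot>\<^bsub>C\<^esub> swap X (Dom C a)"
    if "a \<in> Ar C" "Cod C a = ?Z" for a
    using swap_natural[of "Id C X" a] X m n f that by simp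
  have "factors C ((f \<cdot>\<^bsub>C\<^esub> swap X ?Z) \<cdot>\<^bsub>C\<^esub> prod_arrow C (Id C X) (pr m n)) t"
  proof (rule prod_pr_least_right[OF X m n t])
    show "factors C ((f \<cdot>\<^bsub>C\<^esub> swap X ?Z) \<cdot>\<^bsub>C\<^esub> prod_arrow C (Id C X) (prod_arrow C (Id C (Cod C m)) n)) t"
      by (subst sw) (use X m n t f in \<open>auto intro!: factors_comp[OF 1] simp del: assoc\<close>)
    show "factors C ((f \<cdot>\<^bsub>C\<^esub> swap X ?Z) \<cdot>\<^bsub>C\<^esub> prod_arrow C (Id C X) (prod_arrow C m (Id C (Cod C n)))) t"
      by (subst sw) (use X m n t f in \<open>auto intro!: factors_comp[OF 2] simp del: assoc\<close>)
  qed (use X m n f in simp_all)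
  then have "factors C ((f \<cdot>\<^bsub>C\<^esub> prod_arrow C (pr m n) (Id C X)) \<cdot>\<^bsub>C\<^esub> swap X (Dom C (pr m n))) t"
    by (subst (asm) sw) (use m n in simp_all)
  then have "factors C (((f \<cdot>\<^bsub>C\<^esub> prod_arrow C (pr m n) (Id C X)) \<cdot>\<^bsub>C\<^esub> swap X (Dom C (pr m n))) \<cdot>\<^bsub>C\<^esub>
      swap (Dom C (pr m n)) X) t"
    by (rule factors_comp) (use X m n t f in simp_all)
  then show ?thesis using X m n t f by simp
qed

lemma factors_prod_right:
  assumes "factors C f m" "f \<in> Ar C" "m \<in> Ar C" "X \<in> Ob C"
  shows "factors C (prod_arrow C (Id C X) f) (prod_arrow C (Id C X) m)"
proof -
  obtain u where "u \<in> Ar C" "Dom C u = Dom C f" "Cod C u = Dom C m" "m \<cdot>\<^bsub>C\<^esub> u = f"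
    using assms(1) by (auto simp: factors_def hom_iff)
  then show ?thesis using assms
    by (intro factorsI[of "prod_arrow C (Id C X) u"]) (simp_all add: prod_arrow_comp)
qed

lemma factors_prod_left:
  assumes "factors C f m" "f \<in> Ar C" "m \<in> Ar C" "X \<in> Ob C"
  shows "factors C (prod_arrow C f (Id C X)) (prod_arrow C m (Id C X))"
proof -
  obtain u where "u \<in> Ar C" "Dom C u = Dom C f" "Cod C u = Dom C m" "m \<cdot>\<^bsub>C\<^esub> u = f"
    using assms(1) by (auto simp: factors_def hom_iff)
  then show ?thesis using assms
    by (intro factorsI[of "prod_arrow C u (Id C X)"]) (simp_all add: prod_arrow_comp)
qed

lemma factors_prods:
  assumes "m \<in> Dist P" "n \<in> Dist P" "f \<in> Ar C"
  shows "Cod C f = Cod C n \<Longrightarrow> factors C f n \<Longrightarrow> factors C (prod_arrow C (Id C (Cod C m)) f) (pr m n)"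
    "Cod C f = Cod C m \<Longrightarrow> factors C f m \<Longrightarrow> factors C (prod_arrow C f (Id C (Cod C n))) (pr m n)"
  using factors_trans1[OF factors_prod_right[of f n "Cod C m"] pr_simps(3)[of m n]]
    factors_trans1[OF factors_prod_left[of f m "Cod C n"] pr_simps(4)[of m n]] assms by simp_all

definition pairmap :: "'a \<Rightarrow> 'a \<Rightarrow> 'a \<Rightarrow> bool" where
  "pairmap m f n \<longleftrightarrow> m \<in> Dist P \<and> n \<in> Dist P \<and> f \<in> Ar C \<and> Dom C f = Cod C m \<and> Cod C f = Cod C n \<and>
    factors C (f \<cdot>\<^bsub>C\<^esub> m) n"

lemma pairmapD:
  assumes "pairmap m f n"
  shows "m \<in> Dist P" "n \<in> Dist P" "f \<in> Ar C" "Dom C f = Cod C m" "Cod C f = Cod C n"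
    "factors C (f \<cdot>\<^bsub>C\<^esub> m) n"
  using assms by (auto simp: pairmap_def)

lemma pairmap_Id: "m \<in> Dist P \<Longrightarrow> pairmap m (Id C (Cod C m)) m"
  by (simp add: pairmap_def factors_self)

lemma pairmap_comp:
  assumes "pairmap m f n" "pairmap n g k"
  shows "pairmap m (g \<cdot>\<^bsub>C\<^esub> f) k"
proof -
  note f = pairmapD[OF assms(1)] and g = pairmapD[OF assms(2)]
  have "factors C (g \<cdot>\<^bsub>C\<^esub> (f \<cdot>\<^bsub>C\<^esub> m)) k" by (rule factors_trans[OF f(6) g(6)]) (use f g in simp_all)
  then show ?thesis using f g by (simp add: pairmap_def)
qed

lemma pairmap_prod:
  assumes "pairmap m f n" "pairmap m' f' n'"
  shows "pairmap (pr m m') (prod_arrow C f f') (pr n n')"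
proof -
  note f = pairmapD[OF assms(1)] and g = pairmapD[OF assms(2)]
  have "factors C (prod_arrow C f f' \<cdot>\<^bsub>C\<^esub> pr m m') (pr n n')"
  proof (rule pr_least)
    have "prod_arrow C f f' \<cdot>\<^bsub>C\<^esub> prod_arrow C (Id C (Cod C m)) m' =
        prod_arrow C (Id C (Cod C n)) (f' \<cdot>\<^bsub>C\<^esub> m') \<cdot>\<^bsub>C\<^esub> prod_arrow C f (Id C (Dom C m'))"
      using f(1-5) g(1-5) by (simp add: prod_arrow_comp)
    then show "factors C (prod_arrow C f f' \<cdot>\<^bsub>C\<^esub> prod_arrow C (Id C (Cod C m)) m') (pr n n')"
      using factors_comp[OF factors_prods(1)[OF f(2) g(2) _ _ g(6)]] f g by simp
    have "prod_arrow C f f' \<cdot>\<^bsub>C\<^esub> prod_arrow C m (Id C (Cod C m')) =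
        prod_arrow C (f \<cdot>\<^bsub>C\<^esub> m) (Id C (Cod C n')) \<cdot>\<^bsub>C\<^esub> prod_arrow C (Id C (Dom C m)) f'"
      using f(1-5) g(1-5) by (simp add: prod_arrow_comp)
    then show "factors C (prod_arrow C f f' \<cdot>\<^bsub>C\<^esub> prod_arrow C m (Id C (Cod C m'))) (pr n n')"
      using factors_comp[OF factors_prods(2)[OF f(2) g(2) _ _ f(6)]] f g by simp
  qed (use f g in simp_all)
  then show ?thesis using f g by (simp add: pairmap_def)
qed

lemma pairmap_swap:
  assumes "m \<in> Dist P" "n \<in> Dist P"
  shows "pairmap (pr m n) (swap (Cod C m) (Cod C n)) (pr n m)"
proof -
  have "factors C (swap (Cod C m) (Cod C n) \<cdot>\<^bsub>C\<^esub> pr m n) (pr n m)"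
  proof (rule pr_least)
    show "factors C (swap (Cod C m) (Cod C n) \<cdot>\<^bsub>C\<^esub> prod_arrow C (Id C (Cod C m)) n) (pr n m)"
      using swap_natural[of "Id C (Cod C m)" n] factors_comp[OF pr_simps(4)[of n m]] assms by simp
    show "factors C (swap (Cod C m) (Cod C n) \<cdot>\<^bsub>C\<^esub> prod_arrow C m (Id C (Cod C n))) (pr n m)"
      using swap_natural[of m "Id C (Cod C n)"] factors_comp[OF pr_simps(3)[of n m]] assms by simp
  qed (use assms in simp_all)
  then show ?thesis using assms by (simp add: pairmap_def)
qed

text \<open>Either bracketing is covered by three pieces, in each of which one of the three objects
  is replaced by its subobject. Applying the universal property of unions twice reduces the claim to
  these pieces, and \<open>assc_natural\<close> matches them.\<close>

lemma pairmap_assc: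
  assumes D: "m \<in> Dist P" "n \<in> Dist P" "k \<in> Dist P"
  shows "pairmap (pr (pr m n) k) (assc (Cod C m) (Cod C n) (Cod C k)) (pr m (pr n k))"
proof -
  let ?x = "Cod C m" and ?y = "Cod C n" and ?z = "Cod C k"
  let ?a = "assc ?x ?y ?z" and ?t = "pr m (pr n k)"
  have "factors C (?a \<cdot>\<^bsub>C\<^esub> pr (pr m n) k) ?t"
  proof (rule pr_least)
    have "factors C (prod_arrow C (Id C ?x) (prod_arrow C (Id C ?y) k)) ?t"
      by (rule factors_prods) (use D in simp_all)
    then show "factors C (?a \<cdot>\<^bsub>C\<^esub> prod_arrow C (Id C (Cod C (pr m n))) k) ?t"
      using assc_natural(1)[of "Id C ?x" "Id C ?y" k] factors_comp[of _ ?t] D by simp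
    have "factors C (?a \<cdot>\<^bsub>C\<^esub> prod_arrow C (pr m n) (Id C ?z)) ?t"
    proof (rule prod_pr_least_left)
      have "factors C (prod_arrow C (Id C ?x) (prod_arrow C n (Id C ?z))) ?t"
        by (rule factors_prods) (use D in simp_all)
      then show "factors C (?a \<cdot>\<^bsub>C\<^esub> prod_arrow C (prod_arrow C (Id C ?x) n) (Id C ?z)) ?t"
        using assc_natural(1)[of "Id C ?x" n "Id C ?z"] factors_comp[of _ ?t] D by simp
      have "factors C (prod_arrow C m (Id C (Cod C (pr n k)))) ?t"
        by (rule factors_prods) (use D in \<open>simp_all add: factors_self\<close>)
      then show "factors C (?a \<cdot>\<^bsub>C\<^esub> prod_arrow C (prod_arrow C m (Id C ?y)) (Id C ?z)) ?t"
        using assc_natural(1)[of m "Id C ?y" "Id C ?z"] factors_comp[of _ ?t] D by simp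
    qed (use D in simp_all)
    then show "factors C (?a \<cdot>\<^bsub>C\<^esub> prod_arrow C (pr m n) (Id C ?z)) ?t" .
  qed (use D in simp_all)
  then show ?thesis using D by (simp add: pairmap_def)
qed

lemma pairmap_assc':
  assumes D: "m \<in> Dist P" "n \<in> Dist P" "k \<in> Dist P"
  shows "pairmap (pr m (pr n k)) (assc' (Cod C m) (Cod C n) (Cod C k)) (pr (pr m n) k)"
proof -
  let ?x = "Cod C m" and ?y = "Cod C n" and ?z = "Cod C k"
  let ?a = "assc' ?x ?y ?z" and ?t = "pr (pr m n) k"
  have "factors C (?a \<cdot>\<^bsub>C\<^esub> pr m (pr n k)) ?t"
  proof (rule pr_least)
    have "factors C (prod_arrow C (prod_arrow C m (Id C ?y)) (Id C ?z)) ?t"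
      by (rule factors_prods) (use D in simp_all)
    then show "factors C (?a \<cdot>\<^bsub>C\<^esub> prod_arrow C m (Id C (Cod C (pr n k)))) ?t"
      using assc_natural(2)[of m "Id C ?y" "Id C ?z"] factors_comp[of _ ?t] D by simp
    have "factors C (?a \<cdot>\<^bsub>C\<^esub> prod_arrow C (Id C ?x) (pr n k)) ?t"
    proof (rule prod_pr_least_right)
      have "factors C (prod_arrow C (Id C (Cod C (pr m n))) k) ?t"
        by (rule factors_prods) (use D in \<open>simp_all add: factors_self\<close>)
      then show "factors C (?a \<cdot>\<^bsub>C\<^esub> prod_arrow C (Id C ?x) (prod_arrow C (Id C ?y) k)) ?t"
        using assc_natural(2)[of "Id C ?x" "Id C ?y" k] factors_comp[of _ ?t] D by simp
      have "factors C (prod_arrow C (prod_arrow C (Id C ?x) n) (Id C ?z)) ?t"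
        by (rule factors_prods) (use D in simp_all)
      then show "factors C (?a \<cdot>\<^bsub>C\<^esub> prod_arrow C (Id C ?x) (prod_arrow C n (Id C ?z))) ?t"
        using assc_natural(2)[of "Id C ?x" n "Id C ?z"] factors_comp[of _ ?t] D by simp
    qed (use D in simp_all)
    then show "factors C (?a \<cdot>\<^bsub>C\<^esub> prod_arrow C (Id C ?x) (pr n k)) ?t" .
  qed (use D in simp_all)
  then show ?thesis using D by (simp add: pairmap_def)
qed

lemma from_empty [simp]:
  assumes "X \<in> Ob C"
  shows "from_empty C P X \<in> Dist P" "Dom C (from_empty C P X) = Empty P"
    "Cod C (from_empty C P X) = X"
proof -
  show "from_empty C P X \<in> Dist P" by (rule Empty_Dist[OF assms])
  have "\<exists>!f. f \<in> hom C (Empty P) X" using Empty_initial assms by (simp add: initial_object_def)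
  from theI'[OF this] show "Dom C (from_empty C P X) = Empty P" "Cod C (from_empty C P X) = X"
    by (auto simp: from_empty_def hom_iff)
qed

lemma Empty_Ob [simp]: "Empty P \<in> Ob C"
  using Empty_initial by (simp add: initial_object_def)

lemma initial_factors:
  assumes "initial_object C (Dom C f)" "f \<in> Ar C" "t \<in> Ar C" "Cod C f = Cod C t"
  shows "factors C f t"
proof -
  have i: "\<exists>!g. g \<in> hom C (Dom C f) Y" if "Y \<in> Ob C" for Y
    using assms(1) that by (simp add: initial_object_def)
  obtain u where u: "u \<in> hom C (Dom C f) (Dom C t)"
    using i[of "Dom C t"] assms(3) by auto
  then have "t \<cdot>\<^bsub>C\<^esub> u \<in> hom C (Dom C f) (Cod C t)" "f \<in> hom C (Dom C f) (Cod C t)"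
    using assms by (auto simp: hom_iff)
  then have "t \<cdot>\<^bsub>C\<^esub> u = f" using i[of "Cod C t"] assms(3) by auto
  then show ?thesis using u by (auto simp: factors_def)
qed

lemma Empty_prod_left:
  assumes "X \<in> Ob C" shows "initial_object C (Prod C (Empty P) X)"
  unfolding initial_object_def
proof (intro conjI ballI)
  show "Prod C (Empty P) X \<in> Ob C" using assms by simp
  fix Y assume Y: "Y \<in> Ob C"
  have i: "\<exists>!f. f \<in> hom C (Prod C X (Empty P)) Y"
    using Empty_prod[OF assms] Y by (simp add: initial_object_def)
  then obtain f where f: "f \<in> hom C (Prod C X (Empty P)) Y" by blast
  show "\<exists>!f. f \<in> hom C (Prod C (Empty P) X) Y"
  proof (rule ex1I[of _ "f \<cdot>\<^bsub>C\<^esub> swap (Empty P) X"])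
    show "f \<cdot>\<^bsub>C\<^esub> swap (Empty P) X \<in> hom C (Prod C (Empty P) X) Y"
      using f assms by (simp add: hom_iff)
    fix g assume g: "g \<in> hom C (Prod C (Empty P) X) Y"
    then have "g \<cdot>\<^bsub>C\<^esub> swap X (Empty P) \<in> hom C (Prod C X (Empty P)) Y"
      using assms by (simp add: hom_iff)
    then have e: "g \<cdot>\<^bsub>C\<^esub> swap X (Empty P) = f" using i f by blast
    have "(g \<cdot>\<^bsub>C\<^esub> swap X (Empty P)) \<cdot>\<^bsub>C\<^esub> swap (Empty P) X = g"
      using g assms by (simp add: hom_iff)
    then show "g = f \<cdot>\<^bsub>C\<^esub> swap (Empty P) X" unfolding e by simp
  qed
qed

text \<open>The piece in which the final object is replaced by \<open>Empty P\<close> is initial, so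
  it maps into any subobject; what remains is the subobject of the other factor.\<close>

lemma pairmap_units:
  assumes m: "m \<in> Dist P"
  defines "u \<equiv> from_empty C P (Final C)"
  shows "pairmap (pr u m) (Snd C (Final C) (Cod C m)) m"
    "pairmap m (pairing C (bang (Cod C m)) (Id C (Cod C m))) (pr u m)"
    "pairmap (pr m u) (Fst C (Cod C m) (Final C)) m"
    "pairmap m (pairing C (Id C (Cod C m)) (bang (Cod C m))) (pr m u)"
proof -
  let ?X = "Cod C m"
  have u [simp]: "u \<in> Dist P" "Dom C u = Empty P" "Cod C u = Final C" by (simp_all add: u_def)
  have mA [simp]: "m \<in> Ar C" using m by simp
  have "factors C (Snd C (Final C) ?X \<cdot>\<^bsub>C\<^esub> pr u m) m"
  proof (rule pr_least)
    show "factors C (Snd C (Final C) ?X \<cdot>\<^bsub>C\<^esub> prod_arrow C (Id C (Cod C u)) m) m"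
      by (rule factorsI[of "Snd C (Final C) (Dom C m)"]) (use m in \<open>simp_all add: prod_arrow_def\<close>)
    show "factors C (Snd C (Final C) ?X \<cdot>\<^bsub>C\<^esub> prod_arrow C u (Id C ?X)) m"
      by (rule initial_factors) (use m Empty_prod_left in simp_all)
  qed (use m in simp_all)
  then show "pairmap (pr u m) (Snd C (Final C) ?X) m" using m by (simp add: pairmap_def)
  have "factors C (Fst C ?X (Final C) \<cdot>\<^bsub>C\<^esub> pr m u) m"
  proof (rule pr_least)
    show "factors C (Fst C ?X (Final C) \<cdot>\<^bsub>C\<^esub> prod_arrow C m (Id C (Cod C u))) m"
      by (rule factorsI[of "Fst C (Dom C m) (Final C)"]) (use m in \<open>simp_all add: prod_arrow_def\<close>)
    show "factors C (Fst C ?X (Final C) \<cdot>\<^bsub>C\<^esub> prod_arrow C (Id C ?X) u) m"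
      by (rule initial_factors) (use m Empty_prod in simp_all)
  qed (use m in simp_all)
  then show "pairmap (pr m u) (Fst C ?X (Final C)) m" using m by (simp add: pairmap_def)
  have b: "bang ?X \<cdot>\<^bsub>C\<^esub> m = bang (Dom C m)" by (rule Final_unique) (use m in simp_all)
  have "factors C (pairing C (bang ?X) (Id C ?X) \<cdot>\<^bsub>C\<^esub> m) (prod_arrow C (Id C (Final C)) m)"
    by (rule factorsI[of "pairing C (bang (Dom C m)) (Id C (Dom C m))"])
      (use m b in \<open>simp_all add: prod_arrow_def\<close>)
  then have "factors C (pairing C (bang ?X) (Id C ?X) \<cdot>\<^bsub>C\<^esub> m) (pr u m)"
    by (rule factors_trans1) (use m pr_simps(3)[of u m] in simp_all)
  then show "pairmap m (pairing C (bang ?X) (Id C ?X)) (pr u m)" using m by (simp add: pairmap_def)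
  have "factors C (pairing C (Id C ?X) (bang ?X) \<cdot>\<^bsub>C\<^esub> m) (prod_arrow C m (Id C (Final C)))"
    by (rule factorsI[of "pairing C (Id C (Dom C m)) (bang (Dom C m))"])
      (use m b in \<open>simp_all add: prod_arrow_def\<close>)
  then have "factors C (pairing C (Id C ?X) (bang ?X) \<cdot>\<^bsub>C\<^esub> m) (pr m u)"
    by (rule factors_trans1) (use m pr_simps(4)[of m u] in simp_all)
  then show "pairmap m (pairing C (Id C ?X) (bang ?X)) (pr m u)" using m by (simp add: pairmap_def)
qed

abbreviation PC :: "('a, 'a \<times> 'a \<times> 'a) tcat" where "PC \<equiv> pair_category C P"

lemma PC_simps:
  "Ob PC = Dist P" "(m, f, n) \<in> Ar PC \<longleftrightarrow> pairmap m f n" "Dom PC (m, f, n) = m" "Cod PC (m, f, n) = n"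
  "Id PC m = (m, Id C (Cod C m), m)" "(n', g, k) \<cdot>\<^bsub>PC\<^esub> (m, f, n) = (m, g \<cdot>\<^bsub>C\<^esub> f, k)"
  "m \<otimes>\<^bsub>PC\<^esub> n = pr m n"
  "(m, f, n) \<odot>\<^bsub>PC\<^esub> (m', f', n') = (pr m m', prod_arrow C f f', pr n n')"
  "\<one>\<^bsub>PC\<^esub> = from_empty C P (Final C)"
  "Assoc PC m n k = (pr (pr m n) k, assc (Cod C m) (Cod C n) (Cod C k), pr m (pr n k))"
  "Lun PC m = (pr (from_empty C P (Final C)) m, Snd C (Final C) (Cod C m), m)"
  "Run PC m = (pr m (from_empty C P (Final C)), Fst C (Cod C m) (Final C), m)"
  "Sym PC m n = (pr m n, swap (Cod C m) (Cod C n), pr n m)"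
  by (auto simp: pair_category_def Let_def pairmap_def hom_iff)

lemma PC_hom: "c \<in> hom PC m n \<longleftrightarrow> (\<exists>f. c = (m, f, n) \<and> pairmap m f n)"
  by (cases c) (auto simp: hom_iff PC_simps)

lemma PC_iso:
  assumes "pairmap m f n" "pairmap n g m" "g \<cdot>\<^bsub>C\<^esub> f = Id C (Cod C m)" "f \<cdot>\<^bsub>C\<^esub> g = Id C (Cod C n)"
  shows "iso_arrow PC (m, f, n)"
  unfolding iso_arrow_def inverse_arrows_def
  by (rule exI[of _ "(n, g, m)"]) (use assms in \<open>simp add: hom_iff PC_simps\<close>)

text \<open>Arrows of pairs are arrows of \<open>C\<close> with a property, so the laws are those of
  the product tensor structure. What has to be added is that the structure isomorphisms and their
  inverses respect the subobjects: a morphism of pairs can be invertible in \<open>C\<close> without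
  being so here.\<close>

lemma tensor_category_PC: "tensor_category PC"
proof -
  interpret T: tensor_category "cartesian_tensor C" by (rule tensor_category_cartesian)
  have hT: "f \<in> hom (cartesian_tensor C) (Cod C m) (Cod C n)" if "pairmap m f n" for m f n
    using pairmapD[OF that] by (simp add: hom_iff)
  show ?thesis
  proof unfold_locales
    fix w x y z assume o: "x \<in> Ob PC" "y \<in> Ob PC" "z \<in> Ob PC"
    then have d: "x \<in> Dist P" "y \<in> Dist P" "z \<in> Dist P" by (simp_all add: PC_simps)
    then have D: "Cod C x \<in> Ob C" "Cod C y \<in> Ob C" "Cod C z \<in> Ob C" by simp_all
    show "iso_arrow PC (Assoc PC x y z)"
      unfolding PC_simps
      by (rule PC_iso[OF pairmap_assc pairmap_assc']) (use d assc_inverse[OF D] in simp_all)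
    show "Assoc PC y z x \<cdot>\<^bsub>PC\<^esub> (Sym PC x (y \<otimes>\<^bsub>PC\<^esub> z) \<cdot>\<^bsub>PC\<^esub> Assoc PC x y z) =
        (Id PC y \<odot>\<^bsub>PC\<^esub> Sym PC x z) \<cdot>\<^bsub>PC\<^esub> (Assoc PC y x z \<cdot>\<^bsub>PC\<^esub> (Sym PC x y \<odot>\<^bsub>PC\<^esub> Id PC z))"
      using T.hexagon[of "Cod C x" "Cod C y" "Cod C z"] d by (simp add: PC_simps)
    assume "w \<in> Ob PC"
    then show "(Id PC w \<odot>\<^bsub>PC\<^esub> Assoc PC x y z) \<cdot>\<^bsub>PC\<^esub>
          (Assoc PC w (x \<otimes>\<^bsub>PC\<^esub> y) z \<cdot>\<^bsub>PC\<^esub> (Assoc PC w x y \<odot>\<^bsub>PC\<^esub> Id PC z)) =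
        Assoc PC w x (y \<otimes>\<^bsub>PC\<^esub> z) \<cdot>\<^bsub>PC\<^esub> Assoc PC (w \<otimes>\<^bsub>PC\<^esub> x) y z"
      using T.pentagon[of "Cod C w" "Cod C x" "Cod C y" "Cod C z"] d by (simp add: PC_simps)
  next
    fix x y assume o: "x \<in> Ob PC" "y \<in> Ob PC"
    then have d: "x \<in> Dist P" "y \<in> Dist P" by (simp_all add: PC_simps)
    show "Sym PC y x \<cdot>\<^bsub>PC\<^esub> Sym PC x y = Id PC (x \<otimes>\<^bsub>PC\<^esub> y)" using d by (simp add: PC_simps)
    show "(Id PC x \<odot>\<^bsub>PC\<^esub> Lun PC y) \<cdot>\<^bsub>PC\<^esub> Assoc PC x \<one>\<^bsub>PC\<^esub> y = Run PC x \<odot>\<^bsub>PC\<^esub> Id PC y"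
      using T.triangle[of "Cod C x" "Cod C y"] d by (simp add: PC_simps)
  next
    fix x assume o: "x \<in> Ob PC"
    then have d: "x \<in> Dist P" by (simp add: PC_simps)
    note u = unit_inverse[of "Cod C x"]
    show "iso_arrow PC (Lun PC x)" "iso_arrow PC (Run PC x)"
      unfolding PC_simps
      by (rule PC_iso[OF pairmap_units(1,2)[OF d]] PC_iso[OF pairmap_units(3,4)[OF d]];
        use d u in \<open>simp del: pairing_comp add: pairing_comp[of "bang _"] pairing_comp[of "Id C _" "bang _"]\<close>)+
  next
    fix f x x' g y y' h z z'
    assume "f \<in> hom PC x x'" "g \<in> hom PC y y'" "h \<in> hom PC z z'"
    then obtain f' g' h' where e: "f = (x, f', x')" "g = (y, g', y')" "h = (z, h', z')"
      and p: "pairmap x f' x'" "pairmap y g' y'" "pairmap z h' z'"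
      by (auto simp: PC_hom)
    show "Assoc PC x' y' z' \<cdot>\<^bsub>PC\<^esub> ((f \<odot>\<^bsub>PC\<^esub> g) \<odot>\<^bsub>PC\<^esub> h) = (f \<odot>\<^bsub>PC\<^esub> (g \<odot>\<^bsub>PC\<^esub> h)) \<cdot>\<^bsub>PC\<^esub> Assoc PC x y z"
      using T.Assoc_nat[OF hT[OF p(1)] hT[OF p(2)] hT[OF p(3)]] by (simp add: e PC_simps)
  next
    fix f x x' g y y' assume "f \<in> hom PC x x'" "g \<in> hom PC y y'"
    then obtain f' g' where e: "f = (x, f', x')" "g = (y, g', y')"
      and p: "pairmap x f' x'" "pairmap y g' y'"
      by (auto simp: PC_hom)
    show "Sym PC x' y' \<cdot>\<^bsub>PC\<^esub> (f \<odot>\<^bsub>PC\<^esub> g) = (g \<odot>\<^bsub>PC\<^esub> f) \<cdot>\<^bsub>PC\<^esub> Sym PC x y"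
      using T.Sym_nat[OF hT[OF p(1)] hT[OF p(2)]] by (simp add: e PC_simps)
  next
    fix f x x' assume "f \<in> hom PC x x'"
    then obtain f' where e: "f = (x, f', x')" and p: "pairmap x f' x'" by (auto simp: PC_hom)
    show "Lun PC x' \<cdot>\<^bsub>PC\<^esub> (Id PC \<one>\<^bsub>PC\<^esub> \<odot>\<^bsub>PC\<^esub> f) = f \<cdot>\<^bsub>PC\<^esub> Lun PC x"
      using T.Lun_nat[OF hT[OF p]] by (simp add: e PC_simps)
    show "Run PC x' \<cdot>\<^bsub>PC\<^esub> (f \<odot>\<^bsub>PC\<^esub> Id PC \<one>\<^bsub>PC\<^esub>) = f \<cdot>\<^bsub>PC\<^esub> Run PC x"
      using T.Run_nat[OF hT[OF p]] by (simp add: e PC_simps)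
  next
    show "Dom PC c \<in> Ob PC" "Cod PC c \<in> Ob PC" if "c \<in> Ar PC" for c
      using that by (cases c, simp add: PC_simps pairmapD)+
  qed (auto simp: PC_hom PC_simps pairmap_Id pairmap_comp pairmap_prod pairmap_assc pairmap_swap
      pairmap_units prod_arrow_comp pairmapD)
qed

end

section \<open>The boundary data of relative cohomologies\<close>

text \<open>\<open>IsoC\<close> consists of all excisions. The arrows inverted in
  \<open>ProdC\<close> are among them, which is not visible here and comes from
  \<open>prod_excision\<close>.\<close>

definition rel_data :: "('o, 'a, 'z) ccat_scheme \<Rightarrow> ('o, 'a, 'v) pairs_scheme \<Rightarrow> ('a, 'a \<times> 'a \<times> 'a) bdata" where
  "rel_data C P =
    \<lparr>Tri = triples C P,
     NatC = {((m, n), (m', n'), (m, f, m'), (n, g, n')) | m n m' n' f g.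
       (m, n) \<in> triples C P \<and> (m', n') \<in> triples C P \<and> f \<in> hom C (Cod C m) (Cod C m') \<and>
       g \<in> hom C (Dom C m) (Dom C m') \<and> f \<cdot>\<^bsub>C\<^esub> m = m' \<cdot>\<^bsub>C\<^esub> g \<and> factors C (g \<cdot>\<^bsub>C\<^esub> n) n'},
     MonC = {(m \<cdot>\<^bsub>C\<^esub> n, Id C (Cod C m), m) | m n. (m, n) \<in> triples C P},
     ExA = {((m \<cdot>\<^bsub>C\<^esub> n, Id C (Cod C m), m), (n, m, m \<cdot>\<^bsub>C\<^esub> n)) | m n. (m, n) \<in> triples C P},
     ExB = {((n, m, m \<cdot>\<^bsub>C\<^esub> n), (m, n)) | m n. (m, n) \<in> triples C P},
     ExC = {((m, n), (m \<cdot>\<^bsub>C\<^esub> n, Id C (Cod C m), m)) | m n. (m, n) \<in> triples C P},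
     IsoC = {(p, m, n) | p m n q. m \<in> Dist P \<and> n \<in> Dist P \<and> Cod C m = Cod C n \<and>
       iso_arrow C (Union P m n) \<and> is_pullback C m n p q \<and> p \<in> Dist P},
     ProdC = {((m, y), m', (w, a), (c, b, a), (c, Id C (Cod C c), prod_pair C P y m')) | m m' w a b c y.
       m \<in> Dist P \<and> m' \<in> Dist P \<and> w = prod_pair C P m m' \<and>
       a = factor C (prod_arrow C (Id C (Cod C m)) m') w \<and>
       b = factor C (prod_arrow C m (Id C (Cod C m'))) w \<and>
       c = prod_arrow C (Id C (Dom C m)) m' \<and> y = from_empty C P (Dom C m)}\<rparr>"

context pair_structure
begin

lemma factor_Dist:
  assumes "m \<in> Dist P" "f \<in> Dist P" "factors C f m"
  shows "factor C f m \<in> Dist P" "Dom C (factor C f m) = Dom C f" "Cod C (factor C f m) = Dom C m"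
    "m \<cdot>\<^bsub>C\<^esub> factor C f m = f"
proof -
  note u = monic_factor[OF Dist_monic[OF assms(1)] assms(3)]
  then show "Dom C (factor C f m) = Dom C f" "Cod C (factor C f m) = Dom C m" "m \<cdot>\<^bsub>C\<^esub> factor C f m = f"
    by (auto simp: hom_iff)
  show "factor C f m \<in> Dist P" by (rule Dist_cancel[OF assms(1)]) (use u assms in \<open>auto simp: hom_iff\<close>)
qed

text \<open>This justifies the inverse in the compatibility of products and boundaries, because it
  makes the arrow to be inverted an excision: the subobjects \<open>a\<close> and \<open>b\<close>
  of the union \<open>w\<close> exhaust it, and their intersection is the product of the two smaller
  objects.\<close>

lemma prod_excision:
  assumes m: "m \<in> Dist P" "m' \<in> Dist P"
  defines "w \<equiv> pr m m'"
  defines "a \<equiv> factor C (prod_arrow C (Id C (Cod C m)) m') w"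
  defines "b \<equiv> factor C (prod_arrow C m (Id C (Cod C m'))) w"
  defines "c \<equiv> prod_arrow C (Id C (Dom C m)) m'"
  shows "a \<in> Dist P" "b \<in> Dist P" "c \<in> Dist P" "Cod C a = Dom C w" "Cod C b = Dom C w"
    "iso_arrow C (Union P b a)" "is_pullback C b a c (prod_arrow C m (Id C (Dom C m')))"
proof -
  let ?X = "Cod C m" and ?Y = "Dom C m" and ?X' = "Cod C m'" and ?Y' = "Dom C m'"
  let ?A = "prod_arrow C (Id C ?X) m'" and ?B = "prod_arrow C m (Id C ?X')"
  have [simp]: "m \<in> Ar C" "m' \<in> Ar C" using m by auto
  have w: "w \<in> Dist P" "w \<in> Ar C" "Cod C w = Prod C ?X ?X'" using m by (simp_all add: w_def)
  have a: "a \<in> Dist P" "a \<in> Ar C" "Dom C a = Prod C ?X ?Y'" "Cod C a = Dom C w" "w \<cdot>\<^bsub>C\<^esub> a = ?A"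
    using factor_Dist[OF w(1), of ?A] m pr_simps(3)[OF m] by (simp_all add: a_def w_def)
  have b: "b \<in> Dist P" "b \<in> Ar C" "Dom C b = Prod C ?Y ?X'" "Cod C b = Dom C w" "w \<cdot>\<^bsub>C\<^esub> b = ?B"
    using factor_Dist[OF w(1), of ?B] m pr_simps(4)[OF m] by (simp_all add: b_def w_def)
  have c: "c \<in> Dist P" "c \<in> Ar C" "Dom C c = Prod C ?Y ?Y'" "Cod C c = Prod C ?Y ?X'"
    using m by (simp_all add: c_def)
  show "a \<in> Dist P" "b \<in> Dist P" "c \<in> Dist P" "Cod C a = Dom C w" "Cod C b = Dom C w"
    using a b c by auto
  let ?U = "Union P b a"
  have cod: "Cod C b = Cod C a" using a b by simp
  note U = Union_Dist[OF b(1) a(1) cod] Union_Cod[OF b(1) a(1) cod] Union_upper[OF b(1) a(1) cod]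
  have UA: "?U \<in> Ar C" using U by simp
  have wU: "w \<cdot>\<^bsub>C\<^esub> ?U \<in> Dist P" by (rule Dist_comp[OF w(1)]) (use U b in auto)
  have "factors C (w \<cdot>\<^bsub>C\<^esub> a) (w \<cdot>\<^bsub>C\<^esub> ?U)" "factors C (w \<cdot>\<^bsub>C\<^esub> b) (w \<cdot>\<^bsub>C\<^esub> ?U)"
    by (rule factors_trans[where m = ?U]; use U UA a b w wU in \<open>auto simp: factors_self\<close>)+
  \<comment> \<open>Minimality of the union \<open>w\<close> lets \<open>w\<close> factor through
    its composite with the union of \<open>b\<close> and \<open>a\<close>. Hence that union, being
    monic, has a right inverse and is an isomorphism.\<close>
  then have "factors C (Id C (Prod C ?X ?X') \<cdot>\<^bsub>C\<^esub> w) (w \<cdot>\<^bsub>C\<^esub> ?U)"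
    unfolding w_def by (intro pr_least) (use m a(5) b(5) wU U UA b(4) w in \<open>simp_all add: w_def\<close>)
  then obtain t where t: "t \<in> Ar C" "Dom C t = Dom C w" "Cod C t = Dom C ?U" "(w \<cdot>\<^bsub>C\<^esub> ?U) \<cdot>\<^bsub>C\<^esub> t = w"
    using w U UA b by (auto simp: factors_def hom_iff)
  have UC: "Cod C ?U = Dom C w" using U b by simp
  have ut: "?U \<cdot>\<^bsub>C\<^esub> t = Id C (Dom C w)"
    by (rule monic_cancel[OF Dist_monic[OF w(1)]]) (use t w UA UC in \<open>simp_all\<close>)
  have utu: "?U \<cdot>\<^bsub>C\<^esub> (t \<cdot>\<^bsub>C\<^esub> ?U) = Id C (Dom C w) \<cdot>\<^bsub>C\<^esub> ?U"
    by (rule comp_extend1[OF ut]) (use t UA UC in simp_all)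
  have "t \<cdot>\<^bsub>C\<^esub> ?U = Id C (Dom C ?U)"
    by (rule monic_cancel[OF Dist_monic[OF U(1)]]) (use t UA UC utu in simp_all)
  with ut show "iso_arrow C ?U" using t UA UC by (intro iso_arrowI(1)[of ?U t]) simp_all
  let ?q = "prod_arrow C m (Id C ?Y')"
  have q: "?q \<in> Ar C" "Dom C ?q = Prod C ?Y ?Y'" "Cod C ?q = Prod C ?X ?Y'" by simp_all
  have bc: "b \<cdot>\<^bsub>C\<^esub> c = a \<cdot>\<^bsub>C\<^esub> ?q"
  proof (rule monic_cancel[OF Dist_monic[OF w(1)]])
    have "w \<cdot>\<^bsub>C\<^esub> (b \<cdot>\<^bsub>C\<^esub> c) = ?B \<cdot>\<^bsub>C\<^esub> c" by (rule comp_extend1[OF b(5)]) (use a b c w q in auto)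
    moreover have "w \<cdot>\<^bsub>C\<^esub> (a \<cdot>\<^bsub>C\<^esub> ?q) = ?A \<cdot>\<^bsub>C\<^esub> ?q"
      by (rule comp_extend1[OF a(5)]) (use a b c w q in auto)
    ultimately show "w \<cdot>\<^bsub>C\<^esub> (b \<cdot>\<^bsub>C\<^esub> c) = w \<cdot>\<^bsub>C\<^esub> (a \<cdot>\<^bsub>C\<^esub> ?q)"
      by (simp add: c_def prod_arrow_comp)
  qed (use a b c w q in auto)
  show "is_pullback C b a c ?q"
    unfolding is_pullback_def
  proof (intro conjI ballI impI)
    show "b \<in> Ar C" "a \<in> Ar C" "c \<in> Ar C" "?q \<in> Ar C" "Cod C b = Cod C a" "Dom C c = Dom C ?q"
      "Cod C c = Dom C b" "Cod C ?q = Dom C a" "b \<cdot>\<^bsub>C\<^esub> c = a \<cdot>\<^bsub>C\<^esub> ?q"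
      using a b c q bc by auto
    fix z f g assume z: "z \<in> Ob C" and "f \<in> hom C z (Dom C b)" "g \<in> hom C z (Dom C a)"
      and e: "b \<cdot>\<^bsub>C\<^esub> f = a \<cdot>\<^bsub>C\<^esub> g"
    then have f: "f \<in> Ar C" "Dom C f = z" "Cod C f = Prod C ?Y ?X'"
      and g: "g \<in> Ar C" "Dom C g = z" "Cod C g = Prod C ?X ?Y'"
      using a b by (auto simp: hom_iff)
    have "?B \<cdot>\<^bsub>C\<^esub> f = w \<cdot>\<^bsub>C\<^esub> (b \<cdot>\<^bsub>C\<^esub> f)"
      by (rule comp_extend1[OF b(5), symmetric]) (use b w f in auto)
    also have "\<dots> = ?A \<cdot>\<^bsub>C\<^esub> g"
      unfolding e by (rule comp_extend1[OF a(5)]) (use a w g in auto)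
    finally have "?B \<cdot>\<^bsub>C\<^esub> f = ?A \<cdot>\<^bsub>C\<^esub> g" .
    then have "Fst C ?X ?X' \<cdot>\<^bsub>C\<^esub> (?B \<cdot>\<^bsub>C\<^esub> f) = Fst C ?X ?X' \<cdot>\<^bsub>C\<^esub> (?A \<cdot>\<^bsub>C\<^esub> g)"
      "Snd C ?X ?X' \<cdot>\<^bsub>C\<^esub> (?B \<cdot>\<^bsub>C\<^esub> f) = Snd C ?X ?X' \<cdot>\<^bsub>C\<^esub> (?A \<cdot>\<^bsub>C\<^esub> g)" by simp_all
    then have fg: "m \<cdot>\<^bsub>C\<^esub> (Fst C ?Y ?X' \<cdot>\<^bsub>C\<^esub> f) = Fst C ?X ?Y' \<cdot>\<^bsub>C\<^esub> g"
      "Snd C ?Y ?X' \<cdot>\<^bsub>C\<^esub> f = m' \<cdot>\<^bsub>C\<^esub> (Snd C ?X ?Y' \<cdot>\<^bsub>C\<^esub> g)"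
      using f g by (simp_all add: prod_arrow_def)
    \<comment> \<open>The first coordinate is taken from \<open>f\<close>, where it lies in
      \<open>?Y\<close>, and the second from \<open>g\<close>, where it lies in
      \<open>?Y'\<close>.\<close>
    let ?h = "pairing C (Fst C ?Y ?X' \<cdot>\<^bsub>C\<^esub> f) (Snd C ?X ?Y' \<cdot>\<^bsub>C\<^esub> g)"
    have h: "?h \<in> Ar C" "Dom C ?h = z" "Cod C ?h = Prod C ?Y ?Y'" using f g by simp_all
    have "c \<cdot>\<^bsub>C\<^esub> ?h = pairing C (Fst C ?Y ?X' \<cdot>\<^bsub>C\<^esub> f) (Snd C ?Y ?X' \<cdot>\<^bsub>C\<^esub> f)"
      using f g by (simp add: c_def prod_arrow_def fg)
    then have ch: "c \<cdot>\<^bsub>C\<^esub> ?h = f" using f by (simp add: pairing_Fst_Snd_comp)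
    have "?q \<cdot>\<^bsub>C\<^esub> ?h = pairing C (Fst C ?X ?Y' \<cdot>\<^bsub>C\<^esub> g) (Snd C ?X ?Y' \<cdot>\<^bsub>C\<^esub> g)"
      using f g by (simp add: prod_arrow_def fg)
    then have qh: "?q \<cdot>\<^bsub>C\<^esub> ?h = g" using g by (simp add: pairing_Fst_Snd_comp)
    show "\<exists>!h. h \<in> hom C z (Dom C c) \<and> c \<cdot>\<^bsub>C\<^esub> h = f \<and> ?q \<cdot>\<^bsub>C\<^esub> h = g"
    proof (rule ex1I[of _ ?h])
      show "?h \<in> hom C z (Dom C c) \<and> c \<cdot>\<^bsub>C\<^esub> ?h = f \<and> ?q \<cdot>\<^bsub>C\<^esub> ?h = g"
        using h c ch qh by (simp add: hom_iff)
      fix k assume k: "k \<in> hom C z (Dom C c) \<and> c \<cdot>\<^bsub>C\<^esub> k = f \<and> ?q \<cdot>\<^bsub>C\<^esub> k = g"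
      show "k = ?h"
        by (rule monic_cancel[OF Dist_monic[OF c(1)]]) (use k ch h c in \<open>auto simp: hom_iff\<close>)
    qed
  qed
qed

lemma boundary_data_rel: "boundary_data PC (rel_data C P)"
proof -
  interpret T: tensor_category PC by (rule tensor_category_PC)
  have t: "m \<in> Dist P" "n \<in> Dist P" "Cod C n = Dom C m" "m \<cdot>\<^bsub>C\<^esub> n \<in> Dist P"
    "pairmap (m \<cdot>\<^bsub>C\<^esub> n) (Id C (Cod C m)) m" "pairmap n m (m \<cdot>\<^bsub>C\<^esub> n)" if "(m, n) \<in> triples C P" for m n
  proof -
    show d: "m \<in> Dist P" "n \<in> Dist P" "Cod C n = Dom C m" using that by (auto simp: triples_def)
    then show mn: "m \<cdot>\<^bsub>C\<^esub> n \<in> Dist P" by (rule Dist_comp)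
    show "pairmap (m \<cdot>\<^bsub>C\<^esub> n) (Id C (Cod C m)) m"
      using d mn factors_comp[OF factors_self[of m], of n] by (simp add: pairmap_def)
    show "pairmap n m (m \<cdot>\<^bsub>C\<^esub> n)" using d mn by (simp add: pairmap_def factors_self)
  qed
  have iso: "pairmap p m n" if "m \<in> Dist P" "n \<in> Dist P" "is_pullback C m n p q" "p \<in> Dist P" for p m n q
  proof -
    have q: "q \<in> Ar C" "Cod C m = Cod C n" "Dom C p = Dom C q" "Cod C p = Dom C m" "Cod C q = Dom C n"
      "m \<cdot>\<^bsub>C\<^esub> p = n \<cdot>\<^bsub>C\<^esub> q"
      using that(3) by (auto simp: is_pullback_def)
    have "factors C (m \<cdot>\<^bsub>C\<^esub> p) n" unfolding q(6) by (rule factorsI[of q]) (use q that in auto)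
    then show ?thesis using q that by (simp add: pairmap_def)
  qed
  show ?thesis
  proof unfold_locales
    fix t assume "t \<in> Tri (rel_data C P)"
    then show "fst t \<in> Ob PC \<and> snd t \<in> Ob PC" by (auto simp: rel_data_def triples_def PC_simps)
  next
    fix t t' f g assume "(t, t', f, g) \<in> NatC (rel_data C P)"
    then obtain m n m' n' f0 g0 where e: "t = (m, n)" "t' = (m', n')" "f = (m, f0, m')" "g = (n, g0, n')"
      and p: "(m, n) \<in> triples C P" "(m', n') \<in> triples C P" "f0 \<in> hom C (Cod C m) (Cod C m')"
      "g0 \<in> hom C (Dom C m) (Dom C m')" "f0 \<cdot>\<^bsub>C\<^esub> m = m' \<cdot>\<^bsub>C\<^esub> g0" "factors C (g0 \<cdot>\<^bsub>C\<^esub> n) n'"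
      by (auto simp: rel_data_def)
    have "factors C (f0 \<cdot>\<^bsub>C\<^esub> m) m'"
      unfolding p(5) by (rule factorsI[of g0]) (use p(4) t[OF p(1)] t[OF p(2)] in \<open>auto simp: hom_iff\<close>)
    then show "t \<in> Tri (rel_data C P) \<and> t' \<in> Tri (rel_data C P) \<and>
        f \<in> hom PC (fst t) (fst t') \<and> g \<in> hom PC (snd t) (snd t')"
      using e p t[OF p(1)] t[OF p(2)] by (simp add: rel_data_def hom_iff PC_simps(2-4) pairmap_def)
  next
    fix t Y t' b c assume "(t, Y, t', b, c) \<in> ProdC (rel_data C P)"
    then obtain m w a b0 c0 y where e: "t = (m, y)" "t' = (w, a)" "b = (c0, b0, a)"
      "c = (c0, Id C (Cod C c0), pr y Y)" and m: "m \<in> Dist P" "Y \<in> Dist P" and d: "w = pr m Y"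
      "a = factor C (prod_arrow C (Id C (Cod C m)) Y) w" "b0 = factor C (prod_arrow C m (Id C (Cod C Y))) w"
      "c0 = prod_arrow C (Id C (Dom C m)) Y" "y = from_empty C P (Dom C m)"
      by (auto simp: rel_data_def)
    note x = prod_excision[OF m, folded d(1), folded d(2) d(3) d(4)]
    have y: "y \<in> Dist P" "Cod C y = Dom C m" using m by (simp_all add: d)
    have "pairmap c0 (Id C (Cod C c0)) (pr y Y)"
      using x(3) y m pr_simps(3)[OF y(1) m(2)] by (simp add: pairmap_def d(4))
    moreover have "b \<in> IsoC (rel_data C P)"
      using x e by (auto simp: rel_data_def)
    ultimately show "t \<in> Tri (rel_data C P) \<and> Y \<in> Ob PC \<and> t' \<in> Tri (rel_data C P) \<and> b \<in> IsoC (rel_data C P) \<and>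
        c \<in> Ar PC \<and> Cod PC c = snd t \<otimes>\<^bsub>PC\<^esub> Y \<and> Dom PC c = Dom PC b \<and> Cod PC b = snd t' \<and>
        fst t' = fst t \<otimes>\<^bsub>PC\<^esub> Y"
      using e m y x(1,4) d(1) by (simp add: PC_simps rel_data_def triples_def)
  qed (use t iso in \<open>auto simp: rel_data_def PC_simps\<close>)
qed

lemma relative_kunneth_iff:
  "relative_kunneth_cohomology C P A H \<longleftrightarrow> bkunneth PC (rel_data C P) A H"
proof
  assume "relative_kunneth_cohomology C P A H"
  then interpret H: relative_kunneth_cohomology C P A H .
  show "bkunneth PC (rel_data C P) A H"
  proof (rule bkunneth.intro[OF boundary_data_rel H.kunneth_cohomology_axioms], rule bkunneth_axioms.intro)
    show "Bd H i t \<in> hom A (FO (Coh H i) (snd t)) (FO (Coh H (Suc i)) (fst t))"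
      if "t \<in> Tri (rel_data C P)" for t i
      using that H.Bd_hom[of "fst t" "snd t" i] by (simp add: rel_data_def)
    show "Bd H i \<in> extensional (Tri (rel_data C P))" for i using H.Bd_ext by (simp add: rel_data_def)
    show "Bd H i t \<cdot>\<^bsub>A\<^esub> FA (Coh H i) g = FA (Coh H (Suc i)) f \<cdot>\<^bsub>A\<^esub> Bd H i t'"
      if "(t, t', f, g) \<in> NatC (rel_data C P)" for t t' f g i
      using that H.Bd_nat[of _ _ _ _ _ _ i] by (auto simp: rel_data_def)
    show "monic A (FA (Coh H 0) f)" if "f \<in> MonC (rel_data C P)" for f
      using that H.exact_start by (auto simp: rel_data_def)
    show "exact_at A (FA (Coh H i) f) (FA (Coh H i) g)" if "(f, g) \<in> ExA (rel_data C P)" for f g i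
      using that H.exact_XZ by (auto simp: rel_data_def)
    show "exact_at A (FA (Coh H i) f) (Bd H i t)" if "(f, t) \<in> ExB (rel_data C P)" for f t i
      using that H.exact_YZ by (auto simp: rel_data_def)
    show "exact_at A (Bd H i t) (FA (Coh H (Suc i)) f)" if "(t, f) \<in> ExC (rel_data C P)" for f t i
      using that H.exact_XY by (auto simp: rel_data_def)
    show "iso_arrow A (FA (Coh H i) f)" if "f \<in> IsoC (rel_data C P)" for f i
      using that H.excision by (auto simp: rel_data_def)
    show "Kap H (Suc i) j (fst t, Y) \<cdot>\<^bsub>A\<^esub> (Bd H i t \<odot>\<^bsub>A\<^esub> Id A (FO (Coh H j) Y)) =
        Bd H (i + j) t' \<cdot>\<^bsub>A\<^esub> (inv_arrow A (FA (Coh H (i + j)) b) \<cdot>\<^bsub>A\<^esub>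
          (FA (Coh H (i + j)) c \<cdot>\<^bsub>A\<^esub> Kap H i j (snd t, Y)))"
      if "(t, Y, t', b, c) \<in> ProdC (rel_data C P)" for t Y t' b c i j
      using that H.Bd_Kap[of "fst t" Y i j] by (auto simp: rel_data_def Let_def)
  qed
next
  assume "bkunneth PC (rel_data C P) A H"
  then interpret H: bkunneth PC "rel_data C P" A H .
  show "relative_kunneth_cohomology C P A H"
  proof (rule relative_kunneth_cohomology.intro[OF pair_structure_axioms H.kunneth_cohomology_axioms],
      rule relative_kunneth_cohomology_axioms.intro)
    fix m n i assume t: "(m, n) \<in> triples C P"
    show "Bd H i (m, n) \<in> hom A (FO (Coh H i) n) (FO (Coh H (Suc i)) m)"
      using t H.Bd_arrow[of "(m, n)" i] by (simp add: rel_data_def)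
    show "monic A (FA (Coh H 0) (m \<cdot>\<^bsub>C\<^esub> n, Id C (Cod C m), m))"
      by (rule H.MonC_monic) (use t in \<open>auto simp: rel_data_def\<close>)
    show "exact_at A (FA (Coh H i) (m \<cdot>\<^bsub>C\<^esub> n, Id C (Cod C m), m)) (FA (Coh H i) (n, m, m \<cdot>\<^bsub>C\<^esub> n))"
      by (rule H.ExA_exact) (use t in \<open>auto simp: rel_data_def\<close>)
    show "exact_at A (FA (Coh H i) (n, m, m \<cdot>\<^bsub>C\<^esub> n)) (Bd H i (m, n))"
      by (rule H.ExB_exact) (use t in \<open>auto simp: rel_data_def\<close>)
    show "exact_at A (Bd H i (m, n)) (FA (Coh H (Suc i)) (m \<cdot>\<^bsub>C\<^esub> n, Id C (Cod C m), m))"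
      by (rule H.ExC_exact) (use t in \<open>auto simp: rel_data_def\<close>)
    fix m' n' f g
    assume "(m', n') \<in> triples C P" "f \<in> hom C (Cod C m) (Cod C m')" "g \<in> hom C (Dom C m) (Dom C m')"
      "f \<cdot>\<^bsub>C\<^esub> m = m' \<cdot>\<^bsub>C\<^esub> g" "factors C (g \<cdot>\<^bsub>C\<^esub> n) n'"
    then show "Bd H i (m, n) \<cdot>\<^bsub>A\<^esub> FA (Coh H i) (n, g, n') =
        FA (Coh H (Suc i)) (m, f, m') \<cdot>\<^bsub>A\<^esub> Bd H i (m', n')"
      by (intro H.Bd_natural) (use t in \<open>auto simp: rel_data_def\<close>)
  next
    show "Bd H i \<in> extensional (triples C P)" for i using H.Bd_extensional by (simp add: rel_data_def)
  next
    fix m n p q i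
    assume "m \<in> Dist P" "n \<in> Dist P" "Cod C m = Cod C n" "iso_arrow C (Union P m n)"
      "is_pullback C m n p q" "p \<in> Dist P"
    then show "iso_arrow A (FA (Coh H i) (p, m, n))"
      by (intro H.IsoC_iso) (auto simp: rel_data_def)
  next
    fix m m' i j assume "m \<in> Dist P" "m' \<in> Dist P"
    then have "((m, from_empty C P (Dom C m)), m', (pr m m', factor C (prod_arrow C (Id C (Cod C m)) m') (pr m m')),
        (prod_arrow C (Id C (Dom C m)) m', factor C (prod_arrow C m (Id C (Cod C m'))) (pr m m'),
          factor C (prod_arrow C (Id C (Cod C m)) m') (pr m m')),
        (prod_arrow C (Id C (Dom C m)) m', Id C (Cod C (prod_arrow C (Id C (Dom C m)) m')),
          prod_pair C P (from_empty C P (Dom C m)) m')) \<in> ProdC (rel_data C P)"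
      by (auto simp: rel_data_def)
    from H.ProdC_eq[OF this, of i j]
    show "Kap H (Suc i) j (m, m') \<cdot>\<^bsub>A\<^esub>
          (Bd H i (m, from_empty C P (Dom C m)) \<odot>\<^bsub>A\<^esub> Id A (FO (Coh H j) m')) =
        (let w = prod_pair C P m m';
             a = factor C (prod_arrow C (Id C (Cod C m)) m') w;
             b = factor C (prod_arrow C m (Id C (Cod C m'))) w;
             c = prod_arrow C (Id C (Dom C m)) m';
             y = from_empty C P (Dom C m)
         in Bd H (i + j) (w, a) \<cdot>\<^bsub>A\<^esub>
              (inv_arrow A (FA (Coh H (i + j)) (c, b, a)) \<cdot>\<^bsub>A\<^esub>
                (FA (Coh H (i + j)) (c, Id C (Cod C c), prod_pair C P y m') \<cdot>\<^bsub>A\<^esub>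
                  Kap H i j (y, m'))))"
      by (simp add: Let_def)
  qed
qed

lemma rel_kunneth_groupoid_eq:
  "rel_kunneth_groupoid C P A = bk_groupoid PC (rel_data C P) A (\<lambda>H. H)"
proof -
  have "rel_kunneth_iso C P A H K \<phi> = bk_iso PC (rel_data C P) A H K \<phi>" for H K \<phi>
    by (simp add: rel_kunneth_iso_def bk_iso_def rel_data_def split_beta')
  then show ?thesis
    by (simp add: rel_kunneth_groupoid_def bk_groupoid_def relative_kunneth_iff PC_simps(1))
qed

theorem universal_relative_kunneth_cohomology_exists:
  fixes e :: "'a \<Rightarrow> 'u"
  assumes inf: "infinite (UNIV :: 'u set)" and e: "inj e"
  shows "\<exists>(A0 :: ('u, 'u) ltcat) U. universal_relative_kunneth_cohomology C P A0 U"
proof -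
  obtain p :: "'u \<times> 'u \<Rightarrow> 'u" where p: "inj p" by (rule exE[OF pairing_exists[OF inf]])
  \<comment> \<open>Arrows of the category of pairs are triples of arrows of \<open>C\<close>, so
    they need a code in \<open>'u\<close> before the general construction applies.\<close>
  have i: "inj (\<lambda>(x, y, z). p (e x, p (e y, e z)))"
    using inj_eq[OF p] inj_eq[OF e] by (intro injI) (simp add: split_beta' prod_eq_iff)
  obtain A0 :: "('u, 'u) ltcat" and U where A0: "ex_tensor_category A0" "bkunneth PC (rel_data C P) A0 U"
    and surj: "\<And>(A :: ('u, 'u) ltcat) H. ex_tensor_category A \<Longrightarrow> bkunneth PC (rel_data C P) A H \<Longrightarrow>
      \<exists>F. exact_tensor_functor A0 A F \<and> push_bk PC (rel_data C P) A U F = H"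
    and ff: "\<And>(A :: ('u, 'u) ltcat) F G \<phi>. exact_tensor_functor A0 A F \<Longrightarrow> exact_tensor_functor A0 A G \<Longrightarrow>
      bk_iso PC (rel_data C P) A (push_bk PC (rel_data C P) A U F) (push_bk PC (rel_data C P) A U G) \<phi> \<Longrightarrow>
      \<exists>!\<eta>. tensor_iso A0 A F G \<eta> \<and> (\<lambda>i. \<lambda>X\<in>Ob PC. \<eta> (FO (Coh U i) X)) = \<phi>"
    by (rule universal_category_exists[OF boundary_data_rel inf e i]) blast
  have push: "push_rel_kunneth C P B U F = push_bk PC (rel_data C P) B U F" for B :: "('u, 'u) ltcat" and F
    by (simp add: push_rel_kunneth_def push_bk_def push_kunneth_truncate rel_data_def)
  have "equivalence_of_categories (tensor_functor_groupoid A0 A) (rel_kunneth_groupoid C P A)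
      (push_rel_kunneth_functor C P A0 A U)" if A: "ex_tensor_category A" for A :: "('u, 'u) ltcat"
    using push_equivalence[OF A0 A surj[OF A] ff, of "\<lambda>H. H" "push_rel_kunneth C P A U"]
    by (simp add: push rel_kunneth_groupoid_eq push_rel_kunneth_functor_def PC_simps(1))
  then show ?thesis
    using A0 by (auto simp: universal_relative_kunneth_cohomology_def relative_kunneth_iff)
qed

end


section \<open>The absolute case\<close>

definition no_data :: "('o, 'a) bdata" where
  "no_data = \<lparr>Tri = {}, NatC = {}, MonC = {}, ExA = {}, ExB = {}, ExC = {}, IsoC = {}, ProdC = {}\<rparr>"

lemma no_data_simps [simp]:
  "Tri no_data = {}" "NatC no_data = {}" "MonC no_data = {}" "ExA no_data = {}" "ExB no_data = {}"
  "ExC no_data = {}" "IsoC no_data = {}" "ProdC no_data = {}"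
  by (simp_all add: no_data_def)

text \<open>When there are no boundary pairs, extensionality forces every boundary map to be
  \<open>undefined\<close>, so this is the only possible completion of an absolute
  cohomology.\<close>

definition bare :: "('o, 'a, 'p, 'b) kunneth \<Rightarrow> ('o, 'a, 'p, 'b) rel_kunneth" where
  "bare H = kunneth.extend H (rel_kunneth.fields (\<lambda>i t. undefined))"

lemma bare_simps [simp]:
  "Coh (bare H) = Coh H" "Kap (bare H) = Kap H" "Ups (bare H) = Ups H" "Bd (bare H) = (\<lambda>i t. undefined)"
  by (simp_all add: bare_def kunneth.defs rel_kunneth.defs)

lemma inj_bare: "inj bare"
  by (rule injI, rule kunneth.equality) (metis bare_simps, metis bare_simps, metis bare_simps, simp)

lemma kunneth_cohomology_bare:
  "kunneth_cohomology T A H \<longleftrightarrow> bkunneth T no_data A (bare H)"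
proof -
  have "kunneth_cohomology T A H \<longleftrightarrow> kunneth_cohomology T A (bare H)"
    by (simp add: kunneth_cohomology_def kunneth_cohomology_axioms_def)
  also have "\<dots> \<longleftrightarrow> bkunneth T no_data A (bare H)"
    by (auto simp: bkunneth_def bkunneth_axioms_def boundary_data_def boundary_data_axioms_def
        kunneth_cohomology_def extensional_def)
  finally show ?thesis .
qed

theorem universal_kunneth_cohomology_exists:
  fixes T :: "('o, 'a, 'z) tcat_scheme" and e :: "'o \<Rightarrow> 'u" and e' :: "'a \<Rightarrow> 'u"
  assumes T: "tensor_category T" and inf: "infinite (UNIV :: 'u set)" and e: "inj e" "inj e'"
  shows "\<exists>(A0 :: ('u, 'u) ltcat) U. universal_kunneth_cohomology T A0 U"
proof -
  have D: "boundary_data T no_data"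
    using T by (simp add: boundary_data_def boundary_data_axioms_def)
  obtain A0 :: "('u, 'u) ltcat" and U where A0: "ex_tensor_category A0" "bkunneth T no_data A0 U"
    and surj: "\<And>(A :: ('u, 'u) ltcat) H. ex_tensor_category A \<Longrightarrow> bkunneth T no_data A H \<Longrightarrow>
      \<exists>F. exact_tensor_functor A0 A F \<and> push_bk T no_data A U F = H"
    and ff: "\<And>(A :: ('u, 'u) ltcat) F G \<phi>. exact_tensor_functor A0 A F \<Longrightarrow> exact_tensor_functor A0 A G \<Longrightarrow>
      bk_iso T no_data A (push_bk T no_data A U F) (push_bk T no_data A U G) \<phi> \<Longrightarrow>
      \<exists>!\<eta>. tensor_iso A0 A F G \<eta> \<and> (\<lambda>i. \<lambda>X\<in>Ob T. \<eta> (FO (Coh U i) X)) = \<phi>"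
    by (rule universal_category_exists[OF D inf e]) blast
  let ?U = "kunneth.truncate U"
  \<comment> \<open>Truncating loses nothing, since extensionality over the empty set of pairs fixes
    the boundary maps.\<close>
  have U: "bare ?U = U"
  proof (rule rel_kunneth.equality)
    have "Bd U i = (\<lambda>t. undefined)" for i
      using bkunneth.Bd_extensional[OF A0(2), of i] by (auto simp: extensional_def)
    then show "Bd (bare ?U) = Bd U" by (simp add: fun_eq_iff)
  qed (simp_all add: kunneth.truncate_def)
  have push: "bare (push_kunneth T B ?U F) = push_bk T no_data B U F" for B :: "('u, 'u) ltcat" and F
    by (simp add: bare_def push_bk_def restrict_def)
  have iso: "bk_iso T no_data A (bare H) (bare K) \<phi> = kunneth_iso T A H K \<phi>" for A :: "('u, 'u) ltcat" and H K \<phi>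
    by (simp add: bk_iso_def kunneth_iso_def)
  have gr: "kunneth_groupoid T A = bk_groupoid T no_data A bare" for A :: "('u, 'u) ltcat"
    by (simp add: kunneth_groupoid_def bk_groupoid_def kunneth_cohomology_bare iso)
  have "equivalence_of_categories (tensor_functor_groupoid A0 A) (kunneth_groupoid T A)
      (push_kunneth_functor T A0 A ?U)" if A: "ex_tensor_category A" for A :: "('u, 'u) ltcat"
    using push_equivalence[OF A0 A surj[OF A] ff inj_bare push]
    by (simp add: gr push_kunneth_functor_def kunneth.truncate_def)
  then show ?thesis
    using A0 U kunneth_cohomology_bare[of T A0 ?U] unfolding universal_kunneth_cohomology_def
    by (intro exI[of _ A0] exI[of _ ?U]) simp
qed

text \<open>Objects and arrows of \<open>C\<close> already lie in \<open>'u\<close>, so identity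
  maps serve as the injections into the universe; infinity of \<open>'u\<close> makes room for the
  pairs and lists of the coding.\<close>

theorem theorem2p1:
  fixes C :: "('u, 'u) ccat"
  assumes "infinite (UNIV :: 'u set)"
    and "cartesian_category C"
  shows "(\<exists>(A :: ('u, 'u) ltcat) U. universal_kunneth_cohomology (cartesian_tensor C) A U) \<and>
    (\<forall>P :: ('u, 'u) pairs. pair_structure C P \<longrightarrow>
      (\<exists>(A :: ('u, 'u) ltcat) U. universal_relative_kunneth_cohomology C P A U))"
  using universal_kunneth_cohomology_exists[OF
      cartesian_category.tensor_category_cartesian[OF assms(2)] assms(1) inj_on_id inj_on_id]
    pair_structure.universal_relative_kunneth_cohomology_exists[OF _ assms(1) inj_on_id] by blast

end
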